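(* Under the standing assumptions of the context on $v$ and $\lambda_0$, let $(\Lambda_1,\Lambda_2)$ be a sufficiently small neighborhood of $\lambda_0$. Then, for sufficiently small $\hbar>0$, for every $\ell=1,\ldots,L$ and every integer $n$ such that $\Phi_\ell^{-1}(\pi(n+1/2)\hbar)$ belongs to $(\Lambda_1,\Lambda_2)$, there exists an eigenvalue $\lambda_{n,\ell}(\hbar)$ of the operator $H(\hbar)$ satisfying $$\lambda_{n,\ell}(\hbar)=\Phi_\ell^{-1}\big(\pi(n+1/2)\hbar\big)+O(\hbar^2),$$ where the constant in $O(\hbar^2)$ does not depend on $n$ and $\hbar$.
   Context: Standing assumptions: $v\in C^2(\mathbb R)$ is real, $\lambda_0\in\mathbb R$; the equation $v(x)=\lambda_0$ has only a finite number of solutions, $v'(x)\ne0$ at each of them, and $v\in C^3$ in some neighborhoods of these points; $\liminf_{x\to\pm\infty}v(x)>\lambda_0$; and, for some $\rho_0>1$ and a fixed point $x_0$ with $v(x_0)=\lambda_0$, the function $$\big(|v(x)-\lambda_0|^{-3}v'(x)^2+|v(x)-\lambda_0|^{-2}|v''(x)|\big)\Big|\int_{x_0}^x|v(y)-\lambda_0|^{1/2}dy\Big|^{\rho_0}$$ is bounded as $|x|\to\infty$. $H(\hbar)=-\hbar^2\,d^2/dx^2+v(x)$ is the self-adjoint Schrödinger operator in $L^2(\mathbb R)$. For $\lambda$ in a sufficiently small neighborhood $(\Lambda_1,\Lambda_2)$ of $\lambda_0$, containing no critical values of $v$ and with closure below $\liminf_{|x|\to\infty}v$, the solutions of $v(x)=\lambda$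 are enumerated as $x_{1,-}(\lambda)<x_{1,+}(\lambda)<\cdots<x_{L,-}(\lambda)<x_{L,+}(\lambda)$, with $v<\lambda$ exactly on the wells $X_\ell(\lambda)=(x_{\ell,-}(\lambda),x_{\ell,+}(\lambda))$, $\ell=1,\ldots,L$. Set $\Phi_\ell(\lambda)=\int_{x_{\ell,-}(\lambda)}^{x_{\ell,+}(\lambda)}(\lambda-v(x))^{1/2}dx$; $\Phi_\ell$ is a $C^1$ function with positive derivative on $(\Lambda_1,\Lambda_2)$, and $\Phi_\ell^{-1}$ denotes its inverse. *)

theory Defs
  imports "HOL-Analysis.Analysis"
begin

definition Ck_on :: "nat \<Rightarrow> (real \<Rightarrow> real) \<Rightarrow> real set \<Rightarrow> bool" where
  "Ck_on k v S \<longleftrightarrow> open S \<and>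
     (\<forall>j<k. \<forall>x\<in>S. (deriv ^^ j) v differentiable (at x)) \<and>
     continuous_on S ((deriv ^^ k) v)"

definition admissible_potential :: "(real \<Rightarrow> real) \<Rightarrow> real \<Rightarrow> bool" where
  "admissible_potential v E0 \<longleftrightarrow>
     Ck_on 2 v UNIV \<and>
     finite {x. v x = E0} \<and>
     (\<forall>x. v x = E0 \<longrightarrow> deriv v x \<noteq> 0) \<and>
     (\<forall>x. v x = E0 \<longrightarrow> (\<exists>S. x \<in> S \<and> Ck_on 3 v S)) \<and>
     Liminf at_top (\<lambda>x. ereal (v x)) > ereal E0 \<and>
     Liminf at_bot (\<lambda>x. ereal (v x)) > ereal E0 \<and>
     (\<exists>\<rho>0>1. \<exists>x0. v x0 = E0 \<and>
        Bfun (\<lambda>x. ((deriv v x)\<^sup>2 / \<bar>v x - E0\<bar> ^ 3 + \<bar>deriv (deriv v) x\<bar> / \<bar>v x - E0\<bar>\<^sup>2)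
                  * \<bar>(LBINT y=x0..x. sqrt \<bar>v y - E0\<bar>)\<bar> powr \<rho>0) at_infinity)"

text \<open>
  Elements of \<open>L\<^sup>2(\<real>)\<close> are represented by Borel functions, identified when they agree
  almost everywhere; an operator is represented by its graph on such representatives.
\<close>

definition L2 :: "(real \<Rightarrow> complex) set" where
  "L2 = {u. u \<in> borel_measurable lborel \<and> integrable lborel (\<lambda>x. (cmod (u x))\<^sup>2)}"

text \<open>
  The operator \<open>-h\<^sup>2 d\<^sup>2/dx\<^sup>2 + v\<close> on its maximal domain: those \<open>u \<in> L\<^sup>2\<close> having a
  differentiable representative \<open>w\<close> whose derivative \<open>w1\<close> is locally absolutely continuous
  (with a.e. derivative \<open>w2\<close>), such that \<open>-h\<^sup>2 w2 + v w \<in> L\<^sup>2\<close>.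
  For \<open>h > 0\<close> and \<open>v\<close> continuous and bounded below, both endpoints are in the limit point case,
  so this is the self-adjoint realization: it is the closure of the restriction to test
  functions, and the only self-adjoint extension of that restriction.
\<close>

definition schroedinger_op ::
  "(real \<Rightarrow> real) \<Rightarrow> real \<Rightarrow> ((real \<Rightarrow> complex) \<times> (real \<Rightarrow> complex)) set" where
  "schroedinger_op v h = {(u, f). u \<in> L2 \<and> f \<in> L2 \<and>
     (\<exists>w w1 w2. (AE x in lborel. u x = w x) \<and>
        (\<forall>x. (w has_vector_derivative w1 x) (at x)) \<and>
        (\<forall>a b. a \<le> b \<longrightarrow> set_integrable lborel {a..b} w2 \<and>
                 w1 b - w1 a = set_lebesgue_integral lborel {a..b} w2) \<and>
        (AE x in lborel. f x = - of_real (h\<^sup>2) * w2 x + of_real (v x) * w x))}"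

definition is_eigenvalue :: "((real \<Rightarrow> complex) \<times> (real \<Rightarrow> complex)) set \<Rightarrow> real \<Rightarrow> bool" where
  "is_eigenvalue A \<mu> \<longleftrightarrow>
     (\<exists>u. (u, \<lambda>x. of_real \<mu> * u x) \<in> A \<and> \<not> (AE x in lborel. u x = 0))"

text \<open>
  The solutions of \<open>v x = E\<close> in increasing order are
  \<open>x\<^sub>1\<^sub>,\<^sub>-(E) < x\<^sub>1\<^sub>,\<^sub>+(E) < \<dots> < x\<^sub>L\<^sub>,\<^sub>-(E) < x\<^sub>L\<^sub>,\<^sub>+(E)\<close>.  Wells are numbered from 1 and list positions
  from 0.  The lists are meaningful only when the solution set is finite, as it is for
  \<open>E\<close> near \<open>E0\<close>.
\<close>

definition turning_points :: "(real \<Rightarrow> real) \<Rightarrow> real \<Rightarrow> real list" where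
  "turning_points v E = sorted_list_of_set {x. v x = E}"

definition x_minus :: "(real \<Rightarrow> real) \<Rightarrow> nat \<Rightarrow> real \<Rightarrow> real" where
  "x_minus v l E = turning_points v E ! (2 * l - 2)"

definition x_plus :: "(real \<Rightarrow> real) \<Rightarrow> nat \<Rightarrow> real \<Rightarrow> real" where
  "x_plus v l E = turning_points v E ! (2 * l - 1)"

definition num_wells :: "(real \<Rightarrow> real) \<Rightarrow> real \<Rightarrow> nat" where
  "num_wells v E = card {x. v x = E} div 2"

definition \<Phi> :: "(real \<Rightarrow> real) \<Rightarrow> nat \<Rightarrow> real \<Rightarrow> real" where
  "\<Phi> v l E = (LBINT x=x_minus v l E..x_plus v l E. sqrt (E - v x))"

end

theory Submission
  imports Defs "HOL-Complex_Analysis.Great_Picard"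
begin

text \<open>
  The eigenvalue is obtained from an approximate eigenfunction. If \<open>f\<close> lies in the domain of the
  self-adjoint operator \<open>H\<close> and \<open>\<parallel>(H - E) f\<parallel> \<le> \<delta> \<parallel>f\<parallel>\<close>, then the spectrum of \<open>H\<close> meets
  \<open>[E - \<delta>, E + \<delta>]\<close>; below the limit inferior of \<open>v\<close> at infinity the spectrum consists of
  eigenvalues. So for every \<open>E\<close> with \<open>\<Phi>\<^sub>l(E) = \<pi> (n + 1/2) h\<close> a function \<open>f\<close> with
  \<open>\<parallel>(H - E) f\<parallel> \<le> C h\<^sup>2 \<parallel>f\<parallel>\<close> is needed, where \<open>C\<close> may depend on the well but not on \<open>n\<close>, \<open>h\<close>, \<open>E\<close>.

  The model for one well is the harmonic oscillator: the rescaled Hermite function \<open>\<psi>\<close> of degree \<open>n\<close>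
  solves \<open>\<psi>'' = (2n + 1)\<^sup>2 (s\<^sup>2 - 1) \<psi>\<close> exactly and decays at both ends. The Liouville transformation
  carries it to the well. Let \<open>\<zeta>\<close> be an increasing map of a neighbourhood of the well onto a
  neighbourhood of \<open>[-1, 1]\<close> with \<open>\<kappa>\<^sup>2 \<zeta>'\<^sup>2 (1 - \<zeta>\<^sup>2) = E - v\<close>. It has to send the turning points to
  \<open>-1\<close> and \<open>1\<close>, and since the integral of \<open>sqrt (1 - s\<^sup>2)\<close> over \<open>[-1, 1]\<close> is \<open>\<pi>/2\<close>, this forces
  \<open>\<kappa> = 2 \<Phi>\<^sub>l(E) / \<pi>\<close>. The quantization condition says exactly that \<open>\<kappa> = (2n + 1) h\<close>, and then
  \<open>f = \<zeta>'\<^sup>-\<^sup>1\<^sup>/\<^sup>2 \<psi>(\<zeta>)\<close> satisfies \<open>(H - E) f = - h\<^sup>2 r f\<close>, where \<open>r\<close> is minus one half of the Schwarzian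
  derivative of \<open>\<zeta>\<close>, that is \<open>r = L'\<^sup>2/4 - L''/2\<close> with \<open>L = ln \<zeta>'\<close>. The theorem therefore rests on
  three facts.

  \<^item> The functions \<open>L\<close>, \<open>L'\<close>, \<open>L''\<close> are bounded uniformly in \<open>E\<close>. Away from the turning points this is
    seen from the formula for \<open>\<zeta>'\<close>. At a turning point both sides of the defining equation vanish, and
    it is here that three derivatives of \<open>v\<close> enter: near a simple zero \<open>x\<^sub>0\<close>, a \<open>C\<^sup>3\<close> function is of the
    form \<open>\<gamma> \<gamma>'\<^sup>2\<close> with \<open>ln \<gamma>'\<close> in \<open>C\<^sup>2\<close> and bounds that do not depend on \<open>x\<^sub>0\<close>
    (\<open>turning_point_normal_form\<close>). Comparing the normal forms of \<open>E - v\<close> and of \<open>1 - s\<^sup>2\<close> gives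
    \<open>uniform_liouville_map\<close>.

  \<^item> The map \<open>\<zeta>\<close> exists only near the well, so \<open>\<psi>\<close> has to be cut off outside \<open>[-1, 1]\<close>. The error is
    bounded by a constant times the norm of \<open>\<psi>\<close>, uniformly in \<open>n\<close>, because a decaying solution is
    monotone in the classically forbidden region (\<open>decaying_solution_tail\<close>,
    \<open>localized_hermite_function\<close>). Together with the bound on \<open>r\<close> this gives \<open>liouville_quasimode\<close>.

  \<^item> A quasimode yields an eigenvalue (\<open>eigenvalue_near_quasimode\<close>). Instead of the spectral theorem
    for unbounded operators, the proof discretizes: for the symmetric matrix \<open>A\<close> of finite differences
    on a grid, minimizing \<open>\<parallel>(A - E) g\<parallel> / \<parallel>g\<parallel>\<close> gives an eigenvalue within \<open>\<delta>\<close> of \<open>E\<close>. Normalized in the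
    maximum norm, the eigenvectors attain their maximum where \<open>v \<le> \<mu>\<close>, hence in a fixed compact set, and
    they have bounded difference quotients. As the grid is refined they converge to a bounded nonzero
    solution of \<open>- h\<^sup>2 u'' + v u = \<mu> u\<close>, and a bounded solution is square integrable because \<open>v > \<mu>\<close> near
    infinity.

  Finally, simple zeros are stable, so the turning points at energies near the reference energy form
  the same wells (\<open>wells_near_energy\<close>), and the action \<open>\<Phi>\<^sub>l\<close> is strictly
  increasing there, so that its inverse is the one used in the statement.
\<close>

section \<open>Eigenvalues of symmetric matrices near a quasimode\<close>

lemma quadratic_nonneg_linear_zero:
  fixes X Y :: real
  assumes "\<And>t. 0 \<le> 2 * t * X + t\<^sup>2 * Y"
  shows "X = 0"
proof (rule ccontr)
  assume "X \<noteq> 0"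
  define c where "c = \<bar>Y\<bar> + 1"
  have c: "c > 0" "Y < c" unfolding c_def by auto
  have "0 \<le> 2 * (-X/c) * X + (-X/c)\<^sup>2 * Y" by (rule assms)
  also have "\<dots> \<le> 2 * (-X/c) * X + (-X/c)\<^sup>2 * c"
    using c by (intro add_left_mono mult_left_mono) auto
  also have "\<dots> = - X\<^sup>2/c" using c by (simp add: power2_eq_square field_simps)
  also have "\<dots> < 0" using c \<open>X \<noteq> 0\<close> by simp
  finally show False by simp
qed

text \<open>
  Let \<open>m\<^sup>2\<close> be the minimum of \<open>|K g|\<^sup>2\<close> on the unit sphere. A minimizer satisfies
  \<open>K\<^sup>2 g = m\<^sup>2 g\<close> by the first-order condition and the symmetry of \<open>K\<close>, so that
  \<open>(K - m) (K + m) g = 0\<close>: either \<open>g\<close> is an eigenvector for \<open>-m\<close>, or \<open>(K + m) g\<close> is one for \<open>m\<close>.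
\<close>

lemma symmetric_matrix_eigenvalue_near:
  fixes K :: "'a \<Rightarrow> 'a \<Rightarrow> real"
  assumes fin: "finite I"
    and sym: "\<And>i j. i \<in> I \<Longrightarrow> j \<in> I \<Longrightarrow> K i j = K j i"
    and f: "(\<Sum>i\<in>I. (\<Sum>j\<in>I. K i j * f j)\<^sup>2) \<le> \<delta>\<^sup>2 * (\<Sum>i\<in>I. (f i)\<^sup>2)"
      "(\<Sum>i\<in>I. (f i)\<^sup>2) > 0" and \<delta>: "\<delta> \<ge> 0"
  shows "\<exists>\<mu> g. \<bar>\<mu>\<bar> \<le> \<delta> \<and> (\<exists>i\<in>I. g i \<noteq> 0) \<and> (\<forall>i\<in>I. (\<Sum>j\<in>I. K i j * g j) = \<mu> * g i)"
proof -
  define B where "B = (\<lambda>g i. \<Sum>j\<in>I. K i j * g j)"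
  define Q where "Q = (\<lambda>g. \<Sum>i\<in>I. (B g i)\<^sup>2)"
  define N where "N = (\<lambda>g. \<Sum>i\<in>I. (g i)\<^sup>2 :: real)"
  have B_scale: "B (\<lambda>i. c * g i) i = c * B g i" for c g i
    unfolding B_def by (simp add: sum_distrib_left mult_ac)
  have B_add: "B (\<lambda>i. g i + t * p i) i = B g i + t * B p i" for t g p i
    unfolding B_def by (simp add: sum_distrib_left sum.distrib algebra_simps)
  have Q_scale: "Q (\<lambda>i. c * g i) = c\<^sup>2 * Q g" for c g
    unfolding Q_def B_scale by (simp add: sum_distrib_left power_mult_distrib)
  have N_scale: "N (\<lambda>i. c * g i) = c\<^sup>2 * N g" for c g
    unfolding N_def by (simp add: sum_distrib_left power_mult_distrib)
  have Q0: "Q g \<ge> 0" and N0: "N g \<ge> 0" for g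
    unfolding Q_def N_def by (auto intro!: sum_nonneg)
  define S where "S = {g. N g = 1}"
  define m2 where "m2 = Inf (Q ` S)"
  have normalize: "(\<lambda>i. (1/sqrt (N p)) * p i) \<in> S" if "N p > 0" for p
    using that unfolding S_def mem_Collect_eq N_scale by (simp add: power_divide)
  have bdd: "bdd_below (Q ` S)" using Q0 by (intro bdd_belowI[of _ 0]) auto
  have "S \<noteq> {}" using normalize[of f] f(2) unfolding N_def by auto
  have min: "m2 * N p \<le> Q p" for p
  proof (cases "N p = 0")
    case False
    then have p: "N p > 0" using N0[of p] by simp
    have "m2 \<le> Q (\<lambda>i. (1/sqrt (N p)) * p i)"
      unfolding m2_def using normalize[OF p] bdd by (intro cInf_lower) auto
    also have "\<dots> = Q p / N p" unfolding Q_scale using p by (simp add: power_divide)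
    finally show ?thesis using p by (simp add: field_simps)
  qed (use Q0 in simp)
  have m2_0: "m2 \<ge> 0" unfolding m2_def using \<open>S \<noteq> {}\<close> Q0 by (intro cInf_greatest) auto
  have "\<exists>g\<in>S. Q g < m2 + 1 / real (Suc k)" for k
    using cInf_lessD[of "Q ` S" "m2 + 1 / real (Suc k)"] \<open>S \<noteq> {}\<close> unfolding m2_def[symmetric] by auto
  then obtain G where G: "\<And>k. G k \<in> S" "\<And>k. Q (G k) < m2 + 1 / real (Suc k)" by metis
  have "norm (G k i) \<le> 1" if "i \<in> I" for k i
  proof -
    have "(G k i)\<^sup>2 \<le> N (G k)" unfolding N_def using that fin by (intro member_le_sum) auto
    also have "\<dots> = 1" using G(1) unfolding S_def by auto
    finally show ?thesis by (simp add: abs_square_le_1)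
  qed
  then obtain r where r: "strict_mono (r::nat\<Rightarrow>nat)" "\<And>i. i \<in> I \<Longrightarrow> \<exists>l. (\<lambda>n. G (r n) i) \<longlonglongrightarrow> l"
    using function_convergent_subsequence[of I G 1] countable_finite[OF fin] by blast
  then obtain g where g: "\<And>i. i \<in> I \<Longrightarrow> (\<lambda>n. G (r n) i) \<longlonglongrightarrow> g i" by metis
  have "(\<lambda>n. N (G (r n))) \<longlonglongrightarrow> N g" unfolding N_def using g by (intro tendsto_intros) auto
  moreover have "N (G (r n)) = 1" for n using G(1) unfolding S_def by auto
  ultimately have Ng: "N g = 1" by (simp add: LIMSEQ_const_iff)
  have "(\<lambda>n. Q (G (r n))) \<longlonglongrightarrow> Q g" unfolding Q_def B_def using g by (intro tendsto_intros) auto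
  moreover have "(\<lambda>n. m2 + 1 / real (Suc (r n))) \<longlonglongrightarrow> m2 + 0"
    using LIMSEQ_subseq_LIMSEQ[OF LIMSEQ_inverse_real_of_nat r(1)]
    by (intro tendsto_intros) (simp add: o_def inverse_eq_divide)
  ultimately have "Q g \<le> m2 + 0"
    using G(2) by (intro LIMSEQ_le[of "\<lambda>n. Q (G (r n))"]) (auto intro: less_imp_le)
  then have Qg: "Q g = m2" using min[of g] Ng by simp
  have crit: "(\<Sum>i\<in>I. B g i * B p i) - m2 * (\<Sum>i\<in>I. g i * p i) = 0" for p
  proof (rule quadratic_nonneg_linear_zero[where Y = "Q p - m2 * N p"])
    fix t :: real
    have "Q (\<lambda>i. g i + t * p i) = Q g + 2 * t * (\<Sum>i\<in>I. B g i * B p i) + t\<^sup>2 * Q p"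
      unfolding Q_def B_add by (simp add: power2_eq_square sum_distrib_left sum.distrib algebra_simps)
    moreover have "N (\<lambda>i. g i + t * p i) = N g + 2 * t * (\<Sum>i\<in>I. g i * p i) + t\<^sup>2 * N p"
      unfolding N_def by (simp add: power2_eq_square sum_distrib_left sum.distrib algebra_simps)
    ultimately show "0 \<le> 2 * t * ((\<Sum>i\<in>I. B g i * B p i) - m2 * (\<Sum>i\<in>I. g i * p i)) + t\<^sup>2 * (Q p - m2 * N p)"
      using min[of "\<lambda>i. g i + t * p i"] Qg Ng by (simp add: algebra_simps)
  qed
  have BB: "B (B g) j = m2 * g j" if j: "j \<in> I" for j
  proof -
    define p where "p = (\<lambda>i. if i = j then 1 else 0 :: real)"
    have "B p i = K j i" if "i \<in> I" for i
      unfolding B_def p_def using fin j that sym by (simp add: if_distrib[of "\<lambda>x. _ * x"] cong: if_cong)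
    then have "(\<Sum>i\<in>I. B g i * B p i) = (\<Sum>i\<in>I. K j i * B g i)"
      by (intro sum.cong) (auto simp: mult.commute)
    also have "\<dots> = B (B g) j" by (simp add: B_def)
    finally have "(\<Sum>i\<in>I. B g i * B p i) = B (B g) j" .
    moreover have "(\<Sum>i\<in>I. g i * p i) = g j"
      unfolding p_def using fin j by (simp add: if_distrib[of "\<lambda>x. _ * x"] cong: if_cong)
    ultimately show ?thesis using crit[of p] by simp
  qed
  define m where "m = sqrt m2"
  have m: "m * m = m2" "m \<ge> 0" using m2_0 unfolding m_def by auto
  have "m2 * N f \<le> \<delta>\<^sup>2 * N f" using min[of f] f(1) unfolding Q_def N_def B_def by simp
  then have "m2 \<le> \<delta>\<^sup>2" using f(2) unfolding N_def by simp
  then have m\<delta>: "m \<le> \<delta>" unfolding m_def using \<delta> by (simp add: real_le_lsqrt)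
  show ?thesis
  proof (cases "\<forall>i\<in>I. B g i + m * g i = 0")
    case True
    have "\<exists>i\<in>I. g i \<noteq> 0"
    proof (rule ccontr)
      assume "\<not> ?thesis"
      then have "N g = 0" unfolding N_def by (intro sum.neutral) auto
      with Ng show False by simp
    qed
    with True m m\<delta> show ?thesis
      by (intro exI[of _ "-m"] exI[of _ g]) (auto simp: B_def add_eq_0_iff2)
  next
    case False
    have "B (\<lambda>i. B g i + m * g i) j = m * (B g j + m * g j)" if "j \<in> I" for j
      unfolding B_add using BB[OF that] m by (simp add: algebra_simps)
    with False m m\<delta> show ?thesis
      by (intro exI[of _ m] exI[of _ "\<lambda>i. B g i + m * g i"]) (auto simp: B_def)
  qed
qed

text \<open>
  The matrix result for the discretized Schroedinger operator with Dirichlet conditions outside the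
  grid. The last conjunct is a discrete maximum principle: at a maximum of \<open>g\<close> with value 1 the second
  difference is at most 0. It is what keeps the mass of the eigenvectors from escaping to infinity when
  the grid grows.
\<close>

lemma grid_eigenvector:
  fixes q f :: "int \<Rightarrow> real" and c E \<delta> :: real and N :: int
  assumes c: "c > 0" and \<delta>: "\<delta> \<ge> 0"
    and supp: "\<And>i. \<bar>i\<bar> > N \<Longrightarrow> f i = 0"
    and f: "(\<Sum>i=-N..N. (- c * (f (i+1) - 2 * f i + f (i-1)) + (q i - E) * f i)\<^sup>2)
              \<le> \<delta>\<^sup>2 * (\<Sum>i=-N..N. (f i)\<^sup>2)" "(\<Sum>i=-N..N. (f i)\<^sup>2) > 0"
  shows "\<exists>\<mu> g. \<bar>\<mu> - E\<bar> \<le> \<delta> \<and> (\<forall>i. \<bar>g i\<bar> \<le> 1)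
      \<and> (\<forall>i\<in>{-N..N}. c * (g (i+1) - 2 * g i + g (i-1)) = (q i - \<mu>) * g i)
      \<and> (\<exists>i\<in>{-N..N}. \<bar>g i\<bar> = 1 \<and> q i \<le> \<mu>)"
proof -
  define I where "I = {-N..N}"
  define K where "K = (\<lambda>i j. if i = j then 2 * c + q i - E else if \<bar>i - j\<bar> = 1 then - c else 0)"
  have K: "(\<Sum>j\<in>I. K i j * p j) = - c * (p (i+1) - 2 * p i + p (i-1)) + (q i - E) * p i"
    if p: "\<And>i. \<bar>i\<bar> > N \<Longrightarrow> p i = 0" for p :: "int \<Rightarrow> real" and i
  proof -
    have "(\<Sum>j\<in>I. K i j * p j) = (\<Sum>j\<in>I \<union> {i-1,i,i+1}. K i j * p j)"
      by (rule sum.mono_neutral_left) (auto simp: I_def intro!: p)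
    also have "\<dots> = (\<Sum>j\<in>{i-1,i,i+1}. K i j * p j)"
      by (rule sum.mono_neutral_right) (auto simp: K_def I_def)
    also have "\<dots> = - c * (p (i+1) - 2 * p i + p (i-1)) + (q i - E) * p i"
      by (simp add: K_def algebra_simps)
    finally show ?thesis .
  qed
  have "\<exists>\<mu> g. \<bar>\<mu>\<bar> \<le> \<delta> \<and> (\<exists>i\<in>I. g i \<noteq> 0) \<and> (\<forall>i\<in>I. (\<Sum>j\<in>I. K i j * g j) = \<mu> * g i)"
  proof (rule symmetric_matrix_eigenvalue_near[of _ _ f])
    show "(\<Sum>i\<in>I. (\<Sum>j\<in>I. K i j * f j)\<^sup>2) \<le> \<delta>\<^sup>2 * (\<Sum>i\<in>I. (f i)\<^sup>2)"
    proof -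
      have "(\<Sum>j\<in>I. K i j * f j) = - c * (f (i+1) - 2 * f i + f (i-1)) + (q i - E) * f i" for i
        by (rule K) (rule supp)
      then show ?thesis using f(1) unfolding I_def by simp
    qed
  qed (use f \<delta> in \<open>auto simp: K_def I_def\<close>)
  then obtain \<nu> g0 where g0: "\<bar>\<nu>\<bar> \<le> \<delta>" "\<exists>i\<in>I. g0 i \<noteq> 0" "\<forall>i\<in>I. (\<Sum>j\<in>I. K i j * g0 j) = \<nu> * g0 i"
    by blast
  define g1 where "g1 = (\<lambda>i. if i \<in> I then g0 i else 0)"
  define A where "A = Max ((\<lambda>i. \<bar>g1 i\<bar>) ` I)"
  have finI: "finite I" "I \<noteq> {}" using g0(2) unfolding I_def by auto
  have le_A: "\<bar>g1 i\<bar> \<le> A" if "i \<in> I" for i unfolding A_def using finI that by (intro Max_ge) auto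
  have A0: "A > 0"
  proof -
    obtain i where "i \<in> I" "g0 i \<noteq> 0" using g0(2) by blast
    then have "0 < \<bar>g1 i\<bar>" "\<bar>g1 i\<bar> \<le> A" using le_A[of i] by (auto simp: g1_def)
    then show ?thesis by linarith
  qed
  have "A \<in> (\<lambda>i. \<bar>g1 i\<bar>) ` I" unfolding A_def using finI by (intro Max_in) auto
  then obtain j where j: "j \<in> I" "\<bar>g1 j\<bar> = A" by auto
  define s where "s = (if g1 j > 0 then 1 else -1 :: real)"
  define g where "g = (\<lambda>i. s * g1 i / A)"
  have gj: "g j = 1" using j A0 by (auto simp: g_def s_def)
  have g_le: "\<bar>g i\<bar> \<le> 1" for i
    using le_A[of i] A0 by (cases "i \<in> I") (auto simp: g_def s_def g1_def abs_mult)
  have eq: "c * (g (i+1) - 2 * g i + g (i-1)) = (q i - (E + \<nu>)) * g i" if "i \<in> I" for i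
  proof -
    have "(\<Sum>j\<in>I. K i j * g1 j) = (\<Sum>j\<in>I. K i j * g0 j)" by (simp add: g1_def)
    also have "\<dots> = \<nu> * g1 i" using g0(3) that by (simp add: g1_def)
    finally have "- c * (g1 (i+1) - 2 * g1 i + g1 (i-1)) + (q i - E) * g1 i = \<nu> * g1 i"
      by (subst (asm) K) (auto simp: g1_def I_def)
    then have "c * (g1 (i+1) - 2 * g1 i + g1 (i-1)) = (q i - (E + \<nu>)) * g1 i" by (simp add: algebra_simps)
    then have "(s/A) * (c * (g1 (i+1) - 2 * g1 i + g1 (i-1))) = (s/A) * ((q i - (E + \<nu>)) * g1 i)"
      by simp
    then show ?thesis unfolding g_def by (simp add: algebra_simps add_divide_distrib diff_divide_distrib)
  qed
  have "q j \<le> E + \<nu>"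
  proof -
    have "g (j+1) - 2 * g j + g (j-1) \<le> 0" using g_le[of "j+1"] g_le[of "j-1"] gj by auto
    then have "c * (g (j+1) - 2 * g j + g (j-1)) \<le> 0" using c by (simp add: mult_le_0_iff)
    then show ?thesis using eq[OF j(1)] gj by simp
  qed
  with g_le eq gj j(1) g0(1) show ?thesis
    by (intro exI[of _ "E + \<nu>"] exI[of _ g]) (auto simp: I_def intro!: bexI[of _ j])
qed

section \<open>Convergence of grid eigenvectors to a solution of the differential equation\<close>

lemma has_integral_step:
  fixes b :: "int \<Rightarrow> real" and K :: real and i0 :: int
  assumes K: "K > 0"
  shows "((\<lambda>t. b \<lfloor>t * K\<rfloor>) has_integral ((\<Sum>i<n. b (i0 + int i)) / K))
            {of_int i0 / K..(of_int i0 + real n) / K}"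
proof (induction n)
  case 0
  show ?case using has_integral_refl(2)[of "\<lambda>t. b \<lfloor>t * K\<rfloor>" "of_int i0 / K"] by simp
next
  case (Suc n)
  define x y where "x = (of_int i0 + real n) / K" and "y = (of_int i0 + real (Suc n)) / K"
  have xy: "x \<le> y" "of_int i0 / K \<le> x" "y - x = 1 / K" unfolding x_def y_def using K by (auto simp: field_simps)
  have "((\<lambda>t. b (i0 + int n)) has_integral (b (i0 + int n) * (1/K))) {x..y}"
    using has_integral_const_real[of "b (i0 + int n)" x y] xy by simp
  then have "((\<lambda>t. b \<lfloor>t * K\<rfloor>) has_integral (b (i0 + int n) * (1/K))) {x..y}"
  proof (rule has_integral_spike_finite[where S="{y}", rotated 2])
    fix t assume t: "t \<in> {x..y} - {y}"
    have "\<lfloor>t * K\<rfloor> = i0 + int n"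
      using t K unfolding x_def y_def by (intro floor_unique) (auto simp: field_simps)
    then show "b \<lfloor>t * K\<rfloor> = b (i0 + int n)" by simp
  qed simp
  with Suc.IH have "((\<lambda>t. b \<lfloor>t * K\<rfloor>) has_integral ((\<Sum>i<n. b (i0 + int i)) / K + b (i0 + int n) * (1/K))) {of_int i0 / K..y}"
    unfolding x_def[symmetric] using xy by (intro has_integral_combine[of _ x]) auto
  then show ?case unfolding y_def by (simp add: add_divide_distrib)
qed

text \<open>
  A discrete fundamental theorem of calculus in the limit: if the grid function \<open>a\<close> has difference
  quotients \<open>b\<close>, which converge boundedly to \<open>B\<close>, then \<open>a\<close> converges to a primitive of \<open>B\<close>. The sum of \<open>b\<close> is
  the integral of a step function, and dominated convergence applies. It is used twice, for the first
  and for the second differences of the eigenvectors.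
\<close>

lemma step_function_limit:
  fixes a b :: "nat \<Rightarrow> int \<Rightarrow> real" and K :: "nat \<Rightarrow> nat" and R :: nat and B :: "real \<Rightarrow> real"
  assumes K: "\<And>k. K k > 0" "filterlim K at_top sequentially"
    and bd: "\<And>k i. \<bar>i\<bar> \<le> int (R * K k) \<Longrightarrow> \<bar>b k i\<bar> \<le> M"
    and conv: "\<And>x. - real R \<le> x \<Longrightarrow> x < real R \<Longrightarrow> (\<lambda>k. b k \<lfloor>x * K k\<rfloor>) \<longlonglongrightarrow> B x"
    and step: "\<And>k i. - int (R * K k) \<le> i \<Longrightarrow> i < int (R * K k) \<Longrightarrow> a k (i+1) - a k i = b k i / K k"
    and base: "(\<lambda>k. a k (- int (R * K k))) \<longlonglongrightarrow> a0"
    and x: "- real R \<le> x" "x < real R"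
  shows "B integrable_on {- real R..x}"
    and "(\<lambda>k. a k \<lfloor>x * K k\<rfloor>) \<longlonglongrightarrow> a0 + integral {- real R..x} B"
proof -
  define S where "S = (\<lambda>k t. b k \<lfloor>t * real (K k)\<rfloor>)"
  define j where "j = (\<lambda>k. \<lfloor>x * real (K k)\<rfloor>)"
  define n where "n = (\<lambda>k. nat (j k + int (R * K k)))"
  have jb: "- int (R * K k) \<le> j k" "j k < int (R * K k)" for k
  proof -
    have "real_of_int (- int (R * K k)) \<le> x * K k" using x mult_right_mono[of "- real R" x "K k"] by simp
    then show "- int (R * K k) \<le> j k" unfolding j_def by (simp add: le_floor_iff)
    have "x * K k < R * K k" using x K(1)[of k] by simp
    then show "j k < int (R * K k)" unfolding j_def by (simp add: floor_less_iff)
  qed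
  have n: "int (n k) = j k + int (R * K k)" for k unfolding n_def using jb[of k] by simp
  have tele: "a k (- int (R * K k) + int m) = a k (- int (R * K k)) + (\<Sum>i<m. b k (- int (R * K k) + int i)) / K k"
    if "m \<le> n k" for k m using that
  proof (induction m)
    case (Suc m)
    define i where "i = - int (R * K k) + int m"
    have "a k (i+1) = a k i + b k i / K k"
      using Suc.prems step[of k i] jb(2)[of k] n[of k] unfolding i_def by linarith
    moreover have "a k i = a k (- int (R * K k)) + (\<Sum>i<m. b k (- int (R * K k) + int i)) / K k"
      using Suc.IH Suc.prems unfolding i_def by simp
    moreover have e: "- int (R * K k) + int (Suc m) = i + 1" unfolding i_def by simp
    ultimately show ?case
      unfolding e sum.lessThan_Suc i_def[symmetric] add_divide_distrib by simp
  qed simp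
  have ak: "a k (j k) = a k (- int (R * K k)) + (\<Sum>i<n k. b k (- int (R * K k) + int i)) / K k" for k
    using tele[of "n k" k] n[of k] by simp
  have e1: "of_int (- int (R * K k)) / real (K k) = - real R" for k using K(1)[of k] by simp
  have e2: "(of_int (- int (R * K k)) + real (n k)) / real (K k) = of_int (j k) / real (K k)" for k
  proof -
    have "real (n k) = of_int (int (n k))" by simp
    then show ?thesis unfolding n by simp
  qed
  have I1: "(S k has_integral ((\<Sum>i<n k. b k (- int (R * K k) + int i)) / K k)) {- real R..of_int (j k) / K k}" for k
    using has_integral_step[of "real (K k)" "b k" "- int (R * K k)" "n k"] K(1)[of k]
    unfolding S_def e1 e2 by simp
  have jx: "of_int (j k) / K k \<le> x" "- real R \<le> of_int (j k) / K k" "x - of_int (j k) / K k \<le> 1 / K k" for k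
  proof -
    have "of_int (j k) \<le> x * K k" "x * K k < of_int (j k) + 1" unfolding j_def by linarith+
    then have "of_int (j k) / K k \<le> x" "x \<le> (of_int (j k) + 1) / K k"
      using K(1)[of k] by (simp_all add: divide_le_eq le_divide_eq)
    then show "of_int (j k) / K k \<le> x" "x - of_int (j k) / K k \<le> 1 / K k"
      by (simp_all add: add_divide_distrib)
    have "real_of_int (- int (R * K k)) \<le> of_int (j k)" using jb(1)[of k] by (simp only: of_int_le_iff)
    then show "- real R \<le> of_int (j k) / K k" using K(1)[of k] by (simp add: field_simps)
  qed
  have I2: "(S k has_integral ((x - of_int (j k) / K k) * b k (j k))) {of_int (j k) / K k..x}" for k
  proof -
    have c: "((\<lambda>t. b k (j k)) has_integral ((x - of_int (j k) / K k) * b k (j k))) {of_int (j k) / K k..x}"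
      using has_integral_const_real[of "b k (j k)" "of_int (j k) / K k" x] jx(1)[of k] by simp
    have "S k t = b k (j k)" if t: "t \<in> {of_int (j k) / K k..x}" for t
    proof -
      have "t * K k \<le> x * K k" using t K(1)[of k] by simp
      moreover have "x * K k < of_int (j k) + 1" unfolding j_def by linarith
      moreover have "of_int (j k) \<le> t * K k" using t K(1)[of k] by (auto simp: field_simps)
      ultimately have "\<lfloor>t * K k\<rfloor> = j k" by (intro floor_unique) auto
      then show ?thesis unfolding S_def by simp
    qed
    then show ?thesis using c by (subst has_integral_cong) auto
  qed
  have I: "(S k has_integral ((\<Sum>i<n k. b k (- int (R * K k) + int i)) / K k + (x - of_int (j k) / K k) * b k (j k))) {- real R..x}" for k
    using has_integral_combine[OF jx(2) jx(1) I1 I2] .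
  have Sb: "norm (S k t) \<le> M" if "t \<in> {- real R..x}" for k t
  proof -
    have "real_of_int (- int (R * K k)) \<le> t * K k" using that mult_right_mono[of "- real R" t "K k"] by simp
    then have "- int (R * K k) \<le> \<lfloor>t * K k\<rfloor>" by (simp add: le_floor_iff)
    moreover have "t * K k < R * K k" using that x K(1)[of k] by simp
    then have "\<lfloor>t * K k\<rfloor> < int (R * K k)" by (simp add: floor_less_iff)
    ultimately show ?thesis unfolding S_def real_norm_def by (intro bd) auto
  qed
  have Sc: "(\<lambda>k. S k t) \<longlonglongrightarrow> B t" if "t \<in> {- real R..x}" for t
    unfolding S_def using conv[of t] that x by auto
  have intS: "S k integrable_on {- real R..x}" for k using I by blast
  note dc = dominated_convergence[of S "{- real R..x}" "\<lambda>_. M" B, OF intS integrable_const_ivl Sb Sc]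
  show "B integrable_on {- real R..x}" using dc(1) by simp
  have lim: "(\<lambda>k. integral {- real R..x} (S k)) \<longlonglongrightarrow> integral {- real R..x} B" using dc(2) by simp
  have invK: "(\<lambda>k. 1 / real (K k)) \<longlonglongrightarrow> 0"
    using K(2) by (intro tendsto_divide_0[OF tendsto_const] filterlim_at_top_imp_at_infinity
        filterlim_compose[OF filterlim_real_sequentially])
  \<comment> \<open>The last, incomplete grid cell.\<close>
  have "(\<lambda>k. (x - of_int (j k) / K k) * b k (j k)) \<longlonglongrightarrow> 0"
  proof (rule Lim_null_comparison)
    have M: "0 \<le> M" using Sb[of x] x by (meson atLeastAtMost_iff dual_order.refl norm_ge_zero order_trans)
    show "\<forall>\<^sub>F k in sequentially. norm ((x - of_int (j k) / K k) * b k (j k)) \<le> 1 / K k * M"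
    proof (rule always_eventually, rule allI)
      fix k
      have "\<bar>b k (j k)\<bar> \<le> M" using jb[of k] by (intro bd) auto
      then show "norm ((x - of_int (j k) / K k) * b k (j k)) \<le> 1 / K k * M"
        unfolding real_norm_def abs_mult using jx[of k] M by (intro mult_mono) auto
    qed
    show "(\<lambda>k. 1 / real (K k) * M) \<longlonglongrightarrow> 0" using tendsto_mult_left_zero[OF invK] .
  qed
  from tendsto_diff[OF tendsto_add[OF base lim] this]
  have "(\<lambda>k. a k (- int (R * K k)) + integral {- real R..x} (S k) - (x - of_int (j k) / K k) * b k (j k)) \<longlonglongrightarrow> a0 + integral {- real R..x} B"
    by simp
  moreover have "a k (- int (R * K k)) + integral {- real R..x} (S k) - (x - of_int (j k) / K k) * b k (j k) = a k (j k)" for k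
    unfolding integral_unique[OF I] ak by simp
  ultimately show "(\<lambda>k. a k \<lfloor>x * K k\<rfloor>) \<longlonglongrightarrow> a0 + integral {- real R..x} B" by (simp add: j_def)
qed

lemma bounded_real_convergent_subsequence:
  fixes s :: "nat \<Rightarrow> real"
  assumes "\<And>k. \<bar>s k\<bar> \<le> M"
  obtains r l where "strict_mono (r::nat\<Rightarrow>nat)" "(\<lambda>k. s (r k)) \<longlonglongrightarrow> l"
proof -
  obtain r where r: "strict_mono (r::nat\<Rightarrow>nat)" "\<And>x::unit. x \<in> {()} \<Longrightarrow> \<exists>l. (\<lambda>n. s (r n)) \<longlonglongrightarrow> l"
    using function_convergent_subsequence[of "{()}" "\<lambda>k _. s k" M] assms by auto
  with that show thesis by blast
qed

text \<open>
  Eigenvectors on grids of step \<open>1 / K k\<close> that exhaust the line, with eigenvalues converging to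
  \<open>\<mu>0\<close>. Convergence is assumed at rational points only, as a diagonal subsequence provides it; at the other
  points it follows from a Lipschitz bound.
\<close>

locale grid_solutions =
  fixes v :: "real \<Rightarrow> real" and h \<mu>0 :: real and K :: "nat \<Rightarrow> nat"
    and g :: "nat \<Rightarrow> int \<Rightarrow> real" and \<mu> :: "nat \<Rightarrow> real"
  assumes v: "continuous_on UNIV v" and h: "h > 0"
    and K_pos: "\<And>k. K k > 0" and K_lim: "filterlim K at_top sequentially"
    and g_le: "\<And>k i. \<bar>g k i\<bar> \<le> 1"
    and eq: "\<And>k i. \<bar>i\<bar> \<le> int (K k * K k) \<Longrightarrow>
       h\<^sup>2 * (real (K k))\<^sup>2 * (g k (i+1) - 2 * g k i + g k (i-1)) = (v (i / K k) - \<mu> k) * g k i"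
    and \<mu>: "\<mu> \<longlonglongrightarrow> \<mu>0"
    and conv_rat: "\<And>x::real. x \<in> \<rat> \<Longrightarrow> convergent (\<lambda>k. g k \<lfloor>x * K k\<rfloor>)"
begin

text \<open>
  The difference quotients of \<open>g\<close>, and the coefficient of the equation \<open>u'' = q u\<close>.
\<close>

definition d :: "nat \<Rightarrow> int \<Rightarrow> real" where "d k i = (g k i - g k (i-1)) * K k"
definition q :: "nat \<Rightarrow> int \<Rightarrow> real" where "q k i = (v (i / K k) - \<mu> k) / h\<^sup>2"

lemma d_step: "d k (i+1) - d k i = q k i * g k i / K k" if "\<bar>i\<bar> \<le> int (K k * K k)"
  using eq[OF that] h K_pos[of k] unfolding d_def q_def
  by (simp add: field_simps power2_eq_square)

lemma g_step: "g k (i+1) - g k i = d k (i+1) / K k"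
  unfolding d_def using K_pos[of k] by simp

lemma q_bound: "\<exists>Q\<ge>0. \<forall>k i. \<bar>i\<bar> \<le> int (R * K k) \<longrightarrow> \<bar>q k i * g k i\<bar> \<le> Q"
proof -
  have "compact (v ` {- real R..real R})"
    by (intro compact_continuous_image continuous_on_subset[OF v]) auto
  then obtain V where V: "\<And>x. x \<in> {- real R..real R} \<Longrightarrow> \<bar>v x\<bar> \<le> V"
    using compact_imp_bounded bounded_iff by (metis image_eqI real_norm_def)
  from \<mu> have "Bseq \<mu>" using convergent_imp_Bseq convergent_def by blast
  then obtain M where M: "\<And>k. \<bar>\<mu> k\<bar> \<le> M" unfolding Bseq_def by auto
  have V0: "V + M \<ge> 0" using V[of 0] M[of 0] by force
  show ?thesis
  proof (intro exI[of _ "(V + M) / h\<^sup>2"] conjI allI impI)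
    fix k i assume i: "\<bar>i\<bar> \<le> int (R * K k)"
    have "\<bar>i / K k\<bar> \<le> R"
    proof -
      have "real_of_int \<bar>i\<bar> \<le> real_of_int (int (R * K k))" using i by (simp only: of_int_le_iff)
      then show ?thesis using K_pos[of k] by (simp add: abs_divide divide_le_eq)
    qed
    then have "\<bar>v (i / K k) - \<mu> k\<bar> \<le> V + M" using V[of "i / K k"] M[of k] by (simp only: atLeastAtMost_iff abs_le_iff) (smt (verit))
    then have "\<bar>q k i\<bar> \<le> (V + M) / h\<^sup>2" unfolding q_def abs_divide by (simp add: divide_right_mono)
    with g_le[of k i] V0 show "\<bar>q k i * g k i\<bar> \<le> (V + M) / h\<^sup>2"
      unfolding abs_mult using mult_mono[of "\<bar>q k i\<bar>" "(V+M)/h\<^sup>2" "\<bar>g k i\<bar>" 1] by simp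
  qed (use V0 in simp)
qed

text \<open>
  The second differences are bounded because \<open>q g\<close> is, so \<open>d\<close> oscillates by at most \<open>2 R Q\<close> on
  \<open>[-R, R]\<close>. Its mean over \<open>[0, 1]\<close> equals \<open>g(1) - g(0)\<close>, hence is at most 2 in absolute value, and
  this bounds \<open>d\<close> itself.
\<close>

lemma d_bound: "\<exists>D\<ge>0. \<forall>k i. K k \<ge> R \<longrightarrow> \<bar>i\<bar> \<le> int (R * K k) \<longrightarrow> \<bar>d k i\<bar> \<le> D" if R: "R \<ge> 1"
proof -
  obtain Q where Q: "Q \<ge> 0" "\<And>k i. \<bar>i\<bar> \<le> int (R * K k) \<Longrightarrow> \<bar>q k i * g k i\<bar> \<le> Q"
    using q_bound[of R] by blast
  show ?thesis
  proof (intro exI[of _ "2 + 2 * R * Q"] conjI allI impI)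
    fix k i assume k: "K k \<ge> R" and i: "\<bar>i\<bar> \<le> int (R * K k)"
    have RK: "int (R * K k) \<le> int (K k * K k)" using k by (simp add: mult_right_mono)
    have diff1: "\<bar>d k (j + int m) - d k j\<bar> \<le> m * (Q / K k)"
      if "- int (R * K k) \<le> j" "j + int m \<le> int (R * K k)" for j m using that
    proof (induction m)
      case (Suc m)
      have b: "\<bar>j + int m\<bar> \<le> int (R * K k)" using Suc.prems by auto
      have "\<bar>d k (j + int m + 1) - d k (j + int m)\<bar> \<le> Q / K k"
        using d_step[of "j + int m" k, OF order_trans[OF b RK]] Q(2)[OF b] K_pos[of k]
        by (simp add: abs_divide divide_right_mono)
      moreover have "\<bar>d k (j + int m) - d k j\<bar> \<le> m * (Q / K k)" using Suc by auto
      moreover have "j + int (Suc m) = j + int m + 1" by simp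
      moreover have "real (Suc m) * (Q / K k) = m * (Q / K k) + Q / K k" by (simp add: add_divide_distrib distrib_right)
      ultimately show ?case by (simp only:)
    qed simp
    have diff: "\<bar>d k j - d k j'\<bar> \<le> 2 * R * Q" if "\<bar>j\<bar> \<le> int (R * K k)" "\<bar>j'\<bar> \<le> int (R * K k)" "j' \<le> j" for j j'
    proof -
      have "\<bar>d k (j' + int (nat (j - j'))) - d k j'\<bar> \<le> nat (j - j') * (Q / K k)"
        using that by (intro diff1) auto
      also have "\<dots> \<le> (2 * R * K k) * (Q / K k)"
      proof (rule mult_right_mono)
        have "j - j' \<le> 2 * int (R * K k)" using that by linarith
        then have "nat (j - j') \<le> 2 * R * K k" by (simp add: nat_le_iff)
        then show "real (nat (j - j')) \<le> real (2 * R * K k)" by (simp only: of_nat_le_iff)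
        show "0 \<le> Q / K k" using Q by simp
      qed
      also have "\<dots> = 2 * R * Q" using K_pos[of k] by simp
      finally show ?thesis using that by simp
    qed
    have diff': "\<bar>d k i - d k (int j)\<bar> \<le> 2 * R * Q" if "j \<le> K k" for j
    proof -
      have "int j \<le> int (R * K k)" 
        using mult_le_mono[OF R that] by (simp only: of_nat_le_iff mult_1)
      then show ?thesis using diff[of i "int j"] diff[of "int j" i] i by (cases "int j \<le> i") (auto simp: abs_minus_commute)
    qed
    have tele: "(\<Sum>j<m. d k (int j + 1)) / K k = g k (int m) - g k 0" for m
    proof (induction m)
      case (Suc m)
      then show ?case using g_step[of k "int m"] by (simp add: add_divide_distrib add.commute)
    qed simp
    have "d k i * K k - (\<Sum>j<K k. d k (int j + 1)) = (\<Sum>j<K k. d k i - d k (int j + 1))"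
      by (simp add: sum_subtractf)
    moreover have "\<bar>\<Sum>j<K k. d k i - d k (int j + 1)\<bar> \<le> (\<Sum>j<K k. 2 * R * Q)"
    proof (rule order_trans[OF sum_abs sum_mono])
      fix j assume "j \<in> {..<K k}"
      then show "\<bar>d k i - d k (int j + 1)\<bar> \<le> 2 * R * Q" using diff'[of "Suc j"] by (simp add: add.commute)
    qed
    ultimately have "\<bar>d k i * K k - (\<Sum>j<K k. d k (int j + 1))\<bar> \<le> K k * (2 * R * Q)" by simp
    then have "\<bar>d k i * K k - (\<Sum>j<K k. d k (int j + 1))\<bar> / K k \<le> 2 * R * Q"
      using K_pos[of k] by (simp add: divide_le_eq mult.commute)
    moreover have "\<bar>d k i * K k - (\<Sum>j<K k. d k (int j + 1))\<bar> / K k = \<bar>d k i - (g k (int (K k)) - g k 0)\<bar>"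
    proof -
      have "\<bar>d k i * K k - (\<Sum>j<K k. d k (int j + 1))\<bar> / K k = \<bar>(d k i * K k - (\<Sum>j<K k. d k (int j + 1))) / K k\<bar>"
        by (simp add: abs_divide)
      also have "(d k i * K k - (\<Sum>j<K k. d k (int j + 1))) / K k = d k i - (g k (int (K k)) - g k 0)"
        unfolding tele[symmetric] using K_pos[of k] by (simp add: diff_divide_distrib)
      finally show ?thesis .
    qed
    ultimately show "\<bar>d k i\<bar> \<le> 2 + 2 * R * Q"
      using g_le[of k "int (K k)"] g_le[of k 0] by linarith
  qed (use Q in simp)
qed

lemma g_lipschitz:
  assumes R: "R \<ge> 1"
  shows "\<exists>D\<ge>0. \<forall>k i j. K k \<ge> R \<longrightarrow> \<bar>i\<bar> \<le> int (R * K k) \<longrightarrow> \<bar>j\<bar> \<le> int (R * K k) \<longrightarrow>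
           \<bar>g k i - g k j\<bar> \<le> D * (\<bar>real_of_int i - real_of_int j\<bar> / K k)"
proof -
  obtain D where D: "D \<ge> 0" "\<And>k i. K k \<ge> R \<Longrightarrow> \<bar>i\<bar> \<le> int (R * K k) \<Longrightarrow> \<bar>d k i\<bar> \<le> D"
    using d_bound[OF R] by blast
  have diff1: "\<bar>g k (j + int m) - g k j\<bar> \<le> m * (D / K k)"
    if "K k \<ge> R" "- int (R * K k) \<le> j" "j + int m \<le> int (R * K k)" for k j m using that
  proof (induction m)
    case (Suc m)
    have "\<bar>j + int m + 1\<bar> \<le> int (R * K k)" using Suc.prems by auto
    then have "\<bar>g k (j + int m + 1) - g k (j + int m)\<bar> \<le> D / K k"
      using D(2)[OF Suc.prems(1)] K_pos[of k] unfolding g_step by (simp add: abs_divide divide_right_mono)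
    moreover have "\<bar>g k (j + int m) - g k j\<bar> \<le> m * (D / K k)" using Suc by auto
    moreover have "j + int (Suc m) = j + int m + 1" by simp
    moreover have "real (Suc m) * (D / K k) = m * (D / K k) + D / K k" by (simp add: add_divide_distrib distrib_right)
    ultimately show ?case by (simp only:)
  qed simp
  have diff: "\<bar>g k i - g k j\<bar> \<le> D * (\<bar>real_of_int i - real_of_int j\<bar> / K k)"
    if "K k \<ge> R" "\<bar>j\<bar> \<le> int (R * K k)" "\<bar>i\<bar> \<le> int (R * K k)" "j \<le> i" for k i j
  proof -
    have "\<bar>g k (j + int (nat (i - j))) - g k j\<bar> \<le> nat (i - j) * (D / K k)"
      using that by (intro diff1) auto
    then show ?thesis using that by (simp add: mult.commute)
  qed
  show ?thesis
  proof (intro exI[of _ D] conjI allI impI)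
    fix k i j assume "R \<le> K k" "\<bar>i\<bar> \<le> int (R * K k)" "\<bar>j\<bar> \<le> int (R * K k)"
    then show "\<bar>g k i - g k j\<bar> \<le> D * (\<bar>real_of_int i - real_of_int j\<bar> / K k)"
      using diff[of k i j] diff[of k j i] by (cases "j \<le> i") (auto simp: abs_minus_commute)
  qed (rule D)
qed

lemma floor_index_le: "\<bar>x\<bar> \<le> real R \<Longrightarrow> \<bar>\<lfloor>x * K k\<rfloor>\<bar> \<le> int (R * K k)"
proof -
  assume "\<bar>x\<bar> \<le> real R"
  then have "- real R * K k \<le> x * K k" "x * K k \<le> real R * K k" by (intro mult_right_mono; simp)+
  then have "- int (R * K k) \<le> \<lfloor>x * K k\<rfloor>" "\<lfloor>x * K k\<rfloor> \<le> int (R * K k)"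
    by (simp add: le_floor_iff) (metis \<open>x * K k \<le> real R * K k\<close> floor_mono floor_of_nat of_nat_mult)
  then show ?thesis by auto
qed

lemma inverse_K: "(\<lambda>k. 1 / real (K k)) \<longlonglongrightarrow> 0"
  using K_lim by (intro tendsto_divide_0[OF tendsto_const] filterlim_at_top_imp_at_infinity
        filterlim_compose[OF filterlim_real_sequentially])

lemma K_ge: "\<forall>\<^sub>F k in sequentially. K k \<ge> R"
  using K_lim by (simp add: filterlim_at_top)

lemma grid_continuity:
  assumes R: "R \<ge> 1"
  shows "\<exists>D\<ge>0. \<forall>k (x::real) j. K k \<ge> R \<longrightarrow> \<bar>x\<bar> \<le> R \<longrightarrow> \<bar>j\<bar> \<le> int (R * K k) \<longrightarrow>
           \<bar>g k \<lfloor>x * K k\<rfloor> - g k j\<bar> \<le> D * (\<bar>x - j / K k\<bar> + 1 / K k)"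
proof -
  obtain D where D: "D \<ge> 0" "\<And>k i j. K k \<ge> R \<Longrightarrow> \<bar>i\<bar> \<le> int (R * K k) \<Longrightarrow> \<bar>j\<bar> \<le> int (R * K k) \<Longrightarrow>
           \<bar>g k i - g k j\<bar> \<le> D * (\<bar>real_of_int i - real_of_int j\<bar> / K k)"
    using g_lipschitz[OF R] by blast
  show ?thesis
  proof (intro exI[of _ D] conjI allI impI)
    fix k j and x :: real assume a: "R \<le> K k" "\<bar>x\<bar> \<le> real R" "\<bar>j\<bar> \<le> int (R * K k)"
    have "\<bar>real_of_int \<lfloor>x * K k\<rfloor> - real_of_int j\<bar> \<le> \<bar>x * K k - j\<bar> + 1" by linarith
    then have "\<bar>real_of_int \<lfloor>x * K k\<rfloor> - real_of_int j\<bar> / K k \<le> (\<bar>x * K k - j\<bar> + 1) / K k"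
      by (simp add: divide_right_mono)
    also have "\<dots> = \<bar>x * K k - j\<bar> / K k + 1 / K k" by (rule add_divide_distrib)
    also have "\<bar>x * K k - j\<bar> / K k = \<bar>(x * K k - j) / K k\<bar>" by (simp add: abs_divide)
    also have "(x * K k - j) / K k = x - j / K k" using K_pos[of k] by (simp add: diff_divide_distrib)
    finally have "D * (\<bar>real_of_int \<lfloor>x * K k\<rfloor> - real_of_int j\<bar> / K k) \<le> D * (\<bar>x - j / K k\<bar> + 1 / K k)"
      using D(1) by (intro mult_left_mono) auto
    then show "\<bar>g k \<lfloor>x * K k\<rfloor> - g k j\<bar> \<le> D * (\<bar>x - j / K k\<bar> + 1 / K k)"
      using D(2)[OF a(1) floor_index_le[OF a(2)] a(3)] by linarith
  qed (rule D)
qed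

lemma grid_continuity':
  assumes R: "R \<ge> 1"
  shows "\<exists>D\<ge>0. \<forall>k (x::real) (y::real). K k \<ge> R \<longrightarrow> \<bar>x\<bar> \<le> R \<longrightarrow> \<bar>y\<bar> \<le> R \<longrightarrow>
           \<bar>g k \<lfloor>x * K k\<rfloor> - g k \<lfloor>y * K k\<rfloor>\<bar> \<le> D * (\<bar>x - y\<bar> + 2 / K k)"
proof -
  obtain D where D: "D \<ge> 0" "\<And>k (x::real) j. K k \<ge> R \<Longrightarrow> \<bar>x\<bar> \<le> R \<Longrightarrow> \<bar>j\<bar> \<le> int (R * K k) \<Longrightarrow>
           \<bar>g k \<lfloor>x * K k\<rfloor> - g k j\<bar> \<le> D * (\<bar>x - j / K k\<bar> + 1 / K k)"
    using grid_continuity[OF R] by blast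
  show ?thesis
  proof (intro exI[of _ D] conjI allI impI)
    fix k and x y :: real assume a: "R \<le> K k" "\<bar>x\<bar> \<le> real R" "\<bar>y\<bar> \<le> real R"
    have "of_int \<lfloor>y * K k\<rfloor> \<le> y * K k" "y * K k \<le> of_int \<lfloor>y * K k\<rfloor> + 1" by linarith+
    then have "of_int \<lfloor>y * K k\<rfloor> / K k \<le> y" "y \<le> (of_int \<lfloor>y * K k\<rfloor> + 1) / K k"
      using K_pos[of k] by (simp_all add: divide_le_eq le_divide_eq)
    then have "\<bar>y - of_int \<lfloor>y * K k\<rfloor> / K k\<bar> \<le> 1 / K k" by (simp add: add_divide_distrib)
    then have "\<bar>x - of_int \<lfloor>y * K k\<rfloor> / K k\<bar> + 1 / K k \<le> \<bar>x - y\<bar> + 2 / K k" by linarith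
    from mult_left_mono[OF this D(1)] show "\<bar>g k \<lfloor>x * K k\<rfloor> - g k \<lfloor>y * K k\<rfloor>\<bar> \<le> D * (\<bar>x - y\<bar> + 2 / K k)"
      using D(2)[OF a(1,2) floor_index_le[OF a(3)]] by linarith
  qed (rule D)
qed

definition u :: "real \<Rightarrow> real" where "u x = lim (\<lambda>k. g k \<lfloor>x * K k\<rfloor>)"

lemma u_lim: "(\<lambda>k. g k \<lfloor>x * K k\<rfloor>) \<longlonglongrightarrow> u x" for x :: real
proof -
  obtain R where R: "R \<ge> 1" "\<bar>x\<bar> + 1 \<le> real R"
    using real_arch_simple[of "\<bar>x\<bar> + 1"] by (metis abs_ge_zero le_add_same_cancel2 of_nat_1 of_nat_le_iff order_trans)
  obtain D where D: "D \<ge> 0" "\<And>k (x::real) (y::real). K k \<ge> R \<Longrightarrow> \<bar>x\<bar> \<le> R \<Longrightarrow> \<bar>y\<bar> \<le> R \<Longrightarrow>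
           \<bar>g k \<lfloor>x * K k\<rfloor> - g k \<lfloor>y * K k\<rfloor>\<bar> \<le> D * (\<bar>x - y\<bar> + 2 / K k)"
    using grid_continuity'[OF R(1)] by blast
  have "Cauchy (\<lambda>k. g k \<lfloor>x * K k\<rfloor>)"
  proof (rule metric_CauchyI)
    fix e :: real assume e: "e > 0"
    define e' where "e' = min 1 (e / 8 / (D + 1))"
    have e': "e' > 0" "e' \<le> 1" using e D(1) by (auto simp: e'_def)
    have "D * e' \<le> (D + 1) * (e / 8 / (D + 1))" using e D(1) e' by (intro mult_mono) (auto simp: e'_def)
    also have "(D + 1) * (e / 8 / (D + 1)) = e / 8" using D(1) by (metis add_nonneg_pos less_irrefl nonzero_mult_div_cancel_left times_divide_eq_right zero_less_one)
    finally have De: "D * e' \<le> e / 8" .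
    obtain y where y: "y \<in> \<rat>" "x < y" "y < x + e'" using Rats_dense_in_real[of x "x + e'"] e' by auto
    have yR: "\<bar>y\<bar> \<le> R" "\<bar>x\<bar> \<le> R" using y e' R(2) by auto
    have "Cauchy (\<lambda>k. g k \<lfloor>y * K k\<rfloor>)" using conv_rat[OF y(1)] by (rule convergent_Cauchy)
    then obtain M where M: "\<And>m n. m \<ge> M \<Longrightarrow> n \<ge> M \<Longrightarrow> dist (g m \<lfloor>y * K m\<rfloor>) (g n \<lfloor>y * K n\<rfloor>) < e / 8"
      using e metric_CauchyD[of _ "e/8"] by fastforce
    have "\<forall>\<^sub>F k in sequentially. 1 / real (K k) < e' / 2"
      using order_tendstoD(2)[OF inverse_K, of "e' / 2"] e' by simp
    then have "\<forall>\<^sub>F k in sequentially. K k \<ge> R \<and> 1 / real (K k) < e' / 2" using K_ge[of R] by eventually_elim simp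
    then obtain M' where M': "\<And>k. k \<ge> M' \<Longrightarrow> K k \<ge> R \<and> 1 / real (K k) < e' / 2"
      unfolding eventually_sequentially by blast
    have near: "\<bar>g k \<lfloor>x * K k\<rfloor> - g k \<lfloor>y * K k\<rfloor>\<bar> \<le> e / 4" if "k \<ge> M'" for k
    proof -
      have "\<bar>g k \<lfloor>x * K k\<rfloor> - g k \<lfloor>y * K k\<rfloor>\<bar> \<le> D * (\<bar>x - y\<bar> + 2 / K k)"
        using M'[OF that] yR by (intro D(2)) auto
      also have "\<dots> \<le> D * (2 * e')"
        using M'[OF that] y D(1) by (intro mult_left_mono) auto
      finally show ?thesis using De by linarith
    qed
    show "\<exists>M. \<forall>m\<ge>M. \<forall>n\<ge>M. dist (g m \<lfloor>x * K m\<rfloor>) (g n \<lfloor>x * K n\<rfloor>) < e"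
    proof (intro exI[of _ "max M M'"] allI impI)
      fix m n assume "max M M' \<le> m" "max M M' \<le> n"
      then show "dist (g m \<lfloor>x * K m\<rfloor>) (g n \<lfloor>x * K n\<rfloor>) < e"
        using near[of m] near[of n] M[of m n] e unfolding dist_real_def by linarith
    qed
  qed
  then show ?thesis unfolding u_def by (simp add: Cauchy_convergent_iff convergent_LIMSEQ_iff)
qed

lemma u_le: "\<bar>u x\<bar> \<le> 1" for x :: real
  using tendsto_rabs[OF u_lim[of x]] by (rule LIMSEQ_le_const2) (use g_le in auto)

lemma u_continuous: "continuous_on {- real R..real R} u" if R: "R \<ge> 1"
proof -
  obtain D where D: "D \<ge> 0" "\<And>k (x::real) (y::real). K k \<ge> R \<Longrightarrow> \<bar>x\<bar> \<le> R \<Longrightarrow> \<bar>y\<bar> \<le> R \<Longrightarrow>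
           \<bar>g k \<lfloor>x * K k\<rfloor> - g k \<lfloor>y * K k\<rfloor>\<bar> \<le> D * (\<bar>x - y\<bar> + 2 / K k)"
    using grid_continuity'[OF R] by blast
  have lip: "\<bar>u x - u y\<bar> \<le> D * \<bar>x - y\<bar>" if "\<bar>x\<bar> \<le> R" "\<bar>y\<bar> \<le> R" for x y :: real
  proof (rule tendsto_le[OF sequentially_bot])
    have "(\<lambda>k. D * (\<bar>x - y\<bar> + 2 * (1 / K k))) \<longlonglongrightarrow> D * (\<bar>x - y\<bar> + 2 * 0)"
      by (intro tendsto_mult tendsto_add tendsto_const inverse_K)
    then show "(\<lambda>k. D * (\<bar>x - y\<bar> + 2 * (1 / K k))) \<longlonglongrightarrow> D * \<bar>x - y\<bar>" by simp
    show "(\<lambda>k. \<bar>g k \<lfloor>x * K k\<rfloor> - g k \<lfloor>y * K k\<rfloor>\<bar>) \<longlonglongrightarrow> \<bar>u x - u y\<bar>"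
      by (intro tendsto_rabs tendsto_diff u_lim)
    show "\<forall>\<^sub>F k in sequentially. \<bar>g k \<lfloor>x * K k\<rfloor> - g k \<lfloor>y * K k\<rfloor>\<bar> \<le> D * (\<bar>x - y\<bar> + 2 * (1 / K k))"
      using K_ge[of R] by eventually_elim (use D(2) that in auto)
  qed
  show ?thesis
    using D(1) by (intro lipschitz_on_continuous_on[of D] lipschitz_onI) (auto simp: dist_real_def intro!: lip)
qed

text \<open>
  If the normalized maxima stay at points that converge, they cannot disappear in the limit: the
  Lipschitz bound keeps \<open>g\<close> close to \<open>\<plusminus>1\<close> near the limit point.
\<close>

lemma u_nonzero:
  assumes p: "\<And>k. \<bar>g k (p k)\<bar> = 1" and p2: "(\<lambda>k. real_of_int (p k) / K k) \<longlonglongrightarrow> x"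
  shows "u x \<noteq> 0"
proof -
  obtain R where R: "R \<ge> 1" "\<bar>x\<bar> + 1 \<le> real R"
    using real_arch_simple[of "\<bar>x\<bar> + 1"] by (metis abs_ge_zero le_add_same_cancel2 of_nat_1 of_nat_le_iff order_trans)
  obtain D where D: "D \<ge> 0" "\<And>k (x::real) j. K k \<ge> R \<Longrightarrow> \<bar>x\<bar> \<le> R \<Longrightarrow> \<bar>j\<bar> \<le> int (R * K k) \<Longrightarrow>
           \<bar>g k \<lfloor>x * K k\<rfloor> - g k j\<bar> \<le> D * (\<bar>x - j / K k\<bar> + 1 / K k)"
    using grid_continuity[OF R(1)] by blast
  have "1 - 0 \<le> \<bar>u x\<bar>"
  proof (rule tendsto_le[OF sequentially_bot])
    show "(\<lambda>k. \<bar>g k \<lfloor>x * K k\<rfloor>\<bar>) \<longlonglongrightarrow> \<bar>u x\<bar>" by (intro tendsto_rabs tendsto_diff u_lim)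
    have "(\<lambda>k. 1 - D * (\<bar>x - p k / K k\<bar> + 1 / K k)) \<longlonglongrightarrow> 1 - D * (\<bar>x - x\<bar> + 0)"
      by (intro tendsto_mult tendsto_add tendsto_diff tendsto_rabs tendsto_const p2 inverse_K)
    then show "(\<lambda>k. 1 - D * (\<bar>x - p k / K k\<bar> + 1 / K k)) \<longlonglongrightarrow> 1 - 0" by simp
    have "\<forall>\<^sub>F k in sequentially. \<bar>p k / K k - x\<bar> < 1"
      using tendstoD[OF p2, of 1] by (simp add: dist_real_def)
    then show "\<forall>\<^sub>F k in sequentially. 1 - D * (\<bar>x - p k / K k\<bar> + 1 / K k) \<le> \<bar>g k \<lfloor>x * K k\<rfloor>\<bar>"
      using K_ge[of R]
    proof eventually_elim
      case (elim k)
      have "\<bar>p k / K k\<bar> \<le> R" using elim(1) R(2) by linarith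
      then have "\<bar>real_of_int (p k)\<bar> \<le> R * K k" using K_pos[of k] by (simp add: abs_divide divide_le_eq)
      then have "real_of_int \<bar>p k\<bar> \<le> real_of_int (int (R * K k))" by simp
      then have "\<bar>p k\<bar> \<le> int (R * K k)" by (simp only: of_int_le_iff)
      then have "\<bar>g k \<lfloor>x * K k\<rfloor> - g k (p k)\<bar> \<le> D * (\<bar>x - p k / K k\<bar> + 1 / K k)"
        using elim R(2) by (intro D(2)) auto
      then show ?case using p[of k] by linarith
    qed
  qed
  then show ?thesis by auto
qed

text \<open>
  Passing to a subsequence along which \<open>d\<close> converges at the left end of \<open>[-R, R]\<close>, the limit of sums
  gives first a limit \<open>w\<close> of \<open>d\<close> with \<open>w' = q u\<close>, and then \<open>u' = w\<close>.
\<close>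

lemma limit_ode:
  assumes R: "R \<ge> 1"
  shows "\<exists>w. \<forall>x. \<bar>x\<bar> < real R \<longrightarrow> (u has_real_derivative w x) (at x) \<and>
           (w has_real_derivative (v x - \<mu>0) / h\<^sup>2 * u x) (at x)"
proof -
  obtain D where D: "D \<ge> 0" "\<And>k i. K k \<ge> R \<Longrightarrow> \<bar>i\<bar> \<le> int (R * K k) \<Longrightarrow> \<bar>d k i\<bar> \<le> D"
    using d_bound[OF R] by blast
  obtain D' where D': "D' \<ge> 0" "\<And>k i. K k \<ge> Suc R \<Longrightarrow> \<bar>i\<bar> \<le> int (Suc R * K k) \<Longrightarrow> \<bar>d k i\<bar> \<le> D'"
    using d_bound[of "Suc R"] by auto
  obtain Q where Q: "Q \<ge> 0" "\<And>k i. \<bar>i\<bar> \<le> int (R * K k) \<Longrightarrow> \<bar>q k i * g k i\<bar> \<le> Q"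
    using q_bound[of R] by blast
  obtain k0 where k0: "\<And>k. k \<ge> k0 \<Longrightarrow> K k \<ge> Suc R" using K_ge[of "Suc R"] unfolding eventually_sequentially by blast
  have "\<bar>d (k + k0) (- int (R * K (k + k0)))\<bar> \<le> D" for k
    using k0[of "k + k0"] by (intro D(2)) auto
  then obtain r w0 where r: "strict_mono (r::nat\<Rightarrow>nat)" "(\<lambda>k. d (r k + k0) (- int (R * K (r k + k0)))) \<longlonglongrightarrow> w0"
    using bounded_real_convergent_subsequence[of "\<lambda>k. d (k + k0) (- int (R * K (k + k0)))"] by blast
  define \<sigma> where "\<sigma> = (\<lambda>k. r k + k0)"
  have \<sigma>_lim: "filterlim \<sigma> at_top sequentially"
    unfolding \<sigma>_def using filterlim_subseq[OF r(1)] by (rule filterlim_at_top_mono) auto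
  have sub: "(\<lambda>k. f (\<sigma> k)) \<longlonglongrightarrow> l" if "f \<longlonglongrightarrow> l" for f and l :: real
    using filterlim_compose[OF that \<sigma>_lim] .
  have K\<sigma>: "K (\<sigma> k) > 0" "K (\<sigma> k) \<ge> Suc R" for k using K_pos k0[of "\<sigma> k"] by (auto simp: \<sigma>_def)
  have K\<sigma>_lim: "filterlim (\<lambda>k. K (\<sigma> k)) at_top sequentially" using filterlim_compose[OF K_lim \<sigma>_lim] .
  have RK: "int (R * K (\<sigma> k)) \<le> int (K (\<sigma> k) * K (\<sigma> k))" for k
    using K\<sigma>(2)[of k] by (simp add: mult_right_mono)
  have inv\<sigma>: "(\<lambda>k. 1 / real (K (\<sigma> k))) \<longlonglongrightarrow> 0" using sub[OF inverse_K] .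
  have grid_point: "(\<lambda>k. of_int \<lfloor>x * real (K (\<sigma> k))\<rfloor> / real (K (\<sigma> k))) \<longlonglongrightarrow> x" for x :: real
  proof (rule tendsto_sandwich[of "\<lambda>k. x - 1 / K (\<sigma> k)" _ _ "\<lambda>k. x"])
    have "x - 1 / K (\<sigma> k) \<le> of_int \<lfloor>x * real (K (\<sigma> k))\<rfloor> / real (K (\<sigma> k)) \<and>
        of_int \<lfloor>x * real (K (\<sigma> k))\<rfloor> / real (K (\<sigma> k)) \<le> x" for k
    proof -
      define F where "F = real_of_int \<lfloor>x * real (K (\<sigma> k))\<rfloor>"
      have "F \<le> x * K (\<sigma> k)" "x * K (\<sigma> k) \<le> F + 1" unfolding F_def by linarith+
      then have "F / K (\<sigma> k) \<le> x" "x \<le> (F + 1) / K (\<sigma> k)"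
        using K\<sigma>(1)[of k] by (simp_all add: divide_le_eq le_divide_eq)
      then show ?thesis unfolding F_def by (simp add: add_divide_distrib)
    qed
    then show "\<forall>\<^sub>F k in sequentially. x - 1 / K (\<sigma> k) \<le> of_int \<lfloor>x * real (K (\<sigma> k))\<rfloor> / real (K (\<sigma> k))"
      "\<forall>\<^sub>F k in sequentially. of_int \<lfloor>x * real (K (\<sigma> k))\<rfloor> / real (K (\<sigma> k)) \<le> x" by auto
    have "(\<lambda>k. x - 1 / K (\<sigma> k)) \<longlonglongrightarrow> x - 0" by (intro tendsto_diff tendsto_const inv\<sigma>)
    then show "(\<lambda>k. x - 1 / K (\<sigma> k)) \<longlonglongrightarrow> x" by simp
  qed simp
  define B where "B = (\<lambda>x. (v x - \<mu>0) / h\<^sup>2 * u x)"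
  have qg: "(\<lambda>k. q (\<sigma> k) \<lfloor>x * K (\<sigma> k)\<rfloor> * g (\<sigma> k) \<lfloor>x * K (\<sigma> k)\<rfloor>) \<longlonglongrightarrow> B x" for x :: real
  proof -
    have "isCont v x" using v by (simp add: continuous_on_eq_continuous_at)
    then have "(\<lambda>k. v (of_int \<lfloor>x * real (K (\<sigma> k))\<rfloor> / real (K (\<sigma> k)))) \<longlonglongrightarrow> v x"
      using grid_point by (rule isCont_tendsto_compose)
    then show ?thesis unfolding q_def B_def
      using h by (intro tendsto_mult tendsto_divide tendsto_diff tendsto_const sub[OF \<mu>] sub[OF u_lim]) auto
  qed
  define w where "w = (\<lambda>x. w0 + integral {- real R..x} B)"
  have w_lim: "(\<lambda>k. d (\<sigma> k) \<lfloor>x * K (\<sigma> k)\<rfloor>) \<longlonglongrightarrow> w x" if x: "- real R \<le> x" "x < real R" for x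
    unfolding w_def
  proof (rule step_function_limit[where K = "\<lambda>k. K (\<sigma> k)" and b = "\<lambda>k i. q (\<sigma> k) i * g (\<sigma> k) i" and M = Q])
    fix k i assume "- int (R * K (\<sigma> k)) \<le> i" "i < int (R * K (\<sigma> k))"
    then show "d (\<sigma> k) (i + 1) - d (\<sigma> k) i = q (\<sigma> k) i * g (\<sigma> k) i / real (K (\<sigma> k))"
      using RK[of k] by (intro d_step) auto
  qed (use K\<sigma> K\<sigma>_lim Q qg r(2) x in \<open>auto simp: \<sigma>_def\<close>)
  \<comment> \<open>The differences of \<open>g\<close> at \<open>i\<close> are given by \<open>d\<close> at \<open>i + 1\<close>, so the shifted sequence is needed.\<close>
  have dnext: "(\<lambda>k. d (\<sigma> k) (\<lfloor>x * K (\<sigma> k)\<rfloor> + 1)) \<longlonglongrightarrow> w x" if x: "- real R \<le> x" "x < real R" for x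
  proof -
    have "d (\<sigma> k) (\<lfloor>x * K (\<sigma> k)\<rfloor> + 1) = d (\<sigma> k) \<lfloor>x * K (\<sigma> k)\<rfloor> +
        q (\<sigma> k) \<lfloor>x * K (\<sigma> k)\<rfloor> * g (\<sigma> k) \<lfloor>x * K (\<sigma> k)\<rfloor> * (1 / K (\<sigma> k))" for k
    proof -
      have "\<bar>\<lfloor>x * K (\<sigma> k)\<rfloor>\<bar> \<le> int (R * K (\<sigma> k))" using x by (intro floor_index_le) auto
      from d_step[OF order_trans[OF this RK]] show ?thesis by simp
    qed
    moreover have "(\<lambda>k. d (\<sigma> k) \<lfloor>x * K (\<sigma> k)\<rfloor> +
        q (\<sigma> k) \<lfloor>x * K (\<sigma> k)\<rfloor> * g (\<sigma> k) \<lfloor>x * K (\<sigma> k)\<rfloor> * (1 / K (\<sigma> k))) \<longlonglongrightarrow> w x + B x * 0"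
      by (intro tendsto_add tendsto_mult[OF qg inv\<sigma>] w_lim x)
    ultimately show ?thesis by simp
  qed
  have baseu: "(\<lambda>k. g (\<sigma> k) (- int (R * K (\<sigma> k)))) \<longlonglongrightarrow> u (- real R)"
  proof -
    have "\<lfloor>- real R * K (\<sigma> k)\<rfloor> = - int (R * K (\<sigma> k))" for k
      by (metis floor_of_int mult_minus_left of_int_minus of_int_of_nat_eq of_nat_mult)
    then show ?thesis using sub[OF u_lim[of "- real R"]] by simp
  qed
  have u_eq: "u x = u (- real R) + integral {- real R..x} w" if x: "- real R \<le> x" "x < real R" for x
  proof (rule LIMSEQ_unique[OF sub[OF u_lim]])
    show "(\<lambda>k. g (\<sigma> k) \<lfloor>x * real (K (\<sigma> k))\<rfloor>) \<longlonglongrightarrow> u (- real R) + integral {- real R..x} w"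
    proof (rule step_function_limit[where K = "\<lambda>k. K (\<sigma> k)" and b = "\<lambda>k i. d (\<sigma> k) (i + 1)" and M = D'])
      fix k i assume i: "\<bar>i\<bar> \<le> int (R * K (\<sigma> k))"
      have "int (Suc R * K (\<sigma> k)) = int (K (\<sigma> k)) + int (R * K (\<sigma> k))" by simp
      then have "\<bar>i + 1\<bar> \<le> int (Suc R * K (\<sigma> k))" using i K\<sigma>(1)[of k] by linarith
      then show "\<bar>d (\<sigma> k) (i + 1)\<bar> \<le> D'" using K\<sigma>(2) by (intro D'(2))
    qed (use K\<sigma> K\<sigma>_lim dnext baseu x g_step in auto)
  qed
  have contB: "continuous_on {- real R..real R} B"
    unfolding B_def using h by (intro continuous_intros continuous_on_subset[OF v] u_continuous R) auto
  have w_der: "(w has_real_derivative B x) (at x within {- real R..real R})" if "x \<in> {- real R..real R}" for x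
    unfolding w_def using integral_has_real_derivative[OF contB that]
    by (auto intro!: derivative_eq_intros)
  have contw: "continuous_on {- real R..real R} w"
    using w_der by (meson DERIV_continuous_on)
  have u_der: "((\<lambda>x. u (- real R) + integral {- real R..x} w) has_real_derivative w x) (at x within {- real R..real R})"
    if "x \<in> {- real R..real R}" for x
    using integral_has_real_derivative[OF contw that] by (auto intro!: derivative_eq_intros)
  show ?thesis
  proof (intro exI[of _ w] allI impI conjI)
    fix x assume x: "\<bar>x\<bar> < real R"
    then have at: "at x within {- real R..real R} = at x" by (intro at_within_interior) (auto simp: interior_atLeastAtMost_real)
    show "(w has_real_derivative (v x - \<mu>0) / h\<^sup>2 * u x) (at x)"
      using w_der[of x] x unfolding at B_def by (simp add: abs_less_iff)
    have "((\<lambda>x. u (- real R) + integral {- real R..x} w) has_real_derivative w x) (at x)"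
      using u_der[of x] x unfolding at by (simp add: abs_less_iff)
    then show "(u has_real_derivative w x) (at x)"
      by (rule has_field_derivative_transform_within_open[of _ _ _ "{- real R<..<real R}"]) (use x in \<open>auto simp: u_eq[symmetric]\<close>)
  qed
qed

lemma limit_solves:
  "(u has_real_derivative deriv u x) (at x)"
  "(deriv u has_real_derivative (v x - \<mu>0) / h\<^sup>2 * u x) (at x)"
proof -
  obtain R where R: "R \<ge> 1" "\<bar>x\<bar> + 1 \<le> real R"
    using real_arch_simple[of "\<bar>x\<bar> + 1"] by (metis abs_ge_zero le_add_same_cancel2 of_nat_1 of_nat_le_iff order_trans)
  obtain w where w: "\<And>y. \<bar>y\<bar> < real R \<Longrightarrow> (u has_real_derivative w y) (at y)"
      "\<And>y. \<bar>y\<bar> < real R \<Longrightarrow> (w has_real_derivative (v y - \<mu>0) / h\<^sup>2 * u y) (at y)"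
    using limit_ode[OF R(1)] by blast
  have du: "deriv u y = w y" if "\<bar>y\<bar> < real R" for y using w(1)[OF that] by (rule DERIV_imp_deriv)
  show "(u has_real_derivative deriv u x) (at x)" using w(1)[of x] du[of x] R by simp
  show "(deriv u has_real_derivative (v x - \<mu>0) / h\<^sup>2 * u x) (at x)"
    by (rule has_field_derivative_transform_within_open[OF w(2), of _ "{- real R<..<real R}"]) (use R du in auto)
qed

end

section \<open>Bounded solutions below the limit inferior of the potential are eigenfunctions\<close>

text \<open>
  The product \<open>P = u u'\<close> has derivative \<open>u'\<^sup>2 + q u\<^sup>2 \<ge> c u\<^sup>2\<close> for \<open>x \<ge> R\<close>. If it were positive
  somewhere, then \<open>(u\<^sup>2)' = 2 P\<close> would be bounded below by a positive constant, against the boundedness of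
  \<open>u\<close>. So \<open>P \<le> 0\<close> increases to a finite limit, and \<open>c u\<^sup>2\<close> is dominated by the integrable
  derivative of \<open>P\<close>.
\<close>

lemma bounded_solution_nn_integral:
  fixes u w q :: "real \<Rightarrow> real"
  assumes u: "\<And>x. (u has_real_derivative w x) (at x)"
    and w: "\<And>x. (w has_real_derivative q x * u x) (at x)"
    and q: "continuous_on UNIV q" "\<And>x. x \<ge> R \<Longrightarrow> q x \<ge> c" "c > 0"
    and bd: "\<And>x. \<bar>u x\<bar> \<le> M"
  shows "(\<integral>\<^sup>+x. ennreal ((u x)\<^sup>2) * indicator {R..} x \<partial>lborel) < \<infinity>"
proof -
  define P where "P = (\<lambda>x. u x * w x)"
  define f where "f = (\<lambda>x. (w x)\<^sup>2 + q x * (u x)\<^sup>2)"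
  have cont: "continuous_on UNIV u" "continuous_on UNIV w"
    using u w by (auto intro!: continuous_at_imp_continuous_on DERIV_isCont)
  have P': "(P has_real_derivative f x) (at x)" for x
    unfolding P_def f_def
    by (rule DERIV_cong[OF DERIV_mult[OF u[of x] w[of x]]]) (simp add: power2_eq_square)
  have f0: "f x \<ge> c * (u x)\<^sup>2" "f x \<ge> 0" if "x \<ge> R" for x
  proof -
    have "c * (u x)\<^sup>2 \<le> q x * (u x)\<^sup>2" "0 \<le> c * (u x)\<^sup>2" using q that by (auto intro: mult_right_mono)
    then show "f x \<ge> c * (u x)\<^sup>2" "f x \<ge> 0" unfolding f_def by (smt (verit) zero_le_power2)+
  qed
  have monoP: "P x \<le> P y" if "R \<le> x" "x \<le> y" for x y
  proof (rule DERIV_nonneg_imp_nondecreasing[OF that(2)])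
    show "\<exists>z. (P has_real_derivative z) (at t) \<and> 0 \<le> z" if "x \<le> t" for t
      using P'[of t] f0(2)[of t] \<open>R \<le> x\<close> that by auto
  qed
  have P_le: "P x \<le> 0" if x: "R \<le> x" for x
  proof (rule ccontr)
    assume "\<not> P x \<le> 0"
    then have Px: "P x > 0" by simp
    have "2 * P x * (y - x) \<le> M\<^sup>2" if y: "y \<ge> x" for y
    proof -
      define F where "F = (\<lambda>t. (u t)\<^sup>2 - 2 * P x * t)"
      have "F x \<le> F y"
      proof (rule DERIV_nonneg_imp_nondecreasing[OF y])
        fix t assume t: "x \<le> t" "t \<le> y"
        have "(F has_real_derivative 2 * P t - 2 * P x) (at t)"
          unfolding F_def P_def by (auto intro!: derivative_eq_intros u)
        then show "\<exists>z. (F has_real_derivative z) (at t) \<and> 0 \<le> z" using monoP[OF x t(1)] by auto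
      qed
      moreover have "(u y)\<^sup>2 \<le> M\<^sup>2" using bd[of y] by (metis abs_le_square_iff abs_of_nonneg abs_ge_zero order_trans)
      ultimately show ?thesis unfolding F_def using zero_le_power2[of "u x"] by (simp only: right_diff_distrib)
    qed
    \<comment> \<open>A point far enough to the right for the linear lower bound to exceed \<open>M\<^sup>2\<close>.\<close>
    from this[of "x + (M\<^sup>2 + 1) / (2 * P x)"] Px show False by simp
  qed
  define T where "T = Sup (P ` {R..})"
  have bddP: "bdd_above (P ` {R..})" using P_le by (intro bdd_aboveI[of _ 0]) auto
  have "(P \<longlongrightarrow> T) at_top"
  proof (rule increasing_tendsto)
    show "\<forall>\<^sub>F x in at_top. P x \<le> T"
      using eventually_ge_at_top[of R] by eventually_elim (auto simp: T_def intro!: cSup_upper bddP)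
    fix y assume "y < T"
    then obtain x where x: "x \<ge> R" "y < P x" unfolding T_def using less_cSup_iff[OF _ bddP] by auto
    show "\<forall>\<^sub>F x in at_top. y < P x"
      using eventually_ge_at_top[of x] by eventually_elim (use monoP[OF x(1)] x(2) less_le_trans in blast)
  qed
  moreover have "f \<in> borel_measurable borel"
    unfolding f_def by (intro borel_measurable_continuous_onI continuous_intros cont q(1))
  ultimately have FTC: "(\<integral>\<^sup>+x. ennreal (f x) * indicator {R ..} x \<partial>lborel) = T - P R"
    using P' f0(2) by (intro nn_integral_FTC_atLeast) auto
  have "(\<integral>\<^sup>+x. ennreal ((u x)\<^sup>2) * indicator {R..} x \<partial>lborel)
      \<le> (\<integral>\<^sup>+x. ennreal (1/c) * (ennreal (f x) * indicator {R..} x) \<partial>lborel)"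
  proof (rule nn_integral_mono)
    fix x :: real
    show "ennreal ((u x)\<^sup>2) * indicator {R..} x \<le> ennreal (1/c) * (ennreal (f x) * indicator {R..} x)"
    proof (cases "x \<ge> R")
      case True
      then have "(u x)\<^sup>2 \<le> 1/c * f x" using f0(1)[of x] q(3) by (simp add: field_simps)
      then show ?thesis using True q(3) f0(2)[OF True]
        by (simp add: ennreal_leI flip: ennreal_mult)
    qed simp
  qed
  also have "\<dots> = ennreal (1/c) * (T - P R)"
    unfolding FTC[symmetric]
    by (intro nn_integral_cmult measurable_compose[OF _ measurable_ennreal] borel_measurable_times_ennreal)
       (auto simp: f_def intro!: borel_measurable_continuous_onI continuous_intros cont q(1))
  also have "\<dots> < \<infinity>" by (simp add: ennreal_mult_less_top)
  finally show ?thesis .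
qed

lemma bounded_solution_square_integrable:
  fixes u w q :: "real \<Rightarrow> real"
  assumes u: "\<And>x. (u has_real_derivative w x) (at x)"
    and w: "\<And>x. (w has_real_derivative q x * u x) (at x)"
    and q: "continuous_on UNIV q" "\<And>x. \<bar>x\<bar> \<ge> R \<Longrightarrow> q x \<ge> c" "c > 0"
    and bd: "\<And>x. \<bar>u x\<bar> \<le> M"
  shows "integrable lborel (\<lambda>x. (u x)\<^sup>2)"
proof -
  have contu: "continuous_on UNIV u" using u by (auto intro!: continuous_at_imp_continuous_on DERIV_isCont)
  then have meas[measurable]: "u \<in> borel_measurable borel" by (rule borel_measurable_continuous_onI)
  have M2: "(u y)\<^sup>2 \<le> M\<^sup>2" for y using bd[of y] by (metis abs_le_square_iff abs_of_nonneg abs_ge_zero order_trans)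
  have A: "(\<integral>\<^sup>+x. ennreal ((u x)\<^sup>2) * indicator {\<bar>R\<bar>..} x \<partial>lborel) < \<infinity>"
    by (rule bounded_solution_nn_integral[OF u w q(1) _ q(3) bd]) (auto intro!: q(2))
  have "(\<integral>\<^sup>+x. ennreal ((u (-x))\<^sup>2) * indicator {\<bar>R\<bar>..} x \<partial>lborel) < \<infinity>"
  proof (rule bounded_solution_nn_integral[where w = "\<lambda>x. - w (-x)" and q = "\<lambda>x. q (-x)" and c = c and M = M])
    fix x
    show "((\<lambda>x. u (- x)) has_real_derivative - w (- x)) (at x)"
      using DERIV_chain2[OF u[of "-x"] DERIV_minus[OF DERIV_ident]] by simp
    show "((\<lambda>x. - w (- x)) has_real_derivative q (- x) * u (- x)) (at x)"
      using DERIV_minus[OF DERIV_chain2[OF w[of "-x"] DERIV_minus[OF DERIV_ident]]] by simp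
  qed (use q bd in \<open>auto intro!: continuous_on_compose2[OF q(1)] continuous_intros\<close>)
  also have "(\<integral>\<^sup>+x. ennreal ((u (-x))\<^sup>2) * indicator {\<bar>R\<bar>..} x \<partial>lborel)
    = (\<integral>\<^sup>+x. ennreal ((u x)\<^sup>2) * indicator {..-\<bar>R\<bar>} x \<partial>lborel)"
    using nn_integral_real_affine[of "\<lambda>x. ennreal ((u x)\<^sup>2) * indicator {..-\<bar>R\<bar>} x" "-1" 0]
    by (simp add: indicator_def cong: if_cong)
  finally have B: "(\<integral>\<^sup>+x. ennreal ((u x)\<^sup>2) * indicator {..-\<bar>R\<bar>} x \<partial>lborel) < \<infinity>" .
  have C: "(\<integral>\<^sup>+x. ennreal (M\<^sup>2) * indicator {-\<bar>R\<bar>..\<bar>R\<bar>} x \<partial>lborel) < \<infinity>"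
    by (simp add: nn_integral_cmult ennreal_mult_less_top)
  have "(\<integral>\<^sup>+x. ennreal ((u x)\<^sup>2) \<partial>lborel) \<le> (\<integral>\<^sup>+x. (ennreal ((u x)\<^sup>2) * indicator {\<bar>R\<bar>..} x
     + ennreal ((u x)\<^sup>2) * indicator {..-\<bar>R\<bar>} x) + ennreal (M\<^sup>2) * indicator {-\<bar>R\<bar>..\<bar>R\<bar>} x \<partial>lborel)"
    by (intro nn_integral_mono) (auto simp: indicator_def intro!: ennreal_leI M2)
  also have "\<dots> = (\<integral>\<^sup>+x. ennreal ((u x)\<^sup>2) * indicator {\<bar>R\<bar>..} x \<partial>lborel)
     + (\<integral>\<^sup>+x. ennreal ((u x)\<^sup>2) * indicator {..-\<bar>R\<bar>} x \<partial>lborel)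
     + (\<integral>\<^sup>+x. ennreal (M\<^sup>2) * indicator {-\<bar>R\<bar>..\<bar>R\<bar>} x \<partial>lborel)"
    by (subst nn_integral_add; (subst nn_integral_add)?) auto
  also have "\<dots> < \<infinity>" using A B C by simp
  finally show ?thesis by (intro integrableI_bounded) auto
qed

text \<open>
  A bounded solution is its own continuously differentiable representative; being continuous and nonzero
  at one point, it is not almost everywhere zero.
\<close>

lemma eigenvalueI_bounded_solution:
  fixes u w v :: "real \<Rightarrow> real"
  assumes u: "\<And>x. (u has_real_derivative w x) (at x)"
    and w: "\<And>x. (w has_real_derivative (v x - \<mu>) / h\<^sup>2 * u x) (at x)"
    and v: "continuous_on UNIV v" "\<And>x. \<bar>x\<bar> \<ge> R \<Longrightarrow> v x \<ge> \<mu> + c" "c > 0" and h: "h > 0"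
    and bd: "\<And>x. \<bar>u x\<bar> \<le> M" and nz: "u x0 \<noteq> 0"
  shows "is_eigenvalue (schroedinger_op v h) \<mu>"
proof -
  define U where "U = (\<lambda>x. complex_of_real (u x))"
  define W where "W = (\<lambda>x. complex_of_real (w x))"
  define W2 where "W2 = (\<lambda>x. complex_of_real ((v x - \<mu>) / h\<^sup>2 * u x))"
  have cont: "continuous_on UNIV u" "continuous_on UNIV w"
    using u w by (auto intro!: continuous_at_imp_continuous_on DERIV_isCont)
  have contW2: "continuous_on UNIV W2" unfolding W2_def using h by (intro continuous_intros cont v(1)) auto
  have sq: "integrable lborel (\<lambda>x. (u x)\<^sup>2)"
  proof (rule bounded_solution_square_integrable[OF u w])
    show "continuous_on UNIV (\<lambda>x. (v x - \<mu>) / h\<^sup>2)" using h by (intro continuous_intros v(1)) auto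
    show "c / h\<^sup>2 > 0" using h v(3) by simp
    show "c / h\<^sup>2 \<le> (v x - \<mu>) / h\<^sup>2" if "\<bar>x\<bar> \<ge> R" for x
      using v(2)[OF that] by (intro divide_right_mono) auto
  qed (rule bd)
  have "U \<in> borel_measurable lborel" unfolding U_def
    by (auto intro!: borel_measurable_continuous_onI continuous_intros cont)
  then have L: "(\<lambda>x. of_real c * U x) \<in> L2" for c :: real
    unfolding L2_def mem_Collect_eq U_def
    using integrable_mult_right[OF sq, of "c\<^sup>2"] by (auto simp: norm_mult power_mult_distrib)
  have LU: "U \<in> L2" using L[of 1] by simp
  have U': "(U has_vector_derivative W x) (at x)" for x
    unfolding U_def W_def using u[of x] by (intro has_vector_derivative_of_real) (simp add: has_real_derivative_iff_has_vector_derivative)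
  have W': "(W has_vector_derivative W2 x) (at x)" for x
    unfolding W_def W2_def using w[of x] by (intro has_vector_derivative_of_real) (simp only: has_real_derivative_iff_has_vector_derivative)
  have ac: "set_integrable lborel {a..b} W2 \<and> W b - W a = set_lebesgue_integral lborel {a..b} W2" if "a \<le> b" for a b
  proof
    show i: "set_integrable lborel {a..b} W2"
      unfolding set_integrable_def using contW2 by (intro borel_integrable_compact) (auto intro: continuous_on_subset)
    have "(W2 has_integral (W b - W a)) {a..b}"
      using that by (intro fundamental_theorem_of_calculus) (auto intro: has_vector_derivative_at_within W')
    then show "W b - W a = set_lebesgue_integral lborel {a..b} W2"
      using set_borel_integral_eq_integral(2)[OF i] by (simp add: integral_unique)
  qed
  have "(U, \<lambda>x. of_real \<mu> * U x) \<in> schroedinger_op v h"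
    unfolding schroedinger_op_def mem_Collect_eq prod.case
  proof (intro conjI LU L, rule exI[of _ U], rule exI[of _ W], rule exI[of _ W2], intro conjI)
    show "AE x in lborel. of_real \<mu> * U x = - of_real (h\<^sup>2) * W2 x + of_real (v x) * U x"
      unfolding U_def W2_def using h by (intro AE_I2) (simp add: field_simps)
  qed (use U' ac in auto)
  moreover have "\<not> (AE x in lborel. U x = 0)"
  proof (rule notI)
    assume "AE x in lborel. U x = 0"
    then have "AE x in lebesgue. x \<in> {x. u x = 0}" by (intro AE_completion) (simp add: U_def)
    moreover have "closed {x. u x = 0}" by (intro closed_Collect_eq cont continuous_on_const)
    ultimately have "u x0 = 0" using mem_closed_if_AE_lebesgue by fastforce
    then show False using nz by auto
  qed
  ultimately show ?thesis unfolding is_eigenvalue_def by blast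
qed

section \<open>An eigenvalue near every quasimode\<close>

lemma bounded_of_compact_support:
  fixes f :: "real \<Rightarrow> real"
  assumes "continuous_on UNIV f" "\<And>x. \<bar>x\<bar> \<ge> r \<Longrightarrow> f x = 0"
  shows "\<exists>M\<ge>0. \<forall>x. \<bar>f x\<bar> \<le> M"
proof -
  have "compact (f ` {-r..r})" by (intro compact_continuous_image continuous_on_subset[OF assms(1)]) auto
  then obtain M where M: "\<And>x. x \<in> {-r..r} \<Longrightarrow> \<bar>f x\<bar> \<le> M"
    using compact_imp_bounded bounded_iff by (metis image_eqI real_norm_def)
  have "\<bar>f x\<bar> \<le> \<bar>M\<bar>" for x
    using M[of x] assms(2)[of x] by (smt (verit) atLeastAtMost_iff)
  then show ?thesis by (intro exI[of _ "\<bar>M\<bar>"]) auto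
qed

text \<open>
  The mean value theorem for second differences, by Cauchy's mean value theorem for
  \<open>f (x + t) + f (x - t)\<close> against \<open>t\<^sup>2\<close>. Two derivatives of \<open>f\<close> are enough for this, which matters
  because the cut-off quasimode is only \<open>C\<^sup>2\<close>.
\<close>

lemma second_difference:
  fixes f f1 f2 :: "real \<Rightarrow> real"
  assumes f: "\<And>x. (f has_real_derivative f1 x) (at x)" "\<And>x. (f1 has_real_derivative f2 x) (at x)"
    and d: "d > 0"
  shows "\<exists>y. \<bar>y - x\<bar> \<le> d \<and> f (x + d) - 2 * f x + f (x - d) = d\<^sup>2 * f2 y"
proof -
  define p where "p = (\<lambda>t. f (x + t) + f (x - t))"
  define p1 where "p1 = (\<lambda>t. f1 (x + t) - f1 (x - t))"
  have p: "(p has_real_derivative p1 t) (at t)" for t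
    unfolding p_def p1_def
    by (auto intro!: derivative_eq_intros DERIV_chain2[OF f(1)])
  define c where "c = (p d - p 0) / d\<^sup>2"
  have c: "p d - p 0 = d\<^sup>2 * c" using d by (simp add: c_def)
  define P where "P = (\<lambda>t. p t - p 0 - t\<^sup>2 * c)"
  have "\<exists>z. 0 < z \<and> z < d \<and> (p d - p 0) * (2 * z) = d\<^sup>2 * p1 z"
  proof -
    have "\<exists>z>0. z < d \<and> (P has_real_derivative 0) (at z)"
    proof (rule Rolle)
      show "P 0 = P d" unfolding P_def using c by simp
      show "continuous_on {0..d} P" unfolding P_def
        by (intro continuous_intros) (use p in \<open>auto intro!: continuous_at_imp_continuous_on DERIV_isCont\<close>)
      show "\<And>t. 0 < t \<Longrightarrow> t < d \<Longrightarrow> P differentiable at t"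
        unfolding P_def using p by (intro derivative_intros) (auto simp: real_differentiable_def)
    qed (rule d)
    then obtain z where z: "0 < z" "z < d" "(P has_real_derivative 0) (at z)" by blast
    have "(P has_real_derivative p1 z - 2 * z * c) (at z)"
      unfolding P_def by (auto intro!: derivative_eq_intros p)
    with z(3) have "p1 z = 2 * z * c" using DERIV_unique by force
    then show ?thesis using z c by (intro exI[of _ z]) simp
  qed
  then obtain z where z: "0 < z" "z < d" "(p d - p 0) * (2 * z) = d\<^sup>2 * p1 z" by blast
  have "\<exists>y. x - z < y \<and> y < x + z \<and> f1 (x + z) - f1 (x - z) = (x + z - (x - z)) * f2 y"
    using z by (intro MVT2) (auto intro: f)
  then obtain y where y: "x - z < y" "y < x + z" "f1 (x + z) - f1 (x - z) = (x + z - (x - z)) * f2 y" by blast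
  have "(p d - p 0) * (2 * z) = d\<^sup>2 * f2 y * (2 * z)" using z y by (simp add: p1_def)
  then have "p d - p 0 = d\<^sup>2 * f2 y" using z by simp
  then show ?thesis using y z by (intro exI[of _ y]) (auto simp: p_def)
qed

text \<open>
  Riemann sums whose integrand itself depends on the grid. The sum runs over \<open>[-K, K]\<close> with
  \<open>K = Suc k\<close>, while the terms vanish outside the fixed interval \<open>[-R, R]\<close>.
\<close>

lemma grid_sum_limit:
  fixes b :: "nat \<Rightarrow> int \<Rightarrow> real" and B :: "real \<Rightarrow> real" and R :: nat
  assumes bd: "\<And>k i. \<bar>b k i\<bar> \<le> M"
    and supp: "\<And>k i. \<bar>i\<bar> \<ge> int (R * Suc k) \<Longrightarrow> b k i = 0"
    and conv: "\<And>x::real. (\<lambda>k. b k \<lfloor>x * Suc k\<rfloor>) \<longlonglongrightarrow> B x"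
  shows "(\<lambda>k. (\<Sum>i = - int (Suc k * Suc k)..int (Suc k * Suc k). b k i) / Suc k) \<longlonglongrightarrow> integral {- real R..real R} B"
proof -
  define S where "S = (\<lambda>k t. b k \<lfloor>t * real (Suc k)\<rfloor>)"
  have I: "(S k has_integral ((\<Sum>i<2 * R * Suc k. b k (- int (R * Suc k) + int i)) / Suc k)) {- real R..real R}" for k
  proof -
    have "real_of_int (- int (R * Suc k)) / real (Suc k) = - real R" by (simp add: field_simps)
    moreover have "(real_of_int (- int (R * Suc k)) + real (2 * R * Suc k)) / real (Suc k) = real R"
      by (simp add: field_simps)
    ultimately show ?thesis
      using has_integral_step[of "real (Suc k)" "b k" "- int (R * Suc k)" "2 * R * Suc k"] unfolding S_def by simp
  qed
  have "(\<lambda>k. integral {- real R..real R} (S k)) \<longlonglongrightarrow> integral {- real R..real R} B"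
  proof (rule dominated_convergence(2))
    show "S k integrable_on {- real R..real R}" for k using I by blast
    show "(\<lambda>_. M) integrable_on {- real R..real R}" by (rule integrable_const_ivl)
    show "norm (S k x) \<le> M" for k x using bd by (simp add: S_def)
    show "(\<lambda>k. S k x) \<longlonglongrightarrow> B x" for x unfolding S_def by (rule conv)
  qed
  moreover have "\<forall>\<^sub>F k in sequentially. integral {- real R..real R} (S k)
      = (\<Sum>i = - int (Suc k * Suc k)..int (Suc k * Suc k). b k i) / Suc k"
    using eventually_ge_at_top[of R]
  proof eventually_elim
    case (elim k)
    have RK: "int (R * Suc k) \<le> int (Suc k * Suc k)" using elim by (intro zle_int[THEN iffD2] mult_le_mono) auto
    have "(\<Sum>i = - int (Suc k * Suc k)..int (Suc k * Suc k). b k i) = (\<Sum>i\<in>{- int (R * Suc k)..<int (R * Suc k)}. b k i)"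
      using RK by (intro sum.mono_neutral_right) (auto intro!: supp)
    also have "\<dots> = (\<Sum>i<2 * R * Suc k. b k (- int (R * Suc k) + int i))"
    proof (rule sum.reindex_bij_witness[of _ "\<lambda>i. - int (R * Suc k) + int i" "\<lambda>i. nat (i + int (R * Suc k))"])
      fix i assume "i \<in> {- int (R * Suc k)..<int (R * Suc k)}"
      then have i: "- int (R * Suc k) \<le> i" "i < int (R * Suc k)" by auto
      have "int (2 * R * Suc k) = 2 * int (R * Suc k)" by simp
      then show "nat (i + int (R * Suc k)) \<in> {..<2 * R * Suc k}" using i unfolding lessThan_iff by linarith
      show "- int (R * Suc k) + int (nat (i + int (R * Suc k))) = i" using i by linarith
      then show "b k (- int (R * Suc k) + int (nat (i + int (R * Suc k)))) = b k i" by simp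
    next
      fix i assume "i \<in> {..<2 * R * Suc k}"
      moreover have "int (2 * R * Suc k) = 2 * int (R * Suc k)" by simp
      ultimately have i: "int i < 2 * int (R * Suc k)" by (metis lessThan_iff of_nat_less_iff)
      then show "- int (R * Suc k) + int i \<in> {- int (R * Suc k)..<int (R * Suc k)}" unfolding atLeastLessThan_iff by linarith
      show "nat (- int (R * Suc k) + int i + int (R * Suc k)) = i" by simp
    qed
    finally show ?case using integral_unique[OF I[of k]] by simp
  qed
  ultimately show ?thesis by (rule Lim_transform_eventually)
qed

lemma grid_point_tendsto:
  fixes x :: real
  shows "(\<lambda>k. of_int \<lfloor>x * real (Suc k)\<rfloor> / real (Suc k)) \<longlonglongrightarrow> x"
proof (rule tendsto_sandwich[of "\<lambda>k. x - 1 / real (Suc k)" _ _ "\<lambda>k. x"])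
  have "x - 1 / Suc k \<le> of_int \<lfloor>x * real (Suc k)\<rfloor> / real (Suc k) \<and>
      of_int \<lfloor>x * real (Suc k)\<rfloor> / real (Suc k) \<le> x" for k
  proof -
    define F where "F = real_of_int \<lfloor>x * real (Suc k)\<rfloor>"
    have "F \<le> x * real (Suc k)" "x * real (Suc k) \<le> F + 1" unfolding F_def by linarith+
    then have "F / real (Suc k) \<le> x" "x \<le> (F + 1) / real (Suc k)"
      by (simp_all add: divide_le_eq le_divide_eq)
    then show ?thesis unfolding F_def[symmetric] by (simp add: add_divide_distrib)
  qed
  then show "\<forall>\<^sub>F k in sequentially. x - 1 / real (Suc k) \<le> of_int \<lfloor>x * real (Suc k)\<rfloor> / real (Suc k)"
    "\<forall>\<^sub>F k in sequentially. of_int \<lfloor>x * real (Suc k)\<rfloor> / real (Suc k) \<le> x" by auto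
  have "(\<lambda>k. x - 1 / real (Suc k)) \<longlonglongrightarrow> x - 0"
    using LIMSEQ_inverse_real_of_nat by (intro tendsto_diff tendsto_const) (simp add: inverse_eq_divide)
  then show "(\<lambda>k. x - 1 / real (Suc k)) \<longlonglongrightarrow> x" by simp
qed simp

text \<open>
  The quotient \<open>\<delta>k\<close> of the discretized quasimode converges to that of \<open>f\<close>. For fine grids it stays
  below \<open>\<delta> + c\<close>, so the grid eigenvalues are smaller than \<open>v\<close> outside \<open>[-R, R]\<close> and the maxima of the
  eigenvectors lie in \<open>[-R, R]\<close>. A common convergent subsequence then yields a nonzero bounded solution.
\<close>

theorem eigenvalue_near_quasimode:
  fixes v f f1 f2 :: "real \<Rightarrow> real" and E \<delta> c R h :: real and N :: nat
  assumes v: "continuous_on UNIV v" and h: "h > 0" and \<delta>: "\<delta> \<ge> 0"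
    and far: "\<And>x. \<bar>x\<bar> \<ge> R \<Longrightarrow> v x \<ge> E + \<delta> + c" "c > 0"
    and f: "\<And>x. (f has_real_derivative f1 x) (at x)" "\<And>x. (f1 has_real_derivative f2 x) (at x)"
      "continuous_on UNIV f2"
    and supp: "\<And>x. \<bar>x\<bar> \<ge> real N - 1 \<Longrightarrow> f x = 0 \<and> f2 x = 0"
    and nz: "integral {-real N..real N} (\<lambda>x. (f x)\<^sup>2) > 0"
    and quasi: "integral {-real N..real N} (\<lambda>x. (- h\<^sup>2 * f2 x + (v x - E) * f x)\<^sup>2)
      \<le> \<delta>\<^sup>2 * integral {-real N..real N} (\<lambda>x. (f x)\<^sup>2)"
  shows "\<exists>\<mu>. is_eigenvalue (schroedinger_op v h) \<mu> \<and> \<bar>\<mu> - E\<bar> \<le> \<delta>"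
proof -
  have contf: "continuous_on UNIV f" using f(1) by (auto intro!: continuous_at_imp_continuous_on DERIV_isCont)
  define L where "L = (\<lambda>k i. (real (Suc k))\<^sup>2 *
    (f (of_int (i+1) / real (Suc k)) - 2 * f (of_int i / real (Suc k)) + f (of_int (i-1) / real (Suc k))))"
  define b1 where "b1 = (\<lambda>k i. (f (of_int i / real (Suc k)))\<^sup>2)"
  define b2 where "b2 = (\<lambda>k i. (- h\<^sup>2 * L k i + (v (of_int i / real (Suc k)) - E) * f (of_int i / real (Suc k)))\<^sup>2)"
  have L: "\<exists>y. \<bar>y - of_int i / real (Suc k)\<bar> \<le> 1 / real (Suc k) \<and> L k i = f2 y" for k i
  proof -
    obtain y where y: "\<bar>y - of_int i / real (Suc k)\<bar> \<le> 1 / real (Suc k)"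
      "f (of_int i / real (Suc k) + 1 / real (Suc k)) - 2 * f (of_int i / real (Suc k)) + f (of_int i / real (Suc k) - 1 / real (Suc k)) = (1 / real (Suc k))\<^sup>2 * f2 y"
      using second_difference[OF f(1,2), of "1 / real (Suc k)" "of_int i / real (Suc k)"] by auto
    have e: "real_of_int (i+1) / real (Suc k) = of_int i / real (Suc k) + 1 / real (Suc k)"
       "real_of_int (i-1) / real (Suc k) = of_int i / real (Suc k) - 1 / real (Suc k)"
      by (simp_all add: add_divide_distrib diff_divide_distrib)
    have "L k i = f2 y" unfolding L_def e y(2) by (simp add: power_divide)
    with y(1) show ?thesis by blast
  qed
  obtain F2 where F2: "\<And>x. \<bar>f2 x\<bar> \<le> F2" using bounded_of_compact_support[OF f(3), of "real N - 1"] supp by auto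
  obtain F where F: "\<And>x. \<bar>f x\<bar> \<le> F" "F \<ge> 0" using bounded_of_compact_support[OF contf, of "real N - 1"] supp by auto
  have "\<exists>M\<ge>0. \<forall>x. \<bar>(v x - E) * f x\<bar> \<le> M"
    by (rule bounded_of_compact_support[of _ "real N - 1"]) (auto intro!: continuous_intros v contf simp: supp)
  then obtain G where G: "\<And>x. \<bar>(v x - E) * f x\<bar> \<le> G" by blast
  have far_grid: "\<bar>of_int j / real (Suc k)\<bar> \<ge> real N - 1"
    if "\<bar>i\<bar> \<ge> int (N * Suc k)" "\<bar>j - i\<bar> \<le> 1" for i j k
  proof -
    have "\<bar>j\<bar> \<ge> int (N * Suc k) - 1" using that by linarith
    then have "real_of_int \<bar>j\<bar> \<ge> real_of_int (int (N * Suc k) - 1)" by (simp only: of_int_le_iff)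
    then have "\<bar>real_of_int j\<bar> \<ge> real N * real (Suc k) - 1" by (simp add: algebra_simps)
    moreover have "real N * real (Suc k) - 1 \<ge> (real N - 1) * real (Suc k)" by (simp add: algebra_simps)
    ultimately show ?thesis by (simp add: abs_divide le_divide_eq)
  qed
  have lim1: "(\<lambda>k. (\<Sum>i = - int (Suc k * Suc k)..int (Suc k * Suc k). b1 k i) / Suc k) \<longlonglongrightarrow> integral {-real N..real N} (\<lambda>x. (f x)\<^sup>2)"
  proof (rule grid_sum_limit[where M = "F\<^sup>2"])
    show "\<bar>b1 k i\<bar> \<le> F\<^sup>2" for k i unfolding b1_def using F by (simp add: abs_le_square_iff[symmetric])
    show "b1 k i = 0" if "int (N * Suc k) \<le> \<bar>i\<bar>" for k i
      using far_grid[OF that, of i] supp unfolding b1_def by simp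
    fix x :: real
    have "isCont f x" using f(1) by (rule DERIV_isCont)
    then show "(\<lambda>k. b1 k \<lfloor>x * real (Suc k)\<rfloor>) \<longlonglongrightarrow> (f x)\<^sup>2" unfolding b1_def
      by (intro tendsto_power isCont_tendsto_compose[of x f] grid_point_tendsto)
  qed
  have lim2: "(\<lambda>k. (\<Sum>i = - int (Suc k * Suc k)..int (Suc k * Suc k). b2 k i) / Suc k)
      \<longlonglongrightarrow> integral {-real N..real N} (\<lambda>x. (- h\<^sup>2 * f2 x + (v x - E) * f x)\<^sup>2)"
  proof (rule grid_sum_limit[where M = "(h\<^sup>2 * F2 + G)\<^sup>2"])
    show "\<bar>b2 k i\<bar> \<le> (h\<^sup>2 * F2 + G)\<^sup>2" for k i
    proof -
      obtain y where "L k i = f2 y" using L by blast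
      then have "\<bar>- h\<^sup>2 * L k i\<bar> \<le> h\<^sup>2 * F2" using F2[of y] by (simp add: abs_mult mult_left_mono)
      then have "\<bar>- h\<^sup>2 * L k i + (v (of_int i / real (Suc k)) - E) * f (of_int i / real (Suc k))\<bar> \<le> h\<^sup>2 * F2 + G"
        using G[of "of_int i / real (Suc k)"] by linarith
      then show ?thesis unfolding b2_def by (simp add: abs_le_square_iff[symmetric])
    qed
    show "b2 k i = 0" if "int (N * Suc k) \<le> \<bar>i\<bar>" for k i
    proof -
      have "f (of_int j / real (Suc k)) = 0" if "\<bar>j - i\<bar> \<le> 1" for j
        using far_grid[OF \<open>int (N * Suc k) \<le> \<bar>i\<bar>\<close> that] supp by blast
      then have "L k i = 0" "f (of_int i / real (Suc k)) = 0" unfolding L_def by (simp_all del: of_int_add of_int_diff)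
      then show ?thesis unfolding b2_def by simp
    qed
    fix x :: real
    have "\<forall>k. \<exists>y. \<bar>y - of_int \<lfloor>x * real (Suc k)\<rfloor> / real (Suc k)\<bar> \<le> 1 / real (Suc k)
       \<and> L k \<lfloor>x * real (Suc k)\<rfloor> = f2 y"
      by (intro allI L)
    from choice[OF this] obtain Y where Y: "\<And>k. \<bar>Y k - of_int \<lfloor>x * real (Suc k)\<rfloor> / real (Suc k)\<bar> \<le> 1 / real (Suc k)"
      "\<And>k. L k \<lfloor>x * real (Suc k)\<rfloor> = f2 (Y k)" by blast
    have "(\<lambda>k. Y k - of_int \<lfloor>x * real (Suc k)\<rfloor> / real (Suc k)) \<longlonglongrightarrow> 0"
    proof (rule Lim_null_comparison)
      show "\<forall>\<^sub>F k in sequentially. norm (Y k - of_int \<lfloor>x * real (Suc k)\<rfloor> / real (Suc k)) \<le> 1 / real (Suc k)"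
        using Y(1) by simp
      show "(\<lambda>k. 1 / real (Suc k)) \<longlonglongrightarrow> 0" using LIMSEQ_inverse_real_of_nat by (simp add: inverse_eq_divide)
    qed
    from tendsto_add[OF this grid_point_tendsto[of x]] have Yx: "Y \<longlonglongrightarrow> x" by simp
    have "isCont f2 x" using f(3) by (simp add: continuous_on_eq_continuous_at)
    then have "(\<lambda>k. L k \<lfloor>x * real (Suc k)\<rfloor>) \<longlonglongrightarrow> f2 x" unfolding Y(2) using Yx by (rule isCont_tendsto_compose)
    moreover have "isCont f x" "isCont v x" using f(1) v by (auto intro: DERIV_isCont simp: continuous_on_eq_continuous_at)
    ultimately show "(\<lambda>k. b2 k \<lfloor>x * real (Suc k)\<rfloor>) \<longlonglongrightarrow> (- h\<^sup>2 * f2 x + (v x - E) * f x)\<^sup>2" unfolding b2_def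
      by (intro tendsto_power tendsto_add tendsto_mult tendsto_diff tendsto_const
          isCont_tendsto_compose[of x f] isCont_tendsto_compose[of x v] grid_point_tendsto)
  qed
  define I1 where "I1 = integral {-real N..real N} (\<lambda>x. (f x)\<^sup>2)"
  define I2 where "I2 = integral {-real N..real N} (\<lambda>x. (- h\<^sup>2 * f2 x + (v x - E) * f x)\<^sup>2)"
  define T1 where "T1 = (\<lambda>k. \<Sum>i = - int (Suc k * Suc k)..int (Suc k * Suc k). b1 k i)"
  define T2 where "T2 = (\<lambda>k. \<Sum>i = - int (Suc k * Suc k)..int (Suc k * Suc k). b2 k i)"
  define \<delta>k where "\<delta>k = (\<lambda>k. sqrt (T2 k / T1 k))"
  have I1: "I1 > 0" using nz unfolding I1_def .
  have "(\<lambda>k. sqrt ((T2 k / Suc k) / (T1 k / Suc k))) \<longlonglongrightarrow> sqrt (I2 / I1)"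
    using I1 unfolding T1_def T2_def I1_def I2_def by (intro tendsto_real_sqrt tendsto_divide lim1 lim2) auto
  then have \<delta>k_lim: "\<delta>k \<longlonglongrightarrow> sqrt (I2 / I1)" unfolding \<delta>k_def by simp
  have I2_le: "sqrt (I2 / I1) \<le> \<delta>"
    using quasi I1 \<delta> unfolding I1_def[symmetric] I2_def[symmetric] by (intro real_le_lsqrt) (auto simp: field_simps)
  have T2_0: "T2 k \<ge> 0" for k unfolding T2_def b2_def by (intro sum_nonneg) auto
  have "\<forall>\<^sub>F k in sequentially. T1 k / Suc k > 0" using order_tendstoD(1)[OF lim1 nz] unfolding T1_def .
  moreover have "\<forall>\<^sub>F k in sequentially. \<delta>k k < \<delta> + c"
    using I2_le far(2) by (intro order_tendstoD(2)[OF \<delta>k_lim]) auto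
  ultimately have "\<forall>\<^sub>F k in sequentially. T1 k > 0 \<and> \<delta>k k < \<delta> + c \<and> k \<ge> N"
    using eventually_ge_at_top[of N] by eventually_elim (auto simp: zero_less_divide_iff)
  then obtain k0 where k0: "\<And>k. k \<ge> k0 \<Longrightarrow> T1 k > 0 \<and> \<delta>k k < \<delta> + c \<and> k \<ge> N"
    unfolding eventually_sequentially by blast
  have step: "\<exists>\<mu> g p. \<bar>\<mu> - E\<bar> \<le> \<delta>k k \<and> (\<forall>i. \<bar>g i\<bar> \<le> 1) \<and>
      (\<forall>i. \<bar>i\<bar> \<le> int (Suc k * Suc k) \<longrightarrow>
        h\<^sup>2 * (real (Suc k))\<^sup>2 * (g (i+1) - 2 * g i + g (i-1)) = (v (of_int i / real (Suc k)) - \<mu>) * g i) \<and>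
      \<bar>g p\<bar> = 1 \<and> \<bar>of_int p / real (Suc k)\<bar> \<le> \<bar>R\<bar>" if k: "k \<ge> k0" for k
  proof -
    have "\<exists>\<mu> g. \<bar>\<mu> - E\<bar> \<le> \<delta>k k \<and> (\<forall>i. \<bar>g i\<bar> \<le> 1)
      \<and> (\<forall>i\<in>{-int (Suc k * Suc k)..int (Suc k * Suc k)}. (h\<^sup>2 * (real (Suc k))\<^sup>2) * (g (i+1) - 2 * g i + g (i-1)) = (v (of_int i / real (Suc k)) - \<mu>) * g i)
      \<and> (\<exists>i\<in>{-int (Suc k * Suc k)..int (Suc k * Suc k)}. \<bar>g i\<bar> = 1 \<and> v (of_int i / real (Suc k)) \<le> \<mu>)"
    proof (rule grid_eigenvector[where f = "\<lambda>i. f (of_int i / real (Suc k))"])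
      show "f (of_int i / real (Suc k)) = 0" if "int (Suc k * Suc k) < \<bar>i\<bar>" for i
      proof -
        have "int (N * Suc k) \<le> int (Suc k * Suc k)"
          unfolding of_nat_le_iff using k0[OF k] by (intro mult_le_mono) auto
        then have "int (N * Suc k) \<le> \<bar>i\<bar>" using that by linarith
        from far_grid[OF this, of i] show ?thesis using supp by simp
      qed
      show "(\<Sum>i = - int (Suc k * Suc k)..int (Suc k * Suc k).
        (- (h\<^sup>2 * (real (Suc k))\<^sup>2) * (f (of_int (i + 1) / real (Suc k)) - 2 * f (of_int i / real (Suc k)) + f (of_int (i - 1) / real (Suc k))) +
         (v (of_int i / real (Suc k)) - E) * f (of_int i / real (Suc k)))\<^sup>2)
        \<le> (\<delta>k k)\<^sup>2 * (\<Sum>i = - int (Suc k * Suc k)..int (Suc k * Suc k). (f (of_int i / real (Suc k)))\<^sup>2)"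
      proof -
        have "T2 k = (\<delta>k k)\<^sup>2 * T1 k" unfolding \<delta>k_def using k0[OF k] T2_0[of k] by simp
        then show ?thesis unfolding T1_def T2_def b1_def b2_def L_def by (simp add: mult.assoc)
      qed
      show "(\<Sum>i = - int (Suc k * Suc k)..int (Suc k * Suc k). (f (of_int i / real (Suc k)))\<^sup>2) > 0"
        using k0[OF k] unfolding T1_def b1_def by simp
      show "\<delta>k k \<ge> 0" unfolding \<delta>k_def using k0[OF k] T2_0[of k] by simp
      show "h\<^sup>2 * (real (Suc k))\<^sup>2 > 0" using h by simp
    qed
    then obtain \<mu> g p where a: "\<bar>\<mu> - E\<bar> \<le> \<delta>k k" "\<forall>i. \<bar>g i\<bar> \<le> 1"
      "\<forall>i\<in>{-int (Suc k * Suc k)..int (Suc k * Suc k)}. (h\<^sup>2 * (real (Suc k))\<^sup>2) * (g (i+1) - 2 * g i + g (i-1)) = (v (of_int i / real (Suc k)) - \<mu>) * g i"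
      "\<bar>g p\<bar> = 1" "v (of_int p / real (Suc k)) \<le> \<mu>" by blast
    have "\<bar>of_int p / real (Suc k)\<bar> \<le> \<bar>R\<bar>"
    proof (rule ccontr)
      assume "\<not> ?thesis"
      then have "v (of_int p / real (Suc k)) \<ge> E + \<delta> + c" by (intro far) auto
      then show False using a(1,5) k0[OF k] by linarith
    qed
    then show ?thesis using a(1-4) by (intro exI[of _ \<mu>] exI[of _ g] exI[of _ p]) (auto simp: abs_le_iff)
  qed
  obtain \<mu> g p where
      mu: "\<And>k. k \<ge> k0 \<Longrightarrow> \<bar>\<mu> k - E\<bar> \<le> \<delta>k k"
    and g: "\<And>k i. k \<ge> k0 \<Longrightarrow> \<bar>g k i\<bar> \<le> 1"
    and geq: "\<And>k i. k \<ge> k0 \<Longrightarrow> \<bar>i\<bar> \<le> int (Suc k * Suc k) \<Longrightarrow>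
        h\<^sup>2 * (real (Suc k))\<^sup>2 * (g k (i+1) - 2 * g k i + g k (i-1)) = (v (of_int i / real (Suc k)) - \<mu> k) * g k i"
    and p: "\<And>k. k \<ge> k0 \<Longrightarrow> \<bar>g k (p k)\<bar> = 1" "\<And>k. k \<ge> k0 \<Longrightarrow> \<bar>of_int (p k) / real (Suc k)\<bar> \<le> \<bar>R\<bar>"
  proof -
    define W where "W = (\<lambda>k \<mu> g p. \<bar>\<mu> - E\<bar> \<le> \<delta>k k \<and> (\<forall>i. \<bar>g i\<bar> \<le> 1) \<and>
      (\<forall>i. \<bar>i\<bar> \<le> int (Suc k * Suc k) \<longrightarrow>
        h\<^sup>2 * (real (Suc k))\<^sup>2 * (g (i+1) - 2 * g i + g (i-1)) = (v (of_int i / real (Suc k)) - \<mu>) * g i) \<and>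
      \<bar>g (p :: int)\<bar> = 1 \<and> \<bar>of_int p / real (Suc k)\<bar> \<le> \<bar>R\<bar>)"
    have "\<forall>k. \<exists>\<mu> g p. k \<ge> k0 \<longrightarrow> W k \<mu> g p" using step unfolding W_def by meson
    then obtain \<mu> g p where "\<And>k. k \<ge> k0 \<Longrightarrow> W k (\<mu> k) (g k) (p k)" by metis
    then show thesis unfolding W_def by (intro that[of \<mu> g p]) blast+
  qed
  \<comment> \<open>One countable family for a single diagonal argument: the values at rational points, the eigenvalues,
    and the positions of the maxima.\<close>
  define J where "J = (\<lambda>k (t :: rat + bool). case t of Inl s \<Rightarrow> g (k + k0) \<lfloor>of_rat s * real (Suc (k + k0))\<rfloor>
     | Inr True \<Rightarrow> \<mu> (k + k0) | Inr False \<Rightarrow> of_int (p (k + k0)) / real (Suc (k + k0)))"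
  have "norm (J k t) \<le> 1 + \<bar>E\<bar> + \<delta> + c + \<bar>R\<bar>" for k t
  proof (cases t)
    case (Inl s)
    then show ?thesis using g[of "k + k0" "\<lfloor>of_rat s * real (Suc (k + k0))\<rfloor>"] \<delta> far(2)
      unfolding J_def by (simp only: sum.case real_norm_def) linarith
  next
    case (Inr b)
    have "\<bar>\<mu> (k + k0)\<bar> \<le> 1 + \<bar>E\<bar> + \<delta> + c + \<bar>R\<bar>" using mu[of "k + k0"] k0[of "k + k0"] by linarith
    moreover have "\<bar>of_int (p (k + k0)) / real (Suc (k + k0))\<bar> \<le> 1 + \<bar>E\<bar> + \<delta> + c + \<bar>R\<bar>"
      using p(2)[of "k + k0"] \<delta> far(2) by linarith
    ultimately show ?thesis unfolding J_def Inr by (cases b) (simp_all only: sum.case bool.case real_norm_def)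
  qed
  then obtain r where r: "strict_mono (r::nat\<Rightarrow>nat)" "\<And>t. \<exists>l. (\<lambda>k. J (r k) t) \<longlonglongrightarrow> l"
    using function_convergent_subsequence[of UNIV J] by (metis UNIV_I countableI_type)
  define \<sigma> where "\<sigma> = (\<lambda>k. r k + k0)"
  have \<sigma>: "\<sigma> k \<ge> k0" for k unfolding \<sigma>_def by simp
  have \<sigma>_lim: "filterlim \<sigma> at_top sequentially"
    unfolding \<sigma>_def using filterlim_subseq[OF r(1)] by (rule filterlim_at_top_mono) auto
  obtain \<mu>0 where \<mu>0: "(\<lambda>k. \<mu> (\<sigma> k)) \<longlonglongrightarrow> \<mu>0" using r(2)[of "Inr True"] unfolding J_def \<sigma>_def by auto
  obtain x0 where x0: "(\<lambda>k. of_int (p (\<sigma> k)) / real (Suc (\<sigma> k))) \<longlonglongrightarrow> x0" using r(2)[of "Inr False"] unfolding J_def \<sigma>_def by auto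
  interpret G: grid_solutions v h \<mu>0 "\<lambda>k. Suc (\<sigma> k)" "\<lambda>k. g (\<sigma> k)" "\<lambda>k. \<mu> (\<sigma> k)"
  proof
    show "filterlim (\<lambda>k. Suc (\<sigma> k)) at_top sequentially"
      using filterlim_compose[OF filterlim_Suc \<sigma>_lim] .
    fix x :: real assume "x \<in> \<rat>"
    then obtain s where "x = of_rat s" by (auto elim: Rats_cases)
    then show "convergent (\<lambda>k. g (\<sigma> k) \<lfloor>x * real (Suc (\<sigma> k))\<rfloor>)"
      using r(2)[of "Inl s"] unfolding J_def \<sigma>_def convergent_def by simp
  qed (use v h \<sigma> g geq \<mu>0 in auto)
  have "\<bar>\<mu>0 - E\<bar> \<le> sqrt (I2 / I1)"
  proof (rule LIMSEQ_le)
    show "(\<lambda>k. \<bar>\<mu> (\<sigma> k) - E\<bar>) \<longlonglongrightarrow> \<bar>\<mu>0 - E\<bar>" by (intro tendsto_intros \<mu>0)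
    show "(\<lambda>k. \<delta>k (\<sigma> k)) \<longlonglongrightarrow> sqrt (I2 / I1)" using filterlim_compose[OF \<delta>k_lim \<sigma>_lim] .
  qed (use mu[OF \<sigma>] in auto)
  then have le: "\<bar>\<mu>0 - E\<bar> \<le> \<delta>" using I2_le by linarith
  have "G.u x0 \<noteq> 0" by (rule G.u_nonzero[OF p(1)[OF \<sigma>] x0])
  then have "is_eigenvalue (schroedinger_op v h) \<mu>0"
  proof (rule eigenvalueI_bounded_solution[OF G.limit_solves v _ far(2) h G.u_le, rotated])
    show "v x \<ge> \<mu>0 + c" if "\<bar>x\<bar> \<ge> R" for x using far(1)[OF that] le by linarith
  qed
  with le show ?thesis by blast
qed

section \<open>The localized Hermite functions\<close>

text \<open>
  The physicists' Hermite polynomials.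
\<close>

fun hermite :: "nat \<Rightarrow> real poly" where
  "hermite 0 = 1"
| "hermite (Suc n) = [:0, 2:] * hermite n - pderiv (hermite n)"

lemma pderiv_hermite: "pderiv (hermite (Suc n)) = smult (2 * (real n + 1)) (hermite n)"
proof (induction n)
  case (Suc n)
  have "pderiv (hermite (Suc (Suc n))) =
      smult 2 (hermite (Suc n)) + [:0, 2:] * pderiv (hermite (Suc n)) - pderiv (pderiv (hermite (Suc n)))"
    by (simp only: hermite.simps(2)[of "Suc n"] pderiv_diff pderiv_mult) (simp add: pderiv_pCons)
  also have "\<dots> = smult 2 (hermite (Suc n)) + smult (2 * (real n + 1)) ([:0, 2:] * hermite n - pderiv (hermite n))"
    unfolding Suc.IH pderiv_smult by (simp only: mult_smult_right smult_diff_right add_diff_eq)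
  also have "\<dots> = smult 2 (hermite (Suc n)) + smult (2 * (real n + 1)) (hermite (Suc n))"
    by (simp only: hermite.simps)
  also have "\<dots> = smult (2 * (real (Suc n) + 1)) (hermite (Suc n))"
    by (simp only: smult_add_left[symmetric]) (simp add: algebra_simps)
  finally show ?case .
qed (simp add: pderiv_pCons)

lemma hermite_nonzero: "hermite n \<noteq> 0"
proof (induction n)
  case (Suc n)
  then have "pderiv (hermite (Suc n)) \<noteq> 0" unfolding pderiv_hermite by auto
  then show ?case by (metis pderiv_0)
qed simp

lemma hermite_ode:
  "poly (pderiv (pderiv (hermite n))) x - 2 * x * poly (pderiv (hermite n)) x + 2 * real n * poly (hermite n) x = 0"
proof (cases n)
  case (Suc k)
  have "poly (hermite (Suc k)) x = 2 * x * poly (hermite k) x - poly (pderiv (hermite k)) x" by simp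
  then show ?thesis unfolding Suc pderiv_hermite pderiv_smult by (simp only: poly_smult) (simp add: algebra_simps)
qed (simp add: pderiv_1)

lemma poly_times_gaussian_tendsto_0:
  fixes p :: "real poly"
  assumes "a > 0"
  shows "((\<lambda>x. poly p x * exp (- (a * x\<^sup>2))) \<longlongrightarrow> 0) at_top"
proof -
  have "((\<lambda>x. coeff p i * (x ^ i * exp (- (a * x\<^sup>2)))) \<longlongrightarrow> 0) at_top" for i
  proof (rule tendsto_mult_right_zero)
    show "((\<lambda>x::real. x ^ i * exp (- (a * x\<^sup>2))) \<longlongrightarrow> 0) at_top"
    proof (rule tendsto_sandwich[of "\<lambda>_. 0" _ _ "\<lambda>x. x ^ i / exp x"])
      show "\<forall>\<^sub>F x::real in at_top. 0 \<le> x ^ i * exp (- (a * x\<^sup>2))"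
        using eventually_ge_at_top[of 0] by eventually_elim simp
      show "\<forall>\<^sub>F x::real in at_top. x ^ i * exp (- (a * x\<^sup>2)) \<le> x ^ i / exp x"
        using eventually_ge_at_top[of 0] eventually_ge_at_top[of "1/a"]
      proof eventually_elim
        case (elim x)
        have "1 \<le> a * x" using elim(2) assms by (simp add: field_simps)
        then have "x \<le> a * x\<^sup>2" using elim(1) mult_right_mono[of 1 "a * x" x] by (simp add: power2_eq_square)
        then have "exp (- (a * x\<^sup>2)) \<le> exp (- x)" by simp
        then show ?case using elim(1) by (simp add: exp_minus divide_inverse mult_left_mono)
      qed
      show "((\<lambda>x::real. x ^ i / exp x) \<longlongrightarrow> 0) at_top" by (rule tendsto_power_div_exp_0)
    qed simp
  qed
  then have "((\<lambda>x. \<Sum>i\<le>degree p. coeff p i * (x ^ i * exp (- (a * x\<^sup>2)))) \<longlongrightarrow> (\<Sum>i\<le>degree p. 0)) at_top"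
    by (intro tendsto_sum) auto
  then show ?thesis by (simp add: poly_altdef sum_distrib_right mult.assoc)
qed

text \<open>
  The solution is \<open>H(r s) exp (- \<nu> s\<^sup>2 / 2)\<close> with \<open>\<nu> = 2n + 1\<close>, \<open>r = sqrt \<nu>\<close> and \<open>H\<close> the Hermite
  polynomial of degree \<open>n\<close>. In this scaling the turning points are at \<open>-1\<close> and \<open>1\<close> for every \<open>n\<close>, and \<open>\<nu>\<close> becomes
  the large parameter.
\<close>

lemma hermite_function:
  fixes n :: nat
  obtains \<psi> \<psi>1 :: "real \<Rightarrow> real"
  where "\<And>s. (\<psi> has_real_derivative \<psi>1 s) (at s)"
    and "\<And>s. (\<psi>1 has_real_derivative (2 * real n + 1)\<^sup>2 * (s\<^sup>2 - 1) * \<psi> s) (at s)"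
    and "(\<psi> \<longlongrightarrow> 0) at_top" "((\<lambda>s. \<psi> (- s)) \<longlongrightarrow> 0) at_top"
    and "\<exists>s. \<bar>s\<bar> < 1 \<and> \<psi> s \<noteq> 0"
proof -
  define \<nu> where "\<nu> = 2 * real n + 1"
  define r where "r = sqrt \<nu>"
  have \<nu>: "\<nu> > 0" unfolding \<nu>_def by simp
  then have r: "r > 0" "r * r = \<nu>" unfolding r_def by auto
  define H where "H = hermite n"
  define G where "G = (\<lambda>s. exp (- (\<nu> / 2 * s\<^sup>2)))"
  have G': "(G has_real_derivative - \<nu> * s * G s) (at s)" for s
    unfolding G_def by (auto intro!: derivative_eq_intros)
  have P': "((\<lambda>s. poly p (r * s)) has_real_derivative r * poly (pderiv p) (r * s)) (at s)" for p s
    by (rule DERIV_cong[OF DERIV_chain2[OF poly_DERIV DERIV_cmult_Id]]) simp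
  define \<psi> where "\<psi> = (\<lambda>s. poly H (r * s) * G s)"
  define \<psi>1 where "\<psi>1 = (\<lambda>s. (r * poly (pderiv H) (r * s) - \<nu> * s * poly H (r * s)) * G s)"
  have d1: "(\<psi> has_real_derivative \<psi>1 s) (at s)" for s
    unfolding \<psi>_def \<psi>1_def by (rule DERIV_cong[OF DERIV_mult[OF P' G']]) (simp add: algebra_simps)
  have d2: "(\<psi>1 has_real_derivative \<nu>\<^sup>2 * (s\<^sup>2 - 1) * \<psi> s) (at s)" for s
  proof -
    define A B C where "A = poly H (r * s)" and "B = poly (pderiv H) (r * s)" and "C = poly (pderiv (pderiv H)) (r * s)"
    have "((\<lambda>s. r * poly (pderiv H) (r * s) - \<nu> * s * poly H (r * s)) has_real_derivative
        r * (r * C) - (\<nu> * A + \<nu> * s * (r * B))) (at s)"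
      unfolding A_def B_def C_def by (auto intro!: derivative_eq_intros P' simp: algebra_simps)
    from DERIV_mult[OF this G'[of s]]
    have "(\<psi>1 has_real_derivative (r * B - \<nu> * s * A) * (- \<nu> * s * G s) + (r * (r * C) - (\<nu> * A + \<nu> * s * (r * B))) * G s) (at s)"
      unfolding \<psi>1_def A_def B_def by (simp add: algebra_simps)
    moreover have "C = 2 * (r * s) * B - 2 * real n * A"
      using hermite_ode[of n "r * s"] unfolding A_def B_def C_def H_def by simp
    then have e: "r * (r * C) = \<nu> * (2 * (r * s) * B - (\<nu> - 1) * A)"
      using r(2) unfolding \<nu>_def by (simp add: mult.assoc[symmetric])
    have "(r * B - \<nu> * s * A) * (- \<nu> * s * G s) + (r * (r * C) - (\<nu> * A + \<nu> * s * (r * B))) * G s = \<nu>\<^sup>2 * (s\<^sup>2 - 1) * \<psi> s"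
      unfolding e \<psi>_def A_def[symmetric] by (simp add: algebra_simps power2_eq_square)
    ultimately show ?thesis by simp
  qed
  have lim: "((\<lambda>s. poly p (r * s) * G s) \<longlongrightarrow> 0) at_top" for p
  proof -
    have "filterlim (\<lambda>s. r * s) at_top at_top"
      using r by (intro filterlim_tendsto_pos_mult_at_top[OF tendsto_const]) (auto simp: filterlim_ident)
    from filterlim_compose[OF poly_times_gaussian_tendsto_0[of "1/2" p] this]
    have "((\<lambda>s. poly p (r * s) * exp (- (1/2 * (r * s)\<^sup>2))) \<longlongrightarrow> 0) at_top" by simp
    moreover have "(r * s)\<^sup>2 = \<nu> * s\<^sup>2" for s using r(2) by (simp add: power2_eq_square algebra_simps)
    ultimately show ?thesis unfolding G_def by simp
  qed
  have "(\<lambda>s. \<psi> (- s)) = (\<lambda>s. poly (pcompose H [:0, -1:]) (r * s) * G s)"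
    unfolding \<psi>_def G_def by (simp add: poly_pcompose)
  then have lim': "((\<lambda>s. \<psi> (- s)) \<longlongrightarrow> 0) at_top" using lim by simp
  have nz: "\<exists>s. \<bar>s\<bar> < 1 \<and> \<psi> s \<noteq> 0"
  proof (rule ccontr)
    assume "\<not> ?thesis"
    then have "(\<lambda>s. r * s) ` {-1<..<1} \<subseteq> {x. poly H x = 0}" unfolding \<psi>_def G_def by (auto simp: abs_less_iff)
    moreover have "finite {x. poly H x = 0}" using hermite_nonzero by (intro poly_roots_finite) (simp add: H_def)
    ultimately have "finite ((\<lambda>s. r * s) ` {-1<..<1})" by (rule finite_subset)
    moreover have "inj_on (\<lambda>s. r * s) {-1<..<1}" using r(1) by (simp add: inj_on_def)
    ultimately have "finite {-1<..<1::real}" by (rule finite_imageD)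
    then show False using infinite_Ioo[of "-1::real" 1] by simp
  qed
  show thesis using that[of \<psi> \<psi>1] d1 d2 lim[of H] lim' nz unfolding \<nu>_def \<psi>_def[symmetric] by blast
qed

text \<open>
  As for bounded solutions, \<open>P = \<psi> \<psi>'\<close> increases and is at most 0 where \<open>Q \<ge> 0\<close>, so
  \<open>\<psi>\<^sup>2\<close> decreases there. The mass in a window is therefore controlled by the mass in the window before it,
  and the integral of \<open>\<psi>'\<^sup>2\<close> by \<open>- P\<close> at the left end, which is in turn bounded by the decrease of \<open>\<psi>\<^sup>2\<close>. The
  constant does not depend on \<open>Q\<close>; this gives the uniformity in the degree of the Hermite function.
\<close>

lemma decaying_solution_tail:
  fixes \<psi> \<psi>1 Q :: "real \<Rightarrow> real" and a m :: real
  assumes d: "\<And>s. (\<psi> has_real_derivative \<psi>1 s) (at s)" "\<And>s. (\<psi>1 has_real_derivative Q s * \<psi> s) (at s)"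
    and Q: "\<And>s. s \<ge> a \<Longrightarrow> Q s \<ge> 0" and lim: "(\<psi> \<longlongrightarrow> 0) at_top" and m: "m > 0"
  shows "integral {a + m..a + 2 * m} (\<lambda>s. (\<psi> s)\<^sup>2 + (\<psi>1 s)\<^sup>2) \<le> (2 + 2 / m\<^sup>2) * integral {a..a + m} (\<lambda>s. (\<psi> s)\<^sup>2)"
proof -
  define P where "P = (\<lambda>s. \<psi> s * \<psi>1 s)"
  have P': "(P has_real_derivative (\<psi>1 s)\<^sup>2 + Q s * (\<psi> s)\<^sup>2) (at s)" for s
    unfolding P_def by (rule DERIV_cong[OF DERIV_mult[OF d]]) (simp add: power2_eq_square)
  have sq': "((\<lambda>s. (\<psi> s)\<^sup>2) has_real_derivative 2 * P s) (at s)" for s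
    unfolding P_def by (auto intro!: derivative_eq_intros d(1))
  have cont: "continuous_on S \<psi>" "continuous_on S \<psi>1" for S
    using d by (auto intro!: continuous_at_imp_continuous_on DERIV_isCont)
  have monoP: "P s \<le> P t" if "a \<le> s" "s \<le> t" for s t
  proof (rule DERIV_nonneg_imp_nondecreasing[OF that(2)])
    fix x assume "s \<le> x"
    then have "Q x \<ge> 0" using that Q by simp
    then have "(\<psi>1 x)\<^sup>2 + Q x * (\<psi> x)\<^sup>2 \<ge> 0" by simp
    then show "\<exists>y. (P has_real_derivative y) (at x) \<and> 0 \<le> y" using P' by blast
  qed
  have P_le: "P s \<le> 0" if s: "a \<le> s" for s
  proof (rule ccontr)
    assume "\<not> P s \<le> 0"
    then have Ps: "P s > 0" by simp
    have incr: "(\<psi> (s + 1))\<^sup>2 \<le> (\<psi> t)\<^sup>2" if "s + 1 \<le> t" for t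
    proof (rule DERIV_nonneg_imp_nondecreasing[OF that])
      fix x assume "s + 1 \<le> x"
      then show "\<exists>y. ((\<lambda>s. (\<psi> s)\<^sup>2) has_real_derivative y) (at x) \<and> 0 \<le> y"
        using sq'[of x] monoP[OF s, of x] Ps by (intro exI[of _ "2 * P x"]) auto
    qed
    have "((\<lambda>t. (\<psi> t)\<^sup>2) \<longlongrightarrow> 0\<^sup>2) at_top" by (intro tendsto_power lim)
    then have "(\<psi> (s + 1))\<^sup>2 \<le> 0\<^sup>2"
      by (rule tendsto_lowerbound[OF _ eventually_mono[OF eventually_ge_at_top[of "s+1"] incr]]) auto
    then have "\<psi> (s + 1) = 0" by simp
    then have "P (s + 1) = 0" unfolding P_def by simp
    with monoP[OF s, of "s + 1"] Ps show False by simp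
  qed
  have decr: "(\<psi> t)\<^sup>2 \<le> (\<psi> s)\<^sup>2" if "a \<le> s" "s \<le> t" for s t
  proof (rule DERIV_nonpos_imp_nonincreasing[OF that(2)])
    fix x assume "s \<le> x"
    then show "\<exists>y. ((\<lambda>s. (\<psi> s)\<^sup>2) has_real_derivative y) (at x) \<and> y \<le> 0"
      using sq'[of x] P_le[of x] that by (intro exI[of _ "2 * P x"]) auto
  qed
  define b where "b = (\<psi> (a + m / 2))\<^sup>2"
  define I where "I = integral {a..a + m} (\<lambda>s. (\<psi> s)\<^sup>2)"
  have b0: "b \<ge> 0" unfolding b_def by simp
  have bI: "m / 2 * b \<le> I"
  proof -
    have "m / 2 * b = integral {a..a + m / 2} (\<lambda>s. b)" using m by simp
    also have "\<dots> \<le> integral {a..a + m / 2} (\<lambda>s. (\<psi> s)\<^sup>2)"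
      unfolding b_def using m
      by (intro integral_le integrable_continuous_real continuous_intros cont) (auto intro!: decr)
    also have "\<dots> \<le> I" unfolding I_def using m
      by (intro integral_subset_le integrable_continuous_real continuous_intros cont) auto
    finally show ?thesis .
  qed
  have Pb: "- P (a + m) * m \<le> b"
  proof -
    have "\<exists>z. a + m / 2 < z \<and> z < a + m \<and> (\<psi> (a + m))\<^sup>2 - (\<psi> (a + m / 2))\<^sup>2 = (a + m - (a + m / 2)) * (2 * P z)"
      using m by (intro MVT2 sq') auto
    then obtain z where z: "a + m / 2 < z" "z < a + m" "(\<psi> (a + m))\<^sup>2 - b = m * P z"
      unfolding b_def by (auto simp: field_simps)
    have "P z \<le> P (a + m)" using z m by (intro monoP) auto
    then have "m * P z \<le> m * P (a + m)" using m by simp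
    then show ?thesis using z(3) zero_le_power2[of "\<psi> (a + m)"] by (simp only: mult_minus_left mult.commute[of m])
  qed
  have "integral {a + m..a + 2 * m} (\<lambda>s. (\<psi>1 s)\<^sup>2) \<le> - P (a + m)"
  proof -
    have FTC: "((\<lambda>s. (\<psi>1 s)\<^sup>2 + Q s * (\<psi> s)\<^sup>2) has_integral (P (a + 2 * m) - P (a + m))) {a + m..a + 2 * m}"
      using m by (intro fundamental_theorem_of_calculus)
        (auto intro!: has_field_derivative_at_within P' simp flip: has_real_derivative_iff_has_vector_derivative)
    have "integral {a + m..a + 2 * m} (\<lambda>s. (\<psi>1 s)\<^sup>2) \<le> P (a + 2 * m) - P (a + m)"
    proof (rule has_integral_le[OF integrable_integral FTC])
      show "(\<lambda>s. (\<psi>1 s)\<^sup>2) integrable_on {a + m..a + 2 * m}" by (intro integrable_continuous_real continuous_intros cont)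
      show "(\<psi>1 s)\<^sup>2 \<le> (\<psi>1 s)\<^sup>2 + Q s * (\<psi> s)\<^sup>2" if "s \<in> {a + m..a + 2 * m}" for s
        using Q[of s] that m by simp
    qed
    then show ?thesis using P_le[of "a + 2 * m"] m by simp
  qed
  moreover have "integral {a + m..a + 2 * m} (\<lambda>s. (\<psi> s)\<^sup>2) \<le> m * b"
  proof -
    have "integral {a + m..a + 2 * m} (\<lambda>s. (\<psi> s)\<^sup>2) \<le> integral {a + m..a + 2 * m} (\<lambda>s. b)"
      unfolding b_def using m
      by (intro integral_le integrable_continuous_real continuous_intros cont) (auto intro!: decr)
    also have "\<dots> = m * b" using m by simp
    finally show ?thesis .
  qed
  moreover have "integral {a + m..a + 2 * m} (\<lambda>s. (\<psi> s)\<^sup>2 + (\<psi>1 s)\<^sup>2)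
     = integral {a + m..a + 2 * m} (\<lambda>s. (\<psi> s)\<^sup>2) + integral {a + m..a + 2 * m} (\<lambda>s. (\<psi>1 s)\<^sup>2)"
    by (intro integral_add integrable_continuous_real continuous_intros cont)
  moreover have "m * b \<le> 2 * I" using bI by simp
  moreover have "- P (a + m) \<le> 2 / m\<^sup>2 * I"
  proof -
    have "- P (a + m) * m * m \<le> 2 * I" using mult_right_mono[OF Pb, of m] bI m by (simp add: mult.commute)
    then show ?thesis using m by (simp add: field_simps power2_eq_square)
  qed
  ultimately show ?thesis unfolding I_def[symmetric] by (simp only: distrib_right)
qed

lemma max0_power_deriv:
  "((\<lambda>x. max 0 x ^ Suc (Suc k)) has_real_derivative real (Suc (Suc k)) * max 0 x ^ Suc k) (at x)"
proof -
  consider "x < 0" | "x > 0" | "x = 0" by linarith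
  then show ?thesis
  proof cases
    case 1
    have "((\<lambda>x::real. 0) has_real_derivative real (Suc (Suc k)) * max 0 x ^ Suc k) (at x)" using 1 by simp
    then show ?thesis
      by (rule has_field_derivative_transform_within_open[of _ _ _ "{..<0}"]) (use 1 in auto)
  next
    case 2
    have "((\<lambda>x. x ^ Suc (Suc k)) has_real_derivative real (Suc (Suc k)) * max 0 x ^ Suc k) (at x)"
      using 2 DERIV_pow[of "Suc (Suc k)" x] by simp
    then show ?thesis
      by (rule has_field_derivative_transform_within_open[of _ _ _ "{0<..}"]) (use 2 in auto)
  next
    case 3
    have "(\<lambda>y. (max 0 (0 + y) ^ Suc (Suc k) - max 0 0 ^ Suc (Suc k)) / y) \<midarrow>0\<rightarrow> (0::real)"
    proof (rule Lim_null_comparison)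
      show "\<forall>\<^sub>F y in at 0. norm ((max 0 (0 + y) ^ Suc (Suc k) - max 0 0 ^ Suc (Suc k)) / y) \<le> \<bar>y\<bar> ^ Suc k"
        by (intro always_eventually allI) (auto simp: max_def abs_mult power_abs not_le intro: mult_nonpos_nonneg)
      have "((\<lambda>y::real. \<bar>y\<bar> ^ Suc k) \<longlongrightarrow> \<bar>0\<bar> ^ Suc k) (at 0)" by (intro tendsto_intros)
      then show "((\<lambda>y::real. \<bar>y\<bar> ^ Suc k) \<longlongrightarrow> 0) (at 0)" by simp
    qed
    then show ?thesis using 3 by (simp add: DERIV_def)
  qed
qed

text \<open>
  The antiderivative of the quadratic B-spline: a \<open>C\<^sup>2\<close> step from 0 to 1 on \<open>[0, 3]\<close>, together with its
  first two derivatives.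
\<close>

definition spline :: "real \<Rightarrow> real" where
  "spline t = (max 0 t ^ 3 - 3 * max 0 (t - 1) ^ 3 + 3 * max 0 (t - 2) ^ 3 - max 0 (t - 3) ^ 3) / 6"

definition spline1 :: "real \<Rightarrow> real" where
  "spline1 t = (max 0 t ^ 2 - 3 * max 0 (t - 1) ^ 2 + 3 * max 0 (t - 2) ^ 2 - max 0 (t - 3) ^ 2) / 2"

definition spline2 :: "real \<Rightarrow> real" where
  "spline2 t = max 0 t - 3 * max 0 (t - 1) + 3 * max 0 (t - 2) - max 0 (t - 3)"

lemma spline_derivs:
  "(spline has_real_derivative spline1 t) (at t)"
  "(spline1 has_real_derivative spline2 t) (at t)"
proof -
  have 3: "((\<lambda>t. max 0 (t - c) ^ 3) has_real_derivative 3 * max 0 (t - c) ^ 2) (at t)" for c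
    using DERIV_chain2[OF max0_power_deriv[of 1 "t - c"] DERIV_diff[OF DERIV_ident DERIV_const]]
    by (simp add: numeral_eq_Suc)
  have 2: "((\<lambda>t. max 0 (t - c) ^ 2) has_real_derivative 2 * max 0 (t - c)) (at t)" for c
    using DERIV_chain2[OF max0_power_deriv[of 0 "t - c"] DERIV_diff[OF DERIV_ident DERIV_const]]
    by (simp add: numeral_eq_Suc)
  show "(spline has_real_derivative spline1 t) (at t)"
    unfolding spline_def spline1_def
    by (rule DERIV_cong[OF DERIV_cdivide[OF DERIV_diff[OF DERIV_add[OF DERIV_diff[OF 3[of 0, simplified]
        DERIV_cmult[OF 3[of 1]]] DERIV_cmult[OF 3[of 2]]] 3[of 3]]]]) (simp add: field_simps)
  show "(spline1 has_real_derivative spline2 t) (at t)"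
    unfolding spline1_def spline2_def
    by (rule DERIV_cong[OF DERIV_cdivide[OF DERIV_diff[OF DERIV_add[OF DERIV_diff[OF 2[of 0, simplified]
        DERIV_cmult[OF 2[of 1]]] DERIV_cmult[OF 2[of 2]]] 2[of 3]]]]) (simp add: field_simps)
qed

lemma spline_left: "t \<le> 0 \<Longrightarrow> spline t = 0 \<and> spline1 t = 0 \<and> spline2 t = 0"
  unfolding spline_def spline1_def spline2_def by simp

lemma spline_right: "t \<ge> 3 \<Longrightarrow> spline t = 1 \<and> spline1 t = 0 \<and> spline2 t = 0"
  unfolding spline_def spline1_def spline2_def by (simp add: power3_eq_cube power2_eq_square algebra_simps)

lemma cutoff_function:
  fixes m :: real
  assumes m: "m > 0"
  obtains \<eta> \<eta>1 \<eta>2 :: "real \<Rightarrow> real" and C :: real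
  where "\<And>s. (\<eta> has_real_derivative \<eta>1 s) (at s)" "\<And>s. (\<eta>1 has_real_derivative \<eta>2 s) (at s)"
    and "continuous_on UNIV \<eta>2"
    and "\<And>s. \<bar>s\<bar> \<le> 1 + m \<Longrightarrow> \<eta> s = 1 \<and> \<eta>1 s = 0 \<and> \<eta>2 s = 0"
    and "\<And>s. \<bar>s\<bar> \<ge> 1 + 2 * m \<Longrightarrow> \<eta> s = 0 \<and> \<eta>1 s = 0 \<and> \<eta>2 s = 0"
    and "\<And>s. \<bar>\<eta>1 s\<bar> \<le> C" "\<And>s. \<bar>\<eta>2 s\<bar> \<le> C" "C \<ge> 0"
proof -
  define k where "k = 3 / m"
  have k: "k > 0" "k * m = 3" using m by (auto simp: k_def)
  define L R where "L = (\<lambda>s. k * (1 + 2 * m + s))" and "R = (\<lambda>s. k * (1 + 2 * m - s))"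
  have L': "(L has_real_derivative k) (at s)" and R': "(R has_real_derivative - k) (at s)" for s
    unfolding L_def R_def by (auto intro!: derivative_eq_intros)
  note SL = DERIV_chain2[OF spline_derivs(1) L'] and SR = DERIV_chain2[OF spline_derivs(1) R']
  note SL1 = DERIV_chain2[OF spline_derivs(2) L'] and SR1 = DERIV_chain2[OF spline_derivs(2) R']
  define \<eta> where "\<eta> = (\<lambda>s. spline (L s) * spline (R s))"
  define \<eta>1 where "\<eta>1 = (\<lambda>s. k * (spline1 (L s) * spline (R s) - spline (L s) * spline1 (R s)))"
  define \<eta>2 where "\<eta>2 = (\<lambda>s. k\<^sup>2 * (spline2 (L s) * spline (R s) - 2 * (spline1 (L s) * spline1 (R s)) + spline (L s) * spline2 (R s)))"
  have d1: "(\<eta> has_real_derivative \<eta>1 s) (at s)" for s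
    unfolding \<eta>_def \<eta>1_def by (rule DERIV_cong[OF DERIV_mult[OF SL SR]]) (simp add: algebra_simps)
  have d2: "(\<eta>1 has_real_derivative \<eta>2 s) (at s)" for s
    unfolding \<eta>1_def \<eta>2_def
    by (rule DERIV_cong[OF DERIV_cmult[OF DERIV_diff[OF DERIV_mult[OF SL1 SR] DERIV_mult[OF SL SR1]]]])
       (simp add: algebra_simps power2_eq_square)
  have cont: "continuous_on UNIV \<eta>" "continuous_on UNIV \<eta>1"
    using d1 d2 by (auto intro!: continuous_at_imp_continuous_on DERIV_isCont)
  have contS: "continuous_on UNIV (\<lambda>s. spline (L s))" "continuous_on UNIV (\<lambda>s. spline (R s))"
     "continuous_on UNIV (\<lambda>s. spline1 (L s))" "continuous_on UNIV (\<lambda>s. spline1 (R s))"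
    using SL SR SL1 SR1 by (auto intro!: continuous_at_imp_continuous_on DERIV_isCont)
  have contLR: "continuous_on UNIV (\<lambda>s. spline2 (L s))" "continuous_on UNIV (\<lambda>s. spline2 (R s))"
    unfolding spline2_def L_def R_def by (intro continuous_intros)+
  have cont2: "continuous_on UNIV \<eta>2" unfolding \<eta>2_def by (intro continuous_intros contS contLR)
  have one: "\<eta> s = 1 \<and> \<eta>1 s = 0 \<and> \<eta>2 s = 0" if "\<bar>s\<bar> \<le> 1 + m" for s
  proof -
    have "L s \<ge> k * m" "R s \<ge> k * m" unfolding L_def R_def using that k by (intro mult_left_mono; simp)+
    then show ?thesis unfolding \<eta>_def \<eta>1_def \<eta>2_def using k spline_right[of "L s"] spline_right[of "R s"] by simp
  qed
  have zero: "\<eta> s = 0 \<and> \<eta>1 s = 0 \<and> \<eta>2 s = 0" if "\<bar>s\<bar> \<ge> 1 + 2 * m" for s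
  proof -
    have "L s \<le> 0 \<or> R s \<le> 0" unfolding L_def R_def using that k by (auto simp: mult_le_0_iff)
    then show ?thesis unfolding \<eta>_def \<eta>1_def \<eta>2_def using spline_left[of "L s"] spline_left[of "R s"] by auto
  qed
  obtain C1 where C1: "C1 \<ge> 0" "\<And>s. \<bar>\<eta>1 s\<bar> \<le> C1"
    using bounded_of_compact_support[OF cont(2), of "1 + 2 * m"] zero by blast
  obtain C2 where C2: "C2 \<ge> 0" "\<And>s. \<bar>\<eta>2 s\<bar> \<le> C2"
    using bounded_of_compact_support[OF cont2, of "1 + 2 * m"] zero by blast
  have "\<bar>\<eta>1 s\<bar> \<le> max C1 C2 \<and> \<bar>\<eta>2 s\<bar> \<le> max C1 C2" for s
    using C1(2)[of s] C2(2)[of s] by linarith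
  then show thesis using that[of \<eta> \<eta>1 \<eta>2 "max C1 C2"] C1(1) d1 d2 cont2 one zero by auto
qed

text \<open>
  The cut-off function \<open>\<eta>\<close> is 1 for \<open>|s| \<le> 1 + m\<close>, so \<open>e = 2 \<eta>' \<psi>' + \<eta>'' \<psi>\<close> lives in the windows
  \<open>1 + m \<le> |s| \<le> 1 + 2 m\<close>. There the tail estimate, applied to \<open>\<psi>(s)\<close> and to \<open>\<psi>(-s)\<close> with \<open>a = 1\<close>, bounds
  \<open>\<psi>\<close> and \<open>\<psi>'\<close> by the part of the mass that the cut-off leaves untouched.
\<close>

lemma localized_hermite_function:
  fixes m :: real
  assumes m: "m > 0"
  shows "\<exists>C\<ge>0. \<forall>n::nat. \<exists>p p1 p2 e. (\<forall>s. (p has_real_derivative p1 s) (at s)) \<and> (\<forall>s. (p1 has_real_derivative p2 s) (at s))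
     \<and> continuous_on UNIV e
     \<and> (\<forall>s. p2 s = (2 * real n + 1)\<^sup>2 * (s\<^sup>2 - 1) * p s + e s)
     \<and> (\<forall>s. \<bar>s\<bar> \<ge> 1 + 2 * m \<longrightarrow> p s = 0 \<and> p1 s = 0 \<and> p2 s = 0 \<and> e s = 0)
     \<and> integral {-(1+2*m)..1+2*m} (\<lambda>s. (e s)\<^sup>2) \<le> C * integral {-(1+2*m)..1+2*m} (\<lambda>s. (p s)\<^sup>2)
     \<and> integral {-(1+2*m)..1+2*m} (\<lambda>s. (p s)\<^sup>2) > 0"
proof -
  obtain \<eta> \<eta>1 \<eta>2 C0 where \<eta>: "\<And>s. (\<eta> has_real_derivative \<eta>1 s) (at s)" "\<And>s. (\<eta>1 has_real_derivative \<eta>2 s) (at s)"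
    and \<eta>2: "continuous_on UNIV \<eta>2"
    and one: "\<And>s. \<bar>s\<bar> \<le> 1 + m \<Longrightarrow> \<eta> s = 1 \<and> \<eta>1 s = 0 \<and> \<eta>2 s = 0"
    and zero: "\<And>s. \<bar>s\<bar> \<ge> 1 + 2 * m \<Longrightarrow> \<eta> s = 0 \<and> \<eta>1 s = 0 \<and> \<eta>2 s = 0"
    and C0: "\<And>s. \<bar>\<eta>1 s\<bar> \<le> C0" "\<And>s. \<bar>\<eta>2 s\<bar> \<le> C0" "C0 \<ge> 0"
    using cutoff_function[OF m] by metis
  define C where "C = 8 * C0\<^sup>2 * (2 + 2 / m\<^sup>2)"
  show ?thesis
  proof (intro exI[of _ C] conjI allI)
    show "C \<ge> 0" unfolding C_def by simp
    fix n :: nat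
    obtain \<psi> \<psi>1 where \<psi>: "\<And>s. (\<psi> has_real_derivative \<psi>1 s) (at s)"
      "\<And>s. (\<psi>1 has_real_derivative (2 * real n + 1)\<^sup>2 * (s\<^sup>2 - 1) * \<psi> s) (at s)"
      and lim: "(\<psi> \<longlongrightarrow> 0) at_top" "((\<lambda>s. \<psi> (- s)) \<longlongrightarrow> 0) at_top"
      and nz: "\<exists>s. \<bar>s\<bar> < 1 \<and> \<psi> s \<noteq> 0" using hermite_function[of n] by metis
    have cont: "continuous_on S \<psi>" "continuous_on S \<psi>1" "continuous_on S \<eta>" "continuous_on S \<eta>1" "continuous_on S \<eta>2" for S
      using \<psi> \<eta> continuous_on_subset[OF \<eta>2] by (auto intro!: continuous_at_imp_continuous_on DERIV_isCont)
    define p where "p = (\<lambda>s. \<eta> s * \<psi> s)"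
    define e where "e = (\<lambda>s. 2 * \<eta>1 s * \<psi>1 s + \<eta>2 s * \<psi> s)"
    define p1 where "p1 = (\<lambda>s. \<eta>1 s * \<psi> s + \<eta> s * \<psi>1 s)"
    define p2 where "p2 = (\<lambda>s. (2 * real n + 1)\<^sup>2 * (s\<^sup>2 - 1) * p s + e s)"
    have d1: "(p has_real_derivative p1 s) (at s)" for s
      unfolding p_def p1_def by (rule DERIV_cong[OF DERIV_mult[OF \<eta>(1) \<psi>(1)]]) simp
    have d2: "(p1 has_real_derivative p2 s) (at s)" for s
      unfolding p1_def p2_def p_def e_def
      by (rule DERIV_cong[OF DERIV_add[OF DERIV_mult[OF \<eta>(2) \<psi>(1)] DERIV_mult[OF \<eta>(1) \<psi>(2)]]]) (simp add: algebra_simps)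
    have conte: "continuous_on S e" and contp: "continuous_on S p" for S
      unfolding e_def p_def by (intro continuous_intros cont)+
    define core where "core = integral {-(1+m)..1+m} (\<lambda>s. (\<psi> s)\<^sup>2)"
    have core_le: "core \<le> integral {-(1+2*m)..1+2*m} (\<lambda>s. (p s)\<^sup>2)"
    proof -
      have "core = integral {-(1+m)..1+m} (\<lambda>s. (p s)\<^sup>2)"
        unfolding core_def by (intro integral_cong) (use one in \<open>auto simp: p_def abs_le_iff\<close>)
      also have "\<dots> \<le> integral {-(1+2*m)..1+2*m} (\<lambda>s. (p s)\<^sup>2)"
        using m by (intro integral_subset_le integrable_continuous_real continuous_intros contp) auto
      finally show ?thesis .
    qed
    have core_pos: "core > 0"
    proof -
      have "core \<ge> 0" unfolding core_def by (intro integral_nonneg integrable_continuous_real continuous_intros cont) auto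
      moreover have "core \<noteq> 0"
      proof
        assume "core = 0"
        then have "\<forall>s\<in>{-(1+m)..1+m}. (\<psi> s)\<^sup>2 = 0"
          using m unfolding core_def
          by (subst (asm) integral_eq_0_iff) (auto intro!: continuous_intros cont)
        moreover obtain s where "\<bar>s\<bar> < 1" "\<psi> s \<noteq> 0" using nz by blast
        moreover from this m have "s \<in> {-(1+m)..1+m}" by auto
        ultimately show False by fastforce
      qed
      ultimately show ?thesis by simp
    qed
    have tail_R: "integral {1 + m..1 + 2 * m} (\<lambda>s. (\<psi> s)\<^sup>2 + (\<psi>1 s)\<^sup>2) \<le> (2 + 2 / m\<^sup>2) * integral {1..1 + m} (\<lambda>s. (\<psi> s)\<^sup>2)"
      by (rule decaying_solution_tail[OF \<psi> _ lim(1) m]) (simp add: power_le_one_iff)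
    have \<psi>m: "((\<lambda>s. \<psi> (- s)) has_real_derivative - \<psi>1 (- s)) (at s)"
      "((\<lambda>s. - \<psi>1 (- s)) has_real_derivative (2 * real n + 1)\<^sup>2 * (s\<^sup>2 - 1) * \<psi> (- s)) (at s)" for s
      using DERIV_chain2[OF \<psi>(1)[of "-s"] DERIV_minus[OF DERIV_ident]]
        DERIV_minus[OF DERIV_chain2[OF \<psi>(2)[of "-s"] DERIV_minus[OF DERIV_ident]]] by simp_all
    have "integral {1 + m..1 + 2 * m} (\<lambda>s. (\<psi> (- s))\<^sup>2 + (- \<psi>1 (- s))\<^sup>2) \<le> (2 + 2 / m\<^sup>2) * integral {1..1 + m} (\<lambda>s. (\<psi> (- s))\<^sup>2)"
      by (rule decaying_solution_tail[OF \<psi>m _ lim(2) m]) (simp add: power_le_one_iff)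
    then have tail_L: "integral {-(1 + 2 * m)..-(1 + m)} (\<lambda>s. (\<psi> s)\<^sup>2 + (\<psi>1 s)\<^sup>2) \<le> (2 + 2 / m\<^sup>2) * integral {-(1+m)..-1} (\<lambda>s. (\<psi> s)\<^sup>2)"
      using Henstock_Kurzweil_Integration.integral_reflect_real[where a = "1 + m" and b = "1 + 2 * m" and f = "\<lambda>s. (\<psi> (- s))\<^sup>2 + (\<psi>1 (- s))\<^sup>2"]
        Henstock_Kurzweil_Integration.integral_reflect_real[where a = 1 and b = "1 + m" and f = "\<lambda>s. (\<psi> (- s))\<^sup>2"]
      by simp
    have e_le: "(e s)\<^sup>2 \<le> 8 * C0\<^sup>2 * ((\<psi> s)\<^sup>2 + (\<psi>1 s)\<^sup>2)" for s
    proof -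
      have "\<bar>e s\<bar> \<le> 2 * C0 * \<bar>\<psi>1 s\<bar> + C0 * \<bar>\<psi> s\<bar>"
      proof -
        have "\<bar>2 * \<eta>1 s * \<psi>1 s\<bar> \<le> 2 * C0 * \<bar>\<psi>1 s\<bar>" "\<bar>\<eta>2 s * \<psi> s\<bar> \<le> C0 * \<bar>\<psi> s\<bar>"
          using C0 by (auto simp: abs_mult intro!: mult_right_mono)
        then show ?thesis unfolding e_def by linarith
      qed
      also have "\<dots> = C0 * (2 * \<bar>\<psi>1 s\<bar> + \<bar>\<psi> s\<bar>)" by (simp add: algebra_simps)
      finally have "(e s)\<^sup>2 \<le> (C0 * (2 * \<bar>\<psi>1 s\<bar> + \<bar>\<psi> s\<bar>))\<^sup>2"
        using C0 by (intro power2_le_iff_abs_le[THEN iffD2]) auto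
      also have "\<dots> = C0\<^sup>2 * (2 * \<bar>\<psi>1 s\<bar> + \<bar>\<psi> s\<bar>)\<^sup>2" by (simp add: power_mult_distrib)
      also have "\<dots> \<le> C0\<^sup>2 * (8 * ((\<psi> s)\<^sup>2 + (\<psi>1 s)\<^sup>2))"
      proof (rule mult_left_mono)
        have "(2 * \<bar>\<psi>1 s\<bar> + \<bar>\<psi> s\<bar>)\<^sup>2 + (2 * \<bar>\<psi>1 s\<bar> - \<bar>\<psi> s\<bar>)\<^sup>2 + 6 * \<bar>\<psi> s\<bar>\<^sup>2
            = 8 * (\<bar>\<psi> s\<bar>\<^sup>2 + \<bar>\<psi>1 s\<bar>\<^sup>2)"
          unfolding power2_eq_square by (simp add: algebra_simps)
        moreover have "0 \<le> (2 * \<bar>\<psi>1 s\<bar> - \<bar>\<psi> s\<bar>)\<^sup>2" "0 \<le> \<bar>\<psi> s\<bar>\<^sup>2" by simp_all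
        ultimately have "(2 * \<bar>\<psi>1 s\<bar> + \<bar>\<psi> s\<bar>)\<^sup>2 \<le> 8 * (\<bar>\<psi> s\<bar>\<^sup>2 + \<bar>\<psi>1 s\<bar>\<^sup>2)" by linarith
        then show "(2 * \<bar>\<psi>1 s\<bar> + \<bar>\<psi> s\<bar>)\<^sup>2 \<le> 8 * ((\<psi> s)\<^sup>2 + (\<psi>1 s)\<^sup>2)" by simp
      qed simp
      finally show ?thesis by (simp add: algebra_simps)
    qed
    have piece: "integral {a..b} (\<lambda>s. (e s)\<^sup>2) \<le> 8 * C0\<^sup>2 * integral {a..b} (\<lambda>s. (\<psi> s)\<^sup>2 + (\<psi>1 s)\<^sup>2)" for a b
    proof -
      have "integral {a..b} (\<lambda>s. (e s)\<^sup>2) \<le> integral {a..b} (\<lambda>s. 8 * C0\<^sup>2 * ((\<psi> s)\<^sup>2 + (\<psi>1 s)\<^sup>2))"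
        by (intro integral_le integrable_continuous_real continuous_intros conte cont e_le)
      then show ?thesis by simp
    qed
    have int: "(\<lambda>s. (e s)\<^sup>2) integrable_on {a..b}" "(\<lambda>s. (\<psi> s)\<^sup>2) integrable_on {a..b}" for a b
      by (intro integrable_continuous_real continuous_intros conte cont)+
    have "integral {-(1+2*m)..1+2*m} (\<lambda>s. (e s)\<^sup>2)
        = integral {-(1+2*m)..-(1+m)} (\<lambda>s. (e s)\<^sup>2) + integral {-(1+m)..1+m} (\<lambda>s. (e s)\<^sup>2) + integral {1+m..1+2*m} (\<lambda>s. (e s)\<^sup>2)"
      using m Henstock_Kurzweil_Integration.integral_combine[where a = "-(1+2*m)" and c = "-(1+m)" and b = "1+2*m", OF _ _ int(1)]
        Henstock_Kurzweil_Integration.integral_combine[where a = "-(1+m)" and c = "1+m" and b = "1+2*m", OF _ _ int(1)] by simp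
    also have "integral {-(1+m)..1+m} (\<lambda>s. (e s)\<^sup>2) = integral {-(1+m)..1+m} (\<lambda>s. 0)"
      by (intro integral_cong) (use one in \<open>auto simp: e_def abs_le_iff\<close>)
    also have "integral {-(1+m)..1+m} (\<lambda>s. 0 :: real) = 0" by simp
    finally have "integral {-(1+2*m)..1+2*m} (\<lambda>s. (e s)\<^sup>2)
       \<le> 8 * C0\<^sup>2 * (integral {-(1+2*m)..-(1+m)} (\<lambda>s. (\<psi> s)\<^sup>2 + (\<psi>1 s)\<^sup>2) + integral {1+m..1+2*m} (\<lambda>s. (\<psi> s)\<^sup>2 + (\<psi>1 s)\<^sup>2))"
      using piece[of "-(1+2*m)" "-(1+m)"] piece[of "1+m" "1+2*m"] unfolding distrib_left[of "8 * C0\<^sup>2"] by linarith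
    also have "\<dots> \<le> 8 * C0\<^sup>2 * ((2 + 2 / m\<^sup>2) * core)"
    proof (rule mult_left_mono)
      have "integral {-(1+m)..-1} (\<lambda>s. (\<psi> s)\<^sup>2) + integral {1..1+m} (\<lambda>s. (\<psi> s)\<^sup>2) \<le> core"
      proof -
        have "core = integral {-(1+m)..-1} (\<lambda>s. (\<psi> s)\<^sup>2) + integral {-1..1} (\<lambda>s. (\<psi> s)\<^sup>2) + integral {1..1+m} (\<lambda>s. (\<psi> s)\<^sup>2)"
          unfolding core_def using m Henstock_Kurzweil_Integration.integral_combine[where a = "-(1+m)" and c = "-1" and b = "1+m", OF _ _ int(2)]
            Henstock_Kurzweil_Integration.integral_combine[where a = "-1" and c = 1 and b = "1+m", OF _ _ int(2)] by simp
        moreover have "integral {-1..1} (\<lambda>s. (\<psi> s)\<^sup>2) \<ge> 0" using int(2) by (intro integral_nonneg) auto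
        ultimately show ?thesis by linarith
      qed
      then have "(2 + 2 / m\<^sup>2) * (integral {-(1+m)..-1} (\<lambda>s. (\<psi> s)\<^sup>2) + integral {1..1+m} (\<lambda>s. (\<psi> s)\<^sup>2)) \<le> (2 + 2 / m\<^sup>2) * core"
        by (intro mult_left_mono) auto
      then show "integral {-(1+2*m)..-(1+m)} (\<lambda>s. (\<psi> s)\<^sup>2 + (\<psi>1 s)\<^sup>2) + integral {1+m..1+2*m} (\<lambda>s. (\<psi> s)\<^sup>2 + (\<psi>1 s)\<^sup>2) \<le> (2 + 2 / m\<^sup>2) * core"
        using tail_L tail_R unfolding distrib_left[of "2 + 2 / m\<^sup>2"] by linarith
    qed simp
    also have "\<dots> = C * core" unfolding C_def by simp
    also have "\<dots> \<le> C * integral {-(1+2*m)..1+2*m} (\<lambda>s. (p s)\<^sup>2)"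
      using core_le unfolding C_def by (intro mult_left_mono) auto
    finally have main: "integral {-(1+2*m)..1+2*m} (\<lambda>s. (e s)\<^sup>2) \<le> C * integral {-(1+2*m)..1+2*m} (\<lambda>s. (p s)\<^sup>2)" .
    have vanish: "p s = 0 \<and> p1 s = 0 \<and> p2 s = 0 \<and> e s = 0" if "\<bar>s\<bar> \<ge> 1 + 2 * m" for s
      using zero[OF that] unfolding p2_def p_def p1_def e_def by simp
    have pos: "integral {-(1+2*m)..1+2*m} (\<lambda>s. (p s)\<^sup>2) > 0" using core_le core_pos by linarith
    show "\<exists>p p1 p2 e. (\<forall>s. (p has_real_derivative p1 s) (at s)) \<and> (\<forall>s. (p1 has_real_derivative p2 s) (at s))
     \<and> continuous_on UNIV e
     \<and> (\<forall>s. p2 s = (2 * real n + 1)\<^sup>2 * (s\<^sup>2 - 1) * p s + e s)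
     \<and> (\<forall>s. \<bar>s\<bar> \<ge> 1 + 2 * m \<longrightarrow> p s = 0 \<and> p1 s = 0 \<and> p2 s = 0 \<and> e s = 0)
     \<and> integral {-(1+2*m)..1+2*m} (\<lambda>s. (e s)\<^sup>2) \<le> C * integral {-(1+2*m)..1+2*m} (\<lambda>s. (p s)\<^sup>2)
     \<and> integral {-(1+2*m)..1+2*m} (\<lambda>s. (p s)\<^sup>2) > 0"
      by (rule exI[of _ p], rule exI[of _ p1], rule exI[of _ p2], rule exI[of _ e])
         (use d1 d2 conte main vanish pos in \<open>auto simp: p2_def\<close>)
  qed
qed

section \<open>Normal form of a function near a simple zero\<close>

text \<open>
  The average of \<open>\<phi>\<close> over the segment from \<open>x0\<close> to \<open>x\<close> with weight \<open>w\<close>. Such averages stay as regular in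
  \<open>x\<close> as \<open>\<phi>\<close>, also at \<open>x = x0\<close>, with bounds independent of \<open>x0\<close>; they replace quotients by powers of
  \<open>x - x0\<close>.
\<close>

definition wavg :: "(real \<Rightarrow> real) \<Rightarrow> (real \<Rightarrow> real) \<Rightarrow> real \<Rightarrow> real \<Rightarrow> real" where
  "wavg w \<phi> x0 x = integral {0..1} (\<lambda>t. w t * \<phi> (x0 + t * (x - x0)))"

lemma segment_in_interval:
  fixes x0 x t :: real
  assumes "x0 \<in> {\<alpha>..\<omega>}" "x \<in> {\<alpha>..\<omega>}" "t \<in> {0..1}"
  shows "x0 + t * (x - x0) \<in> {\<alpha>..\<omega>}"
proof -
  have "(1 - t) *\<^sub>R x0 + t *\<^sub>R x \<in> {\<alpha>..\<omega>}"
    using assms convex_real_interval(5)[of \<alpha> \<omega>] by (intro convexD) auto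
  then show ?thesis by (simp add: algebra_simps)
qed

lemma wavg_continuous_param:
  fixes \<phi> w :: "real \<Rightarrow> real" and x0 :: real
  assumes x0: "x0 \<in> {\<alpha>..\<omega>}" and \<phi>: "continuous_on {\<alpha>..\<omega>} \<phi>" and w: "continuous_on {0..1} w"
  shows "continuous_on ({\<alpha>..\<omega>} \<times> {0..1}) (\<lambda>(x, t). w t * \<phi> (x0 + t * (x - x0)))"
proof -
  have "continuous_on ({\<alpha>..\<omega>} \<times> {0..1}) (\<lambda>z. \<phi> (x0 + snd z * (fst z - x0)))"
  proof (rule continuous_on_compose2[OF \<phi>])
    show "(\<lambda>z. x0 + snd z * (fst z - x0)) ` ({\<alpha>..\<omega>} \<times> {0..1}) \<subseteq> {\<alpha>..\<omega>}"
      using segment_in_interval[OF x0] by (intro image_subsetI) (simp only: mem_Times_iff)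
  qed (intro continuous_intros)
  moreover have "continuous_on ({\<alpha>..\<omega>} \<times> {0..1}) (\<lambda>z. w (snd z))"
    by (rule continuous_on_compose2[OF w]) (auto intro!: continuous_intros)
  ultimately show ?thesis unfolding case_prod_beta by (intro continuous_on_mult)
qed

lemma wavg_integrable:
  fixes \<phi> w :: "real \<Rightarrow> real" and x0 :: real
  assumes x0: "x0 \<in> {\<alpha>..\<omega>}" and \<phi>: "continuous_on {\<alpha>..\<omega>} \<phi>" and w: "continuous_on {0..1} w" and x: "x \<in> {\<alpha>..\<omega>}"
  shows "(\<lambda>t. w t * \<phi> (x0 + t * (x - x0))) integrable_on {0..1}"
proof -
  have "continuous_on {0..1} (\<lambda>t. \<phi> (x0 + t * (x - x0)))"
  proof (rule continuous_on_compose2[OF \<phi>])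
    show "(\<lambda>t. x0 + t * (x - x0)) ` {0..1} \<subseteq> {\<alpha>..\<omega>}"
      using segment_in_interval[OF x0 x] by (intro image_subsetI)
  qed (intro continuous_intros)
  then show ?thesis by (intro integrable_continuous_real continuous_on_mult w)
qed

lemma wavg_continuous:
  assumes "x0 \<in> {\<alpha>..\<omega>}" "continuous_on {\<alpha>..\<omega>} \<phi>" "continuous_on {0..1} w"
  shows "continuous_on {\<alpha>..\<omega>} (wavg w \<phi> x0)"
  unfolding wavg_def
  using integral_continuous_on_param[of "{\<alpha>..\<omega>}" 0 1 "\<lambda>x t. w t * \<phi> (x0 + t * (x - x0))"] wavg_continuous_param[OF assms]
  by simp

lemma wavg_deriv:
  assumes x0: "x0 \<in> {\<alpha>..\<omega>}"
    and \<phi>: "\<And>x. x \<in> {\<alpha>..\<omega>} \<Longrightarrow> (\<phi> has_real_derivative \<phi>1 x) (at x within {\<alpha>..\<omega>})"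
    and \<phi>1: "continuous_on {\<alpha>..\<omega>} \<phi>1" and w: "continuous_on {0..1} w" and x: "x \<in> {\<alpha>..\<omega>}"
  shows "(wavg w \<phi> x0 has_real_derivative wavg (\<lambda>t. t * w t) \<phi>1 x0 x) (at x within {\<alpha>..\<omega>})"
proof -
  have cont\<phi>: "continuous_on {\<alpha>..\<omega>} \<phi>" using \<phi> by (rule DERIV_continuous_on)
  have "((\<lambda>x. integral (cbox 0 1) (\<lambda>t. w t * \<phi> (x0 + t * (x - x0)))) has_field_derivative
      integral (cbox 0 1) (\<lambda>t. (t * w t) * \<phi>1 (x0 + t * (x - x0)))) (at x within {\<alpha>..\<omega>})"
  proof (rule leibniz_rule_field_derivative)
    fix y t :: real assume y: "y \<in> {\<alpha>..\<omega>}" and t: "t \<in> cbox 0 1"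
    have z: "x0 + t * (y - x0) \<in> {\<alpha>..\<omega>}" using segment_in_interval[OF x0 y] t by simp
    have "(\<phi> has_real_derivative \<phi>1 (x0 + t * (y - x0))) (at (x0 + t * (y - x0)) within (\<lambda>y. x0 + t * (y - x0)) ` {\<alpha>..\<omega>})"
      using segment_in_interval[OF x0] t by (intro has_field_derivative_subset[OF \<phi>[OF z]]) auto
    moreover have "((\<lambda>y. x0 + t * (y - x0)) has_real_derivative t) (at y within {\<alpha>..\<omega>})"
      by (auto intro!: derivative_eq_intros)
    ultimately have "(\<phi> \<circ> (\<lambda>y. x0 + t * (y - x0)) has_real_derivative \<phi>1 (x0 + t * (y - x0)) * t) (at y within {\<alpha>..\<omega>})"
      by (rule DERIV_image_chain)
    from DERIV_cmult[OF this, of "w t"]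
    show "((\<lambda>y. w t * \<phi> (x0 + t * (y - x0))) has_field_derivative t * w t * \<phi>1 (x0 + t * (y - x0))) (at y within {\<alpha>..\<omega>})"
      by (simp add: o_def mult_ac)
  next
    show "(\<lambda>t. w t * \<phi> (x0 + t * (y - x0))) integrable_on cbox 0 1" if "y \<in> {\<alpha>..\<omega>}" for y
      using wavg_integrable[OF x0 cont\<phi> w that] by simp
    show "continuous_on ({\<alpha>..\<omega>} \<times> cbox 0 1) (\<lambda>(x, t). t * w t * \<phi>1 (x0 + t * (x - x0)))"
      using wavg_continuous_param[OF x0 \<phi>1, of "\<lambda>t. t * w t"] w by (simp add: continuous_intros)
  qed (use x in auto)
  then show ?thesis unfolding wavg_def by simp
qed

lemma wavg_le:
  assumes x0: "x0 \<in> {\<alpha>..\<omega>}" and \<phi>: "continuous_on {\<alpha>..\<omega>} \<phi>" and w: "continuous_on {0..1} w"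
    and x: "x \<in> {\<alpha>..\<omega>}" and w01: "\<And>t. t \<in> {0..1} \<Longrightarrow> 0 \<le> w t \<and> w t \<le> 1"
    and B: "\<And>y. y \<in> {\<alpha>..\<omega>} \<Longrightarrow> \<bar>\<phi> y\<bar> \<le> B"
  shows "\<bar>wavg w \<phi> x0 x\<bar> \<le> B"
proof -
  have "norm (wavg w \<phi> x0 x) \<le> integral {0..1::real} (\<lambda>t. B)" unfolding wavg_def
  proof (rule integral_norm_bound_integral[OF wavg_integrable[OF x0 \<phi> w x] integrable_const_ivl])
    fix t :: real assume t: "t \<in> {0..1}"
    have "\<bar>w t\<bar> * \<bar>\<phi> (x0 + t * (x - x0))\<bar> \<le> 1 * B"
      using w01[OF t] B[OF segment_in_interval[OF x0 x t]] by (intro mult_mono) auto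
    then show "norm (w t * \<phi> (x0 + t * (x - x0))) \<le> B" by (simp add: abs_mult)
  qed
  then show ?thesis by simp
qed

lemma path_deriv:
  assumes x0: "x0 \<in> {\<alpha>..\<omega>}" and x: "x \<in> {\<alpha>..\<omega>}"
    and \<phi>: "\<And>x. x \<in> {\<alpha>..\<omega>} \<Longrightarrow> (\<phi> has_real_derivative \<phi>1 x) (at x within {\<alpha>..\<omega>})" and t: "t \<in> {0<..<1}"
  shows "((\<lambda>t. \<phi> (x0 + t * (x - x0))) has_real_derivative \<phi>1 (x0 + t * (x - x0)) * (x - x0)) (at t)"
proof -
  have z: "x0 + t * (x - x0) \<in> {\<alpha>..\<omega>}" using t by (intro segment_in_interval[OF x0 x]) auto
  have "(\<phi> has_real_derivative \<phi>1 (x0 + t * (x - x0))) (at (x0 + t * (x - x0)) within (\<lambda>t. x0 + t * (x - x0)) ` {0..1})"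
    using segment_in_interval[OF x0 x] by (intro has_field_derivative_subset[OF \<phi>[OF z]]) auto
  moreover have "((\<lambda>t. x0 + t * (x - x0)) has_real_derivative (x - x0)) (at t within {0..1})"
    by (auto intro!: derivative_eq_intros)
  ultimately have "(\<phi> \<circ> (\<lambda>t. x0 + t * (x - x0)) has_real_derivative \<phi>1 (x0 + t * (x - x0)) * (x - x0)) (at t within {0..1})"
    by (rule DERIV_image_chain)
  moreover have "at t within {0..1} = at t" using t by (intro at_within_interior) auto
  ultimately show ?thesis by (simp add: o_def)
qed

lemma sqrt_weight_deriv: "t > 0 \<Longrightarrow> ((\<lambda>t. t * sqrt t) has_real_derivative 3 / 2 * sqrt t) (at t)"
proof -
  assume t: "t > 0"
  have "((\<lambda>t. t * sqrt t) has_real_derivative 1 * sqrt t + (inverse (sqrt t) / 2) * t) (at t)"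
    using t by (intro DERIV_mult DERIV_ident DERIV_real_sqrt)
  moreover have "1 * sqrt t + (inverse (sqrt t) / 2) * t = 3 / 2 * sqrt t"
  proof -
    have "(inverse (sqrt t) / 2) * t = (t / sqrt t) / 2" by (simp add: field_simps)
    also have "t / sqrt t = sqrt t" using t by (intro real_div_sqrt) simp
    finally show ?thesis by simp
  qed
  ultimately show ?thesis by simp
qed

text \<open>
  Integration by parts in \<open>t\<close>, or equivalently the derivative of the identity
  \<open>(x - x0)\<^sup>3\<^sup>/\<^sup>2 wavg sqrt \<phi> x0 x = \<integral> (y - x0)\<^sup>1\<^sup>/\<^sup>2 \<phi>(y) dy\<close>, freed of the singular factor.
\<close>

lemma wavg_sqrt_identity:
  assumes x0: "x0 \<in> {\<alpha>..\<omega>}" and x: "x \<in> {\<alpha>..\<omega>}"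
    and \<phi>: "\<And>x. x \<in> {\<alpha>..\<omega>} \<Longrightarrow> (\<phi> has_real_derivative \<phi>1 x) (at x within {\<alpha>..\<omega>})" and \<phi>1: "continuous_on {\<alpha>..\<omega>} \<phi>1"
  shows "(x - x0) * wavg (\<lambda>t. t * sqrt t) \<phi>1 x0 x + 3 / 2 * wavg sqrt \<phi> x0 x = \<phi> x" (is "?I = _")
proof -
  have cont\<phi>: "continuous_on {\<alpha>..\<omega>} \<phi>" using \<phi> by (rule DERIV_continuous_on)
  define F where "F = (\<lambda>t. t * sqrt t * \<phi> (x0 + t * (x - x0)))"
  have "((\<lambda>t. (x - x0) * (t * sqrt t * \<phi>1 (x0 + t * (x - x0))) + 3 / 2 * (sqrt t * \<phi> (x0 + t * (x - x0)))) has_integral (F 1 - F 0)) {0..1}"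
  proof (rule fundamental_theorem_of_calculus_interior)
    show "continuous_on {0..1} F" unfolding F_def
      by (intro continuous_on_mult continuous_on_compose2[OF cont\<phi>] continuous_on_real_sqrt continuous_on_id continuous_on_add continuous_on_const)
         (use segment_in_interval[OF x0 x] in \<open>auto simp del: atLeastAtMost_iff\<close>)
    fix t :: real assume t: "t \<in> {0<..<1}"
    from DERIV_mult[OF sqrt_weight_deriv[of t] path_deriv[OF x0 x \<phi> t]] t
    show "(F has_vector_derivative (x - x0) * (t * sqrt t * \<phi>1 (x0 + t * (x - x0))) + 3 / 2 * (sqrt t * \<phi> (x0 + t * (x - x0)))) (at t)"
      unfolding F_def has_real_derivative_iff_has_vector_derivative[symmetric] by (simp add: algebra_simps)
  qed simp
  moreover have "((\<lambda>t. (x - x0) * (t * sqrt t * \<phi>1 (x0 + t * (x - x0))) + 3 / 2 * (sqrt t * \<phi> (x0 + t * (x - x0)))) has_integral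
     ((x - x0) * wavg (\<lambda>t. t * sqrt t) \<phi>1 x0 x + 3 / 2 * wavg sqrt \<phi> x0 x)) {0..1}"
    unfolding wavg_def
    by (intro has_integral_add has_integral_mult_right integrable_integral wavg_integrable[OF x0 \<phi>1 _ x] wavg_integrable[OF x0 cont\<phi> _ x] continuous_intros)
  ultimately have "F 1 - F 0 = ?I" by (rule has_integral_unique)
  then show ?thesis unfolding F_def by simp
qed

text \<open>
  Hadamard's lemma.
\<close>

lemma wavg_hadamard:
  assumes x0: "x0 \<in> {\<alpha>..\<omega>}" and x: "x \<in> {\<alpha>..\<omega>}"
    and g: "\<And>x. x \<in> {\<alpha>..\<omega>} \<Longrightarrow> (g has_real_derivative g1 x) (at x within {\<alpha>..\<omega>})" and g1: "continuous_on {\<alpha>..\<omega>} g1"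
  shows "g x - g x0 = (x - x0) * wavg (\<lambda>_. 1) g1 x0 x" (is "_ = ?I")
proof -
  have contg: "continuous_on {\<alpha>..\<omega>} g" using g by (rule DERIV_continuous_on)
  define F where "F = (\<lambda>t. g (x0 + t * (x - x0)))"
  have "((\<lambda>t. (x - x0) * (1 * g1 (x0 + t * (x - x0)))) has_integral (F 1 - F 0)) {0..1}"
  proof (rule fundamental_theorem_of_calculus_interior)
    show "continuous_on {0..1} F" unfolding F_def
      by (intro continuous_on_mult continuous_on_compose2[OF contg] continuous_on_id continuous_on_add continuous_on_const)
         (use segment_in_interval[OF x0 x] in \<open>auto simp del: atLeastAtMost_iff\<close>)
    fix t :: real assume t: "t \<in> {0<..<1}"
    from path_deriv[OF x0 x g t]
    show "(F has_vector_derivative (x - x0) * (1 * g1 (x0 + t * (x - x0)))) (at t)"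
      unfolding F_def has_real_derivative_iff_has_vector_derivative[symmetric] by (simp add: mult.commute)
  qed simp
  moreover have "((\<lambda>t. (x - x0) * (1 * g1 (x0 + t * (x - x0)))) has_integral ((x - x0) * wavg (\<lambda>_. 1) g1 x0 x)) {0..1}"
    unfolding wavg_def
    by (intro has_integral_mult_right integrable_integral wavg_integrable[OF x0 g1 _ x] continuous_intros)
  ultimately have "F 1 - F 0 = ?I" by (rule has_integral_unique)
  then show ?thesis unfolding F_def by simp
qed

lemma abs_ln_le:
  fixes y :: real
  assumes "0 < a" "a \<le> y" "y \<le> b"
  shows "\<bar>ln y\<bar> \<le> \<bar>ln a\<bar> + \<bar>ln b\<bar>"
proof -
  have "ln a \<le> ln y" "ln y \<le> ln b" using assms by (auto intro: ln_mono)
  then show ?thesis by linarith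
qed

text \<open>
  Write \<open>g x - g x0 = (x - x0) p x\<close> with \<open>p \<ge> m\<close> the average of \<open>g'\<close>, and \<open>P = sqrt p\<close>. The equation
  \<open>\<gamma> \<gamma>'\<^sup>2 = g - g x0\<close> says that \<open>2/3 \<gamma>\<^sup>3\<^sup>/\<^sup>2\<close> is a primitive of \<open>sqrt (g - g x0)\<close>. Substituting the average
  form gives \<open>\<gamma> = (x - x0) J\<^sup>2\<^sup>/\<^sup>3\<close> with \<open>J = 3/2 wavg sqrt P x0\<close>, hence \<open>\<gamma>' = P J\<^sup>-\<^sup>1\<^sup>/\<^sup>3\<close>. Here \<open>P\<close> and \<open>J\<close> are
  bounded away from 0 and twice differentiable, which is why \<open>g\<close> needs three derivatives, and every bound is
  uniform in \<open>x0\<close>.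
\<close>

lemma turning_point_normal_form:
  fixes g g1 g2 g3 :: "real \<Rightarrow> real"
  assumes \<alpha>\<omega>: "\<alpha> \<le> \<omega>" and m: "m > 0"
    and g: "\<And>x. x \<in> {\<alpha>..\<omega>} \<Longrightarrow> (g has_real_derivative g1 x) (at x within {\<alpha>..\<omega>})"
      "\<And>x. x \<in> {\<alpha>..\<omega>} \<Longrightarrow> (g1 has_real_derivative g2 x) (at x within {\<alpha>..\<omega>})"
      "\<And>x. x \<in> {\<alpha>..\<omega>} \<Longrightarrow> (g2 has_real_derivative g3 x) (at x within {\<alpha>..\<omega>})"
      "continuous_on {\<alpha>..\<omega>} g3"
    and g1m: "\<And>x. x \<in> {\<alpha>..\<omega>} \<Longrightarrow> g1 x \<ge> m"
  shows "\<exists>K. \<forall>x0\<in>{\<alpha>..\<omega>}. \<exists>\<gamma> l l1 l2. \<gamma> x0 = 0 \<and> continuous_on {\<alpha>..\<omega>} l2 \<and>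
    (\<forall>x\<in>{\<alpha>..\<omega>}. (\<gamma> has_real_derivative exp (l x)) (at x within {\<alpha>..\<omega>}) \<and>
       (l has_real_derivative l1 x) (at x within {\<alpha>..\<omega>}) \<and> (l1 has_real_derivative l2 x) (at x within {\<alpha>..\<omega>}) \<and>
       \<bar>l x\<bar> \<le> K \<and> \<bar>l1 x\<bar> \<le> K \<and> \<bar>l2 x\<bar> \<le> K \<and> \<gamma> x * (exp (l x))\<^sup>2 = g x - g x0)"
proof -
  let ?N = "{\<alpha>..\<omega>}"
  have cont: "continuous_on ?N g1" "continuous_on ?N g2"
    by (rule DERIV_continuous_on[OF g(2)], assumption) (rule DERIV_continuous_on[OF g(3)], assumption)
  have bnd: "\<exists>M. \<forall>x\<in>?N. \<bar>f x\<bar> \<le> M" if "continuous_on ?N f" for f :: "real \<Rightarrow> real"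
    using compact_imp_bounded[OF compact_continuous_image[OF that compact_Icc]] unfolding bounded_iff by auto
  obtain M1 where M1: "\<And>x. x \<in> ?N \<Longrightarrow> \<bar>g1 x\<bar> \<le> M1" using bnd[OF cont(1)] by blast
  obtain M2 where M2: "\<And>x. x \<in> ?N \<Longrightarrow> \<bar>g2 x\<bar> \<le> M2" using bnd[OF cont(2)] by blast
  obtain M3 where M3: "\<And>x. x \<in> ?N \<Longrightarrow> \<bar>g3 x\<bar> \<le> M3" using bnd[OF g(4)] by blast
  have \<alpha>N: "\<alpha> \<in> ?N" using \<alpha>\<omega> by simp
  have M0: "M1 \<ge> m" "M2 \<ge> 0" "M3 \<ge> 0" using M1[OF \<alpha>N] M2[OF \<alpha>N] M3[OF \<alpha>N] g1m[OF \<alpha>N] by linarith+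
  define r where "r = sqrt m"
  define R where "R = sqrt M1"
  have r: "r > 0" "r \<le> R" unfolding r_def R_def using m M0 by auto
  define B1 where "B1 = M2 / (2 * r)"
  define B2 where "B2 = (M3 + 2 * B1\<^sup>2) / (2 * r)"
  have B: "B1 \<ge> 0" "B2 \<ge> 0" unfolding B1_def B2_def using M0 r by auto
  define C1 where "C1 = 3/2 * B1"
  define C2 where "C2 = 3/2 * B2"
  define K0 where "K0 = (\<bar>ln r\<bar> + \<bar>ln R\<bar>) + (\<bar>ln r\<bar> + \<bar>ln (3/2 * R)\<bar>)"
  define K1 where "K1 = B1 / r + C1 / r"
  define K2 where "K2 = (B2 / r + (B1 / r)\<^sup>2) + (C2 / r + (C1 / r)\<^sup>2)"
  have K: "K0 \<ge> 0" "K1 \<ge> 0" "K2 \<ge> 0" unfolding K0_def K1_def K2_def C1_def C2_def using B r by auto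
  show ?thesis
  proof (intro exI[of _ "K0 + K1 + K2"] ballI)
    fix x0 assume x0: "x0 \<in> ?N"
    define p where "p = wavg (\<lambda>_. 1) g1 x0"
    define p1 where "p1 = wavg (\<lambda>t. t) g2 x0"
    define p2 where "p2 = wavg (\<lambda>t. t * t) g3 x0"
    have p': "(p has_real_derivative p1 x) (at x within ?N)" if "x \<in> ?N" for x
      unfolding p_def p1_def using wavg_deriv[OF x0 g(2) cont(2) _ that, of "\<lambda>_. 1"] by simp
    have p1': "(p1 has_real_derivative p2 x) (at x within ?N)" if "x \<in> ?N" for x
      unfolding p1_def p2_def using wavg_deriv[OF x0 g(3) g(4) _ that, of "\<lambda>t. t"] by simp
    have p2c: "continuous_on ?N p2" unfolding p2_def by (intro wavg_continuous x0 g(4) continuous_intros)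
    have p1b: "\<bar>p1 x\<bar> \<le> M2" and p2b: "\<bar>p2 x\<bar> \<le> M3" and pb: "\<bar>p x\<bar> \<le> M1" if "x \<in> ?N" for x
      unfolding p_def p1_def p2_def
      by (rule wavg_le[OF x0 _ _ that]; auto intro!: cont g(4) continuous_intros M1 M2 M3 mult_le_one)+
    have pm: "p x \<ge> m" if x: "x \<in> ?N" for x
    proof -
      have "m = integral {0..1::real} (\<lambda>t. m)" by simp
      also have "\<dots> \<le> p x" unfolding p_def wavg_def
        by (intro integral_le integrable_const_ivl wavg_integrable[OF x0 cont(1) _ x] continuous_intros)
           (use g1m segment_in_interval[OF x0 x] in auto)
      finally show ?thesis .
    qed
    define P where "P = (\<lambda>x. sqrt (p x))"
    have Pr: "P x \<ge> r" "P x \<le> R" "P x > 0" "P x * P x = p x" if "x \<in> ?N" for x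
    proof -
      have "0 < p x" using pm[OF that] m by linarith
      then show "P x > 0" "P x * P x = p x" unfolding P_def by auto
      show "P x \<ge> r" "P x \<le> R" unfolding P_def r_def R_def using pm[OF that] pb[OF that] by auto
    qed
    define P1 where "P1 = (\<lambda>x. p1 x / (2 * P x))"
    define P2 where "P2 = (\<lambda>x. (p2 x - 2 * (P1 x)\<^sup>2) / (2 * P x))"
    have P': "(P has_real_derivative P1 x) (at x within ?N)" if x: "x \<in> ?N" for x
    proof -
      have "p x > 0" using pm[OF x] m by linarith
      then have "(sqrt has_real_derivative inverse (sqrt (p x)) / 2) (at (p x) within p ` ?N)"
        by (rule has_field_derivative_at_within[OF DERIV_real_sqrt])
      from DERIV_image_chain[OF this p'[OF x]]
      have "(sqrt \<circ> p has_real_derivative inverse (sqrt (p x)) / 2 * p1 x) (at x within ?N)" .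
      moreover have "inverse (sqrt (p x)) / 2 * p1 x = P1 x" unfolding P1_def P_def by (simp add: field_simps)
      moreover have "sqrt \<circ> p = P" unfolding P_def o_def ..
      ultimately show ?thesis by simp
    qed
    have P1': "(P1 has_real_derivative P2 x) (at x within ?N)" if x: "x \<in> ?N" for x
    proof -
      have "(P1 has_real_derivative (p2 x * (2 * P x) - p1 x * (2 * P1 x)) / (2 * P x * (2 * P x))) (at x within ?N)"
        unfolding P1_def[abs_def] using Pr(3)[OF x]
        by (intro DERIV_divide p1'[OF x] DERIV_cmult P'[OF x, unfolded P1_def]) simp
      moreover have e: "p1 x = 2 * P x * P1 x" unfolding P1_def using Pr(3)[OF x] by simp
      have num: "p2 x * (2 * P x) - p1 x * (2 * P1 x) = (2 * P x) * (p2 x - 2 * (P1 x)\<^sup>2)"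
        unfolding e by (simp add: algebra_simps power2_eq_square)
      moreover have "(p2 x * (2 * P x) - p1 x * (2 * P1 x)) / (2 * P x * (2 * P x)) = P2 x"
      proof -
        have "2 * P x \<noteq> 0" using Pr(3)[OF x] by simp
        then show ?thesis unfolding P2_def num by (rule mult_divide_mult_cancel_left)
      qed
      ultimately show ?thesis by simp
    qed
    have contP: "continuous_on ?N P" "continuous_on ?N P1"
      by (rule DERIV_continuous_on[OF P'], assumption) (rule DERIV_continuous_on[OF P1'], assumption)
    have P2c: "continuous_on ?N P2" unfolding P2_def
      by (intro continuous_intros p2c contP) (use Pr(3) in force)
    have P1b: "\<bar>P1 x\<bar> \<le> B1" if x: "x \<in> ?N" for x
      unfolding P1_def B1_def abs_divide using p1b[OF x] Pr(1,3)[OF x] r by (intro frac_le) auto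
    have P2b: "\<bar>P2 x\<bar> \<le> B2" if x: "x \<in> ?N" for x
      unfolding P2_def B2_def abs_divide
    proof (rule frac_le)
      have "(P1 x)\<^sup>2 \<le> B1\<^sup>2" using P1b[OF x] by (metis abs_le_square_iff abs_of_nonneg B(1))
      then show "\<bar>p2 x - 2 * (P1 x)\<^sup>2\<bar> \<le> M3 + 2 * B1\<^sup>2" using p2b[OF x] zero_le_power2[of "P1 x"] by linarith
    qed (use Pr(1,3)[OF x] r M0 in auto)
    define J where "J = (\<lambda>x. 3/2 * wavg sqrt P x0 x)"
    define J1 where "J1 = (\<lambda>x. 3/2 * wavg (\<lambda>t. t * sqrt t) P1 x0 x)"
    define J2 where "J2 = (\<lambda>x. 3/2 * wavg (\<lambda>t. t * (t * sqrt t)) P2 x0 x)"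
    have J': "(J has_real_derivative J1 x) (at x within ?N)" if "x \<in> ?N" for x
      unfolding J_def J1_def by (intro DERIV_cmult wavg_deriv x0 P' contP that continuous_intros)
    have J1': "(J1 has_real_derivative J2 x) (at x within ?N)" if "x \<in> ?N" for x
      unfolding J1_def J2_def by (intro DERIV_cmult wavg_deriv x0 P1' P2c that continuous_intros)
    have J2c: "continuous_on ?N J2" unfolding J2_def by (intro continuous_intros wavg_continuous x0 P2c)
    have sq1: "sqrt t \<le> 1" if "t \<in> {0..1}" for t :: real using that by simp
    have Jb: "J x \<le> 3/2 * R" "\<bar>J1 x\<bar> \<le> C1" "\<bar>J2 x\<bar> \<le> C2" if x: "x \<in> ?N" for x
    proof -
      have "\<bar>wavg sqrt P x0 x\<bar> \<le> R"
        by (rule wavg_le[OF x0 contP(1) _ x]) (use Pr in \<open>auto intro!: continuous_intros simp: less_imp_le\<close>)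
      then show "J x \<le> 3/2 * R" unfolding J_def by linarith
      have "\<bar>wavg (\<lambda>t. t * sqrt t) P1 x0 x\<bar> \<le> B1"
        by (rule wavg_le[OF x0 contP(2) _ x]) (auto intro!: continuous_intros mult_le_one P1b)
      then show "\<bar>J1 x\<bar> \<le> C1" unfolding J1_def C1_def by linarith
      have "\<bar>wavg (\<lambda>t. t * (t * sqrt t)) P2 x0 x\<bar> \<le> B2"
        by (rule wavg_le[OF x0 P2c _ x]) (auto intro!: continuous_intros mult_le_one P2b)
      then show "\<bar>J2 x\<bar> \<le> C2" unfolding J2_def C2_def by linarith
    qed
    have Jr: "J x \<ge> r" if x: "x \<in> ?N" for x
    proof -
      have "3/2 * wavg sqrt (\<lambda>_. r) x0 x = r"
        using wavg_sqrt_identity[OF x0 x, of "\<lambda>_. r" "\<lambda>_. 0"] by (simp add: wavg_def)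
      moreover have "wavg sqrt (\<lambda>_. r) x0 x \<le> wavg sqrt P x0 x" unfolding wavg_def
        by (intro integral_le wavg_integrable[OF x0 _ _ x] wavg_integrable[OF x0 contP(1) _ x] continuous_intros mult_left_mono Pr segment_in_interval[OF x0 x]) auto
      ultimately show ?thesis unfolding J_def by linarith
    qed
    \<comment> \<open>The differential equation for \<open>J\<close> that makes \<open>\<gamma>\<close> have the right derivative.\<close>
    have ident: "J x + 2/3 * ((x - x0) * J1 x) = P x" if x: "x \<in> ?N" for x
      using wavg_sqrt_identity[OF x0 x P' contP(2)] unfolding J_def J1_def by simp
    define l where "l = (\<lambda>x. ln (P x) - ln (J x) / 3)"
    define l1 where "l1 = (\<lambda>x. P1 x / P x - J1 x / J x / 3)"
    define l2 where "l2 = (\<lambda>x. (P2 x / P x - (P1 x / P x)\<^sup>2) - (J2 x / J x - (J1 x / J x)\<^sup>2) / 3)"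
    define \<gamma> where "\<gamma> = (\<lambda>x. (x - x0) * exp (2/3 * ln (J x)))"
    have ln_within: "((\<lambda>x. ln (f x)) has_real_derivative f' / f x) (at x within ?N)"
      if "(f has_real_derivative f') (at x within ?N)" "f x > 0" for f f' x
    proof -
      have "(ln has_real_derivative inverse (f x)) (at (f x) within f ` ?N)"
        using that(2) by (rule has_field_derivative_at_within[OF DERIV_ln])
      from DERIV_image_chain[OF this that(1)] show ?thesis by (simp add: o_def divide_inverse mult.commute)
    qed
    have quot: "((\<lambda>x. f1 x / f x) has_real_derivative f2 / f x - (f1 x / f x)\<^sup>2) (at x within ?N)"
      if "(f has_real_derivative f1 x) (at x within ?N)" "(f1 has_real_derivative f2) (at x within ?N)" "f x > 0" for f f1 f2 x
    proof -
      have "((\<lambda>x. f1 x / f x) has_real_derivative (f2 * f x - f1 x * f1 x) / (f x * f x)) (at x within ?N)"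
        using that by (intro DERIV_divide) auto
      moreover have "(f2 * f x - f1 x * f1 x) / (f x * f x) = f2 / f x - (f1 x / f x)\<^sup>2"
        using that(3) by (simp add: diff_divide_distrib power2_eq_square)
      ultimately show ?thesis by simp
    qed
    have J0: "J x > 0" if "x \<in> ?N" for x using Jr[OF that] r by linarith
    have l': "(l has_real_derivative l1 x) (at x within ?N)" if x: "x \<in> ?N" for x
      unfolding l_def l1_def by (intro DERIV_diff DERIV_cdivide ln_within P' J' x Pr J0)
    have l1': "(l1 has_real_derivative l2 x) (at x within ?N)" if x: "x \<in> ?N" for x
      unfolding l1_def l2_def by (intro DERIV_diff DERIV_cdivide quot P' J' P1' J1' x Pr J0)
    have expl: "exp (l x) = P x * exp (2/3 * ln (J x)) / J x" if x: "x \<in> ?N" for x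
    proof -
      have e: "l x = ln (P x) + 2/3 * ln (J x) - ln (J x)" unfolding l_def by simp
      show ?thesis unfolding e exp_diff exp_add exp_ln[OF Pr(3)[OF x]] exp_ln[OF J0[OF x]] ..
    qed
    have \<gamma>': "(\<gamma> has_real_derivative exp (l x)) (at x within ?N)" if x: "x \<in> ?N" for x
    proof -
      have "((\<lambda>x. exp (2/3 * ln (J x))) has_real_derivative exp (2/3 * ln (J x)) * (2/3 * (J1 x / J x))) (at x within ?N)"
        by (rule DERIV_chain2[where f = exp, OF DERIV_exp DERIV_cmult[OF ln_within[OF J'[OF x] J0[OF x]]]])
      from DERIV_mult[OF DERIV_diff[OF DERIV_ident DERIV_const] this, of x0]
      have "(\<gamma> has_real_derivative exp (2/3 * ln (J x)) + exp (2/3 * ln (J x)) * (2/3 * (J1 x / J x)) * (x - x0)) (at x within ?N)"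
        unfolding \<gamma>_def by simp
      moreover have "exp (2/3 * ln (J x)) + exp (2/3 * ln (J x)) * (2/3 * (J1 x / J x)) * (x - x0)
          = (J x + 2/3 * ((x - x0) * J1 x)) * exp (2/3 * ln (J x)) / J x"
      proof -
        have "(J x + 2/3 * ((x - x0) * J1 x)) * exp (2/3 * ln (J x)) / J x
            = exp (2/3 * ln (J x)) * ((J x + 2/3 * ((x - x0) * J1 x)) / J x)" by simp
        also have "(J x + 2/3 * ((x - x0) * J1 x)) / J x = 1 + 2/3 * (J1 x / J x) * (x - x0)"
          using J0[OF x] by (simp add: add_divide_distrib)
        finally show ?thesis by (simp add: algebra_simps)
      qed
      ultimately show ?thesis unfolding expl[OF x] ident[OF x] by simp
    qed
    have rel: "\<gamma> x * (exp (l x))\<^sup>2 = g x - g x0" if x: "x \<in> ?N" for x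
    proof -
      have "exp (2/3 * ln (J x)) * (exp (l x))\<^sup>2 = exp (2/3 * ln (J x) + 2 * l x)"
        by (simp add: exp_add exp_double)
      also have "2/3 * ln (J x) + 2 * l x = 2 * ln (P x)" unfolding l_def by simp
      also have "exp (2 * ln (P x)) = p x" using Pr(3,4)[OF x] by (simp add: exp_double power2_eq_square)
      finally have e: "exp (2/3 * ln (J x)) * (exp (l x))\<^sup>2 = p x" .
      have "g x - g x0 = (x - x0) * p x" unfolding p_def by (rule wavg_hadamard[OF x0 x _ cont(1)]) (rule g(1))
      then show ?thesis unfolding \<gamma>_def mult.assoc e by simp
    qed
    have l2c: "continuous_on ?N l2" unfolding l2_def
      by (intro continuous_intros contP P2c J2c DERIV_continuous_on[OF J'] DERIV_continuous_on[OF J1']) (use Pr(3) J0 in force)+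
    have quotb: "\<bar>a / b\<bar> \<le> A / r" if "\<bar>a\<bar> \<le> A" "b \<ge> r" for a b A
      unfolding abs_divide using that r by (intro frac_le) auto
    have lb: "\<bar>l x\<bar> \<le> K0" if x: "x \<in> ?N" for x
    proof -
      have "\<bar>ln (P x)\<bar> \<le> \<bar>ln r\<bar> + \<bar>ln R\<bar>" using Pr[OF x] r by (intro abs_ln_le) auto
      moreover have "\<bar>ln (J x)\<bar> \<le> \<bar>ln r\<bar> + \<bar>ln (3/2 * R)\<bar>" using Jb(1)[OF x] Jr[OF x] r by (intro abs_ln_le) auto
      ultimately show ?thesis unfolding l_def K0_def by linarith
    qed
    have lin1: "\<bar>a - b / 3\<bar> \<le> A + B" if "\<bar>a\<bar> \<le> A" "\<bar>b\<bar> \<le> B" for a b A B :: real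
      using that by linarith
    have lin2: "\<bar>(a - s) - (b - t) / 3\<bar> \<le> (A + S) + (B + T)"
      if "\<bar>a\<bar> \<le> A" "\<bar>b\<bar> \<le> B" "0 \<le> s" "s \<le> S" "0 \<le> t" "t \<le> T" for a b s t A B S T :: real
    proof (rule lin1)
      show "\<bar>a - s\<bar> \<le> A + S" "\<bar>b - t\<bar> \<le> B + T" using that by linarith+
    qed
    have l1b: "\<bar>l1 x\<bar> \<le> K1" if x: "x \<in> ?N" for x
      unfolding l1_def K1_def
      by (intro lin1 quotb[OF P1b[OF x] Pr(1)[OF x]] quotb[OF Jb(2)[OF x] Jr[OF x]])
    have l2b: "\<bar>l2 x\<bar> \<le> K2" if x: "x \<in> ?N" for x
    proof -
      have "(P1 x / P x)\<^sup>2 \<le> (B1 / r)\<^sup>2" "(J1 x / J x)\<^sup>2 \<le> (C1 / r)\<^sup>2"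
        using quotb[OF P1b[OF x] Pr(1)[OF x]] quotb[OF Jb(2)[OF x] Jr[OF x]]
        by (metis abs_le_square_iff abs_ge_zero abs_of_nonneg order_trans)+
      then show ?thesis unfolding l2_def K2_def
        by (intro lin2 quotb[OF P2b[OF x] Pr(1)[OF x]] quotb[OF Jb(3)[OF x] Jr[OF x]] zero_le_power2)
    qed
    show "\<exists>\<gamma> l l1 l2. \<gamma> x0 = 0 \<and> continuous_on ?N l2 \<and>
      (\<forall>x\<in>?N. (\<gamma> has_real_derivative exp (l x)) (at x within ?N) \<and>
       (l has_real_derivative l1 x) (at x within ?N) \<and> (l1 has_real_derivative l2 x) (at x within ?N) \<and>
       \<bar>l x\<bar> \<le> K0 + K1 + K2 \<and> \<bar>l1 x\<bar> \<le> K0 + K1 + K2 \<and> \<bar>l2 x\<bar> \<le> K0 + K1 + K2 \<and> \<gamma> x * (exp (l x))\<^sup>2 = g x - g x0)"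
    proof (rule exI[of _ \<gamma>], rule exI[of _ l], rule exI[of _ l1], rule exI[of _ l2], intro conjI ballI)
      show "\<gamma> x0 = 0" unfolding \<gamma>_def by simp
      show "continuous_on ?N l2" by (rule l2c)
      fix x assume x: "x \<in> ?N"
      show "\<bar>l x\<bar> \<le> K0 + K1 + K2" "\<bar>l1 x\<bar> \<le> K0 + K1 + K2" "\<bar>l2 x\<bar> \<le> K0 + K1 + K2"
        using lb[OF x] l1b[OF x] l2b[OF x] K by linarith+
    qed (auto intro: \<gamma>' l' l1' rel)
  qed
qed

section \<open>Charts for the Liouville map\<close>

text \<open>
  The odd antiderivative of \<open>sqrt |y|\<close>. Working with absolute values lets both sides of a turning point
  be treated at once.
\<close>

definition pow32 :: "real \<Rightarrow> real" where "pow32 y = 2/3 * (y * sqrt \<bar>y\<bar>)"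

lemma pow32_deriv: "(pow32 has_real_derivative sqrt \<bar>y\<bar>) (at y)"
proof -
  consider "y > 0" | "y < 0" | "y = 0" by linarith
  then show ?thesis
  proof cases
    case 1
    have "((\<lambda>y. 2/3 * (y * sqrt y)) has_real_derivative 2/3 * (3/2 * sqrt y)) (at y)"
      by (rule DERIV_cmult[OF sqrt_weight_deriv[OF 1]])
    then have "((\<lambda>y. 2/3 * (y * sqrt y)) has_real_derivative sqrt \<bar>y\<bar>) (at y)" using 1 by simp
    then show ?thesis
      by (rule has_field_derivative_transform_within_open[of _ _ _ "{0<..}"]) (use 1 in \<open>auto simp: pow32_def\<close>)
  next
    case 2
    have "((\<lambda>y. 2/3 * (-y * sqrt (-y))) has_real_derivative 2/3 * (3/2 * sqrt (-y) * (-1))) (at y)"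
      using 2 by (intro DERIV_cmult DERIV_chain2[OF sqrt_weight_deriv[of "-y"] DERIV_minus[OF DERIV_ident]]) simp
    from DERIV_minus[OF this] have "((\<lambda>y. 2/3 * (y * sqrt (-y))) has_real_derivative sqrt \<bar>y\<bar>) (at y)" using 2 by simp
    then show ?thesis
      by (rule has_field_derivative_transform_within_open[of _ _ _ "{..<0}"]) (use 2 in \<open>auto simp: pow32_def\<close>)
  next
    case 3
    have "(\<lambda>h. (pow32 (0 + h) - pow32 0) / h) \<midarrow>0\<rightarrow> 0"
    proof (rule Lim_transform_eventually)
      show "\<forall>\<^sub>F h in at 0. 2/3 * sqrt \<bar>h\<bar> = (pow32 (0 + h) - pow32 0) / h"
        by (auto simp: eventually_at_filter pow32_def)
      have "((\<lambda>h. 2/3 * sqrt \<bar>h\<bar>) \<longlongrightarrow> 2/3 * sqrt \<bar>0\<bar>) (at (0::real))" by (intro tendsto_intros)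
      then show "((\<lambda>h. 2/3 * sqrt \<bar>h\<bar>) \<longlongrightarrow> 0) (at (0::real))" by simp
    qed
    then show ?thesis using 3 by (simp add: DERIV_def)
  qed
qed

lemma strictly_increasing_of_deriv:
  fixes f f' :: "real \<Rightarrow> real"
  assumes ab: "a < b" and d: "\<And>x. x \<in> {a..b} \<Longrightarrow> (f has_real_derivative f' x) (at x)"
    and nn: "\<And>x. x \<in> {a..b} \<Longrightarrow> f' x \<ge> 0" and fin: "finite {x\<in>{a..b}. f' x = 0}"
  shows "f a < f b"
proof -
  have mono: "f x \<le> f y" if "a \<le> x" "x \<le> y" "y \<le> b" for x y
    using that by (intro DERIV_nonneg_imp_nondecreasing[of x y f]) (auto intro!: exI d nn)
  have "f a \<noteq> f b"
  proof
    assume eq: "f a = f b"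
    have const: "f x = f a" if "x \<in> {a..b}" for x
      using mono[of a x] mono[of x b] that eq by auto
    have "f' x = 0" if x: "x \<in> {a<..<b}" for x
    proof -
      have "((\<lambda>_. f a) has_real_derivative f' x) (at x)"
        by (rule has_field_derivative_transform_within_open[OF d[of x], of "{a<..<b}"]) (use x in \<open>auto intro: const\<close>)
      then show ?thesis by (rule DERIV_unique) simp
    qed
    then have "{a<..<b} \<subseteq> {x\<in>{a..b}. f' x = 0}" by auto
    then have "finite {a<..<b}" using fin by (rule finite_subset)
    then show False using ab infinite_Ioo[of a b] by simp
  qed
  with mono[of a b] ab show ?thesis by simp
qed

lemma pow32_less: "a < b \<Longrightarrow> pow32 a < pow32 b"
proof (rule strictly_increasing_of_deriv[of a b pow32 "\<lambda>y. sqrt \<bar>y\<bar>"])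
  have "{x \<in> {a..b}. sqrt \<bar>x\<bar> = 0} \<subseteq> {0}" by auto
  then show "finite {x \<in> {a..b}. sqrt \<bar>x\<bar> = 0}" by (rule finite_subset) simp
qed (auto intro: pow32_deriv)

lemma pow32_inj: "pow32 a = pow32 b \<Longrightarrow> a = b"
  using pow32_less[of a b] pow32_less[of b a] by (cases a b rule: linorder_cases) auto

lemma pow32_scale: "c \<ge> 0 \<Longrightarrow> pow32 (c * y) = c * sqrt c * pow32 y"
  unfolding pow32_def by (simp add: abs_mult real_sqrt_mult)

text \<open>
  The normal form coordinate \<open>\<gamma>\<close> is determined by a primitive \<open>H\<close> of \<open>sqrt |g|\<close>, and so can be
  compared with the other coordinates that are defined by primitives.
\<close>

lemma normal_form_antiderivative:
  fixes \<gamma> l g H :: "real \<Rightarrow> real"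
  assumes x0: "x0 \<in> {\<alpha>..\<omega>}" and x: "x \<in> {\<alpha>..\<omega>}" and \<gamma>0: "\<gamma> x0 = 0"
    and \<gamma>: "\<And>x. x \<in> {\<alpha>..\<omega>} \<Longrightarrow> (\<gamma> has_real_derivative exp (l x)) (at x within {\<alpha>..\<omega>})"
    and rel: "\<And>x. x \<in> {\<alpha>..\<omega>} \<Longrightarrow> \<gamma> x * (exp (l x))\<^sup>2 = g x"
    and H: "\<And>x. x \<in> {\<alpha>..\<omega>} \<Longrightarrow> (H has_real_derivative sqrt \<bar>g x\<bar>) (at x within {\<alpha>..\<omega>})"
  shows "pow32 (\<gamma> x) = H x - H x0"
proof -
  have "((\<lambda>x. pow32 (\<gamma> x) - H x) has_field_derivative 0) (at y within {\<alpha>..\<omega>})" if y: "y \<in> {\<alpha>..\<omega>}" for y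
  proof -
    have "(pow32 \<circ> \<gamma> has_real_derivative sqrt \<bar>\<gamma> y\<bar> * exp (l y)) (at y within {\<alpha>..\<omega>})"
      by (rule DERIV_image_chain[OF has_field_derivative_at_within[OF pow32_deriv] \<gamma>[OF y]])
    moreover have "sqrt \<bar>\<gamma> y\<bar> * exp (l y) = sqrt \<bar>g y\<bar>"
      unfolding rel[OF y, symmetric] by (simp add: abs_mult real_sqrt_mult)
    ultimately show ?thesis using DERIV_diff[OF _ H[OF y], of "pow32 \<circ> \<gamma>" "sqrt \<bar>g y\<bar>"] by (simp add: o_def)
  qed
  then have "\<exists>C. \<forall>y\<in>{\<alpha>..\<omega>}. pow32 (\<gamma> y) - H y = C"
    by (intro has_field_derivative_zero_constant convex_real_interval(5))
  then obtain C where C: "\<And>y. y \<in> {\<alpha>..\<omega>} \<Longrightarrow> pow32 (\<gamma> y) - H y = C" by blast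
  have "pow32 0 = 0" by (simp add: pow32_def)
  then show ?thesis using C[OF x] C[OF x0] \<gamma>0 by simp
qed

text \<open>
  The implicit function theorem when the solution \<open>\<zeta>\<close> is already known to be continuous.
\<close>

lemma implicit_derivative:
  fixes f \<zeta> g :: "real \<Rightarrow> real"
  assumes U: "open U" "x \<in> U" and rel: "\<And>y. y \<in> U \<Longrightarrow> f (\<zeta> y) = g y"
    and \<zeta>: "isCont \<zeta> x" and f: "(f has_real_derivative d) (at (\<zeta> x))" "d \<noteq> 0"
    and g: "(g has_real_derivative d') (at x)"
  shows "(\<zeta> has_real_derivative d' / d) (at x)"
proof -
  obtain F where F: "\<And>z. f z - f (\<zeta> x) = F z * (z - \<zeta> x)" "isCont F (\<zeta> x)" "F (\<zeta> x) = d"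
    using f(1) unfolding CARAT_DERIV by blast
  obtain H where H: "\<And>y. g y - g x = H y * (y - x)" "isCont H x" "H x = d'"
    using g unfolding CARAT_DERIV by blast
  have FC: "isCont (\<lambda>y. F (\<zeta> y)) x" using \<zeta> F(2) by (rule isCont_o2)
  have lim: "(\<lambda>y. H y / F (\<zeta> y)) \<midarrow>x\<rightarrow> d' / d"
    using isCont_divide[OF H(2) FC] F(3) H(3) f(2) by (simp add: isCont_def)
  have "\<forall>\<^sub>F y in at x. F (\<zeta> y) \<noteq> 0"
    using FC F(3) f(2) by (intro tendsto_imp_eventually_ne) (auto simp: isCont_def)
  moreover have "\<forall>\<^sub>F y in at x. y \<in> U" using U by (simp add: eventually_at_topological) blast
  ultimately have "\<forall>\<^sub>F y in at x. H y / F (\<zeta> y) = (\<zeta> y - \<zeta> x) / (y - x)"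
    using eventually_neq_at_within[of x x UNIV]
  proof eventually_elim
    case (elim y)
    have "F (\<zeta> y) * (\<zeta> y - \<zeta> x) = H y * (y - x)"
      using F(1)[of "\<zeta> y"] H(1)[of y] rel[OF elim(2)] rel[OF U(2)] by simp
    then show ?case using elim by (simp add: frac_eq_eq mult.commute)
  qed
  from Lim_transform_eventually[OF lim this] show ?thesis by (simp add: has_field_derivative_iff)
qed

text \<open>
  The local form of the desired property of the Liouville map for the function \<open>q\<close>, stated on a
  neighbourhood so that it can be verified in different charts.
\<close>

definition controlled_at :: "(real \<Rightarrow> real) \<Rightarrow> real \<Rightarrow> (real \<Rightarrow> real) \<Rightarrow> real \<Rightarrow> real \<Rightarrow> bool" where
  "controlled_at \<zeta> \<kappa> q K x \<longleftrightarrow> (\<exists>U L L1 L2. open U \<and> x \<in> U \<and> continuous_on U L2 \<and>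
     (\<forall>y\<in>U. (\<zeta> has_real_derivative exp (L y)) (at y) \<and> (L has_real_derivative L1 y) (at y) \<and>
        (L1 has_real_derivative L2 y) (at y) \<and> \<bar>L y\<bar> \<le> K \<and> \<bar>L1 y\<bar> \<le> K \<and> \<bar>L2 y\<bar> \<le> K \<and>
        \<kappa>\<^sup>2 * (exp (L y))\<^sup>2 * (1 - (\<zeta> y)\<^sup>2) = q y))"

text \<open>
  The local functions \<open>L\<close>, \<open>L1\<close>, \<open>L2\<close> are determined by \<open>\<zeta>\<close>, so they agree with \<open>ln \<zeta>'\<close> and its
  derivatives and glue together.
\<close>

lemma controlled_global:
  assumes D: "open D" and c: "\<And>x. x \<in> D \<Longrightarrow> controlled_at \<zeta> \<kappa> q K x"
  shows "\<exists>L L1 L2. continuous_on D L2 \<and> (\<forall>y\<in>D. (\<zeta> has_real_derivative exp (L y)) (at y) \<and> (L has_real_derivative L1 y) (at y) \<and>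
        (L1 has_real_derivative L2 y) (at y) \<and> \<bar>L y\<bar> \<le> K \<and> \<bar>L1 y\<bar> \<le> K \<and> \<bar>L2 y\<bar> \<le> K \<and>
        \<kappa>\<^sup>2 * (exp (L y))\<^sup>2 * (1 - (\<zeta> y)\<^sup>2) = q y)"
proof -
  define L where "L = (\<lambda>x. ln (deriv \<zeta> x))"
  define L1 where "L1 = deriv L"
  define L2 where "L2 = deriv L1"
  have main: "isCont L2 x \<and> (\<zeta> has_real_derivative exp (L x)) (at x) \<and> (L has_real_derivative L1 x) (at x) \<and>
        (L1 has_real_derivative L2 x) (at x) \<and> \<bar>L x\<bar> \<le> K \<and> \<bar>L1 x\<bar> \<le> K \<and> \<bar>L2 x\<bar> \<le> K \<and>
        \<kappa>\<^sup>2 * (exp (L x))\<^sup>2 * (1 - (\<zeta> x)\<^sup>2) = q x" if x: "x \<in> D" for x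
  proof -
    obtain U M M1 M2 where U: "open U" "x \<in> U" "continuous_on U M2"
      and M: "\<And>y. y \<in> U \<Longrightarrow> (\<zeta> has_real_derivative exp (M y)) (at y)"
        "\<And>y. y \<in> U \<Longrightarrow> (M has_real_derivative M1 y) (at y)"
        "\<And>y. y \<in> U \<Longrightarrow> (M1 has_real_derivative M2 y) (at y)"
      and bd: "\<And>y. y \<in> U \<Longrightarrow> \<bar>M y\<bar> \<le> K \<and> \<bar>M1 y\<bar> \<le> K \<and> \<bar>M2 y\<bar> \<le> K \<and> \<kappa>\<^sup>2 * (exp (M y))\<^sup>2 * (1 - (\<zeta> y)\<^sup>2) = q y"
      using c[OF x] unfolding controlled_at_def by metis
    have L: "L y = M y" if "y \<in> U" for y unfolding L_def using DERIV_imp_deriv[OF M(1)[OF that]] by simp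
    have dL: "(L has_real_derivative M1 y) (at y)" if "y \<in> U" for y
      by (rule has_field_derivative_transform_within_open[OF M(2)[OF that] U(1) that]) (simp add: L)
    have L1: "L1 y = M1 y" if "y \<in> U" for y unfolding L1_def using DERIV_imp_deriv[OF dL[OF that]] .
    have dL1: "(L1 has_real_derivative M2 y) (at y)" if "y \<in> U" for y
      by (rule has_field_derivative_transform_within_open[OF M(3)[OF that] U(1) that]) (simp add: L1)
    have L2: "L2 y = M2 y" if "y \<in> U" for y unfolding L2_def using DERIV_imp_deriv[OF dL1[OF that]] .
    have "continuous_on U L2" using U(3) by (rule continuous_on_eq) (simp add: L2)
    then have "isCont L2 x" using U by (simp add: continuous_on_eq_continuous_at)
    then show ?thesis using M(1)[OF U(2)] dL[OF U(2)] dL1[OF U(2)] bd[OF U(2)] L[OF U(2)] L1[OF U(2)] L2[OF U(2)] by simp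
  qed
  then have "continuous_on D L2" by (auto intro!: continuous_at_imp_continuous_on)
  with main show ?thesis by blast
qed

text \<open>
  The sum of the three bounds for \<open>L\<close>, \<open>L'\<close>, \<open>L''\<close> that the chain rule gives for a map \<open>\<zeta>\<close> between two
  charts, when the logarithms of the derivatives of the charts are bounded by \<open>K\<close> together with their first
  two derivatives, and \<open>|ln c| \<le> K\<close> for the factor \<open>c\<close> that relates the charts.
\<close>

definition chart_bound :: "real \<Rightarrow> real" where
  "chart_bound K = 3 * K + (K + K * exp (3 * K)) + (K + (K * (exp (3 * K))\<^sup>2 + K * exp (3 * K) * (K + K * exp (3 * K))))"

text \<open>
  If \<open>\<zeta>\<close> reads \<open>\<phi>(\<zeta>) = c \<gamma>\<close> in charts \<open>\<phi>\<close> and \<open>\<gamma>\<close> with \<open>\<phi>' = exp k\<close> and \<open>\<gamma>' = exp l\<close>, then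
  \<open>ln \<zeta>' = ln c + l - k(\<zeta>)\<close>, and two differentiations give the bounds.
\<close>

lemma controlled_at_chart:
  fixes \<zeta> \<phi> \<gamma> k k1 k2 l l1 l2 q :: "real \<Rightarrow> real"
  assumes U: "open U" "x \<in> U" and \<zeta>: "continuous_on U \<zeta>" and V: "open V" "\<And>y. y \<in> U \<Longrightarrow> \<zeta> y \<in> V"
    and \<phi>: "\<And>s. s \<in> V \<Longrightarrow> (\<phi> has_real_derivative exp (k s)) (at s)"
       "\<And>s. s \<in> V \<Longrightarrow> (k has_real_derivative k1 s) (at s)"
       "\<And>s. s \<in> V \<Longrightarrow> (k1 has_real_derivative k2 s) (at s)" "continuous_on V k2"
    and \<gamma>: "\<And>y. y \<in> U \<Longrightarrow> (\<gamma> has_real_derivative exp (l y)) (at y)"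
       "\<And>y. y \<in> U \<Longrightarrow> (l has_real_derivative l1 y) (at y)"
       "\<And>y. y \<in> U \<Longrightarrow> (l1 has_real_derivative l2 y) (at y)" "continuous_on U l2"
    and rel: "\<And>y. y \<in> U \<Longrightarrow> \<phi> (\<zeta> y) = c * \<gamma> y" and c: "c > 0" "\<bar>ln c\<bar> \<le> K"
    and bl: "\<And>y. y \<in> U \<Longrightarrow> \<bar>l y\<bar> \<le> K \<and> \<bar>l1 y\<bar> \<le> K \<and> \<bar>l2 y\<bar> \<le> K"
    and bk: "\<And>y. y \<in> U \<Longrightarrow> \<bar>k (\<zeta> y)\<bar> \<le> K \<and> \<bar>k1 (\<zeta> y)\<bar> \<le> K \<and> \<bar>k2 (\<zeta> y)\<bar> \<le> K"
    and ident: "\<And>y. y \<in> U \<Longrightarrow> \<kappa>\<^sup>2 * (c * exp (l y) / exp (k (\<zeta> y)))\<^sup>2 * (1 - (\<zeta> y)\<^sup>2) = q y"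
  shows "controlled_at \<zeta> \<kappa> q (chart_bound K) x"
proof -
  have K0: "K \<ge> 0" using c by linarith
  define L where "L = (\<lambda>y. ln c + l y - k (\<zeta> y))"
  define L1 where "L1 = (\<lambda>y. l1 y - k1 (\<zeta> y) * exp (L y))"
  define L2 where "L2 = (\<lambda>y. l2 y - (k2 (\<zeta> y) * (exp (L y))\<^sup>2 + k1 (\<zeta> y) * exp (L y) * L1 y))"
  have eL: "c * exp (l y) / exp (k (\<zeta> y)) = exp (L y)" for y
    unfolding L_def exp_diff exp_add using c by simp
  have d\<zeta>: "(\<zeta> has_real_derivative exp (L y)) (at y)" if y: "y \<in> U" for y
    unfolding eL[symmetric]
  proof (rule implicit_derivative[where f = \<phi> and g = "\<lambda>y. c * \<gamma> y", OF U(1) y rel])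
    show "isCont \<zeta> y" using \<zeta> U(1) y by (simp add: continuous_on_eq_continuous_at)
    show "(\<phi> has_real_derivative exp (k (\<zeta> y))) (at (\<zeta> y))" using \<phi>(1) V(2) y by blast
    show "((\<lambda>y. c * \<gamma> y) has_real_derivative c * exp (l y)) (at y)" using \<gamma>(1)[OF y] by (rule DERIV_cmult)
  qed auto
  have dk: "((\<lambda>y. k (\<zeta> y)) has_real_derivative k1 (\<zeta> y) * exp (L y)) (at y)" if y: "y \<in> U" for y
    by (rule DERIV_chain2[OF \<phi>(2)[OF V(2)[OF y]] d\<zeta>[OF y]])
  have dk1: "((\<lambda>y. k1 (\<zeta> y)) has_real_derivative k2 (\<zeta> y) * exp (L y)) (at y)" if y: "y \<in> U" for y
    by (rule DERIV_chain2[OF \<phi>(3)[OF V(2)[OF y]] d\<zeta>[OF y]])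
  have dL: "(L has_real_derivative L1 y) (at y)" if y: "y \<in> U" for y
    unfolding L_def[abs_def] L1_def
    by (rule DERIV_cong[OF DERIV_diff[OF DERIV_add[OF DERIV_const \<gamma>(2)[OF y]] dk[OF y]]]) (simp add: L_def)
  have dL1: "(L1 has_real_derivative L2 y) (at y)" if y: "y \<in> U" for y
  proof -
    have "((\<lambda>y. exp (L y)) has_real_derivative exp (L y) * L1 y) (at y)"
      by (rule DERIV_chain2[OF DERIV_exp dL[OF y]])
    from DERIV_diff[OF \<gamma>(3)[OF y] DERIV_mult[OF dk1[OF y] this]]
    show ?thesis unfolding L1_def[abs_def] L2_def by (rule DERIV_cong) (simp add: L1_def algebra_simps power2_eq_square)
  qed
  have contL: "continuous_on U L" "continuous_on U L1"
    using dL dL1 by (auto intro!: continuous_at_imp_continuous_on DERIV_isCont)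
  have contk1: "continuous_on U (\<lambda>y. k1 (\<zeta> y))" using dk1 by (auto intro!: continuous_at_imp_continuous_on DERIV_isCont)
  have contk2: "continuous_on U (\<lambda>y. k2 (\<zeta> y))"
    by (rule continuous_on_compose2[OF \<phi>(4) \<zeta>]) (use V(2) in auto)
  have contL2: "continuous_on U L2" unfolding L2_def by (intro continuous_intros \<gamma>(4) contk1 contk2 contL)
  have bL: "\<bar>L y\<bar> \<le> 3 * K" if "y \<in> U" for y using bl[OF that] bk[OF that] c(2) unfolding L_def by linarith
  have be: "\<bar>exp (L y)\<bar> \<le> exp (3 * K)" if "y \<in> U" for y using bL[OF that] by simp
  have b1: "\<bar>k1 (\<zeta> y) * exp (L y)\<bar> \<le> K * exp (3 * K)" if "y \<in> U" for y
    unfolding abs_mult using bk[OF that] be[OF that] K0 by (intro mult_mono) auto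
  have bL1: "\<bar>L1 y\<bar> \<le> K + K * exp (3 * K)" if "y \<in> U" for y
    using b1[OF that] bl[OF that] unfolding L1_def by linarith
  have bL2: "\<bar>L2 y\<bar> \<le> K + (K * (exp (3 * K))\<^sup>2 + K * exp (3 * K) * (K + K * exp (3 * K)))" if "y \<in> U" for y
  proof -
    have "\<bar>k2 (\<zeta> y) * (exp (L y))\<^sup>2\<bar> \<le> K * (exp (3 * K))\<^sup>2"
      unfolding abs_mult power_abs[symmetric] using bk[OF that] be[OF that] K0 by (intro mult_mono power_mono) auto
    moreover have "\<bar>k1 (\<zeta> y) * exp (L y) * L1 y\<bar> \<le> K * exp (3 * K) * (K + K * exp (3 * K))"
      unfolding abs_mult[of _ "L1 y"] using b1[OF that] bL1[OF that] K0 by (intro mult_mono) auto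
    ultimately show ?thesis using bl[OF that] unfolding L2_def by linarith
  qed
  have nn: "0 \<le> K * exp (3 * K)" "0 \<le> K * (exp (3 * K))\<^sup>2" "0 \<le> K * exp (3 * K) * (K + K * exp (3 * K))"
    using K0 by auto
  show ?thesis unfolding controlled_at_def
  proof (rule exI[of _ U], rule exI[of _ L], rule exI[of _ L1], rule exI[of _ L2], intro conjI ballI U contL2)
    fix y assume y: "y \<in> U"
    show "\<bar>L y\<bar> \<le> chart_bound K" "\<bar>L1 y\<bar> \<le> chart_bound K" "\<bar>L2 y\<bar> \<le> chart_bound K"
      using bL[OF y] bL1[OF y] bL2[OF y] nn K0 unfolding chart_bound_def by linarith+
    show "\<kappa>\<^sup>2 * (exp (L y))\<^sup>2 * (1 - (\<zeta> y)\<^sup>2) = q y" using ident[OF y] unfolding eL .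
  qed (use d\<zeta> dL dL1 in auto)
qed

lemma antiderivative_exists:
  fixes h :: "real \<Rightarrow> real"
  assumes "continuous_on UNIV h"
  shows "\<exists>H. H x0 = 0 \<and> (\<forall>x\<in>{lo..hi}. (H has_real_derivative h x) (at x))"
proof -
  define H where "H = (\<lambda>x. integral {lo - 1..x} h - integral {lo - 1..x0} h)"
  have "(H has_real_derivative h x) (at x)" if x: "x \<in> {lo..hi}" for x
  proof -
    have "((\<lambda>x. integral {lo - 1..x} h) has_real_derivative h x) (at x within {lo - 1..hi + 1})"
      using x by (intro integral_has_real_derivative continuous_on_subset[OF assms]) auto
    moreover have "at x within {lo - 1..hi + 1} = at x" using x by (intro at_within_interior) auto
    ultimately show ?thesis unfolding H_def by (auto intro!: derivative_eq_intros)
  qed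
  then show ?thesis by (intro exI[of _ H]) (simp add: H_def)
qed

lemma antiderivative_bounds:
  fixes H h :: "real \<Rightarrow> real"
  assumes d: "\<And>x. x \<in> {lo..hi} \<Longrightarrow> (H has_real_derivative h x) (at x)"
    and xy: "lo \<le> x" "x \<le> y" "y \<le> hi"
  shows "(\<And>t. t \<in> {x..y} \<Longrightarrow> h t \<ge> \<sigma>) \<Longrightarrow> H y - H x \<ge> \<sigma> * (y - x)"
    and "(\<And>t. t \<in> {x..y} \<Longrightarrow> h t \<le> \<sigma>) \<Longrightarrow> H y - H x \<le> \<sigma> * (y - x)"
proof -
  have "x = y \<or> (\<exists>z. x < z \<and> z < y \<and> H y - H x = (y - x) * h z)"
    using xy d MVT2[of x y H h] by (cases "x = y") force+
  then show "(\<And>t. t \<in> {x..y} \<Longrightarrow> h t \<ge> \<sigma>) \<Longrightarrow> H y - H x \<ge> \<sigma> * (y - x)"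
    "(\<And>t. t \<in> {x..y} \<Longrightarrow> h t \<le> \<sigma>) \<Longrightarrow> H y - H x \<le> \<sigma> * (y - x)"
    using xy by (auto simp: mult.commute intro!: mult_right_mono)
qed

text \<open>
  The area of the half disc. It produces the factor \<open>\<pi>\<close> and, through \<open>\<kappa> = (2n + 1) h\<close>, the quantization
  condition.
\<close>

lemma semicircle_antiderivative:
  obtains F :: "real \<Rightarrow> real"
  where "\<And>s. s \<in> {-3..3} \<Longrightarrow> (F has_real_derivative sqrt \<bar>1 - s\<^sup>2\<bar>) (at s)" "F (-1) = 0" "F 1 = pi / 2"
proof -
  have "\<exists>F. F (-1) = 0 \<and> (\<forall>s\<in>{-3..3}. (F has_real_derivative sqrt \<bar>1 - s\<^sup>2\<bar>) (at s))"
    by (rule antiderivative_exists) (intro continuous_intros)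
  then obtain F where F: "F (-1) = 0" "\<And>s. s \<in> {-3..3} \<Longrightarrow> (F has_real_derivative sqrt \<bar>1 - s\<^sup>2\<bar>) (at s)"
    by blast
  have "((\<lambda>s. sqrt \<bar>1 - s\<^sup>2\<bar>) has_integral (F 1 - F (-1))) {-1..1}"
  proof (rule fundamental_theorem_of_calculus)
    fix s :: real assume "s \<in> {-1..1}"
    then show "(F has_vector_derivative sqrt \<bar>1 - s\<^sup>2\<bar>) (at s within {-1..1})"
      unfolding has_real_derivative_iff_has_vector_derivative[symmetric]
      by (intro has_field_derivative_at_within[OF F(2)]) auto
  qed simp
  moreover define A where "A = (\<lambda>s::real. (s * sqrt (1 - s\<^sup>2) + arcsin s) / 2)"
  have "((\<lambda>s. sqrt \<bar>1 - s\<^sup>2\<bar>) has_integral (A 1 - A (-1))) {-1..1}"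
  proof (rule fundamental_theorem_of_calculus_interior)
    show "continuous_on {-1..1} A" unfolding A_def
      by (intro continuous_intros) auto
    fix s :: real assume s: "s \<in> {-1<..<1}"
    have pos: "1 - s\<^sup>2 > 0" using s by (simp add: abs_square_less_1 abs_less_iff)
    define r where "r = sqrt (1 - s\<^sup>2)"
    have r: "r > 0" "r * r = 1 - s\<^sup>2" unfolding r_def using pos by auto
    have "(A has_real_derivative ((1 * r + (inverse r / 2 * (- (2 * s))) * s) + inverse r) / 2) (at s)"
      unfolding A_def r_def
    proof (intro DERIV_cdivide DERIV_add DERIV_mult DERIV_ident)
      show "(arcsin has_real_derivative inverse (sqrt (1 - s\<^sup>2))) (at s)" using s by (intro DERIV_arcsin) auto
      have "((\<lambda>s::real. 1 - s\<^sup>2) has_real_derivative - (2 * s)) (at s)" by (auto intro!: derivative_eq_intros)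
      from DERIV_chain2[OF DERIV_real_sqrt[OF pos] this]
      show "((\<lambda>s. sqrt (1 - s\<^sup>2)) has_real_derivative inverse (sqrt (1 - s\<^sup>2)) / 2 * (- (2 * s))) (at s)" .
    qed
    moreover have "((1 * r + (inverse r / 2 * (- (2 * s))) * s) + inverse r) / 2 = r"
    proof -
      have "(1 * r + (inverse r / 2 * (- (2 * s))) * s) + inverse r = r + inverse r * (1 - s\<^sup>2)"
        by (simp add: algebra_simps power2_eq_square)
      also have "inverse r * (1 - s\<^sup>2) = r" unfolding r(2)[symmetric] using r(1) by simp
      finally show ?thesis by simp
    qed
    ultimately have "(A has_real_derivative r) (at s)" by (simp only:)
    moreover have "sqrt \<bar>1 - s\<^sup>2\<bar> = r" using pos unfolding r_def by simp
    ultimately show "(A has_vector_derivative sqrt \<bar>1 - s\<^sup>2\<bar>) (at s)"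
      unfolding has_real_derivative_iff_has_vector_derivative[symmetric] by (simp only:)
  qed simp
  ultimately have "F 1 - F (-1) = A 1 - A (-1)" by (rule has_integral_unique)
  then have "F 1 = pi / 2" using F(1) by (simp add: A_def arcsin_minus)
  with F show thesis using that by blast
qed

text \<open>
  Near a turning point the charts are, up to the sign \<open>\<sigma>\<close>, the normal forms of \<open>1 - s\<^sup>2\<close> at \<open>s0\<close>
  and of \<open>w = E - v\<close> at \<open>x0\<close>. The relation between primitives becomes \<open>pow32 (\<phi> \<zeta>) = pow32 \<gamma> / \<kappa>\<close>, that is
  \<open>\<phi>(\<zeta>) = c \<gamma>\<close> with \<open>c\<^sup>3\<^sup>/\<^sup>2 = 1 / \<kappa>\<close>. The sign is 1 at the left and -1 at the right turning point.
\<close>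

lemma turning_point_chart:
  fixes \<zeta> \<phi> \<gamma> k k1 k2 l l1 l2 w F G :: "real \<Rightarrow> real"
  assumes \<kappa>: "\<kappa> > 0" and c: "c > 0" "c * sqrt c = 1 / \<kappa>" "\<bar>ln c\<bar> \<le> K"
    and U: "open U" "x \<in> U" "U \<subseteq> {\<alpha>..\<omega>}" and \<zeta>: "continuous_on U \<zeta>" "\<And>y. y \<in> U \<Longrightarrow> \<zeta> y \<in> {p<..<q}"
    and s0: "s0 \<in> {p..q}" "\<phi> s0 = 0" and x0: "x0 \<in> {\<alpha>..\<omega>}" "\<gamma> x0 = 0"
    and \<phi>: "\<And>s. s \<in> {p..q} \<Longrightarrow> (\<phi> has_real_derivative exp (k s)) (at s within {p..q}) \<and>
         (k has_real_derivative k1 s) (at s within {p..q}) \<and> (k1 has_real_derivative k2 s) (at s within {p..q}) \<and>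
         \<bar>k s\<bar> \<le> K \<and> \<bar>k1 s\<bar> \<le> K \<and> \<bar>k2 s\<bar> \<le> K \<and> \<phi> s * (exp (k s))\<^sup>2 = \<sigma> * (1 - s\<^sup>2)" "continuous_on {p..q} k2"
    and \<gamma>: "\<And>y. y \<in> {\<alpha>..\<omega>} \<Longrightarrow> (\<gamma> has_real_derivative exp (l y)) (at y within {\<alpha>..\<omega>}) \<and>
         (l has_real_derivative l1 y) (at y within {\<alpha>..\<omega>}) \<and> (l1 has_real_derivative l2 y) (at y within {\<alpha>..\<omega>}) \<and>
         \<bar>l y\<bar> \<le> K \<and> \<bar>l1 y\<bar> \<le> K \<and> \<bar>l2 y\<bar> \<le> K \<and> \<gamma> y * (exp (l y))\<^sup>2 = \<sigma> * w y" "continuous_on {\<alpha>..\<omega>} l2"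
    and \<sigma>: "\<sigma> = 1 \<or> \<sigma> = -1"
    and F: "\<And>s. s \<in> {p..q} \<Longrightarrow> (F has_real_derivative sqrt \<bar>1 - s\<^sup>2\<bar>) (at s)"
    and G: "\<And>y. y \<in> {\<alpha>..\<omega>} \<Longrightarrow> (G has_real_derivative sqrt \<bar>w y\<bar>) (at y)"
    and FG: "\<And>y. y \<in> U \<Longrightarrow> F (\<zeta> y) - F s0 = (G y - G x0) / \<kappa>"
  shows "controlled_at \<zeta> \<kappa> w (chart_bound K) x"
proof -
  have atU: "at y within {\<alpha>..\<omega>} = at y" if "y \<in> U" for y
    by (rule at_within_interior[OF interiorI[OF U(1) that U(3)]])
  have atV: "at s within {p..q} = at s" if "s \<in> {p<..<q}" for s
    using that by (intro at_within_interior) auto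
  have pF: "pow32 (\<phi> s) = F s - F s0" if "s \<in> {p..q}" for s
  proof (rule normal_form_antiderivative[where \<gamma> = \<phi> and H = F and l = k, OF s0(1) that s0(2), where g = "\<lambda>s. \<sigma> * (1 - s\<^sup>2)"])
    show "(F has_real_derivative sqrt \<bar>\<sigma> * (1 - s\<^sup>2)\<bar>) (at s within {p..q})" if "s \<in> {p..q}" for s
      using has_field_derivative_at_within[OF F[OF that]] \<sigma> by (auto simp: abs_mult)
  qed (use \<phi> in blast)+
  have pG: "pow32 (\<gamma> y) = G y - G x0" if "y \<in> {\<alpha>..\<omega>}" for y
  proof (rule normal_form_antiderivative[where \<gamma> = \<gamma> and H = G and l = l, OF x0(1) that x0(2), where g = "\<lambda>y. \<sigma> * w y"])
    show "(G has_real_derivative sqrt \<bar>\<sigma> * w y\<bar>) (at y within {\<alpha>..\<omega>})" if "y \<in> {\<alpha>..\<omega>}" for y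
      using has_field_derivative_at_within[OF G[OF that]] \<sigma> by (auto simp: abs_mult)
  qed (use \<gamma> in blast)+
  have rel: "\<phi> (\<zeta> y) = c * \<gamma> y" if y: "y \<in> U" for y
  proof (rule pow32_inj)
    have "\<zeta> y \<in> {p..q}" using \<zeta>(2)[OF y] by auto
    then have "pow32 (\<phi> (\<zeta> y)) = (G y - G x0) / \<kappa>" using pF FG[OF y] by simp
    also have "\<dots> = pow32 (c * \<gamma> y)"
      using pG[of y] U(3) y c(1) by (auto simp: pow32_scale c(2))
    finally show "pow32 (\<phi> (\<zeta> y)) = pow32 (c * \<gamma> y)" .
  qed
  show ?thesis
  proof (rule controlled_at_chart[OF U(1,2) \<zeta>(1) _ \<zeta>(2)])
    fix s assume s: "s \<in> {p<..<q}"
    then have "s \<in> {p..q}" by auto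
    from \<phi>(1)[OF this] show "(\<phi> has_real_derivative exp (k s)) (at s)" "(k has_real_derivative k1 s) (at s)"
      "(k1 has_real_derivative k2 s) (at s)" unfolding atV[OF s] by blast+
  next
    show "continuous_on {p<..<q} k2" by (rule continuous_on_subset[OF \<phi>(2)]) auto
    show "continuous_on U l2" by (rule continuous_on_subset[OF \<gamma>(2) U(3)])
    fix y assume y: "y \<in> U"
    then have yN: "y \<in> {\<alpha>..\<omega>}" using U(3) by blast
    have \<zeta>N: "\<zeta> y \<in> {p..q}" using \<zeta>(2)[OF y] by auto
    from \<gamma>(1)[OF yN] show "(\<gamma> has_real_derivative exp (l y)) (at y)" "(l has_real_derivative l1 y) (at y)"
      "(l1 has_real_derivative l2 y) (at y)" "\<bar>l y\<bar> \<le> K \<and> \<bar>l1 y\<bar> \<le> K \<and> \<bar>l2 y\<bar> \<le> K" unfolding atU[OF y] by blast+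
    from \<phi>(1)[OF \<zeta>N] show "\<bar>k (\<zeta> y)\<bar> \<le> K \<and> \<bar>k1 (\<zeta> y)\<bar> \<le> K \<and> \<bar>k2 (\<zeta> y)\<bar> \<le> K" by blast
    define a b where "a = exp (l y)" and "b = exp (k (\<zeta> y))"
    have b: "b \<noteq> 0" unfolding b_def by simp
    have e1: "\<sigma> * (1 - (\<zeta> y)\<^sup>2) = c * \<gamma> y * b\<^sup>2" using \<phi>(1)[OF \<zeta>N] rel[OF y] unfolding b_def by simp
    have e2: "\<gamma> y * a\<^sup>2 = \<sigma> * w y" using \<gamma>(1)[OF yN] unfolding a_def by blast
    have "\<sigma> * (\<kappa>\<^sup>2 * (c * a / b)\<^sup>2 * (1 - (\<zeta> y)\<^sup>2)) = \<kappa>\<^sup>2 * (c * a / b)\<^sup>2 * (\<sigma> * (1 - (\<zeta> y)\<^sup>2))" by simp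
    also have "\<dots> = \<kappa>\<^sup>2 * (c\<^sup>2 * c) * (\<gamma> y * a\<^sup>2)"
      unfolding e1 using b by (simp add: power_divide power_mult_distrib)
    also have "c\<^sup>2 * c = (c * sqrt c)\<^sup>2" using c(1) by (simp add: power_mult_distrib)
    also have "\<kappa>\<^sup>2 * (c * sqrt c)\<^sup>2 * (\<gamma> y * a\<^sup>2) = \<sigma> * w y" unfolding c(2) e2 using \<kappa> by (simp add: power_divide)
    finally show "\<kappa>\<^sup>2 * (c * exp (l y) / exp (k (\<zeta> y)))\<^sup>2 * (1 - (\<zeta> y)\<^sup>2) = w y"
      using \<sigma> unfolding a_def b_def by auto
  qed (use rel c in auto)
qed

text \<open>
  Inside the well, where \<open>1 - \<zeta>\<^sup>2\<close> and \<open>w\<close> are bounded below, the primitives \<open>F\<close> and \<open>G\<close> are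
  themselves charts; the logarithms of their derivatives are \<open>k = ln (1 - s\<^sup>2) / 2\<close> and \<open>l = ln w / 2\<close>.
\<close>

lemma middle_chart:
  fixes \<zeta> w w1 w2 F G :: "real \<Rightarrow> real"
  assumes \<kappa>: "\<kappa> > 0" "\<bar>ln (1 / \<kappa>)\<bar> \<le> K"
    and U: "open U" "x \<in> U" and \<zeta>: "continuous_on U \<zeta>" "\<And>y. y \<in> U \<Longrightarrow> \<bar>\<zeta> y\<bar> < 1 \<and> 1 - (\<zeta> y)\<^sup>2 \<ge> d"
    and w: "\<And>y. y \<in> U \<Longrightarrow> (w has_real_derivative w1 y) (at y)" "\<And>y. y \<in> U \<Longrightarrow> (w1 has_real_derivative w2 y) (at y)"
      "continuous_on U w2"
    and wb: "\<And>y. y \<in> U \<Longrightarrow> w y \<ge> d \<and> w y \<le> M \<and> \<bar>w1 y\<bar> \<le> M \<and> \<bar>w2 y\<bar> \<le> M" and d: "0 < d" "d \<le> 1" "M \<ge> 1"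
    and K: "\<bar>ln d\<bar> + \<bar>ln M\<bar> \<le> K" "M / d + (M / d)\<^sup>2 \<le> K" "2 / d\<^sup>2 \<le> K"
    and F: "\<And>s. s \<in> {-1<..<1} \<Longrightarrow> (F has_real_derivative sqrt \<bar>1 - s\<^sup>2\<bar>) (at s)"
    and G: "\<And>y. y \<in> U \<Longrightarrow> (G has_real_derivative sqrt \<bar>w y\<bar>) (at y)"
    and FG: "\<And>y. y \<in> U \<Longrightarrow> F (\<zeta> y) = G y / \<kappa>"
  shows "controlled_at \<zeta> \<kappa> w (chart_bound K) x"
proof -
  have p1: "1 - s\<^sup>2 > 0" if "s \<in> {-1<..<1}" for s :: real using that by (simp add: abs_square_less_1 abs_less_iff)
  define k k1 k2 where "k = (\<lambda>s::real. 1/2 * ln (1 - s\<^sup>2))" and "k1 = (\<lambda>s::real. - s / (1 - s\<^sup>2))"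
    and "k2 = (\<lambda>s::real. - (1 + s\<^sup>2) / (1 - s\<^sup>2)\<^sup>2)"
  define l l1 l2 where "l = (\<lambda>y. 1/2 * ln (w y))" and "l1 = (\<lambda>y. 1/2 * (w1 y / w y))"
    and "l2 = (\<lambda>y. 1/2 * (w2 y / w y - (w1 y / w y)\<^sup>2))"
  have wpos: "w y > 0" if "y \<in> U" for y using wb[OF that] d by linarith
  have half: "exp (1/2 * ln t) = sqrt t" if "t > 0" for t :: real
  proof -
    have "exp (1/2 * ln t) * exp (1/2 * ln t) = t" using that by (simp flip: exp_add)
    then show ?thesis by (metis exp_ge_zero real_sqrt_unique power2_eq_square)
  qed
  have wcont: "continuous_on U w" "continuous_on U w1" using w(1,2) by (auto intro!: continuous_at_imp_continuous_on DERIV_isCont)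
  have zin: "\<zeta> y \<in> {-1<..<1}" if "y \<in> U" for y using \<zeta>(2)[OF that] by (auto simp: abs_less_iff)
  show ?thesis
  proof (rule controlled_at_chart[OF U \<zeta>(1) _ zin])
    fix s :: real assume s: "s \<in> {-1<..<1}"
    note p = p1[OF s]
    show "(F has_real_derivative exp (k s)) (at s)" using F[OF s] p unfolding k_def half[OF p] by simp
    have q: "((\<lambda>s::real. 1 - s\<^sup>2) has_real_derivative - (2 * s)) (at s)" by (auto intro!: derivative_eq_intros)
    show "(k has_real_derivative k1 s) (at s)" unfolding k_def
      by (rule DERIV_cong[OF DERIV_cmult[OF DERIV_chain2[OF DERIV_ln[OF p] q]]]) (use p in \<open>simp add: k1_def field_simps\<close>)
    have "(k1 has_real_derivative ((-1) * (1 - s\<^sup>2) - (- s) * (- (2 * s))) / ((1 - s\<^sup>2) * (1 - s\<^sup>2))) (at s)"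
      unfolding k1_def using p by (intro DERIV_divide DERIV_minus DERIV_ident q) auto
    moreover have "((-1) * (1 - s\<^sup>2) - (- s) * (- (2 * s))) / ((1 - s\<^sup>2) * (1 - s\<^sup>2)) = k2 s"
      unfolding k2_def by (simp add: power2_eq_square)
    ultimately show "(k1 has_real_derivative k2 s) (at s)" by simp
  next
    show "continuous_on {-1<..<1} k2" unfolding k2_def
      by (intro continuous_intros) (use p1 in force)
    show "continuous_on U l2" unfolding l2_def
      by (intro continuous_intros wcont w(3)) (use wpos in force)+
    fix y assume y: "y \<in> U"
    note wp = wpos[OF y]
    show "(G has_real_derivative exp (l y)) (at y)" using G[OF y] wp unfolding l_def half[OF wp] by simp
    show "(l has_real_derivative l1 y) (at y)" unfolding l_def
      by (rule DERIV_cong[OF DERIV_cmult[OF DERIV_chain2[OF DERIV_ln[OF wp] w(1)[OF y]]]]) (use wp in \<open>simp add: l1_def field_simps\<close>)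
    have "((\<lambda>y. w1 y / w y) has_real_derivative (w2 y * w y - w1 y * w1 y) / (w y * w y)) (at y)"
      using wp by (intro DERIV_divide w y) auto
    moreover have "(w2 y * w y - w1 y * w1 y) / (w y * w y) = w2 y / w y - (w1 y / w y)\<^sup>2"
      using wp by (simp add: diff_divide_distrib power2_eq_square)
    ultimately show "(l1 has_real_derivative l2 y) (at y)" unfolding l1_def l2_def by (intro DERIV_cmult) simp
    show "\<bar>l y\<bar> \<le> K \<and> \<bar>l1 y\<bar> \<le> K \<and> \<bar>l2 y\<bar> \<le> K"
    proof (intro conjI)
      have "\<bar>ln (w y)\<bar> \<le> \<bar>ln d\<bar> + \<bar>ln M\<bar>" using wb[OF y] d by (intro abs_ln_le) auto
      then show "\<bar>l y\<bar> \<le> K" using K(1) unfolding l_def by linarith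
      have q: "\<bar>w1 y / w y\<bar> \<le> M / d" "\<bar>w2 y / w y\<bar> \<le> M / d"
        unfolding abs_divide using wb[OF y] d by (intro frac_le; auto)+
      then have q2: "(w1 y / w y)\<^sup>2 \<le> (M / d)\<^sup>2" by (metis abs_le_square_iff abs_ge_zero abs_of_nonneg order_trans)
      then show "\<bar>l1 y\<bar> \<le> K" using q K(2) zero_le_power2[of "M/d"] unfolding l1_def by linarith
      have "\<bar>w2 y / w y - (w1 y / w y)\<^sup>2\<bar> \<le> M / d + (M / d)\<^sup>2"
        using q q2 zero_le_power2[of "w1 y / w y"] by linarith
      then show "\<bar>l2 y\<bar> \<le> K" using K(2) unfolding l2_def abs_mult by simp
    qed
    show "\<bar>k (\<zeta> y)\<bar> \<le> K \<and> \<bar>k1 (\<zeta> y)\<bar> \<le> K \<and> \<bar>k2 (\<zeta> y)\<bar> \<le> K"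
    proof (intro conjI)
      have z: "\<bar>\<zeta> y\<bar> < 1" "1 - (\<zeta> y)\<^sup>2 \<ge> d" using \<zeta>(2)[OF y] by auto
      have z2: "(\<zeta> y)\<^sup>2 \<le> 1" using p1[OF zin[OF y]] by simp
      have "\<bar>ln (1 - (\<zeta> y)\<^sup>2)\<bar> \<le> \<bar>ln d\<bar> + \<bar>ln 1\<bar>" using z d by (intro abs_ln_le) auto
      then have "\<bar>ln (1 - (\<zeta> y)\<^sup>2)\<bar> \<le> \<bar>ln d\<bar>" by simp
      then show "\<bar>k (\<zeta> y)\<bar> \<le> K" using K(1) abs_ge_zero[of "ln M"] unfolding k_def by linarith
      have dd: "d\<^sup>2 \<le> d" "d\<^sup>2 > 0" using d by (auto simp: power2_eq_square mult_left_le)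
      have "\<bar>k1 (\<zeta> y)\<bar> \<le> 2 / d\<^sup>2" unfolding k1_def abs_divide using z d dd by (intro frac_le) auto
      then show "\<bar>k1 (\<zeta> y)\<bar> \<le> K" using K(3) by linarith
      have "d\<^sup>2 \<le> \<bar>(1 - (\<zeta> y)\<^sup>2)\<^sup>2\<bar>" using z d by (simp only: abs_power2) (intro power_mono; simp)
      moreover have "\<bar>- (1 + (\<zeta> y)\<^sup>2)\<bar> \<le> 2" using z2 zero_le_power2[of "\<zeta> y"] by linarith
      ultimately have "\<bar>k2 (\<zeta> y)\<bar> \<le> 2 / d\<^sup>2" unfolding k2_def abs_divide
        using dd by (intro frac_le) (simp_all only: zero_le_numeral)
      then show "\<bar>k2 (\<zeta> y)\<bar> \<le> K" using K(3) by linarith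
    qed
    have pz: "1 - (\<zeta> y)\<^sup>2 > 0" using p1[OF zin[OF y]] .
    then show "\<kappa>\<^sup>2 * (1 / \<kappa> * exp (l y) / exp (k (\<zeta> y)))\<^sup>2 * (1 - (\<zeta> y)\<^sup>2) = w y"
      unfolding l_def k_def half[OF wp] half[OF pz] using wp \<kappa>(1) by (simp add: power_divide power_mult_distrib)
  qed (use FG \<kappa> in auto)
qed

section \<open>The Liouville map of a well\<close>

text \<open>
  The normal form at a single point, as needed for the fixed model function \<open>1 - s\<^sup>2\<close>.
\<close>

lemma turning_point_normal_form_at:
  fixes g g1 g2 g3 :: "real \<Rightarrow> real"
  assumes "\<alpha> \<le> \<omega>" "m > 0"
    and "\<And>x. x \<in> {\<alpha>..\<omega>} \<Longrightarrow> (g has_real_derivative g1 x) (at x within {\<alpha>..\<omega>})"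
      "\<And>x. x \<in> {\<alpha>..\<omega>} \<Longrightarrow> (g1 has_real_derivative g2 x) (at x within {\<alpha>..\<omega>})"
      "\<And>x. x \<in> {\<alpha>..\<omega>} \<Longrightarrow> (g2 has_real_derivative g3 x) (at x within {\<alpha>..\<omega>})"
      "continuous_on {\<alpha>..\<omega>} g3"
    and "\<And>x. x \<in> {\<alpha>..\<omega>} \<Longrightarrow> g1 x \<ge> m" and x0: "x0 \<in> {\<alpha>..\<omega>}"
  obtains K \<gamma> l l1 l2 where "\<gamma> x0 = 0" "continuous_on {\<alpha>..\<omega>} l2"
    "\<And>x. x \<in> {\<alpha>..\<omega>} \<Longrightarrow> (\<gamma> has_real_derivative exp (l x)) (at x within {\<alpha>..\<omega>}) \<and>
       (l has_real_derivative l1 x) (at x within {\<alpha>..\<omega>}) \<and> (l1 has_real_derivative l2 x) (at x within {\<alpha>..\<omega>}) \<and>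
       \<bar>l x\<bar> \<le> K \<and> \<bar>l1 x\<bar> \<le> K \<and> \<bar>l2 x\<bar> \<le> K \<and> \<gamma> x * (exp (l x))\<^sup>2 = g x - g x0"
proof -
  have "\<exists>K. \<forall>x0\<in>{\<alpha>..\<omega>}. \<exists>\<gamma> l l1 l2. \<gamma> x0 = 0 \<and> continuous_on {\<alpha>..\<omega>} l2 \<and>
    (\<forall>x\<in>{\<alpha>..\<omega>}. (\<gamma> has_real_derivative exp (l x)) (at x within {\<alpha>..\<omega>}) \<and>
       (l has_real_derivative l1 x) (at x within {\<alpha>..\<omega>}) \<and> (l1 has_real_derivative l2 x) (at x within {\<alpha>..\<omega>}) \<and>
       \<bar>l x\<bar> \<le> K \<and> \<bar>l1 x\<bar> \<le> K \<and> \<bar>l2 x\<bar> \<le> K \<and> \<gamma> x * (exp (l x))\<^sup>2 = g x - g x0)"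
    by (rule turning_point_normal_form) (fact assms)+
  then obtain K where K: "\<forall>x0\<in>{\<alpha>..\<omega>}. \<exists>\<gamma> l l1 l2. \<gamma> x0 = 0 \<and> continuous_on {\<alpha>..\<omega>} l2 \<and>
    (\<forall>x\<in>{\<alpha>..\<omega>}. (\<gamma> has_real_derivative exp (l x)) (at x within {\<alpha>..\<omega>}) \<and>
       (l has_real_derivative l1 x) (at x within {\<alpha>..\<omega>}) \<and> (l1 has_real_derivative l2 x) (at x within {\<alpha>..\<omega>}) \<and>
       \<bar>l x\<bar> \<le> K \<and> \<bar>l1 x\<bar> \<le> K \<and> \<bar>l2 x\<bar> \<le> K \<and> \<gamma> x * (exp (l x))\<^sup>2 = g x - g x0)"
    by (elim exE) (rule that)
  from bspec[OF K x0] obtain \<gamma> l l1 l2 where H: "\<gamma> x0 = 0 \<and> continuous_on {\<alpha>..\<omega>} l2 \<and>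
    (\<forall>x\<in>{\<alpha>..\<omega>}. (\<gamma> has_real_derivative exp (l x)) (at x within {\<alpha>..\<omega>}) \<and>
       (l has_real_derivative l1 x) (at x within {\<alpha>..\<omega>}) \<and> (l1 has_real_derivative l2 x) (at x within {\<alpha>..\<omega>}) \<and>
       \<bar>l x\<bar> \<le> K \<and> \<bar>l1 x\<bar> \<le> K \<and> \<bar>l2 x\<bar> \<le> K \<and> \<gamma> x * (exp (l x))\<^sup>2 = g x - g x0)"
    by (elim exE) (rule that)
  show thesis by (rule that[OF conjunct1[OF H] conjunct1[OF conjunct2[OF H]] bspec[OF conjunct2[OF conjunct2[OF H]]]])
qed

text \<open>
  One well of \<open>v\<close>, with \<open>z1 < z2\<close> in the role of two consecutive zeros of \<open>v - E0\<close>, and quantitative data that serve all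
  energies within \<open>e\<close> of \<open>E0\<close>: slope at least \<open>m\<close> in absolute value within \<open>2 \<beta>\<close> of these points, and depth
  \<open>2 e\<close> in the remaining part of the well.
\<close>

locale well =
  fixes v v1 v2 v3 :: "real \<Rightarrow> real" and E0 z1 z2 \<beta> m e :: real
  assumes \<beta>: "\<beta> > 0" and m: "m > 0" and e: "e > 0" and sep: "z1 + 2 * \<beta> < z2 - 2 * \<beta>"
    and dv: "\<And>x. (v has_real_derivative v1 x) (at x)" and dv1: "\<And>x. (v1 has_real_derivative v2 x) (at x)"
    and cv2: "continuous_on UNIV v2"
    and dv2: "\<And>x. x \<in> {z1 - 2 * \<beta>..z1 + 2 * \<beta>} \<or> x \<in> {z2 - 2 * \<beta>..z2 + 2 * \<beta>} \<Longrightarrow> (v2 has_real_derivative v3 x) (at x)"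
    and cv3: "continuous_on {z1 - 2 * \<beta>..z1 + 2 * \<beta>} v3" "continuous_on {z2 - 2 * \<beta>..z2 + 2 * \<beta>} v3"
    and slope1: "\<And>x. x \<in> {z1 - 2 * \<beta>..z1 + 2 * \<beta>} \<Longrightarrow> v1 x \<le> - m"
    and slope2: "\<And>x. x \<in> {z2 - 2 * \<beta>..z2 + 2 * \<beta>} \<Longrightarrow> v1 x \<ge> m"
    and core: "\<And>x. x \<in> {z1 + \<beta>..z2 - \<beta>} \<Longrightarrow> v x \<le> E0 - 2 * e"
begin

definition turning_pair :: "real \<Rightarrow> real \<Rightarrow> real \<Rightarrow> bool" where
  "turning_pair E a b \<longleftrightarrow> \<bar>E - E0\<bar> \<le> e \<and> a \<in> {z1 - \<beta>..z1 + \<beta>} \<and> b \<in> {z2 - \<beta>..z2 + \<beta>} \<and> v a = E \<and> v b = E"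

lemma cont_v: "continuous_on S v" "continuous_on S v1" "continuous_on S v2"
  using dv dv1 continuous_on_subset[OF cv2] by (auto intro!: continuous_at_imp_continuous_on DERIV_isCont)

lemma slope_left:
  assumes "x \<in> {z1 - 2 * \<beta>..z1 + 2 * \<beta>}" "y \<in> {z1 - 2 * \<beta>..z1 + 2 * \<beta>}" "x \<le> y"
  shows "v x - v y \<ge> m * (y - x)"
proof -
  have "v y + m * y \<le> v x + m * x"
  proof (rule DERIV_nonpos_imp_nonincreasing[OF assms(3)])
    fix t assume t: "x \<le> t" "t \<le> y"
    have "((\<lambda>x. v x + m * x) has_real_derivative v1 t + m) (at t)" by (auto intro!: derivative_eq_intros dv)
    moreover have "v1 t + m \<le> 0" using slope1[of t] t assms by auto
    ultimately show "\<exists>z. ((\<lambda>x. v x + m * x) has_real_derivative z) (at t) \<and> z \<le> 0" by blast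
  qed
  then show ?thesis by (simp add: algebra_simps)
qed

lemma slope_right:
  assumes "x \<in> {z2 - 2 * \<beta>..z2 + 2 * \<beta>}" "y \<in> {z2 - 2 * \<beta>..z2 + 2 * \<beta>}" "x \<le> y"
  shows "v y - v x \<ge> m * (y - x)"
proof -
  have "v x - m * x \<le> v y - m * y"
  proof (rule DERIV_nonneg_imp_nondecreasing[OF assms(3)])
    fix t assume t: "x \<le> t" "t \<le> y"
    have "((\<lambda>x. v x - m * x) has_real_derivative v1 t - m) (at t)" by (auto intro!: derivative_eq_intros dv)
    moreover have "v1 t - m \<ge> 0" using slope2[of t] t assms by auto
    ultimately show "\<exists>z. ((\<lambda>x. v x - m * x) has_real_derivative z) (at t) \<and> 0 \<le> z" by blast
  qed
  then show ?thesis by (simp add: algebra_simps)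
qed

text \<open>
  The linear growth of \<open>E - v\<close> from a turning point and the depth of the core combine into one lower
  bound at distance \<open>\<eta>\<close> from the turning points.
\<close>

lemma depth:
  assumes tp: "turning_pair E a b" and y: "a + \<eta> \<le> y" "y \<le> b - \<eta>" and \<eta>: "0 \<le> \<eta>"
  shows "E - v y \<ge> min e (m * \<eta>)"
proof -
  note t = tp[unfolded turning_pair_def]
  consider "y \<le> z1 + \<beta>" | "y \<in> {z1 + \<beta>..z2 - \<beta>}" | "y \<ge> z2 - \<beta>" by fastforce
  then show ?thesis
  proof cases
    case 1
    have "v a - v y \<ge> m * (y - a)" using t 1 y \<eta> \<beta> by (intro slope_left) auto
    moreover have "m * (y - a) \<ge> m * \<eta>" using y m by simp
    ultimately have "m * \<eta> \<le> E - v y" using t by linarith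
    then show ?thesis by (rule min.coboundedI2)
  next
    case 2
    have "e \<le> E - v y" using core[OF 2] t by linarith
    then show ?thesis by (rule min.coboundedI1)
  next
    case 3
    have "v b - v y \<ge> m * (b - y)" using t 3 y \<eta> \<beta> by (intro slope_right) auto
    moreover have "m * (b - y) \<ge> m * \<eta>" using y m by simp
    ultimately have "m * \<eta> \<le> E - v y" using t by linarith
    then show ?thesis by (rule min.coboundedI2)
  qed
qed

lemma barrier_left: "turning_pair E a b \<Longrightarrow> z1 - 2 * \<beta> \<le> y \<Longrightarrow> y \<le> a \<Longrightarrow> v y - E \<ge> m * (a - y)"
  using slope_left[of y a] \<beta> unfolding turning_pair_def by auto

lemma barrier_right: "turning_pair E a b \<Longrightarrow> b \<le> y \<Longrightarrow> y \<le> z2 + 2 * \<beta> \<Longrightarrow> v y - E \<ge> m * (y - b)"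
  using slope_right[of b y] \<beta> unfolding turning_pair_def by auto

lemma uniform_bounds:
  obtains M where "M \<ge> 1" "\<And>x. x \<in> {z1 - 2 * \<beta>..z2 + 2 * \<beta>} \<Longrightarrow> \<bar>v1 x\<bar> \<le> M \<and> \<bar>v2 x\<bar> \<le> M"
    "\<And>x E. x \<in> {z1 - 2 * \<beta>..z2 + 2 * \<beta>} \<Longrightarrow> \<bar>E - E0\<bar> \<le> e \<Longrightarrow> \<bar>E - v x\<bar> \<le> M"
proof -
  have bnd: "\<exists>B. \<forall>x\<in>{z1 - 2 * \<beta>..z2 + 2 * \<beta>}. \<bar>f x\<bar> \<le> B" if "continuous_on {z1 - 2 * \<beta>..z2 + 2 * \<beta>} f" for f :: "real \<Rightarrow> real"
    using compact_imp_bounded[OF compact_continuous_image[OF that compact_Icc]] unfolding bounded_iff by auto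
  obtain B0 where B0: "\<And>x. x \<in> {z1 - 2 * \<beta>..z2 + 2 * \<beta>} \<Longrightarrow> \<bar>v x\<bar> \<le> B0" using bnd[OF cont_v(1)] by blast
  obtain B1 where B1: "\<And>x. x \<in> {z1 - 2 * \<beta>..z2 + 2 * \<beta>} \<Longrightarrow> \<bar>v1 x\<bar> \<le> B1" using bnd[OF cont_v(2)] by blast
  obtain B2 where B2: "\<And>x. x \<in> {z1 - 2 * \<beta>..z2 + 2 * \<beta>} \<Longrightarrow> \<bar>v2 x\<bar> \<le> B2" using bnd[OF cont_v(3)] by blast
  define M where "M = 1 + \<bar>B0\<bar> + \<bar>B1\<bar> + \<bar>B2\<bar> + \<bar>E0\<bar> + e"
  show thesis
  proof (rule that[of M])
    show "M \<ge> 1" using e unfolding M_def by linarith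
    show "\<bar>v1 x\<bar> \<le> M \<and> \<bar>v2 x\<bar> \<le> M" if "x \<in> {z1 - 2 * \<beta>..z2 + 2 * \<beta>}" for x
      using B1[OF that] B2[OF that] e unfolding M_def by linarith
    show "\<bar>E - v x\<bar> \<le> M" if "x \<in> {z1 - 2 * \<beta>..z2 + 2 * \<beta>}" "\<bar>E - E0\<bar> \<le> e" for x E
      using B0[OF that(1)] that(2) unfolding M_def by linarith
  qed
qed

text \<open>
  Let \<open>G\<close> be the primitive of \<open>sqrt |E - v|\<close> vanishing at \<open>a\<close>, and \<open>F\<close> the one of \<open>sqrt |1 - s\<^sup>2|\<close>
  vanishing at \<open>-1\<close>. With \<open>\<kappa> = 2 / \<pi> G(b)\<close> the map defined by \<open>F(\<zeta>) = G / \<kappa>\<close> sends \<open>a\<close> to \<open>-1\<close> and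
  \<open>b\<close> to \<open>1\<close>. It extends beyond the turning points as far as
  \<open>|s| = 1 + 3 \<theta>\<close>, because \<open>G\<close> varies enough there. The bounds come from the turning point charts within \<open>\<eta>\<close> of \<open>a\<close> and \<open>b\<close>, and from the
  middle chart elsewhere. All constants are chosen from the data of the well before \<open>E\<close> is fixed.
\<close>

theorem uniform_liouville_map:
  "\<exists>\<theta>>0. \<exists>K. \<forall>E a b. turning_pair E a b \<longrightarrow>
     (\<exists>dl dr \<zeta> L L1 L2. z1 - 2 * \<beta> \<le> dl \<and> dl < dr \<and> dr \<le> z2 + 2 * \<beta> \<and> continuous_on {dl<..<dr} L2 \<and>
        {- (1 + 2 * \<theta>)..1 + 2 * \<theta>} \<subseteq> \<zeta> ` {dl<..<dr} \<and>
        (\<forall>y\<in>{dl<..<dr}. (\<zeta> has_real_derivative exp (L y)) (at y) \<and> (L has_real_derivative L1 y) (at y) \<and>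
           (L1 has_real_derivative L2 y) (at y) \<and> \<bar>L y\<bar> \<le> K \<and> \<bar>L1 y\<bar> \<le> K \<and> \<bar>L2 y\<bar> \<le> K \<and>
           (2 / pi * integral {a..b} (\<lambda>x. sqrt \<bar>E - v x\<bar>))\<^sup>2 * (exp (L y))\<^sup>2 * (1 - (\<zeta> y)\<^sup>2) = E - v y))"
proof -
  let ?lo = "z1 - 2 * \<beta>" and ?hi = "z2 + 2 * \<beta>"
  let ?N1 = "{z1 - 2 * \<beta>..z1 + 2 * \<beta>}" and ?N2 = "{z2 - 2 * \<beta>..z2 + 2 * \<beta>}"
  have lohi: "?lo < ?hi" "z1 < z2" using sep \<beta> by linarith+
  obtain F where F: "\<And>s. s \<in> {-3..3} \<Longrightarrow> (F has_real_derivative sqrt \<bar>1 - s\<^sup>2\<bar>) (at s)" "F (-1) = 0" "F 1 = pi / 2"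
    using semicircle_antiderivative by metis
  have F_less: "F s < F t" if "-3 \<le> s" "s < t" "t \<le> 3" for s t
  proof (rule strictly_increasing_of_deriv[of s t F "\<lambda>s. sqrt \<bar>1 - s\<^sup>2\<bar>"])
    have "{x \<in> {s..t}. sqrt \<bar>1 - x\<^sup>2\<bar> = 0} \<subseteq> {-1, 1}" by (auto simp: power2_eq_1_iff)
    then show "finite {x \<in> {s..t}. sqrt \<bar>1 - x\<^sup>2\<bar> = 0}" by (rule finite_subset) simp
  qed (use that in \<open>auto intro!: F(1)\<close>)
  have F_le_iff: "F s \<le> F t \<longleftrightarrow> s \<le> t" if "s \<in> {-3..3}" "t \<in> {-3..3}" for s t
    using F_less[of s t] F_less[of t s] that by (cases s t rule: linorder_cases) auto
  have F_lip: "F t - F s \<le> 2 * (t - s)" if "-2 \<le> s" "s \<le> t" "t \<le> 2" for s t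
  proof (rule antiderivative_bounds(2)[OF F(1)])
    fix x assume "x \<in> {s..t}"
    then have "\<bar>x\<bar> \<le> 2" using that by auto
    then have "x\<^sup>2 \<le> 2\<^sup>2" by (simp add: abs_le_square_iff[symmetric] del: power_numeral)
    then have "x\<^sup>2 \<le> 4" by simp
    then have "\<bar>1 - x\<^sup>2\<bar> \<le> 4" using zero_le_power2[of x] by linarith
    then show "sqrt \<bar>1 - x\<^sup>2\<bar> \<le> 2" by (intro real_le_lsqrt) auto
  qed (use that in auto)
  obtain M where M: "M \<ge> 1" "\<And>x. x \<in> {?lo..?hi} \<Longrightarrow> \<bar>v1 x\<bar> \<le> M \<and> \<bar>v2 x\<bar> \<le> M"
    "\<And>x E. x \<in> {?lo..?hi} \<Longrightarrow> \<bar>E - E0\<bar> \<le> e \<Longrightarrow> \<bar>E - v x\<bar> \<le> M" using uniform_bounds by metis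
  define S where "S = sqrt M"
  have S: "S > 0" unfolding S_def using M(1) by simp
  have sq: "sqrt \<bar>E - v x\<bar> \<le> S" if "x \<in> {?lo..?hi}" "\<bar>E - E0\<bar> \<le> e" for x E
    unfolding S_def using M(3)[OF that] by simp
  \<comment> \<open>The constant \<open>cG\<close> bounds below the increase of \<open>G\<close> over a distance \<open>\<beta>\<close> beyond a turning point, and over the
    well itself; it determines how far \<open>\<zeta>\<close> extends and how small \<open>\<kappa>\<close> can be.\<close>
  define cG where "cG = (\<beta> / 2) * sqrt (m * \<beta> / 2)"
  have cG: "cG > 0" unfolding cG_def using \<beta> m by simp
  define \<kappa>min where "\<kappa>min = 2 * cG / pi"
  define \<kappa>max where "\<kappa>max = 2 * (S * (?hi - ?lo)) / pi"
  have \<kappa>min: "\<kappa>min > 0" unfolding \<kappa>min_def using cG by simp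
  have \<kappa>max: "\<kappa>max > 0" unfolding \<kappa>max_def using S lohi by simp
  \<comment> \<open>Within \<open>\<eta>\<close> of a turning point \<open>\<zeta>\<close> stays within 1/2 of \<open>-1\<close> or \<open>1\<close>; this choice of \<open>\<eta>\<close> ensures it through
    the upper bound \<open>S\<close> for the derivative of \<open>G\<close>.\<close>
  define f0 where "f0 = min (F (-1/2) - F (-1)) (F 1 - F (1/2))"
  have f0: "f0 > 0" unfolding f0_def using F_less[of "-1" "-1/2"] F_less[of "1/2" 1] by auto
  define \<theta> where "\<theta> = min (1/6) (cG / (6 * \<kappa>max))"
  have \<theta>: "\<theta> > 0" "3 * \<theta> \<le> 1/2" "\<kappa>max * (6 * \<theta>) \<le> cG"
  proof -
    show "\<theta> > 0" "3 * \<theta> \<le> 1/2" unfolding \<theta>_def using cG \<kappa>max by auto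
    have "\<kappa>max * (6 * \<theta>) \<le> \<kappa>max * (6 * (cG / (6 * \<kappa>max)))" unfolding \<theta>_def using \<kappa>max by (intro mult_left_mono) auto
    then show "\<kappa>max * (6 * \<theta>) \<le> cG" using \<kappa>max by simp
  qed
  define \<eta> where "\<eta> = min \<beta> (\<kappa>min * f0 / S)"
  have \<eta>: "\<eta> > 0" "\<eta> \<le> \<beta>" "S * \<eta> \<le> \<kappa>min * f0"
  proof -
    show "\<eta> > 0" "\<eta> \<le> \<beta>" unfolding \<eta>_def using \<beta> \<kappa>min f0 S by auto
    have "S * \<eta> \<le> S * (\<kappa>min * f0 / S)" unfolding \<eta>_def using S by (intro mult_left_mono) auto
    then show "S * \<eta> \<le> \<kappa>min * f0" using S by simp
  qed
  \<comment> \<open>A lower bound for the increase of \<open>G\<close> between the distances \<open>\<eta> / 4\<close> and \<open>\<eta> / 2\<close> from a turning point; it keeps \<open>\<zeta>\<close> away from \<open>-1\<close>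
    and \<open>1\<close> in the middle chart.\<close>
  define c\<eta> where "c\<eta> = (\<eta> / 4) * sqrt (min e (m * (\<eta> / 4)))"
  have c\<eta>: "c\<eta> > 0" unfolding c\<eta>_def using \<eta> e m by simp
  define d where "d = min (min e (m * (\<eta> / 2))) (min 1 (c\<eta> / (2 * \<kappa>max)))"
  have d: "d > 0" "d \<le> 1" "d \<le> min e (m * (\<eta> / 2))" "d \<le> c\<eta> / (2 * \<kappa>max)"
    unfolding d_def using e m \<eta> c\<eta> \<kappa>max by auto
  have N1lt: "z1 - 2 * \<beta> \<le> z1 + 2 * \<beta>" "z2 - 2 * \<beta> \<le> z2 + 2 * \<beta>" using \<beta> by auto
  obtain K1 where K1: "\<forall>x0\<in>?N1. \<exists>\<gamma> l l1 l2. \<gamma> x0 = 0 \<and> continuous_on ?N1 l2 \<and>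
    (\<forall>x\<in>?N1. (\<gamma> has_real_derivative exp (l x)) (at x within ?N1) \<and>
       (l has_real_derivative l1 x) (at x within ?N1) \<and> (l1 has_real_derivative l2 x) (at x within ?N1) \<and>
       \<bar>l x\<bar> \<le> K1 \<and> \<bar>l1 x\<bar> \<le> K1 \<and> \<bar>l2 x\<bar> \<le> K1 \<and> \<gamma> x * (exp (l x))\<^sup>2 = - v x - (- v x0))"
  proof -
    have "\<exists>K. \<forall>x0\<in>?N1. \<exists>\<gamma> l l1 l2. \<gamma> x0 = 0 \<and> continuous_on ?N1 l2 \<and>
    (\<forall>x\<in>?N1. (\<gamma> has_real_derivative exp (l x)) (at x within ?N1) \<and>
       (l has_real_derivative l1 x) (at x within ?N1) \<and> (l1 has_real_derivative l2 x) (at x within ?N1) \<and>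
       \<bar>l x\<bar> \<le> K \<and> \<bar>l1 x\<bar> \<le> K \<and> \<bar>l2 x\<bar> \<le> K \<and> \<gamma> x * (exp (l x))\<^sup>2 = - v x - (- v x0))"
    proof (rule turning_point_normal_form[OF N1lt(1) m])
      fix x assume x: "x \<in> ?N1"
      show "((\<lambda>x. - v x) has_real_derivative - v1 x) (at x within ?N1)"
        by (rule has_field_derivative_at_within[OF DERIV_minus[OF dv]])
      show "((\<lambda>x. - v1 x) has_real_derivative - v2 x) (at x within ?N1)"
        by (rule has_field_derivative_at_within[OF DERIV_minus[OF dv1]])
      show "((\<lambda>x. - v2 x) has_real_derivative - v3 x) (at x within ?N1)"
        by (rule has_field_derivative_at_within[OF DERIV_minus[OF dv2]]) (use x in blast)
      show "m \<le> - v1 x" using slope1[OF x] by simp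
    qed (intro continuous_intros cv3)
    then show thesis using that by blast
  qed
  obtain K2 where K2: "\<forall>x0\<in>?N2. \<exists>\<gamma> l l1 l2. \<gamma> x0 = 0 \<and> continuous_on ?N2 l2 \<and>
    (\<forall>x\<in>?N2. (\<gamma> has_real_derivative exp (l x)) (at x within ?N2) \<and>
       (l has_real_derivative l1 x) (at x within ?N2) \<and> (l1 has_real_derivative l2 x) (at x within ?N2) \<and>
       \<bar>l x\<bar> \<le> K2 \<and> \<bar>l1 x\<bar> \<le> K2 \<and> \<bar>l2 x\<bar> \<le> K2 \<and> \<gamma> x * (exp (l x))\<^sup>2 = v x - v x0)"
  proof -
    have "\<exists>K. \<forall>x0\<in>?N2. \<exists>\<gamma> l l1 l2. \<gamma> x0 = 0 \<and> continuous_on ?N2 l2 \<and>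
    (\<forall>x\<in>?N2. (\<gamma> has_real_derivative exp (l x)) (at x within ?N2) \<and>
       (l has_real_derivative l1 x) (at x within ?N2) \<and> (l1 has_real_derivative l2 x) (at x within ?N2) \<and>
       \<bar>l x\<bar> \<le> K \<and> \<bar>l1 x\<bar> \<le> K \<and> \<bar>l2 x\<bar> \<le> K \<and> \<gamma> x * (exp (l x))\<^sup>2 = v x - v x0)"
    proof (rule turning_point_normal_form[OF N1lt(2) m])
      fix x assume x: "x \<in> ?N2"
      show "(v has_real_derivative v1 x) (at x within ?N2)" by (rule has_field_derivative_at_within[OF dv])
      show "(v1 has_real_derivative v2 x) (at x within ?N2)" by (rule has_field_derivative_at_within[OF dv1])
      show "(v2 has_real_derivative v3 x) (at x within ?N2)"
        by (rule has_field_derivative_at_within[OF dv2]) (use x in blast)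
      show "m \<le> v1 x" by (rule slope2[OF x])
    qed (rule cv3)
    then show thesis using that by blast
  qed
  obtain K3 \<phi>a ka ka1 ka2 where \<phi>a: "\<phi>a (-1) = 0" "continuous_on {-2..-1/4} ka2"
    "\<And>s. s \<in> {-2..-1/4} \<Longrightarrow> (\<phi>a has_real_derivative exp (ka s)) (at s within {-2..-1/4}) \<and>
       (ka has_real_derivative ka1 s) (at s within {-2..-1/4}) \<and> (ka1 has_real_derivative ka2 s) (at s within {-2..-1/4}) \<and>
       \<bar>ka s\<bar> \<le> K3 \<and> \<bar>ka1 s\<bar> \<le> K3 \<and> \<bar>ka2 s\<bar> \<le> K3 \<and> \<phi>a s * (exp (ka s))\<^sup>2 = - s\<^sup>2 - (- (-1)\<^sup>2)"
  proof -
    show thesis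
    proof (rule turning_point_normal_form_at[of "-2" "-1/4" "1/2" "\<lambda>x. - x\<^sup>2" "\<lambda>x. - 2 * x" "\<lambda>_. - 2" "\<lambda>_. 0" "-1"])
      fix x :: real assume x: "x \<in> {-2..-1/4}"
      show "((\<lambda>x::real. - x\<^sup>2) has_real_derivative - 2 * x) (at x within {-2..-1/4})" by (auto intro!: derivative_eq_intros)
      show "((\<lambda>x::real. - 2 * x) has_real_derivative - 2) (at x within {-2..-1/4})" by (auto intro!: derivative_eq_intros)
      show "((\<lambda>x::real. - 2) has_real_derivative 0) (at x within {-2..-1/4})" by (auto intro!: derivative_eq_intros)
      show "1/2 \<le> - 2 * x" using x by auto
    next
      fix K \<gamma> l l1 l2 assume "\<gamma> (-1) = 0" "continuous_on {-2..-1/4} l2"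
        "\<And>x. x \<in> {-2..-1/4} \<Longrightarrow> (\<gamma> has_real_derivative exp (l x)) (at x within {-2..-1/4}) \<and>
       (l has_real_derivative l1 x) (at x within {-2..-1/4}) \<and> (l1 has_real_derivative l2 x) (at x within {-2..-1/4}) \<and>
       \<bar>l x\<bar> \<le> K \<and> \<bar>l1 x\<bar> \<le> K \<and> \<bar>l2 x\<bar> \<le> K \<and> \<gamma> x * (exp (l x))\<^sup>2 = - x\<^sup>2 - (- (-1)\<^sup>2)"
      then show thesis by (rule that)
    qed auto
  qed
  obtain K4 \<phi>b kb kb1 kb2 where \<phi>b: "\<phi>b 1 = 0" "continuous_on {1/4..2} kb2"
    "\<And>s. s \<in> {1/4..2} \<Longrightarrow> (\<phi>b has_real_derivative exp (kb s)) (at s within {1/4..2}) \<and>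
       (kb has_real_derivative kb1 s) (at s within {1/4..2}) \<and> (kb1 has_real_derivative kb2 s) (at s within {1/4..2}) \<and>
       \<bar>kb s\<bar> \<le> K4 \<and> \<bar>kb1 s\<bar> \<le> K4 \<and> \<bar>kb2 s\<bar> \<le> K4 \<and> \<phi>b s * (exp (kb s))\<^sup>2 = s\<^sup>2 - 1\<^sup>2"
  proof -
    show thesis
    proof (rule turning_point_normal_form_at[of "1/4" 2 "1/2" "\<lambda>x. x\<^sup>2" "\<lambda>x. 2 * x" "\<lambda>_. 2" "\<lambda>_. 0" 1])
      fix x :: real assume x: "x \<in> {1/4..2}"
      show "((\<lambda>x::real. x\<^sup>2) has_real_derivative 2 * x) (at x within {1/4..2})" by (auto intro!: derivative_eq_intros)
      show "((\<lambda>x::real. 2 * x) has_real_derivative 2) (at x within {1/4..2})" by (auto intro!: derivative_eq_intros)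
      show "((\<lambda>x::real. 2) has_real_derivative 0) (at x within {1/4..2})" by (auto intro!: derivative_eq_intros)
      show "1/2 \<le> 2 * x" using x by auto
    next
      fix K \<gamma> l l1 l2 assume "\<gamma> 1 = 0" "continuous_on {1/4..2} l2"
        "\<And>x. x \<in> {1/4..2} \<Longrightarrow> (\<gamma> has_real_derivative exp (l x)) (at x within {1/4..2}) \<and>
       (l has_real_derivative l1 x) (at x within {1/4..2}) \<and> (l1 has_real_derivative l2 x) (at x within {1/4..2}) \<and>
       \<bar>l x\<bar> \<le> K \<and> \<bar>l1 x\<bar> \<le> K \<and> \<bar>l2 x\<bar> \<le> K \<and> \<gamma> x * (exp (l x))\<^sup>2 = x\<^sup>2 - 1\<^sup>2"
      then show thesis by (rule that)
    qed auto
  qed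
  define Kc where "Kc = \<bar>ln \<kappa>min\<bar> + \<bar>ln \<kappa>max\<bar>"
  define K where "K = \<bar>K1\<bar> + \<bar>K2\<bar> + \<bar>K3\<bar> + \<bar>K4\<bar> + Kc + (\<bar>ln d\<bar> + \<bar>ln M\<bar>) + (M / d + (M / d)\<^sup>2) + 2 / d\<^sup>2"
  have Kparts: "0 \<le> Kc" "0 \<le> \<bar>ln d\<bar> + \<bar>ln M\<bar>" "0 \<le> M / d + (M / d)\<^sup>2" "0 \<le> 2 / d\<^sup>2"
    unfolding Kc_def using d M(1) by auto
  have K: "K1 \<le> K" "K2 \<le> K" "K3 \<le> K" "K4 \<le> K" "Kc \<le> K" "\<bar>ln d\<bar> + \<bar>ln M\<bar> \<le> K" "M / d + (M / d)\<^sup>2 \<le> K" "2 / d\<^sup>2 \<le> K"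
    using Kparts unfolding K_def by linarith+
  have main: "\<exists>dl dr \<zeta>. z1 - 2 * \<beta> \<le> dl \<and> dl < dr \<and> dr \<le> z2 + 2 * \<beta> \<and>
        {- (1 + 2 * \<theta>)..1 + 2 * \<theta>} \<subseteq> \<zeta> ` {dl<..<dr} \<and>
        (\<forall>y\<in>{dl<..<dr}. controlled_at \<zeta> (2 / pi * integral {a..b} (\<lambda>x. sqrt \<bar>E - v x\<bar>)) (\<lambda>y. E - v y) (chart_bound K) y)"
    if tp: "turning_pair E a b" for E a b
  proof -
    note t = tp[unfolded turning_pair_def]
    have Ee: "\<bar>E - E0\<bar> \<le> e" using t by blast
    have ab: "z1 - \<beta> \<le> a" "a \<le> z1 + \<beta>" "z2 - \<beta> \<le> b" "b \<le> z2 + \<beta>" "v a = E" "v b = E" using t by auto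
    have ab': "a + 2 * \<beta> < b" using ab sep by linarith
    have "\<exists>G. G a = 0 \<and> (\<forall>x\<in>{?lo..?hi}. (G has_real_derivative sqrt \<bar>E - v x\<bar>) (at x))"
      by (rule antiderivative_exists) (intro continuous_intros cont_v)
    then obtain G where G0: "G a = 0" and G: "\<And>x. x \<in> {?lo..?hi} \<Longrightarrow> (G has_real_derivative sqrt \<bar>E - v x\<bar>) (at x)" by blast
    have G_lower: "G y - G x \<ge> \<sigma> * (y - x)"
      if "?lo \<le> x" "x \<le> y" "y \<le> ?hi" "\<And>t. t \<in> {x..y} \<Longrightarrow> sqrt \<bar>E - v t\<bar> \<ge> \<sigma>" for x y \<sigma>
      by (rule antiderivative_bounds(1)[OF G]) (use that in auto)
    have G_mono: "G x \<le> G y" if "?lo \<le> x" "x \<le> y" "y \<le> ?hi" for x y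
      using G_lower[OF that, of 0] by simp
    have G_upper: "G y - G x \<le> S * (y - x)" if "?lo \<le> x" "x \<le> y" "y \<le> ?hi" for x y
      by (rule antiderivative_bounds(2)[OF G]) (use that sq Ee in auto)
    have cG_eq: "sqrt (m * \<beta> / 2) * (\<beta> / 2) = cG" unfolding cG_def by simp
    have G_left: "G (a - \<beta>) \<le> - cG"
    proof -
      have "sqrt (m * \<beta> / 2) * ((a - \<beta> / 2) - (a - \<beta>)) \<le> G (a - \<beta> / 2) - G (a - \<beta>)"
      proof (rule G_lower)
        fix y assume y: "y \<in> {a - \<beta>..a - \<beta> / 2}"
        have "v y - E \<ge> m * (a - y)" using y ab \<beta> by (intro barrier_left[OF tp]) auto
        moreover have "m * (a - y) \<ge> m * (\<beta> / 2)" using y m by (intro mult_left_mono) auto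
        ultimately show "sqrt (m * \<beta> / 2) \<le> sqrt \<bar>E - v y\<bar>" by (intro real_sqrt_le_mono) linarith
      qed (use ab \<beta> sep in auto)
      moreover have "(a - \<beta> / 2) - (a - \<beta>) = \<beta> / 2" by simp
      moreover have "G (a - \<beta> / 2) \<le> G a" using ab \<beta> sep by (intro G_mono) auto
      ultimately show ?thesis using G0 cG_eq by simp
    qed
    have G_right: "G (b + \<beta>) - G b \<ge> cG"
    proof -
      have "sqrt (m * \<beta> / 2) * ((b + \<beta>) - (b + \<beta> / 2)) \<le> G (b + \<beta>) - G (b + \<beta> / 2)"
      proof (rule G_lower)
        fix y assume y: "y \<in> {b + \<beta> / 2..b + \<beta>}"
        have "v y - E \<ge> m * (y - b)" using y ab \<beta> by (intro barrier_right[OF tp]) auto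
        moreover have "m * (y - b) \<ge> m * (\<beta> / 2)" using y m by (intro mult_left_mono) auto
        ultimately show "sqrt (m * \<beta> / 2) \<le> sqrt \<bar>E - v y\<bar>" by (intro real_sqrt_le_mono) linarith
      qed (use ab \<beta> sep in auto)
      moreover have "(b + \<beta>) - (b + \<beta> / 2) = \<beta> / 2" by simp
      moreover have "G b \<le> G (b + \<beta> / 2)" using ab \<beta> sep by (intro G_mono) auto
      ultimately show ?thesis using cG_eq by simp
    qed
    have G_mid: "G b \<ge> cG"
    proof -
      have "sqrt (m * \<beta> / 2) * ((a + \<beta>) - (a + \<beta> / 2)) \<le> G (a + \<beta>) - G (a + \<beta> / 2)"
      proof (rule G_lower)
        fix y assume y: "y \<in> {a + \<beta> / 2..a + \<beta>}"
        have "v a - v y \<ge> m * (y - a)" using y ab \<beta> by (intro slope_left) auto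
        moreover have "m * (y - a) \<ge> m * (\<beta> / 2)" using y m by (intro mult_left_mono) auto
        ultimately show "sqrt (m * \<beta> / 2) \<le> sqrt \<bar>E - v y\<bar>" using ab by (intro real_sqrt_le_mono) linarith
      qed (use ab ab' \<beta> sep in auto)
      moreover have "(a + \<beta>) - (a + \<beta> / 2) = \<beta> / 2" by simp
      moreover have "G a \<le> G (a + \<beta> / 2)" "G (a + \<beta>) \<le> G b" using ab ab' \<beta> sep by (auto intro!: G_mono)
      ultimately show ?thesis using G0 cG_eq by simp
    qed
    define \<kappa> where "\<kappa> = 2 / pi * G b"
    have \<kappa>_eq: "2 / pi * integral {a..b} (\<lambda>x. sqrt \<bar>E - v x\<bar>) = \<kappa>"
    proof -
      have "((\<lambda>x. sqrt \<bar>E - v x\<bar>) has_integral (G b - G a)) {a..b}"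
      proof (rule fundamental_theorem_of_calculus)
        fix y assume "y \<in> {a..b}"
        then show "(G has_vector_derivative sqrt \<bar>E - v y\<bar>) (at y within {a..b})"
          unfolding has_real_derivative_iff_has_vector_derivative[symmetric]
          using ab \<beta> by (intro has_field_derivative_at_within[OF G]) auto
      qed (use ab' \<beta> in simp)
      then show ?thesis unfolding \<kappa>_def using G0 by (simp add: integral_unique)
    qed
    have \<kappa>b: "\<kappa>min \<le> \<kappa>" "\<kappa> \<le> \<kappa>max" "\<kappa> > 0"
    proof -
      show "\<kappa>min \<le> \<kappa>" unfolding \<kappa>min_def \<kappa>_def using G_mid by (simp add: divide_right_mono)
      have "G b \<le> S * (b - a)" using G_upper[of a b] ab ab' \<beta> G0 by simp
      also have "\<dots> \<le> S * (?hi - ?lo)" using S ab \<beta> by (intro mult_left_mono) auto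
      finally show "\<kappa> \<le> \<kappa>max" unfolding \<kappa>max_def \<kappa>_def by (simp add: divide_right_mono)
      show "\<kappa> > 0" using \<kappa>min \<open>\<kappa>min \<le> \<kappa>\<close> by linarith
    qed
    have Gb: "G b = \<kappa> * F 1" unfolding \<kappa>_def F(3) by simp
    have ln\<kappa>: "\<bar>ln \<kappa>\<bar> \<le> Kc" unfolding Kc_def using \<kappa>b \<kappa>min by (intro abs_ln_le) auto
    \<comment> \<open>The scaling between the normal form coordinates.\<close>
    define c where "c = \<kappa> powr (- (2/3))"
    have c: "c > 0" "c * sqrt c = 1 / \<kappa>" "\<bar>ln c\<bar> \<le> K"
    proof -
      show c0: "c > 0" unfolding c_def using \<kappa>b by simp
      have "sqrt c = \<kappa> powr (- (1/3))" unfolding c_def powr_half_sqrt[OF powr_ge_zero, symmetric] powr_powr by simp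
      then have "c * sqrt c = \<kappa> powr (- 1)" unfolding c_def by (simp flip: powr_add)
      then show "c * sqrt c = 1 / \<kappa>" using \<kappa>b by (simp add: powr_minus_divide)
      have "ln c = - (2/3) * ln \<kappa>" unfolding c_def using \<kappa>b by (simp add: ln_powr)
      then show "\<bar>ln c\<bar> \<le> K" using ln\<kappa> K(5) by (simp add: abs_mult)
    qed
    have sm: "\<kappa> * (6 * \<theta>) \<le> cG" using \<theta> \<kappa>b mult_right_mono[of \<kappa> \<kappa>max "6 * \<theta>"] by linarith
    have contG: "continuous_on {?lo..?hi} G"
      by (rule continuous_at_imp_continuous_on, rule ballI, rule DERIV_isCont, erule G)
    have F1: "F (- (1 + 3 * \<theta>)) \<ge> - (6 * \<theta>)" "F (- (1 + 3 * \<theta>)) < 0"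
      using F_lip[of "- (1 + 3 * \<theta>)" "-1"] F_less[of "- (1 + 3 * \<theta>)" "-1"] \<theta> F(2) by auto
    have F2: "F (1 + 3 * \<theta>) - F 1 \<le> 6 * \<theta>" "F 1 < F (1 + 3 * \<theta>)"
      using F_lip[of 1 "1 + 3 * \<theta>"] F_less[of 1 "1 + 3 * \<theta>"] \<theta> by auto
    have "\<exists>x\<ge>a - \<beta>. x \<le> a \<and> G x = \<kappa> * F (- (1 + 3 * \<theta>))"
    proof (rule IVT')
      have "\<kappa> * F (- (1 + 3 * \<theta>)) \<ge> \<kappa> * (- (6 * \<theta>))" using F1 \<kappa>b by (intro mult_left_mono) auto
      then show "G (a - \<beta>) \<le> \<kappa> * F (- (1 + 3 * \<theta>))" using G_left sm by simp
      show "\<kappa> * F (- (1 + 3 * \<theta>)) \<le> G a" using F1 \<kappa>b G0 by (simp add: mult_le_0_iff)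
      show "continuous_on {a - \<beta>..a} G" using ab \<beta> sep by (intro continuous_on_subset[OF contG]) auto
    qed (use \<beta> in simp)
    then obtain dl where dl: "a - \<beta> \<le> dl" "dl \<le> a" "G dl = \<kappa> * F (- (1 + 3 * \<theta>))" by blast
    have "\<exists>x\<ge>b. x \<le> b + \<beta> \<and> G x = \<kappa> * F (1 + 3 * \<theta>)"
    proof (rule IVT')
      have "\<kappa> * (F (1 + 3 * \<theta>) - F 1) \<le> \<kappa> * (6 * \<theta>)" using F2 \<kappa>b by (intro mult_left_mono) auto
      then show "\<kappa> * F (1 + 3 * \<theta>) \<le> G (b + \<beta>)" using G_right sm Gb by (simp add: algebra_simps)
      show "G b \<le> \<kappa> * F (1 + 3 * \<theta>)" using F2 \<kappa>b Gb by simp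
      show "continuous_on {b..b + \<beta>} G" using ab \<beta> sep by (intro continuous_on_subset[OF contG]) auto
    qed (use \<beta> in simp)
    then obtain dr where dr: "b \<le> dr" "dr \<le> b + \<beta>" "G dr = \<kappa> * F (1 + 3 * \<theta>)" by blast
    have dlr: "?lo \<le> dl" "dr \<le> ?hi" "dl < dr" using dl dr ab ab' \<beta> by linarith+
    \<comment> \<open>The map is the composition of \<open>G / \<kappa>\<close> with the inverse of \<open>F\<close>.\<close>
    define Fi where "Fi = the_inv_into {-2..2} F"
    have injF: "inj_on F {-2..2}"
    proof (rule inj_onI)
      fix s t assume "s \<in> {-2..2}" "t \<in> {-2..2}" "F s = F t"
      then show "s = t" using F_less[of s t] F_less[of t s] by (cases s t rule: linorder_cases) auto
    qed
    have contF: "continuous_on {-2..2} F"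
      by (rule continuous_at_imp_continuous_on, rule ballI, rule DERIV_isCont, rule F(1)) auto
    have contFi: "continuous_on (F ` {-2..2}) Fi"
      by (rule continuous_on_inv[OF contF compact_Icc]) (auto simp: Fi_def intro!: the_inv_into_f_f injF)
    define \<zeta> where "\<zeta> = (\<lambda>x. Fi (G x / \<kappa>))"
    have range: "\<exists>s\<in>{- (1 + 3 * \<theta>)..1 + 3 * \<theta>}. F s = G x / \<kappa>" if "x \<in> {dl..dr}" for x
    proof -
      have "G dl \<le> G x" "G x \<le> G dr" using that dlr by (auto intro!: G_mono)
      then have "F (- (1 + 3 * \<theta>)) \<le> G x / \<kappa>" "G x / \<kappa> \<le> F (1 + 3 * \<theta>)"
        using \<kappa>b unfolding dl(3) dr(3) by (simp_all add: le_divide_eq divide_le_eq mult.commute)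
      moreover have "continuous_on {- (1 + 3 * \<theta>)..1 + 3 * \<theta>} F" using \<theta> by (intro continuous_on_subset[OF contF]) auto
      ultimately show ?thesis using \<theta> IVT'[of F "- (1 + 3 * \<theta>)" "G x / \<kappa>" "1 + 3 * \<theta>"] by auto
    qed
    have \<zeta>: "\<zeta> x \<in> {- (1 + 3 * \<theta>)..1 + 3 * \<theta>}" "F (\<zeta> x) = G x / \<kappa>" if x: "x \<in> {dl..dr}" for x
    proof -
      obtain s where s: "s \<in> {- (1 + 3 * \<theta>)..1 + 3 * \<theta>}" "F s = G x / \<kappa>" using range[OF x] by blast
      then have "s \<in> {-2..2}" using \<theta> by auto
      then have "\<zeta> x = s" unfolding \<zeta>_def Fi_def s(2)[symmetric] by (rule the_inv_into_f_f[OF injF])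
      with s show "\<zeta> x \<in> {- (1 + 3 * \<theta>)..1 + 3 * \<theta>}" "F (\<zeta> x) = G x / \<kappa>" by auto
    qed
    have \<zeta>2: "\<zeta> x \<in> {-3/2..3/2}" if "x \<in> {dl..dr}" for x using \<zeta>(1)[OF that] \<theta> by auto
    have cont\<zeta>: "continuous_on {dl..dr} \<zeta>" unfolding \<zeta>_def
    proof (rule continuous_on_compose2[OF contFi])
      show "continuous_on {dl..dr} (\<lambda>x. G x / \<kappa>)"
        using dlr \<kappa>b by (intro continuous_intros continuous_on_subset[OF contG]) auto
      show "(\<lambda>x. G x / \<kappa>) ` {dl..dr} \<subseteq> F ` {-2..2}"
      proof (rule image_subsetI)
        fix x assume "x \<in> {dl..dr}"
        from range[OF this] obtain s where "s \<in> {- (1 + 3 * \<theta>)..1 + 3 * \<theta>}" "F s = G x / \<kappa>" by blast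
        moreover from this(1) \<theta> have "s \<in> {-2..2}" by auto
        ultimately show "G x / \<kappa> \<in> F ` {-2..2}" by (metis image_eqI)
      qed
    qed
    have F_iff: "F s = F t \<longleftrightarrow> s = t" if "s \<in> {-2..2}" "t \<in> {-2..2}" for s t using injF that by (auto dest: inj_onD)
    have surj: "{- (1 + 2 * \<theta>)..1 + 2 * \<theta>} \<subseteq> \<zeta> ` {dl<..<dr}"
    proof
      fix s assume s: "s \<in> {- (1 + 2 * \<theta>)..1 + 2 * \<theta>}"
      have ends: "\<zeta> dl = - (1 + 3 * \<theta>)" "\<zeta> dr = 1 + 3 * \<theta>"
        using \<zeta>[of dl] \<zeta>[of dr] dlr dl(3) dr(3) \<kappa>b \<theta> F_iff[of "\<zeta> dl" "- (1 + 3 * \<theta>)"] F_iff[of "\<zeta> dr" "1 + 3 * \<theta>"] by auto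
      have "\<exists>x\<ge>dl. x \<le> dr \<and> \<zeta> x = s"
        using s \<theta> dlr ends by (intro IVT' cont\<zeta>) auto
      then obtain x where x: "dl \<le> x" "x \<le> dr" "\<zeta> x = s" by blast
      moreover from this have "x \<noteq> dl" "x \<noteq> dr" using ends s \<theta> by auto
      ultimately show "s \<in> \<zeta> ` {dl<..<dr}" by (intro image_eqI[of _ _ x]) auto
    qed
    have ctrl: "controlled_at \<zeta> \<kappa> (\<lambda>y. E - v y) (chart_bound K) x" if x: "x \<in> {dl<..<dr}" for x
    proof -
      consider (L) "x < a + \<eta>" | (R) "x > b - \<eta>" | (C) "x \<in> {a + \<eta> / 2<..<b - \<eta> / 2}" using \<eta> by fastforce
      then show ?thesis
      proof cases
        case L
        have aN: "a \<in> ?N1" using ab \<beta> by auto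
        from bspec[OF K1 aN] obtain \<gamma> l l1 l2 where \<gamma>c: "\<gamma> a = 0 \<and> continuous_on ?N1 l2 \<and>
    (\<forall>x\<in>?N1. (\<gamma> has_real_derivative exp (l x)) (at x within ?N1) \<and>
       (l has_real_derivative l1 x) (at x within ?N1) \<and> (l1 has_real_derivative l2 x) (at x within ?N1) \<and>
       \<bar>l x\<bar> \<le> K1 \<and> \<bar>l1 x\<bar> \<le> K1 \<and> \<bar>l2 x\<bar> \<le> K1 \<and> \<gamma> x * (exp (l x))\<^sup>2 = - v x - (- v a))"
          by (elim exE) (rule that)
        note \<gamma> = conjunct1[OF \<gamma>c] conjunct1[OF conjunct2[OF \<gamma>c]] bspec[OF conjunct2[OF conjunct2[OF \<gamma>c]]]
        define U where "U = {dl<..<a + \<eta>}"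
        have U_dlr: "U \<subseteq> {dl..dr}" unfolding U_def using dr ab' \<eta> \<beta> by auto
        show ?thesis
        proof (rule turning_point_chart[OF \<kappa>b(3) c, where U = U and \<alpha> = ?lo and \<omega> = "z1 + 2 * \<beta>" and p = "-2" and q = "-1/4"
              and \<phi> = \<phi>a and k = ka and ?k1.0 = ka1 and ?k2.0 = ka2 and \<gamma> = \<gamma> and l = l and ?l1.0 = l1 and ?l2.0 = l2
              and \<sigma> = 1 and F = F and G = G and ?s0.0 = "-1" and ?x0.0 = a])
          show "open U" "x \<in> U" using L x unfolding U_def by auto
          show "U \<subseteq> ?N1" unfolding U_def using dlr ab \<eta> by auto
          show "continuous_on U \<zeta>" by (rule continuous_on_subset[OF cont\<zeta> U_dlr])
          fix y assume y: "y \<in> U"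
          then have yd: "y \<in> {dl..dr}" using U_dlr by blast
          show "F (\<zeta> y) - F (-1) = (G y - G a) / \<kappa>" using \<zeta>(2)[OF yd] F(2) G0 by simp
          have "G y \<le> S * \<eta>"
          proof (cases "y \<le> a")
            case True
            then have "G y \<le> G a" using y dlr ab \<beta> sep unfolding U_def by (intro G_mono) auto
            then show ?thesis using G0 S \<eta> by (smt (verit) mult_nonneg_nonneg)
          next
            case False
            then have "G y - G a \<le> S * (y - a)" using y ab \<eta> \<beta> sep unfolding U_def by (intro G_upper) auto
            also have "\<dots> \<le> S * \<eta>" using y S unfolding U_def by (intro mult_left_mono) auto
            finally show ?thesis using G0 by simp
          qed
          also have "\<dots> \<le> \<kappa> * f0" using \<eta>(3) mult_right_mono[OF \<kappa>b(1), of f0] f0 by linarith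
          finally have "F (\<zeta> y) \<le> f0" using \<zeta>(2)[OF yd] \<kappa>b by (simp add: divide_le_eq mult.commute)
          then have "F (\<zeta> y) \<le> F (-1/2)" unfolding f0_def F(2) by simp
          then have "\<zeta> y \<le> -1/2" using F_le_iff[of "\<zeta> y" "-1/2"] \<zeta>2[OF yd] by auto
          then show "\<zeta> y \<in> {-2<..<-1/4}" using \<zeta>2[OF yd] by auto
        next
          fix y assume y: "y \<in> ?N1"
          show "(\<gamma> has_real_derivative exp (l y)) (at y within ?N1) \<and>
            (l has_real_derivative l1 y) (at y within ?N1) \<and> (l1 has_real_derivative l2 y) (at y within ?N1) \<and>
            \<bar>l y\<bar> \<le> K \<and> \<bar>l1 y\<bar> \<le> K \<and> \<bar>l2 y\<bar> \<le> K \<and> \<gamma> y * (exp (l y))\<^sup>2 = 1 * (E - v y)"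
            using \<gamma>(3)[OF y] K(1) ab by auto
          show "(G has_real_derivative sqrt \<bar>E - v y\<bar>) (at y)" using y sep \<beta> by (intro G) auto
        next
          fix s :: real assume s: "s \<in> {-2..-1/4}"
          show "(\<phi>a has_real_derivative exp (ka s)) (at s within {-2..-1/4}) \<and>
            (ka has_real_derivative ka1 s) (at s within {-2..-1/4}) \<and> (ka1 has_real_derivative ka2 s) (at s within {-2..-1/4}) \<and>
            \<bar>ka s\<bar> \<le> K \<and> \<bar>ka1 s\<bar> \<le> K \<and> \<bar>ka2 s\<bar> \<le> K \<and> \<phi>a s * (exp (ka s))\<^sup>2 = 1 * (1 - s\<^sup>2)"
            using \<phi>a(3)[OF s] K(3) by auto
          show "(F has_real_derivative sqrt \<bar>1 - s\<^sup>2\<bar>) (at s)" using s by (intro F(1)) auto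
        qed (use \<phi>a \<gamma> aN in auto)
      next
        case R
        have bN: "b \<in> ?N2" using ab \<beta> by auto
        from bspec[OF K2 bN] obtain \<gamma> l l1 l2 where \<gamma>c: "\<gamma> b = 0 \<and> continuous_on ?N2 l2 \<and>
    (\<forall>x\<in>?N2. (\<gamma> has_real_derivative exp (l x)) (at x within ?N2) \<and>
       (l has_real_derivative l1 x) (at x within ?N2) \<and> (l1 has_real_derivative l2 x) (at x within ?N2) \<and>
       \<bar>l x\<bar> \<le> K2 \<and> \<bar>l1 x\<bar> \<le> K2 \<and> \<bar>l2 x\<bar> \<le> K2 \<and> \<gamma> x * (exp (l x))\<^sup>2 = v x - v b)"
          by (elim exE) (rule that)
        note \<gamma> = conjunct1[OF \<gamma>c] conjunct1[OF conjunct2[OF \<gamma>c]] bspec[OF conjunct2[OF conjunct2[OF \<gamma>c]]]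
        define U where "U = {b - \<eta><..<dr}"
        have U_dlr: "U \<subseteq> {dl..dr}" unfolding U_def using dl ab' \<eta> \<beta> by auto
        show ?thesis
        proof (rule turning_point_chart[OF \<kappa>b(3) c, where U = U and \<alpha> = "z2 - 2 * \<beta>" and \<omega> = ?hi and p = "1/4" and q = 2
              and \<phi> = \<phi>b and k = kb and ?k1.0 = kb1 and ?k2.0 = kb2 and \<gamma> = \<gamma> and l = l and ?l1.0 = l1 and ?l2.0 = l2
              and \<sigma> = "-1" and F = F and G = G and ?s0.0 = 1 and ?x0.0 = b])
          show "open U" "x \<in> U" using R x unfolding U_def by auto
          show "U \<subseteq> ?N2" unfolding U_def using dlr ab \<eta> by auto
          show "continuous_on U \<zeta>" by (rule continuous_on_subset[OF cont\<zeta> U_dlr])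
          fix y assume y: "y \<in> U"
          then have yd: "y \<in> {dl..dr}" using U_dlr by blast
          show "F (\<zeta> y) - F 1 = (G y - G b) / \<kappa>" using \<zeta>(2)[OF yd] Gb \<kappa>b(3) by (simp add: diff_divide_distrib)
          have "G b - G y \<le> S * \<eta>"
          proof (cases "y \<ge> b")
            case True
            then have "G b \<le> G y" using y dlr ab \<beta> sep unfolding U_def by (intro G_mono) auto
            then show ?thesis using S \<eta> by (smt (verit) mult_nonneg_nonneg)
          next
            case False
            then have "G b - G y \<le> S * (b - y)" using y ab \<eta> \<beta> sep unfolding U_def by (intro G_upper) auto
            also have "\<dots> \<le> S * \<eta>" using y S unfolding U_def by (intro mult_left_mono) auto
            finally show ?thesis .
          qed
          also have "\<dots> \<le> \<kappa> * f0" using \<eta>(3) mult_right_mono[OF \<kappa>b(1), of f0] f0 by linarith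
          finally have "\<kappa> * (F 1 - f0) \<le> G y" using Gb by (simp add: algebra_simps)
          then have "F 1 - f0 \<le> F (\<zeta> y)" using \<zeta>(2)[OF yd] \<kappa>b by (simp add: le_divide_eq mult.commute)
          then have "F (1/2) \<le> F (\<zeta> y)" unfolding f0_def by linarith
          then have "1/2 \<le> \<zeta> y" using F_le_iff[of "1/2" "\<zeta> y"] \<zeta>2[OF yd] by auto
          then show "\<zeta> y \<in> {1/4<..<2}" using \<zeta>2[OF yd] by auto
        next
          fix y assume y: "y \<in> ?N2"
          show "(\<gamma> has_real_derivative exp (l y)) (at y within ?N2) \<and>
            (l has_real_derivative l1 y) (at y within ?N2) \<and> (l1 has_real_derivative l2 y) (at y within ?N2) \<and>
            \<bar>l y\<bar> \<le> K \<and> \<bar>l1 y\<bar> \<le> K \<and> \<bar>l2 y\<bar> \<le> K \<and> \<gamma> y * (exp (l y))\<^sup>2 = (-1) * (E - v y)"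
            using \<gamma>(3)[OF y] K(2) ab by auto
          show "(G has_real_derivative sqrt \<bar>E - v y\<bar>) (at y)" using y sep \<beta> by (intro G) auto
        next
          fix s :: real assume s: "s \<in> {1/4..2}"
          show "(\<phi>b has_real_derivative exp (kb s)) (at s within {1/4..2}) \<and>
            (kb has_real_derivative kb1 s) (at s within {1/4..2}) \<and> (kb1 has_real_derivative kb2 s) (at s within {1/4..2}) \<and>
            \<bar>kb s\<bar> \<le> K \<and> \<bar>kb1 s\<bar> \<le> K \<and> \<bar>kb2 s\<bar> \<le> K \<and> \<phi>b s * (exp (kb s))\<^sup>2 = (-1) * (1 - s\<^sup>2)"
            using \<phi>b(3)[OF s] K(4) by auto
          show "(F has_real_derivative sqrt \<bar>1 - s\<^sup>2\<bar>) (at s)" using s by (intro F(1)) auto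
        qed (use \<phi>b \<gamma> bN in auto)
      next
        case C
        define U where "U = {a + \<eta> / 2<..<b - \<eta> / 2}"
        have U_dlr: "U \<subseteq> {dl..dr}" unfolding U_def using dl dr ab' \<eta> by auto
        have quarter: "G (a + \<eta> / 2) \<ge> c\<eta>" "G b - G (b - \<eta> / 2) \<ge> c\<eta>"
        proof -
          have "sqrt (min e (m * (\<eta> / 4))) * ((a + \<eta> / 2) - (a + \<eta> / 4)) \<le> G (a + \<eta> / 2) - G (a + \<eta> / 4)"
          proof (rule G_lower)
            fix y assume "y \<in> {a + \<eta> / 4..a + \<eta> / 2}"
            then have "E - v y \<ge> min e (m * (\<eta> / 4))" using \<eta> ab' by (intro depth[OF tp]) auto
            then show "sqrt (min e (m * (\<eta> / 4))) \<le> sqrt \<bar>E - v y\<bar>" by (intro real_sqrt_le_mono) linarith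
          qed (use ab ab' \<beta> \<eta> sep in auto)
          moreover have "G a \<le> G (a + \<eta> / 4)" using ab \<beta> \<eta> sep by (intro G_mono) auto
          moreover have "(a + \<eta> / 2) - (a + \<eta> / 4) = \<eta> / 4" by simp
          ultimately show "G (a + \<eta> / 2) \<ge> c\<eta>" using G0 unfolding c\<eta>_def by (simp add: mult.commute)
          have "sqrt (min e (m * (\<eta> / 4))) * ((b - \<eta> / 4) - (b - \<eta> / 2)) \<le> G (b - \<eta> / 4) - G (b - \<eta> / 2)"
          proof (rule G_lower)
            fix y assume "y \<in> {b - \<eta> / 2..b - \<eta> / 4}"
            then have "E - v y \<ge> min e (m * (\<eta> / 4))" using \<eta> ab' by (intro depth[OF tp]) auto
            then show "sqrt (min e (m * (\<eta> / 4))) \<le> sqrt \<bar>E - v y\<bar>" by (intro real_sqrt_le_mono) linarith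
          qed (use ab ab' \<beta> \<eta> sep in auto)
          moreover have "G (b - \<eta> / 4) \<le> G b" using ab \<beta> \<eta> sep by (intro G_mono) auto
          moreover have "(b - \<eta> / 4) - (b - \<eta> / 2) = \<eta> / 4" by simp
          ultimately show "G b - G (b - \<eta> / 2) \<ge> c\<eta>" unfolding c\<eta>_def by (simp add: mult.commute)
        qed
        have c\<kappa>: "c\<eta> / \<kappa>max \<le> c\<eta> / \<kappa>" using c\<eta> \<kappa>b by (intro divide_left_mono) auto
        have d2: "2 * d \<le> c\<eta> / \<kappa>max" using d(4) by simp
        show ?thesis
        proof (rule middle_chart[where U = U and d = d and M = M and F = F and G = G and ?w1.0 = "\<lambda>y. - v1 y" and ?w2.0 = "\<lambda>y. - v2 y"])
          show "open U" "x \<in> U" using C unfolding U_def by auto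
          show "\<bar>ln (1 / \<kappa>)\<bar> \<le> K" using ln\<kappa> K(5) \<kappa>b by (simp add: ln_div)
          show "continuous_on U \<zeta>" by (rule continuous_on_subset[OF cont\<zeta> U_dlr])
          show "continuous_on U (\<lambda>y. - v2 y)" by (intro continuous_intros cont_v)
          fix y assume y: "y \<in> U"
          then have yd: "y \<in> {dl..dr}" using U_dlr by blast
          have yh: "y \<in> {?lo..?hi}" using yd dlr by auto
          show "F (\<zeta> y) = G y / \<kappa>" by (rule \<zeta>(2)[OF yd])
          have "G (a + \<eta> / 2) \<le> G y" "G y \<le> G (b - \<eta> / 2)"
            using y yh ab \<beta> \<eta> sep unfolding U_def by (auto intro!: G_mono)
          then have "c\<eta> \<le> G y" "c\<eta> \<le> G b - G y" using quarter by linarith+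
          then have "c\<eta> / \<kappa> \<le> G y / \<kappa>" "c\<eta> / \<kappa> \<le> (G b - G y) / \<kappa>" using \<kappa>b by (auto intro!: divide_right_mono)
          moreover have "(G b - G y) / \<kappa> = F 1 - F (\<zeta> y)" unfolding \<zeta>(2)[OF yd] Gb using \<kappa>b by (simp add: diff_divide_distrib)
          ultimately have FF: "2 * d \<le> F (\<zeta> y) - F (-1)" "2 * d \<le> F 1 - F (\<zeta> y)"
            using c\<kappa> d2 \<zeta>(2)[OF yd] F(2) by linarith+
          have z1: "-1 < \<zeta> y" using F_le_iff[of "\<zeta> y" "-1"] FF d(1) \<zeta>2[OF yd] by fastforce
          have z2: "\<zeta> y < 1" using F_le_iff[of 1 "\<zeta> y"] FF d(1) \<zeta>2[OF yd] by fastforce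
          have "F (\<zeta> y) - F (-1) \<le> 2 * (\<zeta> y - (-1))" "F 1 - F (\<zeta> y) \<le> 2 * (1 - \<zeta> y)"
            using z1 z2 F_lip[of "-1" "\<zeta> y"] F_lip[of "\<zeta> y" 1] by simp_all
          from order_trans[OF FF(1) this(1)] order_trans[OF FF(2) this(2)]
          have zd: "d \<le> 1 + \<zeta> y" "d \<le> 1 - \<zeta> y" by simp_all
          have "d \<le> (1 - \<zeta> y) * (1 + \<zeta> y)"
          proof (cases "\<zeta> y \<ge> 0")
            case True
            have "d * 1 \<le> (1 - \<zeta> y) * (1 + \<zeta> y)" using True zd d by (intro mult_mono) auto
            then show ?thesis by simp
          next
            case False
            have "1 * d \<le> (1 - \<zeta> y) * (1 + \<zeta> y)" using False zd d by (intro mult_mono) auto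
            then show ?thesis by simp
          qed
          then show "\<bar>\<zeta> y\<bar> < 1 \<and> d \<le> 1 - (\<zeta> y)\<^sup>2" using z1 z2 by (simp add: algebra_simps power2_eq_square abs_less_iff)
          show "((\<lambda>y. E - v y) has_real_derivative - v1 y) (at y)" by (auto intro!: derivative_eq_intros dv)
          show "((\<lambda>y. - v1 y) has_real_derivative - v2 y) (at y)" by (rule DERIV_minus[OF dv1])
          have "E - v y \<ge> min e (m * (\<eta> / 2))" using y \<eta> unfolding U_def by (intro depth[OF tp]) auto
          then show "d \<le> E - v y \<and> E - v y \<le> M \<and> \<bar>- v1 y\<bar> \<le> M \<and> \<bar>- v2 y\<bar> \<le> M"
            using d(3) M(2)[OF yh] M(3)[OF yh Ee] by auto
          show "(G has_real_derivative sqrt \<bar>E - v y\<bar>) (at y)" by (rule G[OF yh])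
        next
          fix s :: real assume s: "s \<in> {-1<..<1}"
          show "(F has_real_derivative sqrt \<bar>1 - s\<^sup>2\<bar>) (at s)" using s by (intro F(1)) auto
        qed (use \<kappa>b d K M in auto)
      qed
    qed
    show ?thesis unfolding \<kappa>_eq
      by (rule exI[of _ dl], rule exI[of _ dr], rule exI[of _ \<zeta>]) (use dlr surj ctrl in blast)
  qed
  show ?thesis
  proof (rule exI[of _ \<theta>], intro conjI \<theta>(1), rule exI[of _ "chart_bound K"], intro allI impI)
    fix E a b assume "turning_pair E a b"
    from main[OF this] obtain dl dr \<zeta> where 1: "?lo \<le> dl" "dl < dr" "dr \<le> ?hi"
      "{- (1 + 2 * \<theta>)..1 + 2 * \<theta>} \<subseteq> \<zeta> ` {dl<..<dr}"
      "\<And>y. y \<in> {dl<..<dr} \<Longrightarrow> controlled_at \<zeta> (2 / pi * integral {a..b} (\<lambda>x. sqrt \<bar>E - v x\<bar>)) (\<lambda>y. E - v y) (chart_bound K) y" by blast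
    from controlled_global[OF open_greaterThanLessThan 1(5)] obtain L L1 L2 where
      2: "continuous_on {dl<..<dr} L2" "\<forall>y\<in>{dl<..<dr}. (\<zeta> has_real_derivative exp (L y)) (at y) \<and> (L has_real_derivative L1 y) (at y) \<and>
           (L1 has_real_derivative L2 y) (at y) \<and> \<bar>L y\<bar> \<le> chart_bound K \<and> \<bar>L1 y\<bar> \<le> chart_bound K \<and> \<bar>L2 y\<bar> \<le> chart_bound K \<and>
           (2 / pi * integral {a..b} (\<lambda>x. sqrt \<bar>E - v x\<bar>))\<^sup>2 * (exp (L y))\<^sup>2 * (1 - (\<zeta> y)\<^sup>2) = E - v y" by blast
    show "\<exists>dl dr \<zeta> L L1 L2. ?lo \<le> dl \<and> dl < dr \<and> dr \<le> ?hi \<and> continuous_on {dl<..<dr} L2 \<and>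
        {- (1 + 2 * \<theta>)..1 + 2 * \<theta>} \<subseteq> \<zeta> ` {dl<..<dr} \<and>
        (\<forall>y\<in>{dl<..<dr}. (\<zeta> has_real_derivative exp (L y)) (at y) \<and> (L has_real_derivative L1 y) (at y) \<and>
           (L1 has_real_derivative L2 y) (at y) \<and> \<bar>L y\<bar> \<le> chart_bound K \<and> \<bar>L1 y\<bar> \<le> chart_bound K \<and> \<bar>L2 y\<bar> \<le> chart_bound K \<and>
           (2 / pi * integral {a..b} (\<lambda>x. sqrt \<bar>E - v x\<bar>))\<^sup>2 * (exp (L y))\<^sup>2 * (1 - (\<zeta> y)\<^sup>2) = E - v y)"
      by (rule exI[of _ dl], rule exI[of _ dr], rule exI[of _ \<zeta>], rule exI[of _ L], rule exI[of _ L1], rule exI[of _ L2])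
         (use 1 2 in blast)
  qed
qed

end

section \<open>The quasimode\<close>

text \<open>
  The Liouville transformation of \<open>p'' = (2n + 1)\<^sup>2 (s\<^sup>2 - 1) p + \<epsilon>\<close>. For \<open>f = exp (- L / 2) p(\<zeta>)\<close> with
  \<open>L = ln \<zeta>'\<close> the first-derivative terms of \<open>p\<close> cancel, and \<open>(H - E) f = - h\<^sup>2 (r f + exp (3 L / 2) \<epsilon>(\<zeta>))\<close> with
  \<open>r = L'\<^sup>2 / 4 - L'' / 2\<close>. The norms of \<open>p\<close> and \<open>\<epsilon>\<close> are compared with those on the \<open>x\<close>-side by the substitution
  \<open>s = \<zeta>(x)\<close>, at the cost of factors \<open>exp (2 K)\<close>.
\<close>

lemma liouville_quasimode:
  fixes v \<zeta> L L1 L2 p p1 p2 \<epsilon> :: "real \<Rightarrow> real" and dl dr E h K CH \<theta> :: real and n N :: nat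
  assumes h: "h > 0" and \<theta>: "\<theta> > 0" and CH: "CH \<ge> 0"
    and N: "real N - 1 \<ge> \<bar>dl\<bar>" "real N - 1 \<ge> \<bar>dr\<bar>"
    and v: "continuous_on UNIV v"
    and surj: "{- (1 + 2 * \<theta>)..1 + 2 * \<theta>} \<subseteq> \<zeta> ` {dl<..<dr}"
    and d\<zeta>: "\<And>y. y \<in> {dl<..<dr} \<Longrightarrow> (\<zeta> has_real_derivative exp (L y)) (at y)"
    and dL: "\<And>y. y \<in> {dl<..<dr} \<Longrightarrow> (L has_real_derivative L1 y) (at y)"
    and dL1: "\<And>y. y \<in> {dl<..<dr} \<Longrightarrow> (L1 has_real_derivative L2 y) (at y)"
    and cL2: "continuous_on {dl<..<dr} L2"
    and bd: "\<And>y. y \<in> {dl<..<dr} \<Longrightarrow> \<bar>L y\<bar> \<le> K \<and> \<bar>L1 y\<bar> \<le> K \<and> \<bar>L2 y\<bar> \<le> K"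
    and ident: "\<And>y. y \<in> {dl<..<dr} \<Longrightarrow> ((2 * real n + 1) * h)\<^sup>2 * (exp (L y))\<^sup>2 * (1 - (\<zeta> y)\<^sup>2) = E - v y"
    and dp: "\<And>s. (p has_real_derivative p1 s) (at s)" "\<And>s. (p1 has_real_derivative p2 s) (at s)"
    and c\<epsilon>: "continuous_on UNIV \<epsilon>"
    and p2: "\<And>s. p2 s = (2 * real n + 1)\<^sup>2 * (s\<^sup>2 - 1) * p s + \<epsilon> s"
    and vanish: "\<And>s. \<bar>s\<bar> \<ge> 1 + 2 * \<theta> \<Longrightarrow> p s = 0 \<and> p1 s = 0 \<and> p2 s = 0 \<and> \<epsilon> s = 0"
    and err: "integral {-(1+2*\<theta>)..1+2*\<theta>} (\<lambda>s. (\<epsilon> s)\<^sup>2) \<le> CH * integral {-(1+2*\<theta>)..1+2*\<theta>} (\<lambda>s. (p s)\<^sup>2)"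
    and pos: "integral {-(1+2*\<theta>)..1+2*\<theta>} (\<lambda>s. (p s)\<^sup>2) > 0"
  shows "\<exists>f f1 f2. (\<forall>x. (f has_real_derivative f1 x) (at x)) \<and> (\<forall>x. (f1 has_real_derivative f2 x) (at x)) \<and>
      continuous_on UNIV f2 \<and> (\<forall>x. \<bar>x\<bar> \<ge> real N - 1 \<longrightarrow> f x = 0 \<and> f2 x = 0) \<and>
      integral {-real N..real N} (\<lambda>x. (f x)\<^sup>2) > 0 \<and>
      integral {-real N..real N} (\<lambda>x. (- h\<^sup>2 * f2 x + (v x - E) * f x)\<^sup>2)
        \<le> (sqrt (2 * ((K\<^sup>2 / 4 + K / 2)\<^sup>2 + CH * exp (4 * K))) * h\<^sup>2)\<^sup>2 * integral {-real N..real N} (\<lambda>x. (f x)\<^sup>2)"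
proof -
  let ?D = "{dl<..<dr}"
  define \<rho> where "\<rho> = 1 + 2 * \<theta>"
  have \<rho>: "\<rho> > 0" unfolding \<rho>_def using \<theta> by simp
  have mem: "- \<rho> \<in> \<zeta> ` ?D" "\<rho> \<in> \<zeta> ` ?D" using \<rho> unfolding \<rho>_def by (intro subsetD[OF surj]; simp)+
  obtain xl where xl: "xl \<in> ?D" "\<zeta> xl = - \<rho>" using mem(1) by (elim imageE) (rule that; simp)
  obtain xr where xr: "xr \<in> ?D" "\<zeta> xr = \<rho>" using mem(2) by (elim imageE) (rule that; simp)
  have \<zeta>_less: "\<zeta> x < \<zeta> y" if "x \<in> ?D" "y \<in> ?D" "x < y" for x y
  proof (rule DERIV_pos_imp_increasing[OF that(3)])
    fix t assume "x \<le> t" "t \<le> y"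
    then have "t \<in> ?D" using that by auto
    then show "\<exists>z. (\<zeta> has_real_derivative z) (at t) \<and> 0 < z" using d\<zeta> by (intro exI[of _ "exp (L t)"]) auto
  qed
  have xlr: "xl < xr" using \<zeta>_less[of xr xl] xl xr \<rho> by (cases xl xr rule: linorder_cases) auto
  have sub: "{xl..xr} \<subseteq> ?D" using xl xr by auto
  have outside: "\<bar>\<zeta> x\<bar> \<ge> \<rho>" if "x \<in> ?D" "x \<notin> {xl..xr}" for x
    using \<zeta>_less[OF that(1) xl(1)] \<zeta>_less[OF xr(1) that(1)] that xl xr by auto
  have inside: "\<zeta> x \<in> {-\<rho>..\<rho>}" if "x \<in> {xl..xr}" for x
    using \<zeta>_less[of xl x] \<zeta>_less[of x xr] that sub xl xr by (cases "x = xl"; cases "x = xr") force+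
  have \<zeta>c: "continuous_on ?D \<zeta>" "continuous_on ?D L" "continuous_on ?D L1"
    by (rule continuous_at_imp_continuous_on, rule ballI, rule DERIV_isCont, erule d\<zeta> dL dL1)+
  have pc: "continuous_on UNIV p" "continuous_on UNIV p1" using dp by (auto intro!: continuous_at_imp_continuous_on DERIV_isCont)
  have comp: "continuous_on ?D (\<lambda>x. q (\<zeta> x))" if "continuous_on UNIV q" for q :: "real \<Rightarrow> real"
    by (rule continuous_on_compose2[OF that \<zeta>c(1)]) auto
  define A where "A = (\<lambda>x. exp (- (L x / 2)))"
  define u where "u = (\<lambda>x. A x * p (\<zeta> x))"
  define u1 where "u1 = (\<lambda>x. - (L1 x / 2) * (A x * p (\<zeta> x)) + exp (L x / 2) * p1 (\<zeta> x))"
  define r where "r = (\<lambda>x. (L1 x)\<^sup>2 / 4 - L2 x / 2)"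
  define g where "g = (\<lambda>x. A x * (exp (L x))\<^sup>2 * \<epsilon> (\<zeta> x))"
  define u2 where "u2 = (\<lambda>x. r x * u x + (v x - E) / h\<^sup>2 * u x + g x)"
  have AB: "A x * exp (L x) = exp (L x / 2)" for x unfolding A_def by (simp flip: exp_add)
  have dA: "(A has_real_derivative - (L1 x / 2) * A x) (at x)" if x: "x \<in> ?D" for x
  proof -
    have "((\<lambda>x. - (L x / 2)) has_real_derivative - (L1 x / 2)) (at x)" using dL[OF x] by (intro DERIV_minus DERIV_cdivide)
    from DERIV_chain2[OF DERIV_exp this] show ?thesis unfolding A_def by (simp add: mult.commute)
  qed
  have dB: "((\<lambda>x. exp (L x / 2)) has_real_derivative (L1 x / 2) * exp (L x / 2)) (at x)" if x: "x \<in> ?D" for x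
  proof -
    have "((\<lambda>x. L x / 2) has_real_derivative L1 x / 2) (at x)" using dL[OF x] by (intro DERIV_cdivide)
    from DERIV_chain2[OF DERIV_exp this] show ?thesis by (simp add: mult.commute)
  qed
  have du: "(u has_real_derivative u1 x) (at x)" if x: "x \<in> ?D" for x
    unfolding u_def u1_def
    by (rule DERIV_cong[OF DERIV_mult[OF dA[OF x] DERIV_chain2[OF dp(1) d\<zeta>[OF x]]]])
       (simp add: AB[symmetric] algebra_simps)
  have du1: "(u1 has_real_derivative u2 x) (at x)" if x: "x \<in> ?D" for x
  proof -
    have "((\<lambda>x. - (L1 x / 2)) has_real_derivative - (L2 x / 2)) (at x)" using dL1[OF x] by (intro DERIV_minus DERIV_cdivide)
    from DERIV_mult[OF this du[OF x]]
    have "((\<lambda>x. - (L1 x / 2) * u x) has_real_derivative - (L2 x / 2) * u x + u1 x * - (L1 x / 2)) (at x)" .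
    from DERIV_add[OF this DERIV_mult[OF dB[OF x] DERIV_chain2[OF dp(2) d\<zeta>[OF x]]]]
    have "(u1 has_real_derivative - (L2 x / 2) * u x + u1 x * - (L1 x / 2) +
       (L1 x / 2 * exp (L x / 2) * p1 (\<zeta> x) + p2 (\<zeta> x) * exp (L x) * exp (L x / 2))) (at x)"
      unfolding u1_def u_def by simp
    moreover have "- (L2 x / 2) * u x + u1 x * - (L1 x / 2) +
       (L1 x / 2 * exp (L x / 2) * p1 (\<zeta> x) + p2 (\<zeta> x) * exp (L x) * exp (L x / 2)) = u2 x"
    proof -
      define X where "X = exp (L x)"
      have "p2 (\<zeta> x) * exp (L x) * exp (L x / 2) = A x * X\<^sup>2 * p2 (\<zeta> x)"
        unfolding AB[symmetric] X_def by (simp add: power2_eq_square)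
      also have "\<dots> = (2 * real n + 1)\<^sup>2 * X\<^sup>2 * ((\<zeta> x)\<^sup>2 - 1) * u x + g x"
        unfolding p2 u_def g_def X_def by (simp add: algebra_simps)
      also have "(2 * real n + 1)\<^sup>2 * X\<^sup>2 * ((\<zeta> x)\<^sup>2 - 1) = (v x - E) / h\<^sup>2"
      proof -
        have "((2 * real n + 1)\<^sup>2 * X\<^sup>2 * ((\<zeta> x)\<^sup>2 - 1)) * h\<^sup>2 = v x - E"
          using ident[OF x] unfolding X_def[symmetric] power_mult_distrib by (simp add: algebra_simps)
        then show ?thesis using h by (simp add: nonzero_eq_divide_eq)
      qed
      finally have e: "p2 (\<zeta> x) * exp (L x) * exp (L x / 2) = (v x - E) / h\<^sup>2 * u x + g x" .
      have u1e: "u1 x = - (L1 x / 2) * u x + exp (L x / 2) * p1 (\<zeta> x)" unfolding u1_def u_def ..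
      show ?thesis unfolding e u1e u2_def r_def by (simp add: algebra_simps power2_eq_square)
    qed
    ultimately show ?thesis by simp
  qed
  have cA: "continuous_on ?D A" unfolding A_def by (intro continuous_intros \<zeta>c) auto
  have cu: "continuous_on ?D u" unfolding u_def by (intro continuous_on_mult cA comp pc)
  have cg: "continuous_on ?D g" unfolding g_def by (intro continuous_intros cA comp c\<epsilon> \<zeta>c)
  have cu2: "continuous_on ?D u2" unfolding u2_def r_def
    using h by (intro continuous_intros \<zeta>c cL2 cu cg continuous_on_subset[OF v]) auto
  have zero: "u x = 0 \<and> u1 x = 0 \<and> u2 x = 0 \<and> g x = 0" if "x \<in> ?D" "x \<notin> {xl..xr}" for x
    using vanish[of "\<zeta> x"] outside[OF that] unfolding u2_def g_def u1_def u_def \<rho>_def by simp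
  define f f1 f2 where "f = (\<lambda>x. if x \<in> ?D then u x else 0)" and "f1 = (\<lambda>x. if x \<in> ?D then u1 x else 0)"
    and "f2 = (\<lambda>x. if x \<in> ?D then u2 x else 0)"
  have f0: "f x = 0 \<and> f1 x = 0 \<and> f2 x = 0" if "x \<in> - {xl..xr}" for x
    using zero[of x] that unfolding f_def f1_def f2_def by auto
  have opn: "open (- {xl..xr})" by (intro open_Compl closed_atLeastAtMost)
  have cover: "x \<in> ?D \<or> x \<in> - {xl..xr}" for x using sub by blast
  have df: "(f has_real_derivative f1 x) (at x)" and df1: "(f1 has_real_derivative f2 x) (at x)" for x
  proof -
    have "(f has_real_derivative f1 x) (at x) \<and> (f1 has_real_derivative f2 x) (at x)"
    proof (cases "x \<in> ?D")
      case True
      have "(f has_real_derivative u1 x) (at x)"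
        by (rule has_field_derivative_transform_within_open[OF du[OF True] open_greaterThanLessThan True]) (simp add: f_def)
      moreover have "(f1 has_real_derivative u2 x) (at x)"
        by (rule has_field_derivative_transform_within_open[OF du1[OF True] open_greaterThanLessThan True]) (simp add: f1_def)
      ultimately show ?thesis using True by (simp add: f1_def f2_def)
    next
      case False
      then have x: "x \<in> - {xl..xr}" using cover by blast
      have "(f has_real_derivative 0) (at x)"
        by (rule has_field_derivative_transform_within_open[OF DERIV_const opn x]) (use f0 in simp)
      moreover have "(f1 has_real_derivative 0) (at x)"
        by (rule has_field_derivative_transform_within_open[OF DERIV_const opn x]) (use f0 in simp)
      ultimately show ?thesis using f0[OF x] by simp
    qed
    then show "(f has_real_derivative f1 x) (at x)" "(f1 has_real_derivative f2 x) (at x)" by auto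
  qed
  have cf2: "continuous_on UNIV f2"
  proof -
    have "continuous_on ?D f2" using cu2 by (rule continuous_on_eq) (simp add: f2_def)
    moreover have "continuous_on (- {xl..xr}) f2"
      using continuous_on_const[of _ 0] by (rule continuous_on_eq) (use f0 in simp)
    ultimately have "continuous_on (?D \<union> - {xl..xr}) f2" by (intro continuous_on_open_Un opn open_greaterThanLessThan)
    moreover have "?D \<union> - {xl..xr} = UNIV" using cover by blast
    ultimately show ?thesis by simp
  qed
  have supp: "f x = 0 \<and> f2 x = 0" if "\<bar>x\<bar> \<ge> real N - 1" for x
  proof -
    have "x \<notin> ?D" using that N by auto
    then show ?thesis unfolding f_def f2_def by (simp only: if_False simp_thms)
  qed
  have NN: "{xl..xr} \<subseteq> {-real N..real N}" using xl xr N by auto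
  have Hf: "- h\<^sup>2 * f2 x + (v x - E) * f x = - (h\<^sup>2 * (r x * u x + g x))" if "x \<in> {xl..xr}" for x
  proof -
    have x: "x \<in> ?D" using that sub by blast
    have "h\<^sup>2 * ((v x - E) / h\<^sup>2 * u x) = (v x - E) * u x" using h by simp
    then have "- h\<^sup>2 * u2 x + (v x - E) * u x = - (h\<^sup>2 * (r x * u x + g x))"
      unfolding u2_def distrib_left mult_minus_left by simp
    then show ?thesis unfolding f_def f2_def using x by simp
  qed
  have int_sub: "integral {-real N..real N} F = integral {xl..xr} F"
    if "continuous_on {xl..xr} F" "\<And>x. x \<notin> {xl..xr} \<Longrightarrow> F x = 0" for F :: "real \<Rightarrow> real"
  proof -
    have "(F has_integral integral {xl..xr} F) {xl..xr}" using that(1) by (intro integrable_integral integrable_continuous_real)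
    from has_integral_on_superset[OF this that(2) NN] show ?thesis by (rule integral_unique)
  qed
  have fx: "f x = u x" if "x \<in> {xl..xr}" for x using that sub unfolding f_def by auto
  have cont_sub: "continuous_on {xl..xr} F" if "continuous_on ?D F" for F :: "real \<Rightarrow> real"
    using that sub by (rule continuous_on_subset)
  have cr: "continuous_on ?D r" unfolding r_def by (intro continuous_intros \<zeta>c cL2) auto
  have contf: "continuous_on UNIV f"
    by (rule continuous_at_imp_continuous_on, rule ballI, rule DERIV_isCont, rule df)
  have I1: "integral {-real N..real N} (\<lambda>x. (f x)\<^sup>2) = integral {xl..xr} (\<lambda>x. (u x)\<^sup>2)"
  proof -
    have "integral {-real N..real N} (\<lambda>x. (f x)\<^sup>2) = integral {xl..xr} (\<lambda>x. (f x)\<^sup>2)"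
    proof (rule int_sub)
      show "continuous_on {xl..xr} (\<lambda>x. (f x)\<^sup>2)" by (intro continuous_on_power continuous_on_subset[OF contf]) simp
    qed (use f0 in simp)
    also have "\<dots> = integral {xl..xr} (\<lambda>x. (u x)\<^sup>2)" by (intro integral_cong) (simp add: fx)
    finally show ?thesis .
  qed
  have I2: "integral {-real N..real N} (\<lambda>x. (- h\<^sup>2 * f2 x + (v x - E) * f x)\<^sup>2) = integral {xl..xr} (\<lambda>x. (h\<^sup>2 * (r x * u x + g x))\<^sup>2)"
  proof -
    have "integral {-real N..real N} (\<lambda>x. (- h\<^sup>2 * f2 x + (v x - E) * f x)\<^sup>2) = integral {xl..xr} (\<lambda>x. (- h\<^sup>2 * f2 x + (v x - E) * f x)\<^sup>2)"
    proof (rule int_sub)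
      show "continuous_on {xl..xr} (\<lambda>x. (- h\<^sup>2 * f2 x + (v x - E) * f x)\<^sup>2)"
        by (intro continuous_intros continuous_on_subset[OF cf2] continuous_on_subset[OF contf] continuous_on_subset[OF v]) auto
    qed (use f0 in simp)
    also have "\<dots> = integral {xl..xr} (\<lambda>x. (h\<^sup>2 * (r x * u x + g x))\<^sup>2)"
      by (intro integral_cong) (simp only: Hf power2_minus)
    finally show ?thesis .
  qed
  have subst: "((\<lambda>x. exp (L x) * q (\<zeta> x)) has_integral integral {-\<rho>..\<rho>} q) {xl..xr}" if "continuous_on UNIV q" for q :: "real \<Rightarrow> real"
  proof -
    have "((\<lambda>x. exp (L x) *\<^sub>R q (\<zeta> x)) has_integral integral {\<zeta> xl..\<zeta> xr} q) {xl..xr}"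
    proof (rule has_integral_substitution)
      show "\<zeta> ` {xl..xr} \<subseteq> {-\<rho>..\<rho>}" using inside by blast
      show "(\<zeta> has_real_derivative exp (L x)) (at x within {xl..xr})" if "x \<in> {xl..xr}" for x
        by (rule has_field_derivative_at_within[OF d\<zeta>]) (use that sub in blast)
    qed (use that xlr xl xr \<rho> in \<open>auto intro: continuous_on_subset\<close>)
    then show ?thesis using xl xr by simp
  qed
  have csq: "continuous_on UNIV (\<lambda>s. (p s)\<^sup>2)" "continuous_on UNIV (\<lambda>s. (\<epsilon> s)\<^sup>2)" by (intro continuous_intros pc c\<epsilon>)+
  have u_sq: "(u x)\<^sup>2 = exp (- L x) * (p (\<zeta> x))\<^sup>2" for x
    unfolding u_def A_def power_mult_distrib by (simp flip: exp_double)
  have K0: "K \<ge> 0" using bd[OF xl(1)] by linarith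
  have p_le: "integral {-\<rho>..\<rho>} (\<lambda>s. (p s)\<^sup>2) \<le> exp (2 * K) * integral {xl..xr} (\<lambda>x. (u x)\<^sup>2)"
  proof -
    have "((\<lambda>x. exp (2 * K) * (u x)\<^sup>2) has_integral exp (2 * K) * integral {xl..xr} (\<lambda>x. (u x)\<^sup>2)) {xl..xr}"
      by (intro has_integral_mult_right integrable_integral integrable_continuous_real continuous_intros cont_sub cu)
    then show ?thesis
    proof (rule has_integral_le[OF subst[OF csq(1)]])
      fix x assume "x \<in> {xl..xr}"
      then have "\<bar>L x\<bar> \<le> K" using bd sub by blast
      then have "exp (L x) \<le> exp (2 * K + - L x)" by simp
      then have "exp (L x) * (p (\<zeta> x))\<^sup>2 \<le> exp (2 * K + - L x) * (p (\<zeta> x))\<^sup>2" by (intro mult_right_mono) auto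
      then show "exp (L x) * (p (\<zeta> x))\<^sup>2 \<le> exp (2 * K) * (u x)\<^sup>2" unfolding u_sq exp_add by (simp add: mult.assoc)
    qed
  qed
  have g_le: "integral {xl..xr} (\<lambda>x. (g x)\<^sup>2) \<le> exp (2 * K) * integral {-\<rho>..\<rho>} (\<lambda>s. (\<epsilon> s)\<^sup>2)"
  proof -
    have "((\<lambda>x. (g x)\<^sup>2) has_integral integral {xl..xr} (\<lambda>x. (g x)\<^sup>2)) {xl..xr}"
      by (intro integrable_integral integrable_continuous_real continuous_intros cont_sub cg)
    then show ?thesis
    proof (rule has_integral_le[OF _ has_integral_mult_right[OF subst[OF csq(2)], of "exp (2 * K)"]])
      fix x assume "x \<in> {xl..xr}"
      then have "\<bar>L x\<bar> \<le> K" using bd sub by blast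
      then have "exp (2 * L x + L x) \<le> exp (2 * K + L x)" by simp
      then have "exp (2 * L x + L x) * (\<epsilon> (\<zeta> x))\<^sup>2 \<le> exp (2 * K + L x) * (\<epsilon> (\<zeta> x))\<^sup>2" by (intro mult_right_mono) auto
      moreover have "(g x)\<^sup>2 = exp (2 * L x + L x) * (\<epsilon> (\<zeta> x))\<^sup>2"
      proof -
        have "A x * (exp (L x))\<^sup>2 = (A x * exp (L x)) * exp (L x)" by (simp add: power2_eq_square)
        also have "\<dots> = exp (L x + L x / 2)" by (simp only: AB exp_add mult.commute)
        finally have e: "A x * (exp (L x))\<^sup>2 = exp (L x + L x / 2)" .
        have "(g x)\<^sup>2 = (exp (L x + L x / 2))\<^sup>2 * (\<epsilon> (\<zeta> x))\<^sup>2" unfolding g_def e by (rule power_mult_distrib)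
        also have "(exp (L x + L x / 2))\<^sup>2 = exp (2 * (L x + L x / 2))" by (rule exp_double[symmetric])
        also have "2 * (L x + L x / 2) = 2 * L x + L x" by simp
        finally show ?thesis .
      qed
      ultimately show "(g x)\<^sup>2 \<le> exp (2 * K) * (exp (L x) * (\<epsilon> (\<zeta> x))\<^sup>2)" by (simp add: exp_add mult.assoc)
    qed
  qed
  define I where "I = integral {xl..xr} (\<lambda>x. (u x)\<^sup>2)"
  define R where "R = K\<^sup>2 / 4 + K / 2"
  have g_le': "integral {xl..xr} (\<lambda>x. (g x)\<^sup>2) \<le> CH * exp (4 * K) * I"
  proof -
    have "integral {xl..xr} (\<lambda>x. (g x)\<^sup>2) \<le> exp (2 * K) * (CH * integral {-\<rho>..\<rho>} (\<lambda>s. (p s)\<^sup>2))"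
      using g_le err unfolding \<rho>_def[symmetric] by (meson exp_ge_zero mult_left_mono order_trans)
    also have "\<dots> \<le> exp (2 * K) * (CH * (exp (2 * K) * I))"
      using p_le CH unfolding I_def by (intro mult_left_mono) auto
    also have "\<dots> = CH * (exp (2 * K) * exp (2 * K)) * I" by (simp add: mult_ac)
    also have "exp (2 * K) * exp (2 * K) = exp (4 * K)" by (simp flip: exp_add)
    finally show ?thesis .
  qed
  have I_pos: "I > 0"
  proof -
    have "0 < exp (2 * K) * I" using p_le pos unfolding I_def \<rho>_def by linarith
    then show ?thesis by (simp add: zero_less_mult_iff)
  qed
  have r_le: "(r x)\<^sup>2 \<le> R\<^sup>2" if "x \<in> {xl..xr}" for x
  proof -
    have b: "\<bar>L1 x\<bar> \<le> K" "\<bar>L2 x\<bar> \<le> K" using bd that sub by blast+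
    have "(L1 x)\<^sup>2 \<le> K\<^sup>2" using b K0 by (metis abs_le_square_iff abs_of_nonneg)
    then have "\<bar>r x\<bar> \<le> R" using b zero_le_power2[of "L1 x"] unfolding r_def R_def by linarith
    then show ?thesis by (metis abs_le_square_iff abs_ge_zero abs_of_nonneg order_trans)
  qed
  have "integral {xl..xr} (\<lambda>x. (h\<^sup>2 * (r x * u x + g x))\<^sup>2)
      \<le> integral {xl..xr} (\<lambda>x. 2 * (h\<^sup>2)\<^sup>2 * (R\<^sup>2 * (u x)\<^sup>2 + (g x)\<^sup>2))"
  proof (rule integral_le)
    fix x assume x: "x \<in> {xl..xr}"
    have "(r x * u x + g x)\<^sup>2 + (r x * u x - g x)\<^sup>2 = 2 * ((r x * u x)\<^sup>2 + (g x)\<^sup>2)"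
      by (simp add: power2_sum power2_diff)
    then have "(r x * u x + g x)\<^sup>2 \<le> 2 * ((r x * u x)\<^sup>2 + (g x)\<^sup>2)" using zero_le_power2[of "r x * u x - g x"] by linarith
    also have "(r x * u x)\<^sup>2 \<le> R\<^sup>2 * (u x)\<^sup>2" unfolding power_mult_distrib using r_le[OF x] by (intro mult_right_mono) auto
    finally have "(r x * u x + g x)\<^sup>2 \<le> 2 * (R\<^sup>2 * (u x)\<^sup>2 + (g x)\<^sup>2)" by simp
    from mult_left_mono[OF this zero_le_power2[of "h\<^sup>2"]]
    show "(h\<^sup>2 * (r x * u x + g x))\<^sup>2 \<le> 2 * (h\<^sup>2)\<^sup>2 * (R\<^sup>2 * (u x)\<^sup>2 + (g x)\<^sup>2)"
      unfolding power_mult_distrib[of "h\<^sup>2"] by (simp only: mult_ac)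
  qed (intro integrable_continuous_real continuous_intros cont_sub cu cg cr)+
  also have "\<dots> = 2 * (h\<^sup>2)\<^sup>2 * (R\<^sup>2 * I + integral {xl..xr} (\<lambda>x. (g x)\<^sup>2))"
  proof -
    have "integral {xl..xr} (\<lambda>x. R\<^sup>2 * (u x)\<^sup>2 + (g x)\<^sup>2) = integral {xl..xr} (\<lambda>x. R\<^sup>2 * (u x)\<^sup>2) + integral {xl..xr} (\<lambda>x. (g x)\<^sup>2)"
      by (intro integral_add integrable_continuous_real continuous_intros cont_sub cu cg)
    then show ?thesis unfolding I_def by simp
  qed
  also have "\<dots> \<le> 2 * (h\<^sup>2)\<^sup>2 * (R\<^sup>2 * I + CH * exp (4 * K) * I)"
    using g_le' by (intro mult_left_mono) auto
  also have "\<dots> = (sqrt (2 * (R\<^sup>2 + CH * exp (4 * K))) * h\<^sup>2)\<^sup>2 * I"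
    using CH by (simp add: power_mult_distrib algebra_simps)
  finally have main: "integral {xl..xr} (\<lambda>x. (h\<^sup>2 * (r x * u x + g x))\<^sup>2) \<le> (sqrt (2 * (R\<^sup>2 + CH * exp (4 * K))) * h\<^sup>2)\<^sup>2 * I" .
  show ?thesis
    by (rule exI[of _ f], rule exI[of _ f1], rule exI[of _ f2])
       (use df df1 cf2 supp I_pos main in \<open>simp only: I1 I2 I_def[symmetric] R_def[symmetric]\<close>, blast)
qed

section \<open>Sign changes at simple zeros\<close>

text \<open>
  A function that is positive far to the left crosses its simple zeros alternately downwards and
  upwards. Counted from 0, the zeros with even number are thus left ends of wells, the others right ends.
\<close>

lemma sign_changes_at_zeros:
  fixes f f1 :: "real \<Rightarrow> real"
  assumes f: "\<And>x. (f has_real_derivative f1 x) (at x)" and fin: "finite {x. f x = 0}"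
    and simple: "\<And>x. f x = 0 \<Longrightarrow> f1 x \<noteq> 0"
    and left: "\<And>x. x \<le> X \<Longrightarrow> f x > 0"
    and j: "j < card {x. f x = 0}"
  shows "if even j then f1 (sorted_list_of_set {x. f x = 0} ! j) < 0 else f1 (sorted_list_of_set {x. f x = 0} ! j) > 0"
proof -
  let ?z = "sorted_list_of_set {x. f x = 0}"
  have len: "length ?z = card {x. f x = 0}" and set: "set ?z = {x. f x = 0}" and srt: "sorted ?z" "distinct ?z"
    using fin by auto
  have cont: "continuous_on S f" for S
    by (rule continuous_at_imp_continuous_on, rule ballI, rule DERIV_isCont, rule f)
  have zero: "f (?z ! i) = 0" if "i < card {x. f x = 0}" for i
    using nth_mem[of i ?z] that len set by auto
  have idx: "\<exists>i<length ?z. ?z ! i = y" if "f y = 0" for y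
  proof -
    have "y \<in> set ?z" unfolding set using that by simp
    then show ?thesis by (simp only: in_set_conv_nth)
  qed
  show ?thesis using j
  proof (induction j)
  case 0
  have pos: "f x > 0" if x: "x < ?z ! 0" for x
  proof (rule ccontr)
    assume n: "\<not> f x > 0"
    then have "X < x" using left[of x] by linarith
    then have "\<exists>y\<ge>X. y \<le> x \<and> f y = 0" using left[of X] n by (intro IVT2' cont) auto
    then obtain y where y: "y \<le> x" "f y = 0" by blast
    then obtain i where "i < length ?z" "?z ! i = y" using idx by blast
    then have "?z ! 0 \<le> y" using srt sorted_nth_mono[of ?z 0 i] by simp
    then show False using x y by linarith
  qed
  have "f1 (?z ! 0) \<noteq> 0" using simple zero[OF 0] by simp
  moreover have "\<not> f1 (?z ! 0) > 0"
  proof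
    assume "f1 (?z ! 0) > 0"
    then obtain d where "d > 0" "\<forall>h>0. h < d \<longrightarrow> f (?z ! 0 - h) < f (?z ! 0)" using DERIV_pos_inc_left[OF f] by blast
    then have "f (?z ! 0 - d / 2) < 0" using zero[OF 0] by auto
    then show False using pos[of "?z ! 0 - d / 2"] \<open>d > 0\<close> by auto
  qed
  ultimately show ?case by simp
next
  case (Suc j)
  let ?a = "?z ! j" and ?b = "?z ! Suc j"
  have IH: "if even j then f1 ?a < 0 else f1 ?a > 0" using Suc by simp
  have ab: "?a < ?b"
  proof -
    have "?a \<le> ?b" by (rule sorted_nth_mono[OF srt(1)]) (use Suc.prems len in auto)
    moreover have "?a \<noteq> ?b" using nth_eq_iff_index_eq[OF srt(2), of j "Suc j"] Suc.prems len by simp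
    ultimately show ?thesis by simp
  qed
  have nozero: "f x \<noteq> 0" if x: "?a < x" "x < ?b" for x
  proof
    assume "f x = 0"
    then obtain i where i: "i < length ?z" "?z ! i = x" using idx by blast
    have "\<not> i \<le> j" using sorted_nth_mono[OF srt(1), of i j] i x Suc.prems len by auto
    moreover have "\<not> Suc j \<le> i" using sorted_nth_mono[OF srt(1), of "Suc j" i] i x by auto
    ultimately show False by linarith
  qed
  have ne: "f1 ?b \<noteq> 0" using simple zero[OF Suc.prems] by simp
  show ?case
  proof (cases "even j")
    case True
    then have "f1 ?a < 0" using IH by simp
    then obtain d where d: "d > 0" "\<forall>h>0. h < d \<longrightarrow> f (?a + h) < f ?a" using DERIV_neg_dec_right[OF f] by blast
    define k where "k = min (d / 2) ((?b - ?a) / 2)"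
    have k: "0 < k" "k < d" "k < ?b - ?a" unfolding k_def min_less_iff_disj min_less_iff_conj using d ab by auto
    define y where "y = ?a + k"
    have y: "?a < y" "y < ?b" "f y < 0"
      unfolding y_def using d k zero[of j] Suc.prems by auto
    have neg: "f x < 0" if x: "y \<le> x" "x < ?b" for x
    proof (rule ccontr)
      assume "\<not> f x < 0"
      then have "\<exists>t\<ge>y. t \<le> x \<and> f t = 0" using y x by (intro IVT' cont) auto
      then obtain t where "y \<le> t" "t \<le> x" "f t = 0" by blast
      then show False using nozero[of t] y x by auto
    qed
    have "\<not> f1 ?b < 0"
    proof
      assume "f1 ?b < 0"
      then obtain d where d: "d > 0" "\<forall>h>0. h < d \<longrightarrow> f ?b < f (?b - h)" using DERIV_neg_dec_left[OF f] by blast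
      define h where "h = min (d / 2) (?b - y)"
      have h: "0 < h" "h < d" "h \<le> ?b - y" unfolding h_def using d y by auto
      then have "f (?b - h) > 0" using d zero[OF Suc.prems] by auto
      then show False using neg[of "?b - h"] h by auto
    qed
    then show ?thesis using True ne by simp
  next
    case False
    then have "f1 ?a > 0" using IH by simp
    then obtain d where d: "d > 0" "\<forall>h>0. h < d \<longrightarrow> f ?a < f (?a + h)" using DERIV_pos_inc_right[OF f] by blast
    define k where "k = min (d / 2) ((?b - ?a) / 2)"
    have k: "0 < k" "k < d" "k < ?b - ?a" unfolding k_def min_less_iff_disj min_less_iff_conj using d ab by auto
    define y where "y = ?a + k"
    have y: "?a < y" "y < ?b" "f y > 0"
      unfolding y_def using d k zero[of j] Suc.prems by auto
    have pos: "f x > 0" if x: "y \<le> x" "x < ?b" for x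
    proof (rule ccontr)
      assume "\<not> f x > 0"
      then have "\<exists>t\<ge>y. t \<le> x \<and> f t = 0" using y x by (intro IVT2' cont) auto
      then obtain t where "y \<le> t" "t \<le> x" "f t = 0" by blast
      then show False using nozero[of t] y x by auto
    qed
    have "\<not> f1 ?b > 0"
    proof
      assume "f1 ?b > 0"
      then obtain d where d: "d > 0" "\<forall>h>0. h < d \<longrightarrow> f (?b - h) < f ?b" using DERIV_pos_inc_left[OF f] by blast
      define h where "h = min (d / 2) (?b - y)"
      have h: "0 < h" "h < d" "h \<le> ?b - y" unfolding h_def using d y by auto
      then have "f (?b - h) < 0" using d zero[OF Suc.prems] by auto
      then show False using pos[of "?b - h"] h by auto
    qed
    then show ?thesis using False ne by simp
  qed
  qed
qed

lemma slope_bound_near: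
  fixes g :: "real \<Rightarrow> real"
  assumes "isCont g z" "g z \<noteq> 0"
  shows "\<exists>r>0. \<forall>x. \<bar>x - z\<bar> \<le> r \<longrightarrow> sgn (g x) = sgn (g z) \<and> \<bar>g x\<bar> \<ge> \<bar>g z\<bar> / 2"
proof -
  obtain d where d: "d > 0" "\<And>x. \<bar>x - z\<bar> < d \<Longrightarrow> \<bar>g x - g z\<bar> < \<bar>g z\<bar> / 2"
    using assms unfolding continuous_at_eps_delta by (metis dist_real_def half_gt_zero zero_less_abs_iff)
  have "sgn (g x) = sgn (g z) \<and> \<bar>g x\<bar> \<ge> \<bar>g z\<bar> / 2" if "\<bar>x - z\<bar> \<le> d / 2" for x
  proof -
    have "\<bar>g x - g z\<bar> < \<bar>g z\<bar> / 2" using d that by (intro d(2)) linarith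
    then show ?thesis using assms(2) by (auto simp: sgn_real_def abs_if split: if_splits)
  qed
  moreover have "d / 2 > 0" using d(1) by simp
  ultimately show ?thesis by blast
qed

section \<open>The action integral and the eigenvalue of a well\<close>

context well
begin

text \<open>
  The quantization condition turns the factor \<open>\<kappa>\<close> of the Liouville map into \<open>(2n + 1) h\<close>, which is what the
  Hermite functions require. The constant \<open>C\<close> is built from the bounds of the map and of the cut-off and so
  depends on the well alone.
\<close>

theorem eigenvalue_in_well:
  "\<exists>C\<ge>0. \<forall>E a b h c R. \<forall>n::nat. turning_pair E a b \<longrightarrow> h > 0 \<longrightarrow>
     integral {a..b} (\<lambda>x. sqrt \<bar>E - v x\<bar>) = pi * (real n + 1 / 2) * h \<longrightarrow>
     c > 0 \<longrightarrow> (\<forall>x. \<bar>x\<bar> \<ge> R \<longrightarrow> v x \<ge> E + C * h\<^sup>2 + c) \<longrightarrow>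
     (\<exists>\<mu>. is_eigenvalue (schroedinger_op v h) \<mu> \<and> \<bar>\<mu> - E\<bar> \<le> C * h\<^sup>2)"
proof -
  obtain \<theta> K where \<theta>: "\<theta> > 0" and liouville: "\<And>E a b. turning_pair E a b \<Longrightarrow>
     (\<exists>dl dr \<zeta> L L1 L2. z1 - 2 * \<beta> \<le> dl \<and> dl < dr \<and> dr \<le> z2 + 2 * \<beta> \<and> continuous_on {dl<..<dr} L2 \<and>
        {- (1 + 2 * \<theta>)..1 + 2 * \<theta>} \<subseteq> \<zeta> ` {dl<..<dr} \<and>
        (\<forall>y\<in>{dl<..<dr}. (\<zeta> has_real_derivative exp (L y)) (at y) \<and> (L has_real_derivative L1 y) (at y) \<and>
           (L1 has_real_derivative L2 y) (at y) \<and> \<bar>L y\<bar> \<le> K \<and> \<bar>L1 y\<bar> \<le> K \<and> \<bar>L2 y\<bar> \<le> K \<and>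
           (2 / pi * integral {a..b} (\<lambda>x. sqrt \<bar>E - v x\<bar>))\<^sup>2 * (exp (L y))\<^sup>2 * (1 - (\<zeta> y)\<^sup>2) = E - v y))"
    using uniform_liouville_map by blast
  obtain CH where CH: "CH \<ge> 0" and hermite: "\<And>n::nat. \<exists>p p1 p2 \<epsilon>. (\<forall>s. (p has_real_derivative p1 s) (at s)) \<and> (\<forall>s. (p1 has_real_derivative p2 s) (at s))
     \<and> continuous_on UNIV \<epsilon>
     \<and> (\<forall>s. p2 s = (2 * real n + 1)\<^sup>2 * (s\<^sup>2 - 1) * p s + \<epsilon> s)
     \<and> (\<forall>s. \<bar>s\<bar> \<ge> 1 + 2 * \<theta> \<longrightarrow> p s = 0 \<and> p1 s = 0 \<and> p2 s = 0 \<and> \<epsilon> s = 0)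
     \<and> integral {-(1+2*\<theta>)..1+2*\<theta>} (\<lambda>s. (\<epsilon> s)\<^sup>2) \<le> CH * integral {-(1+2*\<theta>)..1+2*\<theta>} (\<lambda>s. (p s)\<^sup>2)
     \<and> integral {-(1+2*\<theta>)..1+2*\<theta>} (\<lambda>s. (p s)\<^sup>2) > 0"
    using localized_hermite_function[OF \<theta>] by blast
  define C where "C = sqrt (2 * ((K\<^sup>2 / 4 + K / 2)\<^sup>2 + CH * exp (4 * K)))"
  have C: "C \<ge> 0" unfolding C_def using CH by simp
  obtain N :: nat where "real N \<ge> \<bar>z1 - 2 * \<beta>\<bar> + \<bar>z2 + 2 * \<beta>\<bar> + 1" using real_arch_simple by blast
  then have N: "real N - 1 \<ge> \<bar>y\<bar>" if "z1 - 2 * \<beta> \<le> y" "y \<le> z2 + 2 * \<beta>" for y using that by linarith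
  have "\<exists>\<mu>. is_eigenvalue (schroedinger_op v h) \<mu> \<and> \<bar>\<mu> - E\<bar> \<le> C * h\<^sup>2"
    if tp: "turning_pair E a b" and h: "h > 0" and quant: "integral {a..b} (\<lambda>x. sqrt \<bar>E - v x\<bar>) = pi * (real n + 1 / 2) * h"
      and c: "c > 0" and far: "\<forall>x. \<bar>x\<bar> \<ge> R \<longrightarrow> v x \<ge> E + C * h\<^sup>2 + c" for E a b h c R and n :: nat
  proof -
    have \<kappa>: "2 / pi * (pi * (real n + 1 / 2) * h) = (2 * real n + 1) * h" by (simp add: field_simps)
    obtain dl dr \<zeta> L L1 L2 where d: "z1 - 2 * \<beta> \<le> dl" "dl < dr" "dr \<le> z2 + 2 * \<beta>" and L2: "continuous_on {dl<..<dr} L2"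
      and surj: "{- (1 + 2 * \<theta>)..1 + 2 * \<theta>} \<subseteq> \<zeta> ` {dl<..<dr}"
      and map: "\<forall>y\<in>{dl<..<dr}. (\<zeta> has_real_derivative exp (L y)) (at y) \<and> (L has_real_derivative L1 y) (at y) \<and>
           (L1 has_real_derivative L2 y) (at y) \<and> \<bar>L y\<bar> \<le> K \<and> \<bar>L1 y\<bar> \<le> K \<and> \<bar>L2 y\<bar> \<le> K \<and>
           ((2 * real n + 1) * h)\<^sup>2 * (exp (L y))\<^sup>2 * (1 - (\<zeta> y)\<^sup>2) = E - v y"
      using liouville[OF tp, unfolded quant \<kappa>] by (elim exE conjE) (rule that)
    obtain p p1 p2 \<epsilon> where p: "\<forall>s. (p has_real_derivative p1 s) (at s)" "\<forall>s. (p1 has_real_derivative p2 s) (at s)"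
      "continuous_on UNIV \<epsilon>" "\<forall>s. p2 s = (2 * real n + 1)\<^sup>2 * (s\<^sup>2 - 1) * p s + \<epsilon> s"
      "\<forall>s. \<bar>s\<bar> \<ge> 1 + 2 * \<theta> \<longrightarrow> p s = 0 \<and> p1 s = 0 \<and> p2 s = 0 \<and> \<epsilon> s = 0"
      "integral {-(1+2*\<theta>)..1+2*\<theta>} (\<lambda>s. (\<epsilon> s)\<^sup>2) \<le> CH * integral {-(1+2*\<theta>)..1+2*\<theta>} (\<lambda>s. (p s)\<^sup>2)"
      "integral {-(1+2*\<theta>)..1+2*\<theta>} (\<lambda>s. (p s)\<^sup>2) > 0"
      using hermite[of n] by (elim exE conjE) (rule that)
    have "\<exists>f f1 f2. (\<forall>x. (f has_real_derivative f1 x) (at x)) \<and> (\<forall>x. (f1 has_real_derivative f2 x) (at x)) \<and>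
      continuous_on UNIV f2 \<and> (\<forall>x. \<bar>x\<bar> \<ge> real N - 1 \<longrightarrow> f x = 0 \<and> f2 x = 0) \<and>
      integral {-real N..real N} (\<lambda>x. (f x)\<^sup>2) > 0 \<and>
      integral {-real N..real N} (\<lambda>x. (- h\<^sup>2 * f2 x + (v x - E) * f x)\<^sup>2)
        \<le> (C * h\<^sup>2)\<^sup>2 * integral {-real N..real N} (\<lambda>x. (f x)\<^sup>2)"
      unfolding C_def
    proof (rule liouville_quasimode[OF h \<theta> CH])
      show "\<bar>dl\<bar> \<le> real N - 1" "\<bar>dr\<bar> \<le> real N - 1" using d by (intro N; linarith)+
    qed (use L2 surj map p cont_v in \<open>blast+\<close>)
    then obtain f f1 f2 where f: "\<forall>x. (f has_real_derivative f1 x) (at x)" "\<forall>x. (f1 has_real_derivative f2 x) (at x)"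
      "continuous_on UNIV f2" "\<forall>x. \<bar>x\<bar> \<ge> real N - 1 \<longrightarrow> f x = 0 \<and> f2 x = 0"
      "integral {-real N..real N} (\<lambda>x. (f x)\<^sup>2) > 0"
      "integral {-real N..real N} (\<lambda>x. (- h\<^sup>2 * f2 x + (v x - E) * f x)\<^sup>2)
        \<le> (C * h\<^sup>2)\<^sup>2 * integral {-real N..real N} (\<lambda>x. (f x)\<^sup>2)"
      by (elim exE conjE) (rule that)
    show ?thesis
    proof (rule eigenvalue_near_quasimode[OF cont_v(1) h])
      show "0 \<le> C * h\<^sup>2" using C by simp
      show "E + C * h\<^sup>2 + c \<le> v x" if "R \<le> \<bar>x\<bar>" for x using far that by blast
      show "(f has_real_derivative f1 x) (at x)" "(f1 has_real_derivative f2 x) (at x)" for x using f(1,2) by blast+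
      show "f x = 0 \<and> f2 x = 0" if "real N - 1 \<le> \<bar>x\<bar>" for x using f(4) that by blast
    qed (fact c f(3) f(5) f(6))+
  qed
  then show ?thesis using C by blast
qed

lemma action_cont: "continuous_on S (\<lambda>x. sqrt \<bar>E - v x\<bar>)"
  by (intro continuous_intros cont_v)

lemma action_pos:
  assumes "turning_pair E a b"
  shows "integral {a..b} (\<lambda>x. sqrt \<bar>E - v x\<bar>) > 0"
proof -
  note t = assms[unfolded turning_pair_def]
  have ab: "a < b" using t sep \<beta> by auto
  have "integral {a..b} (\<lambda>x. 0) < integral {a..b} (\<lambda>x. sqrt \<bar>E - v x\<bar>)"
  proof (rule integral_less_real)
    show "{a<..<b} \<noteq> {}" using ab by simp
    show "0 < sqrt \<bar>E - v x\<bar>" if "x \<in> {a<..<b}" for x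
    proof -
      define \<eta> where "\<eta> = min (x - a) (b - x)"
      have \<eta>: "\<eta> > 0" "a + \<eta> \<le> x" "x \<le> b - \<eta>" unfolding \<eta>_def using that by auto
      have "min e (m * \<eta>) > 0" using e m \<eta> by simp
      moreover have "E - v x \<ge> min e (m * \<eta>)" using \<eta> by (intro depth[OF assms]) auto
      ultimately have "E - v x > 0" by linarith
      then show ?thesis by simp
    qed
  qed (auto intro!: integrable_continuous_real action_cont)
  then show ?thesis by simp
qed

text \<open>
  A higher energy has a wider well and a larger integrand.
\<close>

lemma action_strict_mono:
  assumes tp: "turning_pair E a b" "turning_pair E' a' b'" and less: "E < E'"
  shows "integral {a..b} (\<lambda>x. sqrt \<bar>E - v x\<bar>) < integral {a'..b'} (\<lambda>x. sqrt \<bar>E' - v x\<bar>)"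
proof -
  note t = tp[unfolded turning_pair_def]
  have ab: "a < b" using t sep \<beta> by auto
  have "a' \<le> a"
  proof (rule ccontr)
    assume "\<not> a' \<le> a"
    then have "v a - v a' \<ge> m * (a' - a)" "m * (a' - a) \<ge> 0" using t \<beta> m by (auto intro: slope_left)
    then show False using t less by linarith
  qed
  moreover have "b \<le> b'"
  proof (rule ccontr)
    assume "\<not> b \<le> b'"
    then have "v b - v b' \<ge> m * (b - b')" using t \<beta> by (intro slope_right) auto
    moreover have "m * (b - b') \<ge> 0" using m \<open>\<not> b \<le> b'\<close> by simp
    ultimately show False using t less by linarith
  qed
  ultimately have sub: "{a..b} \<subseteq> {a'..b'}" by simp
  have "integral {a..b} (\<lambda>x. sqrt \<bar>E - v x\<bar>) < integral {a..b} (\<lambda>x. sqrt \<bar>E' - v x\<bar>)"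
  proof (rule integral_less_real)
    show "{a<..<b} \<noteq> {}" using ab by simp
    show "sqrt \<bar>E - v x\<bar> < sqrt \<bar>E' - v x\<bar>" if "x \<in> {a<..<b}" for x
    proof -
      have "E - v x \<ge> min e (m * 0)" using that by (intro depth[OF tp(1)]) auto
      then have "E - v x \<ge> 0" using e by simp
      then show ?thesis using less by simp
    qed
  qed (auto intro!: integrable_continuous_real action_cont)
  also have "\<dots> \<le> integral {a'..b'} (\<lambda>x. sqrt \<bar>E' - v x\<bar>)"
    by (rule integral_subset_le[OF sub]) (auto intro!: integrable_continuous_real action_cont)
  finally show ?thesis .
qed

lemma action_eq_lebesgue:
  assumes tp: "turning_pair E a b"
  shows "(LBINT x=a..b. sqrt (E - v x)) = integral {a..b} (\<lambda>x. sqrt \<bar>E - v x\<bar>)"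
proof -
  have ab: "a \<le> b" using tp sep \<beta> unfolding turning_pair_def by auto
  have "continuous_on {a..b} (\<lambda>x. sqrt (E - v x))" by (intro continuous_intros cont_v)
  then have "set_integrable lborel {a..b} (\<lambda>x. sqrt (E - v x))"
    unfolding set_integrable_def by (intro borel_integrable_compact) auto
  then have "(LBINT x=a..b. sqrt (E - v x)) = integral {a..b} (\<lambda>x. sqrt (E - v x))"
    using ab by (intro interval_integral_eq_integral)
  also have "\<dots> = integral {a..b} (\<lambda>x. sqrt \<bar>E - v x\<bar>)"
  proof (rule integral_cong)
    fix x assume "x \<in> {a..b}"
    then have "E - v x \<ge> min e (m * 0)" by (intro depth[OF tp]) auto
    then show "sqrt (E - v x) = sqrt \<bar>E - v x\<bar>" using e by simp
  qed
  finally show ?thesis .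
qed

end

section \<open>The wells at energies near the reference energy\<close>

lemma bounded_below_far_out:
  fixes v :: "real \<Rightarrow> real"
  assumes "Liminf at_top (\<lambda>x. ereal (v x)) > ereal E" "Liminf at_bot (\<lambda>x. ereal (v x)) > ereal E"
  obtains c R where "c > 0" "\<And>x. \<bar>x\<bar> \<ge> R \<Longrightarrow> v x \<ge> E + c"
proof -
  obtain r where r: "ereal E < ereal r" "ereal r < Liminf at_top (\<lambda>x. ereal (v x))" using ereal_dense2[OF assms(1)] by blast
  obtain s where s: "ereal E < ereal s" "ereal s < Liminf at_bot (\<lambda>x. ereal (v x))" using ereal_dense2[OF assms(2)] by blast
  obtain A where A: "\<And>x. x \<ge> A \<Longrightarrow> r < v x"
    using less_LiminfD[OF r(2)] unfolding eventually_at_top_linorder by auto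
  obtain B where B: "\<And>x. x \<le> B \<Longrightarrow> s < v x"
    using less_LiminfD[OF s(2)] unfolding eventually_at_bot_linorder by auto
  show thesis
  proof (rule that)
    show "min r s - E > 0" using r s by simp
    fix x :: real assume "\<bar>x\<bar> \<ge> max A (- B)"
    then have "x \<ge> A \<or> x \<le> B" by linarith
    then show "v x \<ge> E + (min r s - E)" using A[of x] B[of x] by auto
  qed
qed

lemma finite_uniform_radius:
  assumes "finite Z" "\<And>z. z \<in> Z \<Longrightarrow> \<exists>r>0. \<forall>s. 0 < s \<longrightarrow> s \<le> r \<longrightarrow> P z s"
  shows "\<exists>r>0::real. \<forall>z\<in>Z. \<forall>s. 0 < s \<longrightarrow> s \<le> r \<longrightarrow> P z s"
  using assms
proof (induction Z rule: finite_induct)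
  case empty
  show ?case by (intro exI[of _ 1]) simp
next
  case (insert z Z)
  obtain r where r: "r > 0" "\<forall>z\<in>Z. \<forall>s. 0 < s \<longrightarrow> s \<le> r \<longrightarrow> P z s" using insert by blast
  obtain q where q: "q > 0" "\<forall>s. 0 < s \<longrightarrow> s \<le> q \<longrightarrow> P z s" using insert by blast
  show ?case using r q by (intro exI[of _ "min r q"]) auto
qed

text \<open>
  By finiteness, one radius \<open>\<beta>\<close> serves all zeros. Outside the balls of radius \<open>\<beta>\<close>, the function
  \<open>|v - E0|\<close> has a positive minimum on a compact interval, and beyond it \<open>v\<close> stays above \<open>E0\<close> by a fixed amount.
\<close>

lemma isolated_simple_zeros:
  fixes v v1 :: "real \<Rightarrow> real"
  assumes dv: "\<And>x. (v has_real_derivative v1 x) (at x)" and cv1: "continuous_on UNIV v1"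
    and fin: "finite {x. v x = E0}" and simple: "\<And>z. v z = E0 \<Longrightarrow> v1 z \<noteq> 0"
    and nbhd: "\<And>z. v z = E0 \<Longrightarrow> z \<in> S z \<and> open (S z)"
    and far: "c > 0" "\<And>x. \<bar>x\<bar> \<ge> R \<Longrightarrow> v x \<ge> E0 + c"
  shows "\<exists>\<beta> m e. \<beta> > 0 \<and> m > 0 \<and> e > 0 \<and> 2 * e \<le> c \<and>
    (\<forall>z x. v z = E0 \<longrightarrow> \<bar>x - z\<bar> \<le> 2 * \<beta> \<longrightarrow> x \<in> S z \<and> sgn (v1 x) = sgn (v1 z) \<and> \<bar>v1 x\<bar> \<ge> m) \<and>
    (\<forall>z z'. v z = E0 \<longrightarrow> v z' = E0 \<longrightarrow> z < z' \<longrightarrow> z + 2 * \<beta> < z' - 2 * \<beta>) \<and>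
    (\<forall>x. (\<forall>z. v z = E0 \<longrightarrow> \<bar>x - z\<bar> \<ge> \<beta>) \<longrightarrow> \<bar>v x - E0\<bar> \<ge> 2 * e)"
proof -
  let ?Z = "{x. v x = E0}"
  have cv: "continuous_on A v" for A by (rule continuous_at_imp_continuous_on, rule ballI, rule DERIV_isCont, rule dv)
  have "\<exists>r>0. \<forall>s. 0 < s \<longrightarrow> s \<le> r \<longrightarrow> (\<forall>x. \<bar>x - z\<bar> \<le> 2 * s \<longrightarrow> x \<in> S z \<and> sgn (v1 x) = sgn (v1 z) \<and> \<bar>v1 x\<bar> \<ge> \<bar>v1 z\<bar> / 2)"
    if z: "z \<in> ?Z" for z
  proof -
    have "isCont v1 z" using cv1 by (simp add: continuous_on_eq_continuous_at)
    then obtain r where r: "r > 0" "\<forall>x. \<bar>x - z\<bar> \<le> r \<longrightarrow> sgn (v1 x) = sgn (v1 z) \<and> \<bar>v1 x\<bar> \<ge> \<bar>v1 z\<bar> / 2"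
      using slope_bound_near[of z v1] simple z by blast
    obtain q where q: "q > 0" "cball z q \<subseteq> S z" using nbhd[of z] z open_contains_cball by blast
    show ?thesis
    proof (intro exI[of _ "min r q / 2"] conjI allI impI)
      show "min r q / 2 > 0" using r q by simp
      fix s x assume "0 < s" "s \<le> min r q / 2" and "\<bar>x - z\<bar> \<le> 2 * s"
      then have x: "\<bar>x - z\<bar> \<le> r" "\<bar>x - z\<bar> \<le> q" by linarith+
      show "x \<in> S z" using q(2) x(2) by (auto simp: dist_real_def abs_minus_commute subset_iff)
      show "sgn (v1 x) = sgn (v1 z)" "\<bar>v1 x\<bar> \<ge> \<bar>v1 z\<bar> / 2" using r(2) x(1) by blast+
    qed
  qed
  then obtain r where r: "r > 0" "\<And>z s x. v z = E0 \<Longrightarrow> 0 < s \<Longrightarrow> s \<le> r \<Longrightarrow> \<bar>x - z\<bar> \<le> 2 * s \<Longrightarrow>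
      x \<in> S z \<and> sgn (v1 x) = sgn (v1 z) \<and> \<bar>v1 x\<bar> \<ge> \<bar>v1 z\<bar> / 2"
    using finite_uniform_radius[OF fin, where P = "\<lambda>z s. \<forall>x. \<bar>x - z\<bar> \<le> 2 * s \<longrightarrow> x \<in> S z \<and> sgn (v1 x) = sgn (v1 z) \<and> \<bar>v1 x\<bar> \<ge> \<bar>v1 z\<bar> / 2"] by blast
  have "\<exists>r>0. \<forall>s. 0 < s \<longrightarrow> s \<le> r \<longrightarrow> (fst w < snd w \<longrightarrow> fst w + 2 * s < snd w - 2 * s)" for w :: "real \<times> real"
  proof (cases "fst w < snd w")
    case True
    then show ?thesis by (intro exI[of _ "(snd w - fst w) / 5"]) auto
  qed (intro exI[of _ 1], simp)
  then obtain q where q: "q > 0" "\<And>w s. w \<in> ?Z \<times> ?Z \<Longrightarrow> 0 < s \<Longrightarrow> s \<le> q \<Longrightarrow> fst w < snd w \<Longrightarrow> fst w + 2 * s < snd w - 2 * s"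
    using finite_uniform_radius[OF finite_cartesian_product[OF fin fin], where P = "\<lambda>w s. fst w < snd w \<longrightarrow> fst w + 2 * s < snd w - 2 * s"] by blast
  have "\<exists>r>0. \<forall>s. 0 < s \<longrightarrow> s \<le> r \<longrightarrow> s \<le> \<bar>v1 z\<bar> / 2" if "z \<in> ?Z" for z
    using simple that by (intro exI[of _ "\<bar>v1 z\<bar> / 2"]) auto
  then obtain m where m: "m > 0" "\<And>z. v z = E0 \<Longrightarrow> m \<le> \<bar>v1 z\<bar> / 2"
    using finite_uniform_radius[OF fin, where P = "\<lambda>z s. s \<le> \<bar>v1 z\<bar> / 2"] by blast
  define \<beta> where "\<beta> = min r q"
  have \<beta>: "0 < \<beta>" "\<beta> \<le> r" "\<beta> \<le> q" unfolding \<beta>_def using r q by auto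
  define K where "K = {-\<bar>R\<bar>..\<bar>R\<bar>} \<inter> (\<Inter>z\<in>?Z. - ball z \<beta>)"
  have "compact K" unfolding K_def by (intro compact_Int_closed closed_INT ballI closed_Compl open_ball compact_Icc)
  have Kne: "\<bar>v x - E0\<bar> > 0" if "x \<in> K" for x
  proof -
    have "x \<notin> ?Z" using that \<beta> unfolding K_def by auto
    then show ?thesis by simp
  qed
  obtain \<mu> where \<mu>: "\<mu> > 0" "\<And>x. x \<in> K \<Longrightarrow> \<bar>v x - E0\<bar> \<ge> \<mu>"
  proof (cases "K = {}")
    case True
    then show ?thesis using that[of 1] by simp
  next
    case False
    have "continuous_on K (\<lambda>x. \<bar>v x - E0\<bar>)" by (intro continuous_intros cv)
    then obtain y where y: "y \<in> K" "\<forall>x\<in>K. \<bar>v y - E0\<bar> \<le> \<bar>v x - E0\<bar>"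
      using continuous_attains_inf[OF \<open>compact K\<close> False] by blast
    show ?thesis using that[OF Kne[OF y(1)]] y(2) by blast
  qed
  show ?thesis
  proof (rule exI[of _ \<beta>], rule exI[of _ m], rule exI[of _ "min c \<mu> / 2"], intro conjI allI impI)
    fix z x assume "v z = E0" "\<bar>x - z\<bar> \<le> 2 * \<beta>"
    then show "x \<in> S z" "sgn (v1 x) = sgn (v1 z)" "\<bar>v1 x\<bar> \<ge> m" using r(2)[of z \<beta> x] m(2)[of z] \<beta> by force+
  next
    fix z z' assume "v z = E0" "v z' = E0" "z < z'"
    then show "z + 2 * \<beta> < z' - 2 * \<beta>" using q(2)[of "(z, z')" \<beta>] \<beta> by simp
  next
    fix x assume x: "\<forall>z. v z = E0 \<longrightarrow> \<bar>x - z\<bar> \<ge> \<beta>"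
    show "\<bar>v x - E0\<bar> \<ge> 2 * (min c \<mu> / 2)"
    proof (cases "\<bar>x\<bar> \<ge> R")
      case True
      then show ?thesis using far(2)[OF True] by linarith
    next
      case False
      then have "x \<in> K" using x unfolding K_def by (auto simp: dist_real_def abs_minus_commute not_less)
      then show ?thesis using \<mu>(2)[of x] by linarith
    qed
  qed (use \<beta> m \<mu> far in auto)
qed

text \<open>
  Each zero of \<open>v - E0\<close> moves to exactly one zero of \<open>v - E\<close> in the ball of radius \<open>\<beta>\<close>: existence by the
  intermediate value theorem, uniqueness since the derivative does not vanish there. No zero arises elsewhere,
  and as the balls are disjoint, the order is preserved.
\<close>

lemma perturbed_zeros:
  fixes v v1 :: "real \<Rightarrow> real"
  assumes dv: "\<And>x. (v has_real_derivative v1 x) (at x)" 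
    and fin: "finite {x. v x = E0}" and pos: "\<beta> > 0" "m > 0" "e > 0"
    and slope: "\<And>z x. v z = E0 \<Longrightarrow> \<bar>x - z\<bar> \<le> 2 * \<beta> \<Longrightarrow> sgn (v1 x) = sgn (v1 z) \<and> \<bar>v1 x\<bar> \<ge> m"
    and gap: "\<And>z z'. v z = E0 \<Longrightarrow> v z' = E0 \<Longrightarrow> z < z' \<Longrightarrow> z + 2 * \<beta> < z' - 2 * \<beta>"
    and away: "\<And>x. (\<And>z. v z = E0 \<Longrightarrow> \<bar>x - z\<bar> \<ge> \<beta>) \<Longrightarrow> \<bar>v x - E0\<bar> \<ge> 2 * e"
    and E: "\<bar>E - E0\<bar> \<le> e"
  shows "\<exists>\<rho>. (\<forall>z. v z = E0 \<longrightarrow> \<rho> z \<in> {z - \<beta>..z + \<beta>} \<and> v (\<rho> z) = E) \<and>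
    sorted_list_of_set {x. v x = E} = map \<rho> (sorted_list_of_set {x. v x = E0})"
proof -
  let ?Z = "{x. v x = E0}"
  have cv: "continuous_on A v" for A by (rule continuous_at_imp_continuous_on, rule ballI, rule DERIV_isCont, rule dv)
  have "\<exists>x. x \<in> {z - \<beta>..z + \<beta>} \<and> v x = E" if z: "v z = E0" for z
  proof -
    have dist: "\<bar>z + \<beta> - z'\<bar> \<ge> \<beta>" "\<bar>z - \<beta> - z'\<bar> \<ge> \<beta>" if z': "v z' = E0" for z'
      using gap[OF z z'] gap[OF z' z] pos by (cases z z' rule: linorder_cases; auto)+
    have ends: "\<bar>v (z + \<beta>) - E0\<bar> \<ge> 2 * e" "\<bar>v (z - \<beta>) - E0\<bar> \<ge> 2 * e" using dist by (intro away; blast)+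
    have "v1 z \<noteq> 0" using slope[OF z, of z] pos by auto
    then consider "v1 z > 0" | "v1 z < 0" by linarith
    then show ?thesis
    proof cases
      case 1
      have s: "v1 x > 0" if "\<bar>x - z\<bar> \<le> 2 * \<beta>" for x using slope[OF z that] 1 by (auto simp: sgn_real_def split: if_splits)
      have inc: "v p < v q" if pq: "p < q" "z - \<beta> \<le> p" "q \<le> z + \<beta>" for p q
      proof (rule DERIV_pos_imp_increasing[OF pq(1)])
        fix t assume "p \<le> t" "t \<le> q"
        then have "\<bar>t - z\<bar> \<le> 2 * \<beta>" using pq pos by auto
        then show "\<exists>y. (v has_real_derivative y) (at t) \<and> 0 < y" using dv s by blast
      qed
      have "v (z - \<beta>) < v z" "v z < v (z + \<beta>)" using pos by (auto intro!: inc)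
      then have "v (z - \<beta>) \<le> E" "E \<le> v (z + \<beta>)" using ends z E pos by linarith+
      then have "\<exists>x\<ge>z - \<beta>. x \<le> z + \<beta> \<and> v x = E" using pos by (intro IVT' cv) auto
      then show ?thesis by auto
    next
      case 2
      have s: "v1 x < 0" if "\<bar>x - z\<bar> \<le> 2 * \<beta>" for x using slope[OF z that] 2 by (auto simp: sgn_real_def split: if_splits)
      have inc: "v p > v q" if pq: "p < q" "z - \<beta> \<le> p" "q \<le> z + \<beta>" for p q
      proof (rule DERIV_neg_imp_decreasing[OF pq(1)])
        fix t assume "p \<le> t" "t \<le> q"
        then have "\<bar>t - z\<bar> \<le> 2 * \<beta>" using pq pos by auto
        then show "\<exists>y. (v has_real_derivative y) (at t) \<and> y < 0" using dv s by blast
      qed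
      have "v (z - \<beta>) > v z" "v z > v (z + \<beta>)" using pos by (auto intro!: inc)
      then have "v (z - \<beta>) \<ge> E" "E \<ge> v (z + \<beta>)" using ends z E pos by linarith+
      then have "\<exists>x\<ge>z - \<beta>. x \<le> z + \<beta> \<and> v x = E" using pos by (intro IVT2' cv) auto
      then show ?thesis by auto
    qed
  qed
  then obtain \<rho> where \<rho>: "\<And>z. v z = E0 \<Longrightarrow> \<rho> z \<in> {z - \<beta>..z + \<beta>} \<and> v (\<rho> z) = E" by metis
  have no_two: "\<not> x < y" if z: "v z = E0" and x: "v x = E" "\<bar>x - z\<bar> \<le> \<beta>" and y: "v y = E" "\<bar>y - z\<bar> \<le> \<beta>" for x y z
  proof
    assume xy: "x < y"
    obtain t where t: "t > x" "t < y" "v y - v x = (y - x) * v1 t" using MVT2[OF xy dv] by blast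
    then have "v1 t = 0" using x y xy by simp
    moreover have "\<bar>t - z\<bar> \<le> 2 * \<beta>" using t x(2) y(2) pos by linarith
    then have "\<bar>v1 t\<bar> \<ge> m" using slope[OF z, of t] by blast
    ultimately show False using pos by simp
  qed
  have img: "{x. v x = E} = \<rho> ` ?Z"
  proof (intro set_eqI iffI)
    fix x assume x: "x \<in> {x. v x = E}"
    have "\<not> (\<forall>z. v z = E0 \<longrightarrow> \<bar>x - z\<bar> \<ge> \<beta>)"
    proof
      assume "\<forall>z. v z = E0 \<longrightarrow> \<bar>x - z\<bar> \<ge> \<beta>"
      then have "\<bar>v x - E0\<bar> \<ge> 2 * e" by (intro away) blast
      then show False using x E pos by simp
    qed
    then obtain z where z: "v z = E0" "\<bar>x - z\<bar> \<le> \<beta>" by (auto simp: not_le intro: less_imp_le)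
    have "\<bar>\<rho> z - z\<bar> \<le> \<beta>" "v (\<rho> z) = E" using \<rho>[OF z(1)] by auto
    then have "\<not> x < \<rho> z" "\<not> \<rho> z < x" using no_two[OF z(1)] x z(2) by blast+
    then have "x = \<rho> z" by linarith
    then show "x \<in> \<rho> ` ?Z" using z(1) by blast
  qed (use \<rho> in auto)
  have mono: "\<rho> z < \<rho> z'" if "v z = E0" "v z' = E0" "z < z'" for z z'
    using gap[OF that] \<rho>[OF that(1)] \<rho>[OF that(2)] pos by auto
  have mono_le: "\<rho> z \<le> \<rho> z'" if "v z = E0" "v z' = E0" "z \<le> z'" for z z'
    using mono[OF that(1,2)] that(3) by (cases "z = z'") auto
  let ?zs = "sorted_list_of_set ?Z"
  have set: "set ?zs = ?Z" using fin by simp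
  have "inj_on \<rho> ?Z"
  proof (rule inj_onI)
    fix x y assume "x \<in> ?Z" "y \<in> ?Z" "\<rho> x = \<rho> y"
    then show "x = y" using mono[of x y] mono[of y x] by (cases x y rule: linorder_cases) auto
  qed
  then have "distinct (map \<rho> ?zs)" unfolding distinct_map set by simp
  moreover have "sorted (map \<rho> ?zs)"
    unfolding sorted_map
  proof (rule sorted_wrt_mono_rel[of _ "(\<le>)"])
    fix x y assume "x \<in> set ?zs" "y \<in> set ?zs" "x \<le> y"
    then show "\<rho> x \<le> \<rho> y" using mono_le unfolding set by blast
  qed simp
  moreover have "set (map \<rho> ?zs) = {x. v x = E}" using img set by simp
  moreover have "finite {x. v x = E}" unfolding img using fin by simp
  ultimately have "sorted_list_of_set {x. v x = E} = map \<rho> ?zs"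
    by (metis sorted_list_of_set.idem_if_sorted_distinct)
  then show ?thesis using \<rho> by blast
qed

text \<open>
  Consecutive zeros number \<open>2 l - 2\<close> and \<open>2 l - 1\<close>, counted from 0, enclose a region where \<open>v < E0\<close>,
  because \<open>v - E0\<close> is positive near \<open>-\<infinity>\<close> and changes sign at every zero.
\<close>

lemma wells_near_energy:
  fixes v :: "real \<Rightarrow> real"
  assumes adm: "admissible_potential v E0"
  obtains \<beta> m e R where "e > 0" "\<And>x. \<bar>x\<bar> \<ge> R \<Longrightarrow> v x \<ge> E0 + 2 * e"
    "\<And>l. l \<in> {1..num_wells v E0} \<Longrightarrow>
       well v (deriv v) ((deriv ^^ 2) v) ((deriv ^^ 3) v) E0 (x_minus v l E0) (x_plus v l E0) \<beta> m e"
    "\<And>l E. l \<in> {1..num_wells v E0} \<Longrightarrow> \<bar>E - E0\<bar> \<le> e \<Longrightarrow>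
       x_minus v l E \<in> {x_minus v l E0 - \<beta>..x_minus v l E0 + \<beta>} \<and> v (x_minus v l E) = E \<and>
       x_plus v l E \<in> {x_plus v l E0 - \<beta>..x_plus v l E0 + \<beta>} \<and> v (x_plus v l E) = E"
proof -
  note a = adm[unfolded admissible_potential_def]
  let ?Z = "{x. v x = E0}" and ?v1 = "deriv v" and ?v2 = "(deriv ^^ 2) v" and ?v3 = "(deriv ^^ 3) v"
  have C2: "Ck_on 2 v UNIV" and fin: "finite ?Z" and simple: "\<And>z. v z = E0 \<Longrightarrow> ?v1 z \<noteq> 0"
    and C3: "\<And>z. v z = E0 \<Longrightarrow> \<exists>S. z \<in> S \<and> Ck_on 3 v S" using a by blast+
  have dv: "(v has_real_derivative ?v1 x) (at x)" for x
  proof -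
    have "(deriv ^^ 0) v differentiable at x" using C2 unfolding Ck_on_def by (metis UNIV_I zero_less_numeral)
    then show ?thesis by (simp add: DERIV_deriv_iff_real_differentiable)
  qed
  have dv1: "(?v1 has_real_derivative ?v2 x) (at x)" for x
  proof -
    have "(deriv ^^ 1) v differentiable at x" using C2 unfolding Ck_on_def by (metis UNIV_I one_less_numeral_iff semiring_norm(76))
    then show ?thesis by (simp add: DERIV_deriv_iff_real_differentiable numeral_2_eq_2)
  qed
  have cv: "continuous_on A v" "continuous_on A ?v1" for A
    by (rule continuous_at_imp_continuous_on, rule ballI, rule DERIV_isCont, rule dv dv1)+
  have cv2: "continuous_on UNIV ?v2" using C2 unfolding Ck_on_def by blast
  obtain S where S: "\<And>z. v z = E0 \<Longrightarrow> z \<in> S z \<and> Ck_on 3 v (S z)" using C3 by metis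
  have dv2: "(?v2 has_real_derivative ?v3 x) (at x)" if "x \<in> S z" "v z = E0" for x z
  proof -
    have "?v2 differentiable at x" using S[OF that(2)] that(1) unfolding Ck_on_def by auto
    then show ?thesis by (simp add: DERIV_deriv_iff_real_differentiable numeral_3_eq_3 numeral_2_eq_2)
  qed
  have cv3: "continuous_on (S z) ?v3" if "v z = E0" for z using S[OF that] unfolding Ck_on_def by blast
  obtain c R where far: "c > 0" "\<And>x. \<bar>x\<bar> \<ge> R \<Longrightarrow> v x \<ge> E0 + c"
    using bounded_below_far_out[of E0 v] a by blast
  have Sop: "z \<in> S z \<and> open (S z)" if "v z = E0" for z using S[OF that] unfolding Ck_on_def by blast
  have "\<exists>\<beta> m e. \<beta> > 0 \<and> m > 0 \<and> e > 0 \<and> 2 * e \<le> c \<and>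
    (\<forall>z x. v z = E0 \<longrightarrow> \<bar>x - z\<bar> \<le> 2 * \<beta> \<longrightarrow> x \<in> S z \<and> sgn (?v1 x) = sgn (?v1 z) \<and> \<bar>?v1 x\<bar> \<ge> m) \<and>
    (\<forall>z z'. v z = E0 \<longrightarrow> v z' = E0 \<longrightarrow> z < z' \<longrightarrow> z + 2 * \<beta> < z' - 2 * \<beta>) \<and>
    (\<forall>x. (\<forall>z. v z = E0 \<longrightarrow> \<bar>x - z\<bar> \<ge> \<beta>) \<longrightarrow> \<bar>v x - E0\<bar> \<ge> 2 * e)"
    by (rule isolated_simple_zeros[where R = R, OF dv cv(2) fin]) (use simple Sop far in blast)+
  then obtain \<beta> m e where \<beta>: "\<beta> > 0" and m: "m > 0" and e: "e > 0" "2 * e \<le> c"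
    and near: "\<And>z x. v z = E0 \<Longrightarrow> \<bar>x - z\<bar> \<le> 2 * \<beta> \<Longrightarrow> x \<in> S z \<and> sgn (?v1 x) = sgn (?v1 z) \<and> \<bar>?v1 x\<bar> \<ge> m"
    and gap: "\<And>z z'. v z = E0 \<Longrightarrow> v z' = E0 \<Longrightarrow> z < z' \<Longrightarrow> z + 2 * \<beta> < z' - 2 * \<beta>"
    and away: "\<And>x. (\<And>z. v z = E0 \<Longrightarrow> \<bar>x - z\<bar> \<ge> \<beta>) \<Longrightarrow> \<bar>v x - E0\<bar> \<ge> 2 * e"
    by blast
  let ?zs = "sorted_list_of_set ?Z"
  have zs: "length ?zs = card ?Z" "set ?zs = ?Z" "sorted ?zs" "distinct ?zs" using fin by auto
  have tpE0: "turning_points v E0 = ?zs" unfolding turning_points_def ..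
  have slope: "if even j then ?v1 (?zs ! j) < 0 else ?v1 (?zs ! j) > 0" if "j < card ?Z" for j
  proof -
    have Z: "{x. v x - E0 = 0} = ?Z" by auto
    have "if even j then ?v1 (sorted_list_of_set {x. v x - E0 = 0} ! j) < 0 else ?v1 (sorted_list_of_set {x. v x - E0 = 0} ! j) > 0"
    proof (rule sign_changes_at_zeros)
      show "((\<lambda>x. v x - E0) has_real_derivative ?v1 x) (at x)" for x by (auto intro!: derivative_eq_intros dv)
      show "v x - E0 > 0" if "x \<le> - \<bar>R\<bar>" for x using far(1) far(2)[of x] that by linarith
    qed (use Z fin simple that in simp_all)
    then show ?thesis unfolding Z .
  qed
  show thesis
  proof (rule that[of e R \<beta> m])
    show "v x \<ge> E0 + 2 * e" if "R \<le> \<bar>x\<bar>" for x using far(2)[OF that] e by linarith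
  next
    fix l assume l: "l \<in> {1..num_wells v E0}"
    then have len: "2 * l - 1 < card ?Z" "2 * l - 2 < card ?Z" "2 * l - 1 = Suc (2 * l - 2)" "even (2 * l - 2)" "odd (2 * l - 1)"
      unfolding num_wells_def by auto
    define z1 z2 where "z1 = ?zs ! (2 * l - 2)" and "z2 = ?zs ! (2 * l - 1)"
    have xpm: "x_minus v l E0 = z1" "x_plus v l E0 = z2" unfolding x_minus_def x_plus_def tpE0 z1_def z2_def by simp_all
    have "z1 \<in> set ?zs" "z2 \<in> set ?zs" unfolding z1_def z2_def using len zs(1) by (auto intro!: nth_mem)
    then have z: "v z1 = E0" "v z2 = E0" unfolding zs(2) by simp_all
    have sl: "?v1 z1 < 0" "?v1 z2 > 0" using slope[OF len(2)] slope[OF len(1)] len(4,5) unfolding z1_def z2_def by (simp_all only: if_True if_False)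
    have z12: "z1 < z2"
    proof -
      have "z1 \<le> z2" unfolding z1_def z2_def by (rule sorted_nth_mono[OF zs(3)]) (use len zs(1) in auto)
      moreover have "z1 \<noteq> z2" using sl by auto
      ultimately show ?thesis by simp
    qed
    have between: "y \<le> z1 \<or> z2 \<le> y" if "v y = E0" for y
    proof -
      have "y \<in> set ?zs" unfolding zs(2) using that by simp
      then obtain i where i: "i < length ?zs" "?zs ! i = y" unfolding in_set_conv_nth by blast
      show ?thesis
      proof (cases "i \<le> 2 * l - 2")
        case True
        then have "y \<le> z1" unfolding z1_def i(2)[symmetric] using len zs(1) by (intro sorted_nth_mono[OF zs(3)]) auto
        then show ?thesis ..
      next
        case False
        then have "z2 \<le> y" unfolding z2_def i(2)[symmetric] using len i(1) by (intro sorted_nth_mono[OF zs(3)]) auto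
        then show ?thesis ..
      qed
    qed
    have sep: "z1 + 2 * \<beta> < z2 - 2 * \<beta>" by (rule gap[OF z z12])
    have s1: "?v1 x \<le> - m" if "\<bar>x - z1\<bar> \<le> 2 * \<beta>" for x
      using near[OF z(1) that] sl(1) m by (auto simp: sgn_real_def split: if_splits)
    have s2: "?v1 x \<ge> m" if "\<bar>x - z2\<bar> \<le> 2 * \<beta>" for x
      using near[OF z(2) that] sl(2) m by (auto simp: sgn_real_def split: if_splits)
    have N: "{z1 - 2 * \<beta>..z1 + 2 * \<beta>} \<subseteq> S z1" "{z2 - 2 * \<beta>..z2 + 2 * \<beta>} \<subseteq> S z2"
      using near[OF z(1)] near[OF z(2)] by (auto simp: subset_iff abs_le_iff)
    show "well v ?v1 ?v2 ?v3 E0 (x_minus v l E0) (x_plus v l E0) \<beta> m e"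
      unfolding xpm
    proof unfold_locales
      fix x assume "x \<in> {z1 - 2 * \<beta>..z1 + 2 * \<beta>} \<or> x \<in> {z2 - 2 * \<beta>..z2 + 2 * \<beta>}"
      then show "(?v2 has_real_derivative ?v3 x) (at x)" using N dv2 z by blast
    next
      show "continuous_on {z1 - 2 * \<beta>..z1 + 2 * \<beta>} ?v3" "continuous_on {z2 - 2 * \<beta>..z2 + 2 * \<beta>} ?v3"
        using continuous_on_subset[OF cv3[OF z(1)] N(1)] continuous_on_subset[OF cv3[OF z(2)] N(2)] .
    next
      fix x assume x: "x \<in> {z1 + \<beta>..z2 - \<beta>}"
      have "\<bar>x - y\<bar> \<ge> \<beta>" if "v y = E0" for y using between[OF that] x by auto
      then have far: "\<bar>v x - E0\<bar> \<ge> 2 * e" by (rule away)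
      have "\<not> v x > E0"
      proof
        assume "v x > E0"
        moreover have "v (z1 + \<beta>) < v z1"
        proof (rule DERIV_neg_imp_decreasing[of z1 "z1 + \<beta>" v])
          fix t assume "z1 \<le> t" "t \<le> z1 + \<beta>"
          then have "?v1 t < 0" using s1[of t] m \<beta> by force
          then show "\<exists>y. (v has_real_derivative y) (at t) \<and> y < 0" using dv by blast
        qed (use \<beta> in simp)
        ultimately have "\<exists>y\<ge>z1 + \<beta>. y \<le> x \<and> v y = E0" using x z by (intro IVT' cv) auto
        then obtain y where "y \<ge> z1 + \<beta>" "y \<le> x" "v y = E0" by blast
        then show False using between[of y] x \<beta> by auto
      qed
      then show "v x \<le> E0 - 2 * e" using far e by linarith
    qed (use \<beta> m e sep dv dv1 cv2 s1 s2 in auto)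
  next
    fix l E assume l: "l \<in> {1..num_wells v E0}" and E: "\<bar>E - E0\<bar> \<le> e"
    have near': "sgn (?v1 x) = sgn (?v1 z) \<and> \<bar>?v1 x\<bar> \<ge> m" if "v z = E0" "\<bar>x - z\<bar> \<le> 2 * \<beta>" for z x
      using near[OF that] by blast
    obtain \<rho> where \<rho>: "\<forall>z. v z = E0 \<longrightarrow> \<rho> z \<in> {z - \<beta>..z + \<beta>} \<and> v (\<rho> z) = E"
      and tp: "sorted_list_of_set {x. v x = E} = map \<rho> ?zs"
      using perturbed_zeros[OF dv fin \<beta> m e(1) near' gap away E] by blast
    have idx: "2 * l - 2 < length ?zs" "2 * l - 1 < length ?zs" using l zs(1) unfolding num_wells_def by auto
    have E_eq: "x_minus v l E = \<rho> (x_minus v l E0)" "x_plus v l E = \<rho> (x_plus v l E0)"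
      unfolding x_minus_def x_plus_def tpE0 using tp idx unfolding turning_points_def by simp_all
    have "x_minus v l E0 \<in> set ?zs" "x_plus v l E0 \<in> set ?zs" unfolding x_minus_def x_plus_def tpE0 using idx by (auto intro!: nth_mem)
    then show "x_minus v l E \<in> {x_minus v l E0 - \<beta>..x_minus v l E0 + \<beta>} \<and> v (x_minus v l E) = E \<and>
       x_plus v l E \<in> {x_plus v l E0 - \<beta>..x_plus v l E0 + \<beta>} \<and> v (x_plus v l E) = E"
      unfolding E_eq zs(2) using \<rho> by simp
  qed (fact e)
qed

section \<open>The quantization condition\<close>

theorem theorem6p4:
  fixes v :: "real \<Rightarrow> real" and E0 :: real
  assumes "admissible_potential v E0"
  shows "\<exists>\<epsilon>>0. \<forall>\<Lambda>1 \<Lambda>2. E0 - \<epsilon> < \<Lambda>1 \<and> \<Lambda>1 < E0 \<and> E0 < \<Lambda>2 \<and> \<Lambda>2 < E0 + \<epsilon> \<longrightarrow>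
    (\<exists>C. \<exists>h0>0. \<forall>h. 0 < h \<and> h < h0 \<longrightarrow>
      (\<forall>l\<in>{1..num_wells v E0}. \<forall>n::int.
        pi * (of_int n + 1/2) * h \<in> \<Phi> v l ` {\<Lambda>1<..<\<Lambda>2} \<longrightarrow>
        (\<exists>\<mu>. is_eigenvalue (schroedinger_op v h) \<mu> \<and>
             \<bar>\<mu> - the_inv_into {\<Lambda>1<..<\<Lambda>2} (\<Phi> v l) (pi * (of_int n + 1/2) * h)\<bar> \<le> C * h\<^sup>2)))"
proof -
  obtain \<beta> m e R where e: "e > 0" and far: "\<And>x. \<bar>x\<bar> \<ge> R \<Longrightarrow> v x \<ge> E0 + 2 * e"
    and well: "\<And>l. l \<in> {1..num_wells v E0} \<Longrightarrow>
       well v (deriv v) ((deriv ^^ 2) v) ((deriv ^^ 3) v) E0 (x_minus v l E0) (x_plus v l E0) \<beta> m e"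
    and roots: "\<And>l E. l \<in> {1..num_wells v E0} \<Longrightarrow> \<bar>E - E0\<bar> \<le> e \<Longrightarrow>
       x_minus v l E \<in> {x_minus v l E0 - \<beta>..x_minus v l E0 + \<beta>} \<and> v (x_minus v l E) = E \<and>
       x_plus v l E \<in> {x_plus v l E0 - \<beta>..x_plus v l E0 + \<beta>} \<and> v (x_plus v l E) = E"
    by (rule wells_near_energy[OF assms]) (rule that; blast)
  have "\<exists>C\<ge>0. \<forall>h>0. C * h\<^sup>2 \<le> e / 2 \<longrightarrow> (\<forall>S n. S \<subseteq> {E0 - e..E0 + e} \<longrightarrow> pi * (of_int n + 1 / 2) * h \<in> \<Phi> v l ` S \<longrightarrow>
      (\<exists>\<mu>. is_eigenvalue (schroedinger_op v h) \<mu> \<and> \<bar>\<mu> - the_inv_into S (\<Phi> v l) (pi * (of_int n + 1/2) * h)\<bar> \<le> C * h\<^sup>2))"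
    if l: "l \<in> {1..num_wells v E0}" for l
  proof -
    interpret well v "deriv v" "(deriv ^^ 2) v" "(deriv ^^ 3) v" E0 "x_minus v l E0" "x_plus v l E0" \<beta> m e
      by (rule well[OF l])
    have tp: "turning_pair E (x_minus v l E) (x_plus v l E)" if "\<bar>E - E0\<bar> \<le> e" for E
      using roots[OF l that] that unfolding turning_pair_def by blast
    have \<Phi>: "\<Phi> v l E = integral {x_minus v l E..x_plus v l E} (\<lambda>x. sqrt \<bar>E - v x\<bar>)" if "\<bar>E - E0\<bar> \<le> e" for E
      unfolding \<Phi>_def by (rule action_eq_lebesgue[OF tp[OF that]])
    have mono: "\<Phi> v l E < \<Phi> v l E'" if "\<bar>E - E0\<bar> \<le> e" "\<bar>E' - E0\<bar> \<le> e" "E < E'" for E E'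
      unfolding \<Phi>[OF that(1)] \<Phi>[OF that(2)] by (rule action_strict_mono[OF tp[OF that(1)] tp[OF that(2)] that(3)])
    obtain C where C: "C \<ge> 0" and eig: "\<And>E a b h c R n. turning_pair E a b \<Longrightarrow> h > 0 \<Longrightarrow>
       integral {a..b} (\<lambda>x. sqrt \<bar>E - v x\<bar>) = pi * (real n + 1 / 2) * h \<Longrightarrow>
       c > 0 \<Longrightarrow> (\<forall>x. \<bar>x\<bar> \<ge> R \<longrightarrow> v x \<ge> E + C * h\<^sup>2 + c) \<Longrightarrow>
       (\<exists>\<mu>. is_eigenvalue (schroedinger_op v h) \<mu> \<and> \<bar>\<mu> - E\<bar> \<le> C * h\<^sup>2)"
      using eigenvalue_in_well by blast
    have "\<exists>\<mu>. is_eigenvalue (schroedinger_op v h) \<mu> \<and> \<bar>\<mu> - the_inv_into S (\<Phi> v l) (pi * (of_int n + 1/2) * h)\<bar> \<le> C * h\<^sup>2"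
      if h: "h > 0" "C * h\<^sup>2 \<le> e / 2" and S: "S \<subseteq> {E0 - e..E0 + e}" and y: "pi * (of_int n + 1 / 2) * h \<in> \<Phi> v l ` S" for h S n
    proof -
      have near: "\<bar>E - E0\<bar> \<le> e" if "E \<in> S" for E using subsetD[OF S that] by (simp add: abs_le_iff)
      obtain E where E: "E \<in> S" "pi * (of_int n + 1 / 2) * h = \<Phi> v l E" using y by (elim imageE) (rule that)
      have "inj_on (\<Phi> v l) S"
      proof (rule inj_onI)
        fix x y assume "x \<in> S" "y \<in> S" "\<Phi> v l x = \<Phi> v l y"
        then show "x = y" using mono[of x y] mono[of y x] near by (cases x y rule: linorder_cases) auto
      qed
      then have inv: "the_inv_into S (\<Phi> v l) (pi * (of_int n + 1/2) * h) = E"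
        unfolding E(2) using E(1) by (intro the_inv_into_f_f)
      \<comment> \<open>The action is positive, so only nonnegative \<open>n\<close> occur.\<close>
      have "pi * (of_int n + 1 / 2) * h > 0"
        unfolding E(2) \<Phi>[OF near[OF E(1)]] by (rule action_pos[OF tp[OF near[OF E(1)]]])
      then have "real_of_int n + 1 / 2 > 0" using h pi_gt_zero by (simp add: zero_less_mult_iff)
      then have "n \<ge> 0" by linarith
      then have n: "real_of_int n = real (nat n)" by simp
      have quant: "integral {x_minus v l E..x_plus v l E} (\<lambda>x. sqrt \<bar>E - v x\<bar>) = pi * (real (nat n) + 1 / 2) * h"
        using E(2) unfolding \<Phi>[OF near[OF E(1)]] n by simp
      have "\<forall>x. \<bar>x\<bar> \<ge> R \<longrightarrow> v x \<ge> E + C * h\<^sup>2 + e / 2"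
      proof (intro allI impI)
        fix x assume "R \<le> \<bar>x\<bar>"
        then show "v x \<ge> E + C * h\<^sup>2 + e / 2" using far[of x] near[OF E(1)] h(2) by linarith
      qed
      from eig[OF tp[OF near[OF E(1)]] h(1) quant _ this] e show ?thesis unfolding inv by simp
    qed
    then show ?thesis using C by blast
  qed
  then obtain C where C: "\<And>l. l \<in> {1..num_wells v E0} \<Longrightarrow> C l \<ge> 0"
    and eig: "\<And>l h S n. l \<in> {1..num_wells v E0} \<Longrightarrow> h > 0 \<Longrightarrow> C l * h\<^sup>2 \<le> e / 2 \<Longrightarrow> S \<subseteq> {E0 - e..E0 + e} \<Longrightarrow>
      pi * (of_int n + 1 / 2) * h \<in> \<Phi> v l ` S \<Longrightarrow>
      (\<exists>\<mu>. is_eigenvalue (schroedinger_op v h) \<mu> \<and> \<bar>\<mu> - the_inv_into S (\<Phi> v l) (pi * (of_int n + 1/2) * h)\<bar> \<le> C l * h\<^sup>2)"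
    by metis
  \<comment> \<open>One constant for all wells; the summand 1 makes it positive.\<close>
  define D where "D = (\<Sum>l\<in>{1..num_wells v E0}. C l) + 1"
  have CD: "C l \<le> D" if "l \<in> {1..num_wells v E0}" for l
    unfolding D_def using member_le_sum[OF that, of C] C by force
  have D: "D > 0" unfolding D_def using sum_nonneg[of "{1..num_wells v E0}" C] C by force
  \<comment> \<open>For \<open>h < h0\<close> the eigenvalue stays at least \<open>e / 2\<close> below the values of \<open>v\<close> near infinity.\<close>
  define h0 where "h0 = sqrt (e / (2 * D))"
  have h0: "h0 > 0" "h0\<^sup>2 = e / (2 * D)" unfolding h0_def using e D by simp_all
  have small: "D * h\<^sup>2 \<le> e / 2" if "0 < h" "h < h0" for h
  proof -
    have "h\<^sup>2 \<le> h0\<^sup>2" using that by (intro power_mono) auto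
    then have "D * h\<^sup>2 \<le> D * (e / (2 * D))" using D unfolding h0(2) by (intro mult_left_mono) auto
    also have "\<dots> = e / 2" using D by simp
    finally show ?thesis .
  qed
  show ?thesis
  proof (rule exI[of _ e], intro conjI allI impI e, rule exI[of _ D], rule exI[of _ h0], intro conjI allI impI ballI h0)
    fix \<Lambda>1 \<Lambda>2 h l and n :: int
    assume \<Lambda>: "E0 - e < \<Lambda>1 \<and> \<Lambda>1 < E0 \<and> E0 < \<Lambda>2 \<and> \<Lambda>2 < E0 + e" and h: "0 < h \<and> h < h0"
      and l: "l \<in> {1..num_wells v E0}" and n: "pi * (of_int n + 1 / 2) * h \<in> \<Phi> v l ` {\<Lambda>1<..<\<Lambda>2}"
    have le: "C l * h\<^sup>2 \<le> D * h\<^sup>2" using CD[OF l] by (intro mult_right_mono) auto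
    have "C l * h\<^sup>2 \<le> e / 2" using le small[of h] h by linarith
    moreover have "{\<Lambda>1<..<\<Lambda>2} \<subseteq> {E0 - e..E0 + e}" using \<Lambda> by auto
    ultimately obtain \<mu> where "is_eigenvalue (schroedinger_op v h) \<mu>"
      "\<bar>\<mu> - the_inv_into {\<Lambda>1<..<\<Lambda>2} (\<Phi> v l) (pi * (of_int n + 1/2) * h)\<bar> \<le> C l * h\<^sup>2"
      using eig[OF l _ _ _ n] h by blast
    then show "\<exists>\<mu>. is_eigenvalue (schroedinger_op v h) \<mu> \<and>
        \<bar>\<mu> - the_inv_into {\<Lambda>1<..<\<Lambda>2} (\<Phi> v l) (pi * (of_int n + 1/2) * h)\<bar> \<le> D * h\<^sup>2"
      using le by (intro exI[of _ \<mu>]) linarith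
  qed
qed

end
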